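(* Let $d\ge1$. For every $r>0$ there is a constant $C$ such that for all $f\in B^0_{\infty,\infty}(\mathbb R^d)$ $$\sup_N\|\mathbb E_Nf-\varPi_Nf\|_{F^0_{\infty,r}}\le C\|f\|_{B^0_{\infty,\infty}},$$ and likewise $\sup_N\|T_N[f,\mathfrak a]\|_{F^0_{\infty,r}}\le C\|f\|_{B^0_{\infty,\infty}}$, uniformly in $\|\mathfrak a\|_{\ell^\infty(\mathbb Z^d\times\Upsilon)}\le1$.
   Context: Let $\varphi_0\in C_c^\infty(\mathbb R^d)$, $\varphi_0(\xi)=1$ for $|\xi|\le1$, $\varphi_0(\xi)=0$ for $|\xi|\ge2$, $\varphi_k=\varphi_0(2^{-k}\cdot)-\varphi_0(2^{-k+1}\cdot)$ for $k\ge1$, $\Delta_kf=\mathcal F^{-1}[\varphi_k\widehat f\,]$. Then $\|f\|_{B^0_{\infty,\infty}}=\sup_{k\ge0}\|\Delta_kf\|_\infty$, and for $0<r<\infty$, $\|f\|_{F^0_{\infty,r}}=\sup_{n\ge0}\sup_{I}\big(\frac1{|I|}\int_I\sum_{k\ge n}|\Delta_kf(x)|^r\,dx\big)^{1/r}$, the inner supremum over dyadic cubes $I$ of side length $2^{-n}$. Let $\eta_0\in C_c^\infty(\mathbb R^d)$ be supported in $\{|\xi|<3/4\}$ with $\eta_0(\xi)=1$ for $|\xi|\le1/4$, and $\widehat{\varPi_Nf}(\xi)=\eta_0(2^{-N}\xi)\widehat f(\xi)$. For $N\in\mathbb N_0$, $\nu\in\mathbb Z^d$, $I_{N,\nu}=2^{-N}(\nu+[0,1)^d)$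 and $\mathbb E_Nf=\sum_{\nu}\mathbb 1_{I_{N,\nu}}2^{Nd}\int_{I_{N,\nu}}f$. With $h^{(0)}=\mathbb 1_{[0,1)}$, $h^{(1)}=\mathbb 1_{[0,1/2)}-\mathbb 1_{[1/2,1)}$, $h^\epsilon_{N,\nu}(x)=\prod_{i}h^{(\epsilon_i)}(2^Nx_i-\nu_i)$, $\Upsilon=\{0,1\}^d\setminus\{\vec0\}$ and $\mathfrak a=(a_{\nu,\epsilon})\in\ell^\infty(\mathbb Z^d\times\Upsilon)$, $T_N[f,\mathfrak a]=\sum_{\epsilon\in\Upsilon}\sum_\nu a_{\nu,\epsilon}2^{Nd}\langle f,h^\epsilon_{N,\nu}\rangle h^\epsilon_{N,\nu}$. These are defined for Schwartz functions and smooth functions of polynomial growth, and for $f\in B^0_{\infty,\infty}$ by $\mathbb E_Nf=\lim_{J\to\infty}\mathbb E_N(\varPi_Jf)$, $T_N[f,\mathfrak a]=\lim_{J\to\infty}T_N[\varPi_Jf,\mathfrak a]$ (limits in the $F^0_{\infty,r}$ quasi-norms). The constant $C$ does not depend on $N$, $f$, $\mathfrak a$. *)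

theory Defs
  imports "HOL-Analysis.Analysis" "HOL-Probability.Essential_Supremum"
begin

section \<open>Schwartz functions and tempered distributions on \<open>\<real>\<^sup>d\<close>, \<open>d = CARD('n)\<close>\<close>

definition partial_deriv :: "'n \<Rightarrow> (real ^ 'n \<Rightarrow> complex) \<Rightarrow> real ^ 'n \<Rightarrow> complex" where
  "partial_deriv i f x = frechet_derivative f (at x) (axis i 1)"

text \<open>A multi-index is represented by the list of the coordinates in which one differentiates.\<close>

primrec partial_derivs :: "'n list \<Rightarrow> (real ^ 'n \<Rightarrow> complex) \<Rightarrow> real ^ 'n \<Rightarrow> complex" where
  "partial_derivs [] f = f"
| "partial_derivs (i # is) f = partial_deriv i (partial_derivs is f)"

definition smooth :: "(real ^ 'n \<Rightarrow> complex) \<Rightarrow> bool" where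
  "smooth f \<longleftrightarrow> (\<forall>is x. partial_derivs is f differentiable (at x))"

definition test_function :: "(real ^ 'n \<Rightarrow> complex) \<Rightarrow> bool" where
  "test_function f \<longleftrightarrow> smooth f \<and> compact (closure {x. f x \<noteq> 0})"

definition schwartz :: "(real ^ 'n \<Rightarrow> complex) set" where
  "schwartz = {\<phi>. smooth \<phi> \<and>
     (\<forall>M is. bounded (range (\<lambda>x. (1 + norm x) ^ M *\<^sub>R partial_derivs is \<phi> x)))}"

definition schwartz_seminorm :: "nat \<Rightarrow> 'n list \<Rightarrow> (real ^ 'n \<Rightarrow> complex) \<Rightarrow> real" where
  "schwartz_seminorm M is \<phi> = (SUP x. (1 + norm x) ^ M * norm (partial_derivs is \<phi> x))"

text \<open>Distributions are functionals on all functions, normalised to vanish off the Schwartz space,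
  so that two tempered distributions are equal iff they agree on Schwartz functions.\<close>

definition on_schwartz ::
    "((real ^ 'n \<Rightarrow> complex) \<Rightarrow> complex) \<Rightarrow> (real ^ 'n \<Rightarrow> complex) \<Rightarrow> complex" where
  "on_schwartz u = (\<lambda>\<phi>. if \<phi> \<in> schwartz then u \<phi> else 0)"

definition tempered :: "((real ^ 'n \<Rightarrow> complex) \<Rightarrow> complex) set" where
  "tempered = {u. on_schwartz u = u \<and>
     (\<forall>\<phi>\<in>schwartz. \<forall>\<psi>\<in>schwartz. u (\<lambda>x. \<phi> x + \<psi> x) = u \<phi> + u \<psi>) \<and>
     (\<forall>c. \<forall>\<phi>\<in>schwartz. u (\<lambda>x. c * \<phi> x) = c * u \<phi>) \<and>
     (\<exists>C M. \<forall>\<phi>\<in>schwartz.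
        norm (u \<phi>) \<le> C * (\<Sum>is | length is \<le> M. schwartz_seminorm M is \<phi>))}"

definition dist_of :: "(real ^ 'n \<Rightarrow> complex) \<Rightarrow> (real ^ 'n \<Rightarrow> complex) \<Rightarrow> complex" where
  "dist_of g = on_schwartz (\<lambda>\<phi>. \<integral>x. g x * \<phi> x \<partial>lborel)"

definition polynomial_growth :: "(real ^ 'n \<Rightarrow> complex) \<Rightarrow> bool" where
  "polynomial_growth g \<longleftrightarrow> (\<exists>C M. \<forall>x. norm (g x) \<le> C * (1 + norm x) ^ M)"

text \<open>The continuous function of polynomial growth with which a distribution is identified. It is
  applied only to distributions with compactly supported Fourier transform; these are given by a
  smooth function of polynomial growth, and a continuous representative is unique.\<close>

definition fun_of_dist ::
    "((real ^ 'n \<Rightarrow> complex) \<Rightarrow> complex) \<Rightarrow> real ^ 'n \<Rightarrow> complex" where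
  "fun_of_dist u = (THE g. continuous_on UNIV g \<and> polynomial_growth g \<and> u = dist_of g)"


section \<open>Fourier multipliers\<close>

text \<open>The normalisation is \<open>\<integral> \<phi>(x) e\<^sup>-\<^sup>i\<^sup>x\<^sup>\<cdot>\<^sup>\<xi> dx\<close>, with the factor \<open>(2\<pi>)\<^sup>-\<^sup>d\<close> in the inverse transform.\<close>

definition fourier :: "(real ^ 'n \<Rightarrow> complex) \<Rightarrow> real ^ 'n \<Rightarrow> complex" where
  "fourier \<phi> \<xi> = (\<integral>x. \<phi> x * exp (- \<i> * complex_of_real (x \<bullet> \<xi>)) \<partial>lborel)"

definition inv_fourier :: "(real ^ 'n \<Rightarrow> complex) \<Rightarrow> real ^ 'n \<Rightarrow> complex" where
  "inv_fourier \<phi> x =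
     (\<integral>\<xi>. \<phi> \<xi> * exp (\<i> * complex_of_real (x \<bullet> \<xi>)) \<partial>lborel) / (2 * of_real pi) ^ CARD('n)"

definition dist_fourier ::
    "((real ^ 'n \<Rightarrow> complex) \<Rightarrow> complex) \<Rightarrow> (real ^ 'n \<Rightarrow> complex) \<Rightarrow> complex" where
  "dist_fourier u = on_schwartz (\<lambda>\<phi>. u (fourier \<phi>))"

definition dist_inv_fourier ::
    "((real ^ 'n \<Rightarrow> complex) \<Rightarrow> complex) \<Rightarrow> (real ^ 'n \<Rightarrow> complex) \<Rightarrow> complex" where
  "dist_inv_fourier u = on_schwartz (\<lambda>\<phi>. u (inv_fourier \<phi>))"

definition dist_mult ::
    "(real ^ 'n \<Rightarrow> complex) \<Rightarrow> ((real ^ 'n \<Rightarrow> complex) \<Rightarrow> complex) \<Rightarrow>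
     (real ^ 'n \<Rightarrow> complex) \<Rightarrow> complex" where
  "dist_mult m u = on_schwartz (\<lambda>\<phi>. u (\<lambda>\<xi>. m \<xi> * \<phi> \<xi>))"

definition multiplier ::
    "(real ^ 'n \<Rightarrow> complex) \<Rightarrow> ((real ^ 'n \<Rightarrow> complex) \<Rightarrow> complex) \<Rightarrow>
     (real ^ 'n \<Rightarrow> complex) \<Rightarrow> complex" where
  "multiplier m u = dist_inv_fourier (dist_mult m (dist_fourier u))"


section \<open>The spaces \<open>B\<^sup>0\<^bsub>\<infinity>,\<infinity>\<^esub>\<close> and \<open>F\<^sup>0\<^bsub>\<infinity>,r\<^esub>\<close>\<close>

definition lp_cutoff :: "(real ^ 'n \<Rightarrow> complex) \<Rightarrow> bool" where
  "lp_cutoff \<phi>0 \<longleftrightarrow> test_function \<phi>0 \<and>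
     (\<forall>\<xi>. norm \<xi> \<le> 1 \<longrightarrow> \<phi>0 \<xi> = 1) \<and> (\<forall>\<xi>. norm \<xi> \<ge> 2 \<longrightarrow> \<phi>0 \<xi> = 0)"

primrec lp_piece :: "(real ^ 'n \<Rightarrow> complex) \<Rightarrow> nat \<Rightarrow> real ^ 'n \<Rightarrow> complex" where
  "lp_piece \<phi>0 0 = \<phi>0"
| "lp_piece \<phi>0 (Suc k) = (\<lambda>\<xi>. \<phi>0 ((1/2) ^ Suc k *\<^sub>R \<xi>) - \<phi>0 ((1/2) ^ k *\<^sub>R \<xi>))"

definition lp_block ::
    "(real ^ 'n \<Rightarrow> complex) \<Rightarrow> nat \<Rightarrow> ((real ^ 'n \<Rightarrow> complex) \<Rightarrow> complex) \<Rightarrow> real ^ 'n \<Rightarrow> complex"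
  where
  "lp_block \<phi>0 k u = fun_of_dist (multiplier (lp_piece \<phi>0 k) u)"

definition B_norm ::
    "(real ^ 'n \<Rightarrow> complex) \<Rightarrow> ((real ^ 'n \<Rightarrow> complex) \<Rightarrow> complex) \<Rightarrow> ennreal" where
  "B_norm \<phi>0 u = (SUP k. esssup lborel (\<lambda>x. ennreal (norm (lp_block \<phi>0 k u x))))"

definition B_space ::
    "(real ^ 'n \<Rightarrow> complex) \<Rightarrow> ((real ^ 'n \<Rightarrow> complex) \<Rightarrow> complex) set" where
  "B_space \<phi>0 = {u \<in> tempered. B_norm \<phi>0 u < \<infinity>}"

definition dyadic_cube :: "nat \<Rightarrow> int ^ 'n \<Rightarrow> (real ^ 'n) set" where
  "dyadic_cube N \<nu> = {x. \<forall>i. 2 ^ N * x $ i - of_int (\<nu> $ i) \<in> {0..<1}}"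

definition ennreal_powr :: "ennreal \<Rightarrow> real \<Rightarrow> ennreal" where
  "ennreal_powr t p = (if t = \<infinity> then \<infinity> else ennreal (enn2real t powr p))"

text \<open>All terms are nonnegative, so the quasi-norm is evaluated in \<open>[0,\<infinity>]\<close>; it is meant for
  \<open>0 < r\<close>.\<close>

definition F_norm ::
    "(real ^ 'n \<Rightarrow> complex) \<Rightarrow> real \<Rightarrow> ((real ^ 'n \<Rightarrow> complex) \<Rightarrow> complex) \<Rightarrow> ennreal" where
  "F_norm \<phi>0 r u = (SUP n. SUP \<nu> :: int ^ 'n.
     ennreal_powr
       ((\<integral>\<^sup>+x \<in> dyadic_cube n \<nu>. (\<Sum>k. ennreal (norm (lp_block \<phi>0 (n + k) u x) powr r)) \<partial>lborel)
          / emeasure lborel (dyadic_cube n \<nu>))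
       (1 / r))"

text \<open>Convergence in the quasi-norms of \<open>F\<^sup>0\<^bsub>\<infinity>,r\<^esub>\<close>, simultaneously for all \<open>0 < r < \<infinity>\<close>, so that
  the operators defined as limits below do not depend on \<open>r\<close>.\<close>

definition F_converges ::
    "(real ^ 'n \<Rightarrow> complex) \<Rightarrow> (nat \<Rightarrow> (real ^ 'n \<Rightarrow> complex) \<Rightarrow> complex) \<Rightarrow>
     ((real ^ 'n \<Rightarrow> complex) \<Rightarrow> complex) \<Rightarrow> bool" where
  "F_converges \<phi>0 X u \<longleftrightarrow> u \<in> tempered \<and>
     (\<forall>r>0. (\<lambda>J. F_norm \<phi>0 r (X J - u)) \<longlonglongrightarrow> 0)"

definition F_lim ::
    "(real ^ 'n \<Rightarrow> complex) \<Rightarrow> (nat \<Rightarrow> (real ^ 'n \<Rightarrow> complex) \<Rightarrow> complex) \<Rightarrow>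
     (real ^ 'n \<Rightarrow> complex) \<Rightarrow> complex" where
  "F_lim \<phi>0 X = (THE u. F_converges \<phi>0 X u)"


section \<open>Smooth projections, conditional expectations and Haar multipliers\<close>

definition proj_cutoff :: "(real ^ 'n \<Rightarrow> complex) \<Rightarrow> bool" where
  "proj_cutoff \<eta>0 \<longleftrightarrow> test_function \<eta>0 \<and> closure {\<xi>. \<eta>0 \<xi> \<noteq> 0} \<subseteq> {\<xi>. norm \<xi> < 3/4} \<and>
     (\<forall>\<xi>. norm \<xi> \<le> 1/4 \<longrightarrow> \<eta>0 \<xi> = 1)"

definition smooth_proj ::
    "(real ^ 'n \<Rightarrow> complex) \<Rightarrow> nat \<Rightarrow> ((real ^ 'n \<Rightarrow> complex) \<Rightarrow> complex) \<Rightarrow>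
     (real ^ 'n \<Rightarrow> complex) \<Rightarrow> complex" where
  "smooth_proj \<eta>0 N u = multiplier (\<lambda>\<xi>. \<eta>0 ((1/2) ^ N *\<^sub>R \<xi>)) u"

text \<open>In the sums over \<open>\<nu>\<close> below, for each \<open>x\<close> exactly one term can be nonzero.\<close>

definition cond_exp_fun :: "nat \<Rightarrow> (real ^ 'n \<Rightarrow> complex) \<Rightarrow> real ^ 'n \<Rightarrow> complex" where
  "cond_exp_fun N g x = (\<Sum>\<^sub>\<infinity>\<nu> :: int ^ 'n. indicator (dyadic_cube N \<nu>) x *
     (2 ^ (N * CARD('n)) * (LINT y : dyadic_cube N \<nu> | lborel. g y)))"

definition haar1 :: "bool \<Rightarrow> real \<Rightarrow> real" where
  "haar1 e t = (if e then indicator {0..<1/2} t - indicator {1/2..<1} t else indicator {0..<1} t)"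

definition haar :: "nat \<Rightarrow> int ^ 'n \<Rightarrow> bool ^ 'n \<Rightarrow> real ^ 'n \<Rightarrow> complex" where
  "haar N \<nu> \<epsilon> x = complex_of_real (\<Prod>i\<in>UNIV. haar1 (\<epsilon> $ i) (2 ^ N * x $ i - of_int (\<nu> $ i)))"

definition Upsilon :: "(bool ^ 'n) set" where
  "Upsilon = UNIV - {\<chi> i. False}"

definition haar_mult_fun ::
    "nat \<Rightarrow> (real ^ 'n \<Rightarrow> complex) \<Rightarrow> (int ^ 'n \<Rightarrow> bool ^ 'n \<Rightarrow> complex) \<Rightarrow> real ^ 'n \<Rightarrow> complex"
  where
  "haar_mult_fun N g a x = (\<Sum>\<epsilon>\<in>Upsilon. \<Sum>\<^sub>\<infinity>\<nu>.
     a \<nu> \<epsilon> * 2 ^ (N * CARD('n)) * (\<integral>y. g y * haar N \<nu> \<epsilon> y \<partial>lborel) * haar N \<nu> \<epsilon> x)"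

definition cond_exp_approx ::
    "(real ^ 'n \<Rightarrow> complex) \<Rightarrow> nat \<Rightarrow> ((real ^ 'n \<Rightarrow> complex) \<Rightarrow> complex) \<Rightarrow>
     nat \<Rightarrow> (real ^ 'n \<Rightarrow> complex) \<Rightarrow> complex" where
  "cond_exp_approx \<eta>0 N f J = dist_of (cond_exp_fun N (fun_of_dist (smooth_proj \<eta>0 J f)))"

definition haar_mult_approx ::
    "(real ^ 'n \<Rightarrow> complex) \<Rightarrow> nat \<Rightarrow> ((real ^ 'n \<Rightarrow> complex) \<Rightarrow> complex) \<Rightarrow>
     (int ^ 'n \<Rightarrow> bool ^ 'n \<Rightarrow> complex) \<Rightarrow> nat \<Rightarrow> (real ^ 'n \<Rightarrow> complex) \<Rightarrow> complex" where
  "haar_mult_approx \<eta>0 N f a J = dist_of (haar_mult_fun N (fun_of_dist (smooth_proj \<eta>0 J f)) a)"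

definition cond_exp_dist ::
    "(real ^ 'n \<Rightarrow> complex) \<Rightarrow> (real ^ 'n \<Rightarrow> complex) \<Rightarrow> nat \<Rightarrow>
     ((real ^ 'n \<Rightarrow> complex) \<Rightarrow> complex) \<Rightarrow> (real ^ 'n \<Rightarrow> complex) \<Rightarrow> complex" where
  "cond_exp_dist \<phi>0 \<eta>0 N f = F_lim \<phi>0 (cond_exp_approx \<eta>0 N f)"

definition haar_mult_dist ::
    "(real ^ 'n \<Rightarrow> complex) \<Rightarrow> (real ^ 'n \<Rightarrow> complex) \<Rightarrow> nat \<Rightarrow>
     ((real ^ 'n \<Rightarrow> complex) \<Rightarrow> complex) \<Rightarrow> (int ^ 'n \<Rightarrow> bool ^ 'n \<Rightarrow> complex) \<Rightarrow>
     (real ^ 'n \<Rightarrow> complex) \<Rightarrow> complex" where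
  "haar_mult_dist \<phi>0 \<eta>0 N f a = F_lim \<phi>0 (haar_mult_approx \<eta>0 N f a)"

end

theory Submission
  imports Defs "HOL-Probability.Characteristic_Functions" "HOL-Probability.Sinc_Integral"
begin

text \<open>
  Every operator is a sum over the increments \<open>P\<^sub>J\<^sub>+\<^sub>1 - P\<^sub>J\<close> of the smooth projections
  \<open>P\<^sub>J = \<Pi>\<^sub>J f\<close>. An increment is the convolution of a mean zero Schwartz kernel dilated to
  scale \<open>2\<^sup>-\<^sup>J\<close> with four blocks of \<open>f\<close>; hence it is bounded by a multiple of the norm of \<open>f\<close>, its
  Lipschitz constant is \<open>O(2\<^sup>J)\<close>, and its averages over dyadic cubes of side \<open>2\<^sup>-\<^sup>N\<close> with \<open>N \<le> J\<close> are
  \<open>O(2\<^sup>N\<^sup>-\<^sup>J)\<close>, since only the boundary layer of the cube contributes. So the approximations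
  \<open>E\<^sub>N P\<^sub>J\<close> and \<open>T\<^sub>N P\<^sub>J\<close> converge geometrically and uniformly to a bounded function \<open>H\<close> that is
  constant on the cubes of side \<open>2\<^sup>-\<^sup>N\<^sup>-\<^sup>1\<close>.

  For \<open>k \<le> N\<close> the block \<open>\<Delta>\<^sub>k\<close> of \<open>H - P\<^sub>N\<close> is \<open>O(2\<^sup>k\<^sup>-\<^sup>N)\<close>: up to a geometrically small error the
  function telescopes into the increments \<open>E\<^sub>M\<^sub>+\<^sub>1 P\<^sub>J - E\<^sub>M P\<^sub>J\<close>, \<open>M \<ge> N\<close>, which have mean zero on the
  cubes of side \<open>2\<^sup>-\<^sup>M\<close>. In the case of \<open>T\<^sub>N\<close> the limit \<open>H\<close> itself is treated in this way, as \<open>T\<^sub>N P\<^sub>J\<close>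
  has mean zero on the cubes of side \<open>2\<^sup>-\<^sup>N\<close>. For \<open>k > N\<close> the
  block of \<open>P\<^sub>N\<close> vanishes, and that of the piecewise constant \<open>H\<close> decays rapidly in \<open>2\<^sup>k\<close> times the
  distance to the cell boundaries. The proportion of a cube that lies within \<open>2\<^sup>-\<^sup>k\<close> of a boundary
  is \<open>O(2\<^sup>N\<^sup>-\<^sup>k)\<close>, so the averages in the quasi-norm are summable in \<open>k\<close> for every \<open>r > 0\<close>.
\<close>

section \<open>Integration on \<open>\<real>\<^sup>d\<close>\<close>

text \<open>An element of \<open>B_space\<close> need not be a function, and the available sup
  bounds for its projections grow with the generation. So no uniform estimate may use the size of a
  projection; only increments, oscillations and mean values enter. The low blocks of H - P_N are
  compared through E_N P_J, E_R P_J and P_J with J = 2N and R = 3N. The errors are 2^(N-J) and, as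
  P_J has Lipschitz constant O(2^J), 2^(J-R). Both equal 2^-N, which is what the bound 2^(k-N)
  permits at k = 0. For the high blocks a decay of order p with p r >= 2 is used, so that r-th
  powers stay integrable across a cell boundary however small r is. Blocks and limits are defined by
  definite descriptions. This explains the groundwork: a tempered distribution filtered by a
  Schwartz symbol must be shown to be a continuous function of polynomial growth, and a distribution
  all of whose blocks vanish must be shown to be zero, which makes limits unique. Convergence holds
  for all r at once because the error is piecewise constant and uniformly small.\<close>

lemma Basis_vec_real: "(Basis :: (real ^ 'n) set) = range (\<lambda>i. axis i 1)"
  by (auto simp: Basis_vec_def)

lemma inj_axis_one: "inj (\<lambda>i :: 'n::finite. axis i (1::real))"
  by (auto simp: inj_def axis_eq_axis)

lemma prod_Basis_vec:
  fixes g :: "real ^ 'n \<Rightarrow> 'b::comm_monoid_mult"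
  shows "(\<Prod>b\<in>Basis. g b) = (\<Prod>i\<in>UNIV. g (axis i 1))"
  unfolding Basis_vec_real by (subst prod.reindex) (auto simp: inj_axis_one)

lemma nn_integral_prod_vec:
  fixes f :: "'n::finite \<Rightarrow> real \<Rightarrow> ennreal"
  assumes "\<And>i. f i \<in> borel_measurable borel"
  shows "(\<integral>\<^sup>+(x::real^'n). (\<Prod>i\<in>UNIV. f i (x $ i)) \<partial>lborel) = (\<Prod>i\<in>UNIV. \<integral>\<^sup>+s. f i s \<partial>lborel)"
proof -
  define g where "g b = f (inv (\<lambda>i. axis i (1::real)) b)" for b :: "real ^ 'n"
  have g: "g (axis i 1) = f i" for i
    unfolding g_def by (simp add: inv_f_f[OF inj_axis_one])
  have m: "(\<lambda>x::real^'n. g b (x \<bullet> b)) \<in> borel_measurable borel" for b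
    unfolding g_def using assms by measurable
  have "(\<integral>\<^sup>+x. (\<Prod>b\<in>Basis. g b (x \<bullet> b)) \<partial>lborel) = (\<Prod>b\<in>Basis. \<integral>\<^sup>+s. g b s \<partial>lborel)"
    by (rule nn_integral_lborel_prod) (auto simp: g_def intro: assms)
  then show ?thesis
    by (simp add: prod_Basis_vec g inner_axis)
qed

lemma integral_prod_vec:
  fixes f :: "'n::finite \<Rightarrow> real \<Rightarrow> complex"
  assumes "\<And>i. integrable lborel (f i)"
  shows "integrable lborel (\<lambda>x :: real ^ 'n. \<Prod>i\<in>UNIV. f i (x $ i))"
    and "(\<integral>(x::real^'n). (\<Prod>i\<in>UNIV. f i (x $ i)) \<partial>lborel) = (\<Prod>i\<in>UNIV. \<integral>s. f i s \<partial>lborel)"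
proof -
  have fm [measurable]: "f i \<in> borel_measurable borel" for i using assms[of i] by simp
  define g where "g b = f (inv (\<lambda>i. axis i (1::real)) b)" for b :: "real ^ 'n"
  have g: "g (axis i 1) = f i" for i
    unfolding g_def by (simp add: inv_f_f[OF inj_axis_one])
  have gm [measurable]: "g b \<in> borel_measurable borel" for b
    unfolding g_def by measurable
  have m [measurable]: "(\<lambda>x::real^'n. g b (x \<bullet> b)) \<in> borel_measurable borel" for b
    by measurable
  interpret product_sigma_finite "\<lambda>b::real^'n. lborel :: real measure" by unfold_locales
  have eq: "(\<Prod>b\<in>Basis. g b ((\<Sum>b'\<in>Basis. y b' *\<^sub>R b') \<bullet> b)) = (\<Prod>b\<in>Basis. g b (y b))" for y :: "real^'n \<Rightarrow> real"
    by (rule prod.cong) (simp_all only: inner_sum_left_Basis)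
  have gi: "integrable lborel (g b)" for b using assms by (simp add: g_def)
  have pm: "(\<lambda>f. \<Sum>b\<in>Basis. f b *\<^sub>R b) \<in> (\<Pi>\<^sub>M b\<in>(Basis :: (real^'n) set). lborel) \<rightarrow>\<^sub>M borel"
    by measurable
  have "integrable lborel (\<lambda>x :: real^'n. \<Prod>b\<in>Basis. g b (x \<bullet> b))"
    by (subst lborel_eq, subst integrable_distr_eq[OF pm], measurable, subst eq)
      (rule product_integrable_prod, simp, rule gi)
  moreover have "(\<integral>(x :: real^'n). (\<Prod>b\<in>Basis. g b (x \<bullet> b)) \<partial>lborel) = (\<Prod>b\<in>Basis. \<integral>s. g b s \<partial>lborel)"
    by (subst lborel_eq, subst integral_distr[OF pm], measurable, subst eq)
      (rule product_integral_prod, simp, rule gi)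
  ultimately show "integrable lborel (\<lambda>x :: real ^ 'n. \<Prod>i\<in>UNIV. f i (x $ i))"
    "(\<integral>(x::real^'n). (\<Prod>i\<in>UNIV. f i (x $ i)) \<partial>lborel) = (\<Prod>i\<in>UNIV. \<integral>s. f i s \<partial>lborel)"
    by (simp_all add: prod_Basis_vec g inner_axis)
qed

text \<open>The common integrable majorant. Two powers of \<open>1 + norm x\<close> are spent on
  each coordinate, so that \<open>weight\<close> lies below the product of the functions 1 / (1 +
  x_i^2) and integrability reduces to dimension one.\<close>

definition weight :: "real ^ 'n \<Rightarrow> real" where
  "weight x = 1 / (1 + norm x) ^ (2 * CARD('n))"

lemma weight_pos: "0 < weight x"
  by (simp add: weight_def add_pos_nonneg)

lemma weight_nonneg [simp]: "0 \<le> weight x"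
  using weight_pos[of x] by simp

lemma weight_measurable [measurable]: "weight \<in> borel_measurable borel"
  unfolding weight_def by measurable

lemma weight_prod_le:
  fixes x :: "real ^ 'n"
  shows "weight x \<le> (\<Prod>i\<in>UNIV. 1 / (1 + (x $ i)\<^sup>2))"
proof -
  have "weight x = (\<Prod>i\<in>(UNIV::'n set). 1 / (1 + norm x)\<^sup>2)"
    by (simp add: weight_def power_mult power_one_over)
  also have "\<dots> \<le> (\<Prod>i\<in>UNIV. 1 / (1 + (x $ i)\<^sup>2))"
  proof (rule prod_mono, safe)
    fix i :: 'n
    have "1 + (x $ i)\<^sup>2 \<le> 1 + (norm x)\<^sup>2"
      using component_le_norm_cart[of x i] by (simp add: abs_le_square_iff[symmetric])
    also have "\<dots> \<le> (1 + norm x)\<^sup>2"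
      by (simp add: power2_sum)
    finally show "1 / (1 + norm x)\<^sup>2 \<le> 1 / (1 + (x $ i)\<^sup>2)"
      by (intro frac_le) (simp_all add: add_pos_nonneg)
  qed simp
  finally show ?thesis .
qed

lemma integrable_weight: "integrable lborel (weight :: real ^ 'n \<Rightarrow> real)"
proof -
  have i: "integrable lborel (\<lambda>s. complex_of_real (1 / (1 + s\<^sup>2)))"
    using integrable_inverse_1_plus_square
    by (intro integrable_of_real) (simp add: set_integrable_def inverse_eq_divide)
  have "norm (\<Prod>j\<in>UNIV. complex_of_real (1 / (1 + (x $ j)\<^sup>2))) = (\<Prod>j\<in>UNIV. 1 / (1 + (x $ j)\<^sup>2))" for x :: "real ^ 'n"
    by (simp only: norm_of_real flip: of_real_prod) (simp add: prod_nonneg)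
  then show ?thesis
    using weight_prod_le
    by (intro Bochner_Integration.integrable_bound
          [OF integral_prod_vec(1)[of "\<lambda>_. \<lambda>s. complex_of_real (1 / (1 + s\<^sup>2))", OF i]])
      (simp_all del: of_real_divide, intro AE_I2)
qed

text \<open>Peetre's inequality: decay known at one point is carried to another at the price of a
  power of \<open>1 + norm h\<close>.\<close>

lemma peetre:
  fixes x h :: "'a::real_normed_vector"
  shows "1 + norm x \<le> (1 + norm h) * (1 + norm (x + h))"
proof -
  have "norm x \<le> norm (x + h) + norm h"
    using norm_triangle_ineq4[of "x + h" h] by simp
  then show ?thesis by (simp add: algebra_simps) (smt (verit) norm_ge_zero mult_nonneg_nonneg)
qed

lemma
  fixes f :: "real ^ 'n \<Rightarrow> 'b::{banach, second_countable_topology}"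
  assumes c: "c \<noteq> 0"
  shows integrable_affine_vec: "integrable lborel f \<Longrightarrow> integrable lborel (\<lambda>x. f (t + c *\<^sub>R x))"
    and integral_affine_vec: "f \<in> borel_measurable borel \<Longrightarrow>
      (\<integral>x. f x \<partial>lborel) = \<bar>c\<bar> ^ CARD('n) *\<^sub>R (\<integral>x. f (t + c *\<^sub>R x) \<partial>lborel)"
proof -
  have eq: "(lborel :: (real^'n) measure) = density (distr lborel borel (\<lambda>x. t + c *\<^sub>R x)) (\<lambda>_. \<bar>c\<bar> ^ CARD('n))"
    using lborel_affine[OF c, of t] by simp
  { assume f: "integrable lborel f"
    then have [measurable]: "f \<in> borel_measurable borel" by simp
    show "integrable lborel (\<lambda>x. f (t + c *\<^sub>R x))"
      using f c integrable_scaleR_right[of "inverse (\<bar>c\<bar> ^ CARD('n))" lborel "\<lambda>x. \<bar>c\<bar> ^ CARD('n) *\<^sub>R f (t + c *\<^sub>R x)"]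
      by (subst (asm) eq) (simp add: integrable_density integrable_distr_eq) }
  { assume [measurable]: "f \<in> borel_measurable borel"
    show "(\<integral>x. f x \<partial>lborel) = \<bar>c\<bar> ^ CARD('n) *\<^sub>R (\<integral>x. f (t + c *\<^sub>R x) \<partial>lborel)"
      by (subst eq) (simp add: integral_density integral_distr) }
qed

lemma integrable_shift_vec:
  fixes f :: "real ^ 'n \<Rightarrow> 'b::{banach, second_countable_topology}"
  assumes "integrable lborel f"
  shows "integrable lborel (\<lambda>x. f (x + t))" "integrable lborel (\<lambda>x. f (x - t))" "integrable lborel (\<lambda>x. f (t - x))"
  using integrable_affine_vec[OF _ assms, of 1 t] integrable_affine_vec[OF _ assms, of 1 "-t"]
    integrable_affine_vec[OF _ assms, of "-1" t] by (simp_all add: add.commute)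

lemma integral_shift_vec:
  fixes f :: "real ^ 'n \<Rightarrow> 'b::{banach, second_countable_topology}"
  assumes "f \<in> borel_measurable borel"
  shows "(\<integral>x. f (x + t) \<partial>lborel) = (\<integral>x. f x \<partial>lborel)"
    "(\<integral>x. f (x - t) \<partial>lborel) = (\<integral>x. f x \<partial>lborel)"
    "(\<integral>x. f (t - x) \<partial>lborel) = (\<integral>x. f x \<partial>lborel)"
  using integral_affine_vec[OF _ assms, of 1 t] integral_affine_vec[OF _ assms, of 1 "-t"]
    integral_affine_vec[OF _ assms, of "-1" t] by (simp_all add: add.commute)

lemma integrable_bounded_mult:
  fixes f g :: "'a \<Rightarrow> complex"
  assumes "integrable M f" "g \<in> borel_measurable M" "\<And>x. norm (g x) \<le> A"
  shows "integrable M (\<lambda>x. f x * g x)" "integrable M (\<lambda>x. g x * f x)"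
proof -
  have A: "0 \<le> A" using assms(3)[of undefined] norm_ge_zero order.trans by blast
  show "integrable M (\<lambda>x. f x * g x)"
    by (rule Bochner_Integration.integrable_bound[where f="\<lambda>x. A *\<^sub>R f x"])
      (use assms A in \<open>auto simp: norm_mult mult.commute[of A] intro!: mult_left_mono\<close>)
  then show "integrable M (\<lambda>x. g x * f x)" by (simp add: mult.commute)
qed

section \<open>The Schwartz space\<close>

lemma partial_deriv_eq:
  "(f has_derivative f') (at x) \<Longrightarrow> partial_deriv i f x = f' (axis i 1)"
  unfolding partial_deriv_def by (metis frechet_derivative_at)

lemma has_derivative_partial:
  assumes "f differentiable (at x)"
  shows "(f has_derivative (\<lambda>h. \<Sum>i\<in>UNIV. h $ i *\<^sub>R partial_deriv i f x)) (at x)"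
proof -
  have d: "(f has_derivative frechet_derivative f (at x)) (at x)"
    using assms by (simp add: frechet_derivative_works)
  then have lin: "linear (frechet_derivative f (at x))"
    by (rule has_derivative_linear)
  have "frechet_derivative f (at x) h = (\<Sum>i\<in>UNIV. h $ i *\<^sub>R partial_deriv i f x)" for h
  proof -
    have "frechet_derivative f (at x) h = frechet_derivative f (at x) (\<Sum>i\<in>UNIV. h $ i *\<^sub>R axis i 1)"
      using basis_expansion[of h] by (simp add: scalar_mult_eq_scaleR)
    also have "\<dots> = (\<Sum>i\<in>UNIV. h $ i *\<^sub>R partial_deriv i f x)"
      by (simp add: linear_sum[OF lin] linear_scale[OF lin] partial_deriv_def)
    finally show ?thesis .
  qed
  then show ?thesis using d by presburger
qed

lemma partial_deriv_add:
  "f differentiable (at x) \<Longrightarrow> g differentiable (at x) \<Longrightarrow>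
    partial_deriv i (\<lambda>x. f x + g x) x = partial_deriv i f x + partial_deriv i g x"
  unfolding partial_deriv_def
  by (subst frechet_derivative_at[OF has_derivative_add, symmetric]) (auto simp: frechet_derivative_works)

lemma partial_deriv_mult:
  assumes "f differentiable (at x)" "g differentiable (at x)"
  shows "partial_deriv i (\<lambda>x. f x * g x) x = f x * partial_deriv i g x + partial_deriv i f x * g x"
  using has_derivative_mult[OF assms[unfolded frechet_derivative_works]]
  by (subst partial_deriv_eq) (auto simp: partial_deriv_def)

lemma has_derivative_coord:
  "((\<lambda>x :: real ^ 'n. complex_of_real (x $ j)) has_derivative (\<lambda>h. complex_of_real (h $ j))) (at x)"
  by (intro bounded_linear_imp_has_derivative bounded_linear_compose[OF bounded_linear_of_real]
      bounded_linear_vec_nth)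

lemma partial_deriv_coord:
  "partial_deriv i (\<lambda>x :: real ^ 'n. complex_of_real (x $ j)) x = (if i = j then 1 else 0)"
  by (subst partial_deriv_eq[OF has_derivative_coord]) (simp add: axis_def)

text \<open>The decay half of the Schwartz condition for a single function. Separated from
  smoothness, it makes \<open>schwartz\<close> accessible to coinduction.\<close>

definition rapid :: "(real ^ 'n \<Rightarrow> complex) \<Rightarrow> bool" where
  "rapid f \<longleftrightarrow> (\<forall>M. \<exists>C. \<forall>x. (1 + norm x) ^ M * norm (f x) \<le> C)"

lemma rapid_iff_bounded: "rapid f \<longleftrightarrow> (\<forall>M. bounded (range (\<lambda>x. (1 + norm x) ^ M *\<^sub>R f x)))"
  by (simp add: rapid_def bounded_iff)

lemma schwartz_iff: "f \<in> schwartz \<longleftrightarrow> smooth f \<and> (\<forall>is. rapid (partial_derivs is f))"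
  by (auto simp: schwartz_def rapid_iff_bounded)

lemma rapid_add: "rapid f \<Longrightarrow> rapid g \<Longrightarrow> rapid (\<lambda>x. f x + g x)"
  unfolding rapid_def
proof safe
  fix M assume *: "\<forall>M. \<exists>C. \<forall>x. (1 + norm x) ^ M * norm (f x) \<le> C" "\<forall>M. \<exists>C. \<forall>x. (1 + norm x) ^ M * norm (g x) \<le> C"
  obtain C D where C: "(1 + norm x) ^ M * norm (f x) \<le> C" and D: "(1 + norm x) ^ M * norm (g x) \<le> D" for x
    using *[THEN spec, of M] by blast
  have "(1 + norm x) ^ M * norm (f x + g x) \<le> C + D" for x
  proof -
    have "(1 + norm x) ^ M * norm (f x + g x) \<le> (1 + norm x) ^ M * (norm (f x) + norm (g x))"
      by (intro mult_left_mono norm_triangle_ineq) simp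
    also have "\<dots> \<le> C + D" using C[of x] D[of x] by (simp add: distrib_left)
    finally show ?thesis .
  qed
  then show "\<exists>C. \<forall>x. (1 + norm x) ^ M * norm (f x + g x) \<le> C" by blast
qed

lemma rapid_bounded_mult:
  assumes "rapid f" "\<And>x. norm (g x) \<le> C"
  shows "rapid (\<lambda>x. g x * f x)"
  unfolding rapid_def
proof
  fix M
  obtain D where D: "(1 + norm x) ^ M * norm (f x) \<le> D" for x
    using assms(1) unfolding rapid_def by blast
  have C: "0 \<le> C" using assms(2) norm_ge_zero order.trans by blast
  have "(1 + norm x) ^ M * norm (g x * f x) \<le> C * D" for x
    using mult_mono[OF assms(2)[of x] D[of x] C] by (simp add: norm_mult mult_ac)
  then show "\<exists>C. \<forall>x. (1 + norm x) ^ M * norm (g x * f x) \<le> C" by blast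
qed

lemma rapid_cmult: "rapid f \<Longrightarrow> rapid (\<lambda>x. c * f x)"
  by (rule rapid_bounded_mult) auto

lemma rapid_coord: "rapid f \<Longrightarrow> rapid (\<lambda>x. complex_of_real (x $ j) * f x)"
  unfolding rapid_def
proof
  fix M assume "\<forall>M. \<exists>C. \<forall>x. (1 + norm x) ^ M * norm (f x) \<le> C"
  then obtain D where D: "(1 + norm x) ^ Suc M * norm (f x) \<le> D" for x by blast
  have "(1 + norm x) ^ M * norm (complex_of_real (x $ j) * f x) \<le> D" for x
  proof -
    have "(1 + norm x) ^ M * norm (complex_of_real (x $ j) * f x) = \<bar>x $ j\<bar> * ((1 + norm x) ^ M * norm (f x))"
      by (simp add: norm_mult)
    also have "\<dots> \<le> (1 + norm x) * ((1 + norm x) ^ M * norm (f x))"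
      using component_le_norm_cart[of x j] by (intro mult_right_mono) auto
    finally show ?thesis using D[of x] by (simp add: mult_ac)
  qed
  then show "\<exists>C. \<forall>x. (1 + norm x) ^ M * norm (complex_of_real (x $ j) * f x) \<le> C" by blast
qed

lemma rapidD: "rapid f \<Longrightarrow> \<exists>C\<ge>0. \<forall>x. norm (f x) \<le> C / (1 + norm x) ^ M"
proof -
  assume "rapid f"
  then obtain C where C: "(1 + norm x) ^ M * norm (f x) \<le> C" for x unfolding rapid_def by blast
  have "0 \<le> C" using C[of 0] order.trans[OF norm_ge_zero[of "f 0"], of C] by simp
  moreover have "norm (f x) \<le> C / (1 + norm x) ^ M" for x
    using C[of x] by (simp add: pos_le_divide_eq add_pos_nonneg mult.commute)
  ultimately show ?thesis by blast
qed

lemma rapid_weight: "rapid (f :: real ^ 'n \<Rightarrow> complex) \<Longrightarrow> \<exists>C\<ge>0. \<forall>x. norm (f x) \<le> C * weight x"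
  using rapidD[of f "2 * CARD('n)"] by (simp add: weight_def)

text \<open>All iterated derivatives stay in \<open>X\<close>, so a closure property of the Schwartz
  space is proved by exhibiting one set that is stable under first partial derivatives; no induction
  over multi-indices is repeated.\<close>

lemma schwartz_coinduct:
  assumes "f \<in> X"
    and d: "\<And>f x. f \<in> X \<Longrightarrow> f differentiable (at x)"
    and r: "\<And>f. f \<in> X \<Longrightarrow> rapid f"
    and p: "\<And>f i. f \<in> X \<Longrightarrow> partial_deriv i f \<in> X"
  shows "f \<in> schwartz"
proof -
  have "partial_derivs is f \<in> X" for "is"
    by (induction "is") (auto simp: assms(1) p)
  then show ?thesis using d r by (auto simp: schwartz_iff smooth_def)
qed

lemma partial_derivs_append: "partial_derivs (is @ js) f = partial_derivs is (partial_derivs js f)"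
  by (induction "is") auto

lemma
  assumes "f \<in> schwartz"
  shows schwartz_differentiable: "f differentiable (at x)"
    and schwartz_rapid: "rapid f"
    and schwartz_partial_deriv: "partial_deriv i f \<in> schwartz"
proof -
  show "f differentiable (at x)"
    using assms unfolding schwartz_iff smooth_def by (metis partial_derivs.simps(1))
  show "rapid f"
    using assms unfolding schwartz_iff by (metis partial_derivs.simps(1))
  have "partial_derivs is (partial_deriv i f) = partial_derivs (is @ [i]) f" for "is"
    by (simp add: partial_derivs_append)
  then show "partial_deriv i f \<in> schwartz"
    using assms by (simp add: schwartz_iff smooth_def)
qed

lemma schwartz_partial_derivs: "f \<in> schwartz \<Longrightarrow> partial_derivs is f \<in> schwartz"
  by (induction "is") (auto intro: schwartz_partial_deriv)

lemma schwartz_continuous: "f \<in> schwartz \<Longrightarrow> continuous_on UNIV f"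
  by (meson differentiable_imp_continuous_within continuous_at_imp_continuous_on schwartz_differentiable)

lemma schwartz_measurable [measurable_dest]: "f \<in> schwartz \<Longrightarrow> f \<in> borel_measurable borel"
  by (intro borel_measurable_continuous_onI schwartz_continuous)

lemma schwartz_integrable: "f \<in> schwartz \<Longrightarrow> integrable lborel f"
proof -
  assume f: "f \<in> schwartz"
  obtain C where "norm (f x) \<le> C * weight x" for x using rapid_weight[OF schwartz_rapid[OF f]] by blast
  then show ?thesis
    using f by (intro Bochner_Integration.integrable_bound[OF integrable_mult_right[OF integrable_weight, of C]])
      (auto intro: order.trans[OF _ abs_ge_self])
qed

text \<open>Coinduction up to the closure under sums and multiplication by polynomials.\<close>

inductive_set polyspan :: "(real ^ 'n \<Rightarrow> complex) set \<Rightarrow> (real ^ 'n \<Rightarrow> complex) set" for X where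
  base: "f \<in> X \<Longrightarrow> f \<in> polyspan X"
| add: "f \<in> polyspan X \<Longrightarrow> g \<in> polyspan X \<Longrightarrow> (\<lambda>x. f x + g x) \<in> polyspan X"
| cmult: "f \<in> polyspan X \<Longrightarrow> (\<lambda>x. c * f x) \<in> polyspan X"
| coord: "f \<in> polyspan X \<Longrightarrow> (\<lambda>x. complex_of_real (x $ j) * f x) \<in> polyspan X"

text \<open>Soundness of the up-to technique: the three hypotheses pass from \<open>X\<close> to its
  span, since by the product rule the derivative of x_j f is x_j times the derivative of f plus f or
  0. Then \<open>schwartz_coinduct\<close> applies to the whole span.\<close>

lemma polyspan_subset_schwartz:
  assumes d: "\<And>f x. f \<in> X \<Longrightarrow> f differentiable (at x)"
    and r: "\<And>f. f \<in> X \<Longrightarrow> rapid f"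
    and p: "\<And>f i. f \<in> X \<Longrightarrow> partial_deriv i f \<in> polyspan X"
  shows "polyspan X \<subseteq> schwartz"
proof -
  have cd: "(\<lambda>x :: real^'n. complex_of_real (x $ j)) differentiable (at x)" for j x
    using has_derivative_coord differentiableI by blast
  have *: "(\<forall>x. f differentiable (at x)) \<and> rapid f \<and> (\<forall>i. partial_deriv i f \<in> polyspan X)"
    if "f \<in> polyspan X" for f
    using that
  proof induction
    case (base f)
    then show ?case using assms by blast
  next
    case (add f g)
    have "partial_deriv i (\<lambda>x. f x + g x) = (\<lambda>x. partial_deriv i f x + partial_deriv i g x)" for i
      using add by (auto simp: partial_deriv_add)
    then show ?case using add by (auto intro: rapid_add polyspan.add)
  next
    case (cmult f c)
    have "partial_deriv i (\<lambda>x. c * f x) x = c * partial_deriv i f x" for i x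
      using cmult partial_deriv_mult[of "\<lambda>_. c" x f i]
      by (simp add: partial_deriv_def)
    then have "partial_deriv i (\<lambda>x. c * f x) = (\<lambda>x. c * partial_deriv i f x)" for i
      by blast
    then show ?case using cmult by (auto intro: rapid_cmult polyspan.cmult)
  next
    case (coord f j)
    have "partial_deriv i (\<lambda>x. complex_of_real (x $ j) * f x) =
      (\<lambda>x. complex_of_real (x $ j) * partial_deriv i f x + (if i = j then 1 else 0) * f x)" for i
      using coord by (auto simp: partial_deriv_mult cd partial_deriv_coord)
    then show ?case
      using coord cd
      by (auto intro!: rapid_coord polyspan.add polyspan.coord polyspan.cmult differentiable_mult)
  qed
  show ?thesis
    by (rule subsetI, rule schwartz_coinduct[where X="polyspan X"]) (auto simp: *)
qed

lemma polyspan_schwartz: "polyspan schwartz \<subseteq> schwartz"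
  by (rule polyspan_subset_schwartz)
    (auto intro: schwartz_differentiable schwartz_rapid schwartz_partial_deriv polyspan.base)

lemma schwartz_add: "f \<in> schwartz \<Longrightarrow> g \<in> schwartz \<Longrightarrow> (\<lambda>x. f x + g x) \<in> schwartz"
  and schwartz_cmult: "f \<in> schwartz \<Longrightarrow> (\<lambda>x. c * f x) \<in> schwartz"
  and schwartz_coord: "f \<in> schwartz \<Longrightarrow> (\<lambda>x. complex_of_real (x $ j) * f x) \<in> schwartz"
  by (auto intro!: subsetD[OF polyspan_schwartz] intro: polyspan.add polyspan.cmult polyspan.coord polyspan.base)

lemma schwartz_diff: "f \<in> schwartz \<Longrightarrow> g \<in> schwartz \<Longrightarrow> (\<lambda>x. f x - g x) \<in> schwartz"
  using schwartz_add[OF _ schwartz_cmult, of f g "-1"] by simp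

text \<open>The set of products is not stable under derivatives, as the Leibniz rule yields a sum of
  two products; it is stable up to \<open>polyspan\<close>, which suffices.\<close>

lemma schwartz_mult:
  assumes "f \<in> schwartz" "g \<in> schwartz"
  shows "(\<lambda>x. f x * g x) \<in> schwartz"
proof -
  let ?X = "{\<lambda>x. f x * g x | f g :: real^'a \<Rightarrow> complex. f \<in> schwartz \<and> g \<in> schwartz}"
  have "polyspan ?X \<subseteq> schwartz"
  proof (rule polyspan_subset_schwartz; clarify)
    fix f g :: "real^'a \<Rightarrow> complex" and x i
    assume fg: "f \<in> schwartz" "g \<in> schwartz"
    show "(\<lambda>x. f x * g x) differentiable (at x)"
      using fg by (intro differentiable_mult schwartz_differentiable)
    obtain C where "norm (f x) \<le> C" for x
      using rapidD[OF schwartz_rapid[OF fg(1)], of 0] by auto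
    then show "rapid (\<lambda>x. f x * g x)" by (intro rapid_bounded_mult schwartz_rapid fg)
    have "partial_deriv i (\<lambda>x. f x * g x) = (\<lambda>x. f x * partial_deriv i g x + partial_deriv i f x * g x)"
      using fg by (auto simp: partial_deriv_mult schwartz_differentiable)
    also have "\<dots> \<in> polyspan ?X"
      using fg by (intro polyspan.add polyspan.base) (blast intro: schwartz_partial_deriv)+
    finally show "partial_deriv i (\<lambda>x. f x * g x) \<in> polyspan ?X" .
  qed
  then show ?thesis using assms by (blast intro: polyspan.base)
qed


lemma schwartz_zero: "(\<lambda>x. 0) \<in> schwartz"
  by (rule schwartz_coinduct[where X="{\<lambda>x. 0}"])
    (auto simp: rapid_def partial_deriv_def intro: exI[of _ 0])

lemma schwartz_sum:
  "(\<And>k. k \<in> A \<Longrightarrow> f k \<in> schwartz) \<Longrightarrow> (\<lambda>x. \<Sum>k\<in>A. f k x) \<in> schwartz"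
  by (induction A rule: infinite_finite_induct) (auto intro: schwartz_add schwartz_zero)

section \<open>Affine substitutions, sums and translates of Schwartz functions\<close>

lemma has_derivative_affine_comp:
  assumes "f differentiable (at (c *\<^sub>R x + a))"
  shows "((\<lambda>x. f (c *\<^sub>R x + a)) has_derivative
    (\<lambda>h. frechet_derivative f (at (c *\<^sub>R x + a)) (c *\<^sub>R h))) (at x)"
proof -
  have "((\<lambda>x. c *\<^sub>R x + a) has_derivative (\<lambda>h. c *\<^sub>R h)) (at x)"
    by (auto intro!: derivative_eq_intros)
  from has_derivative_compose[OF this] assms show ?thesis
    by (auto simp: frechet_derivative_works)
qed

lemma partial_deriv_affine:
  assumes "f differentiable (at (c *\<^sub>R x + a))"
  shows "partial_deriv i (\<lambda>x. f (c *\<^sub>R x + a)) x = of_real c * partial_deriv i f (c *\<^sub>R x + a)"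
proof -
  have "linear (frechet_derivative f (at (c *\<^sub>R x + a)))"
    using assms by (simp add: frechet_derivative_works has_derivative_linear)
  then show ?thesis
    by (subst partial_deriv_eq[OF has_derivative_affine_comp[OF assms]])
      (simp add: partial_deriv_def linear_scale flip: scaleR_conv_of_real)
qed

lemma rapid_affine:
  assumes "rapid f" "c \<noteq> 0"
  shows "rapid (\<lambda>x. f (c *\<^sub>R x + a))"
  unfolding rapid_def
proof
  fix M
  obtain C where C: "(1 + norm x) ^ M * norm (f x) \<le> C" for x
    using assms(1) unfolding rapid_def by blast
  let ?K = "(1 + 1 / \<bar>c\<bar>) * (1 + norm a)"
  have "(1 + norm x) ^ M * norm (f (c *\<^sub>R x + a)) \<le> ?K ^ M * C" for x
  proof -
    have "1 + norm x \<le> (1 + 1 / \<bar>c\<bar>) * (1 + norm (c *\<^sub>R x))"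
      using assms(2) by (simp add: field_simps)
    also have "\<dots> \<le> (1 + 1 / \<bar>c\<bar>) * ((1 + norm a) * (1 + norm (c *\<^sub>R x + a)))"
      by (intro mult_left_mono peetre) simp
    finally have "1 + norm x \<le> ?K * (1 + norm (c *\<^sub>R x + a))" by (simp add: mult.assoc)
    then have "(1 + norm x) ^ M \<le> ?K ^ M * (1 + norm (c *\<^sub>R x + a)) ^ M"
      unfolding power_mult_distrib[symmetric] by (intro power_mono) auto
    then have "(1 + norm x) ^ M * norm (f (c *\<^sub>R x + a)) \<le> ?K ^ M * ((1 + norm (c *\<^sub>R x + a)) ^ M * norm (f (c *\<^sub>R x + a)))"
      by (simp add: mult_right_mono flip: mult.assoc)
    also have "\<dots> \<le> ?K ^ M * C" by (intro mult_left_mono C zero_le_power) simp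
    finally show ?thesis .
  qed
  then show "\<exists>C. \<forall>x. (1 + norm x) ^ M * norm (f (c *\<^sub>R x + a)) \<le> C" by blast
qed

lemma schwartz_affine:
  assumes "f \<in> schwartz" "c \<noteq> 0"
  shows "(\<lambda>x. f (c *\<^sub>R x + a)) \<in> schwartz"
proof (rule schwartz_coinduct)
  \<comment> \<open>The free factor k absorbs the powers of c that the chain rule produces.\<close>
  let ?X = "{\<lambda>x. k * f (c *\<^sub>R x + a) | k f. f \<in> schwartz}"
  show "(\<lambda>x. f (c *\<^sub>R x + a)) \<in> ?X"
    using assms by (auto intro!: exI[of _ 1] exI[of _ f])
  fix g assume "g \<in> ?X"
  then obtain k f where g: "g = (\<lambda>x. k * f (c *\<^sub>R x + a))" and f: "f \<in> schwartz" by blast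
  have d: "(\<lambda>x. f (c *\<^sub>R x + a)) differentiable (at x)" for x
    using has_derivative_affine_comp[OF schwartz_differentiable[OF f]] by (rule differentiableI)
  show "g differentiable (at x)" for x unfolding g by (intro differentiable_mult d) simp
  show "rapid g" unfolding g by (intro rapid_cmult rapid_affine schwartz_rapid f assms)
  have "partial_deriv i g x = (k * of_real c) * partial_deriv i f (c *\<^sub>R x + a)" for i x
    unfolding g using partial_deriv_mult[of "\<lambda>_. k" x "\<lambda>x. f (c *\<^sub>R x + a)" i] d
    by (simp add: partial_deriv_affine schwartz_differentiable f) (simp add: partial_deriv_def)
  then show "partial_deriv i g \<in> ?X" for i
    using schwartz_partial_deriv[OF f] by blast
qed

lemma schwartz_shift: "f \<in> schwartz \<Longrightarrow> (\<lambda>x. f (x + a)) \<in> schwartz"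
  and schwartz_shift_diff: "f \<in> schwartz \<Longrightarrow> (\<lambda>x. f (x - a)) \<in> schwartz"
  and schwartz_reflect: "f \<in> schwartz \<Longrightarrow> (\<lambda>x. f (a - x)) \<in> schwartz"
  and schwartz_uminus_arg: "f \<in> schwartz \<Longrightarrow> (\<lambda>x. f (- x)) \<in> schwartz"
  and schwartz_dilate: "f \<in> schwartz \<Longrightarrow> c \<noteq> 0 \<Longrightarrow> (\<lambda>x. f (c *\<^sub>R x)) \<in> schwartz"
  using schwartz_affine[of f 1 a] schwartz_affine[of f 1 "- a"] schwartz_affine[of f "-1" a]
    schwartz_affine[of f "-1" 0] schwartz_affine[of f c 0]
  by (simp_all add: algebra_simps)

lemma partial_derivs_add:
  assumes "f \<in> schwartz" "g \<in> schwartz"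
  shows "partial_derivs is (\<lambda>x. f x + g x) = (\<lambda>x. partial_derivs is f x + partial_derivs is g x)"
proof (induction "is")
  case (Cons i "is")
  show ?case
    using assms by (auto simp: Cons partial_deriv_add schwartz_differentiable schwartz_partial_derivs)
qed simp

lemma partial_derivs_cmult:
  assumes "f \<in> schwartz"
  shows "partial_derivs is (\<lambda>x. c * f x) = (\<lambda>x. c * partial_derivs is f x)"
proof (induction "is")
  case (Cons i "is")
  have "partial_deriv i (\<lambda>x. c * partial_derivs is f x) x = c * partial_deriv i (partial_derivs is f) x" for x
    using partial_deriv_mult[of "\<lambda>_. c" x "partial_derivs is f" i] assms
    by (simp add: schwartz_differentiable schwartz_partial_derivs) (simp add: partial_deriv_def)
  then show ?case by (auto simp: Cons)
qed simp

lemma partial_derivs_diff: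
  assumes "f \<in> schwartz" "g \<in> schwartz"
  shows "partial_derivs is (\<lambda>x. f x - g x) = (\<lambda>x. partial_derivs is f x - partial_derivs is g x)"
  using partial_derivs_add[OF assms(1) schwartz_cmult[OF assms(2)], of "is" "-1"]
  partial_derivs_cmult[OF assms(2), of "is" "-1"] by simp

lemma partial_derivs_zero: "partial_derivs is (\<lambda>x. 0) = (\<lambda>x. 0)"
  using partial_derivs_cmult[OF schwartz_zero, of "is" 0] by simp

lemma partial_derivs_sum:
  assumes "\<And>k. k \<in> A \<Longrightarrow> f k \<in> schwartz"
  shows "partial_derivs is (\<lambda>x. \<Sum>k\<in>A. f k x) = (\<lambda>x. \<Sum>k\<in>A. partial_derivs is (f k) x)"
  using assms
  by (induction A rule: infinite_finite_induct)
    (simp_all add: partial_derivs_zero partial_derivs_add schwartz_sum)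

lemma partial_derivs_shift:
  assumes "f \<in> schwartz"
  shows "partial_derivs is (\<lambda>x. f (x - a)) = (\<lambda>x. partial_derivs is f (x - a))"
proof (induction "is")
  case (Cons i "is")
  show ?case
    using partial_deriv_affine[of "partial_derivs is f" 1 _ "- a" i] assms
    by (auto simp: Cons schwartz_differentiable schwartz_partial_derivs)
qed simp

text \<open>Every derivative vanishes on the open complement of the support, so the weighted
  derivatives are continuous functions that only have to be bounded on a compact set.\<close>

lemma test_function_schwartz:
  assumes "test_function f"
  shows "f \<in> schwartz"
proof -
  let ?K = "closure {x. f x \<noteq> 0}"
  have sm: "smooth f" and K: "compact ?K" using assms by (auto simp: test_function_def)
  have z: "partial_derivs is f x = 0" if "x \<notin> ?K" for "is" x
    using that
  proof (induction "is" arbitrary: x)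
    case Nil
    then show ?case using closure_subset[of "{x. f x \<noteq> 0}"] by auto
  next
    case (Cons i "is")
    have "(partial_derivs is f has_derivative (\<lambda>_. 0)) (at x)"
      by (rule has_derivative_transform_within_open[OF has_derivative_const, of "- ?K"])
        (use Cons in \<open>auto simp: open_Compl\<close>)
    then show ?case by (simp add: partial_deriv_eq)
  qed
  have "rapid (partial_derivs is f)" for "is"
    unfolding rapid_def
  proof
    fix M
    have "continuous_on UNIV (partial_derivs is f)"
      using sm unfolding smooth_def
      by (meson differentiable_imp_continuous_within continuous_at_imp_continuous_on)
    then have "continuous_on ?K (\<lambda>x. (1 + norm x) ^ M * norm (partial_derivs is f x))"
      by (intro continuous_intros) (auto intro: continuous_on_subset)
    then have "bounded ((\<lambda>x. (1 + norm x) ^ M * norm (partial_derivs is f x)) ` ?K)"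
      using K compact_continuous_image compact_imp_bounded by blast
    then obtain C where "\<forall>x\<in>?K. (1 + norm x) ^ M * norm (partial_derivs is f x) \<le> C"
      unfolding bounded_iff by (auto simp: abs_le_iff)
    then have "(1 + norm x) ^ M * norm (partial_derivs is f x) \<le> max C 0" for x
      using z[of x "is"] by (cases "x \<in> ?K") auto
    then show "\<exists>C. \<forall>x. (1 + norm x) ^ M * norm (partial_derivs is f x) \<le> C" by blast
  qed
  then show ?thesis using sm by (simp add: schwartz_iff)
qed

section \<open>The Gaussian as a Schwartz function\<close>

lemma power_le_fact_mult_exp:
  assumes "0 \<le> (u::real)"
  shows "u ^ M \<le> fact M * exp u"
proof -
  have "(\<Sum>n\<in>{M}. inverse (fact n) *\<^sub>R u ^ n) \<le> (\<Sum>n. inverse (fact n) *\<^sub>R u ^ n)"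
    by (rule sum_le_suminf[OF summable_exp_generic]) (use assms in auto)
  then show ?thesis by (simp add: exp_def field_simps)
qed

definition gauss :: "real ^ 'n \<Rightarrow> complex" where
  "gauss x = complex_of_real (exp (- (x \<bullet> x) / 2))"

lemma has_derivative_gauss: "(gauss has_derivative (\<lambda>h. - complex_of_real (x \<bullet> h) * gauss x)) (at x)"
proof -
  have "((\<lambda>x. exp (- (x \<bullet> x) / 2)) has_derivative (\<lambda>h. - (x \<bullet> h) * exp (- (x \<bullet> x) / 2))) (at x)"
    by (auto intro!: derivative_eq_intros simp: inner_commute)
  from has_derivative_of_real[OF this] show ?thesis
    unfolding gauss_def by simp
qed

lemma gauss_schwartz: "(gauss :: real ^ 'n \<Rightarrow> complex) \<in> schwartz"
proof -
  have d: "gauss differentiable (at x)" for x :: "real ^ 'n"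
    using has_derivative_gauss by (rule differentiableI)
  have "(1 + norm x) ^ M * norm (gauss x) \<le> fact M * exp (3/2)" for x :: "real ^ 'n" and M
  proof -
    \<comment> \<open>Completing the square bounds the exponent 1 + |x| - |x|^2 / 2 that is left
      once the polynomial factor has been replaced by an exponential.\<close>
    have "0 \<le> (norm x - 1)\<^sup>2" by simp
    then have *: "1 + norm x - (norm x)\<^sup>2 / 2 \<le> 3/2" by (simp add: power2_diff)
    have "(1 + norm x) ^ M * norm (gauss x) \<le> (fact M * exp (1 + norm x)) * exp (- (norm x)\<^sup>2 / 2)"
      unfolding gauss_def norm_of_real by (intro mult_mono power_le_fact_mult_exp)
        (auto simp: power2_norm_eq_inner)
    also have "\<dots> = fact M * exp (1 + norm x - (norm x)\<^sup>2 / 2)"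
      by (simp add: add_divide_distrib diff_divide_distrib flip: exp_add)
    also have "\<dots> \<le> fact M * exp (3/2)" using * by (intro mult_left_mono) auto
    finally show ?thesis .
  qed
  then have r: "rapid (gauss :: real ^ 'n \<Rightarrow> complex)" unfolding rapid_def by blast
  have "partial_deriv i gauss = (\<lambda>x :: real ^ 'n. (-1) * (complex_of_real (x $ i) * gauss x))" for i
    by (rule ext, subst partial_deriv_eq[OF has_derivative_gauss]) (simp add: inner_axis)
  moreover have "(\<lambda>x :: real ^ 'n. (-1) * (complex_of_real (x $ i) * gauss x)) \<in> polyspan {gauss}" for i
    by (intro polyspan.intros) simp
  ultimately have p: "partial_deriv i gauss \<in> polyspan {gauss :: real ^ 'n \<Rightarrow> complex}" for i by metis
  have "polyspan {gauss :: real ^ 'n \<Rightarrow> complex} \<subseteq> schwartz"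
    by (rule polyspan_subset_schwartz) (use d r p in \<open>simp_all only: singleton_iff\<close>)
  then show ?thesis by (blast intro: polyspan.base)
qed

text \<open>Mean value inequality on the segment from x to y. The gradient decays at the
  intermediate point, and \<open>peetre\<close> moves this decay to x, which costs the factor with
  exponent M in \<open>norm (x - y)\<close>.\<close>

lemma schwartz_diff_bound:
  assumes "f \<in> schwartz"
  shows "\<exists>C\<ge>0. \<forall>x y. norm (f x - f y) \<le> C * norm (x - y) * (1 + norm (x - y)) ^ M / (1 + norm x) ^ M"
proof -
  have "\<forall>i. \<exists>C\<ge>0. \<forall>x. norm (partial_deriv i f x) \<le> C / (1 + norm x) ^ M"
    using assms by (intro allI rapidD schwartz_rapid schwartz_partial_deriv)
  then obtain C where C0: "C i \<ge> 0" and C: "norm (partial_deriv i f x) \<le> C i / (1 + norm x) ^ M" for i x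
    by metis
  have "norm (f x - f y) \<le> (\<Sum>i\<in>UNIV. C i) * norm (x - y) * (1 + norm (x - y)) ^ M / (1 + norm x) ^ M" for x y
  proof -
    let ?B = "(\<Sum>i\<in>UNIV. C i) * (1 + norm (x - y)) ^ M / (1 + norm x) ^ M"
    have "norm (f x - f y) \<le> ?B * norm (x - y)"
    proof (rule differentiable_bound[of "closed_segment x y"])
      show "(f has_derivative (\<lambda>h. \<Sum>i\<in>UNIV. h $ i *\<^sub>R partial_deriv i f z)) (at z within closed_segment x y)" for z
        by (rule has_derivative_at_withinI[OF has_derivative_partial]) (intro schwartz_differentiable assms)
      show "onorm (\<lambda>h. \<Sum>i\<in>UNIV. h $ i *\<^sub>R partial_deriv i f z) \<le> ?B" if z: "z \<in> closed_segment x y" for z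
      proof (rule onorm_bound)
        fix h
        have xz: "(1 + norm x) ^ M \<le> (1 + norm (x - y)) ^ M * (1 + norm z) ^ M"
        proof -
          have "1 + norm x \<le> (1 + norm (z - x)) * (1 + norm z)"
            using peetre[of x "z - x"] by simp
          also have "\<dots> \<le> (1 + norm (x - y)) * (1 + norm z)"
            using segment_bound1[OF z] by (intro mult_right_mono) (auto simp: norm_minus_commute)
          finally show ?thesis unfolding power_mult_distrib[symmetric] by (intro power_mono) auto
        qed
        have "norm (\<Sum>i\<in>UNIV. h $ i *\<^sub>R partial_deriv i f z) \<le> (\<Sum>i\<in>UNIV. norm h * (C i / (1 + norm z) ^ M))"
          by (intro sum_norm_le, unfold norm_scaleR, intro mult_mono C)
            (simp_all add: component_le_norm_cart)
        also have "\<dots> = (\<Sum>i\<in>UNIV. C i) / (1 + norm z) ^ M * norm h"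
          by (simp add: sum_distrib_left sum_divide_distrib mult_ac)
        also have "\<dots> \<le> ?B * norm h"
        proof (intro mult_right_mono)
          show "(\<Sum>i\<in>UNIV. C i) / (1 + norm z) ^ M \<le> ?B"
            using mult_left_mono[OF xz, of "\<Sum>i\<in>UNIV. C i"] C0
            by (simp add: field_simps add_pos_nonneg sum_nonneg)
        qed simp
        finally show "norm (\<Sum>i\<in>UNIV. h $ i *\<^sub>R partial_deriv i f z) \<le> ?B * norm h" .
      qed (auto intro!: divide_nonneg_nonneg mult_nonneg_nonneg sum_nonneg C0)
    qed auto
    then show ?thesis by (simp add: mult_ac)
  qed
  then show ?thesis using C0 by (intro exI[of _ "\<Sum>i\<in>UNIV. C i"]) (auto intro: sum_nonneg)
qed

text \<open>The mean value inequality is applied to the function of s obtained by subtracting the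
  linear term along the j-th axis. Its derivative is a difference of values of
  \<open>partial_deriv j f\<close>, hence already O(|h|) with decay in x.\<close>

lemma schwartz_taylor:
  assumes "f \<in> schwartz"
  shows "\<exists>C\<ge>0. \<forall>x h. norm (f (x + h *\<^sub>R axis j 1) - f x - h *\<^sub>R partial_deriv j f x)
    \<le> C * h\<^sup>2 * (1 + \<bar>h\<bar>) ^ M / (1 + norm x) ^ M"
proof -
  obtain C where C0: "C \<ge> 0" and C: "norm (partial_deriv j f x - partial_deriv j f y)
      \<le> C * norm (x - y) * (1 + norm (x - y)) ^ M / (1 + norm x) ^ M" for x y
    using schwartz_diff_bound[OF schwartz_partial_deriv[OF assms]] by blast
  have "norm (f (x + h *\<^sub>R axis j 1) - f x - h *\<^sub>R partial_deriv j f x)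
    \<le> C * h\<^sup>2 * (1 + \<bar>h\<bar>) ^ M / (1 + norm x) ^ M" for x h
  proof -
    let ?g = "\<lambda>s. f (x + s *\<^sub>R axis j 1) - s *\<^sub>R partial_deriv j f x"
    let ?B = "C * \<bar>h\<bar> * (1 + \<bar>h\<bar>) ^ M / (1 + norm x) ^ M"
    have "norm (?g h - ?g 0) \<le> ?B * norm (h - 0)"
    proof (rule differentiable_bound[of "closed_segment 0 h"])
      fix s assume s: "s \<in> closed_segment 0 h"
      let ?y = "x + s *\<^sub>R axis j 1"
      have d: "((\<lambda>s. x + s *\<^sub>R axis j 1) has_derivative (\<lambda>t. t *\<^sub>R axis j 1)) (at s)"
        by (auto intro!: derivative_eq_intros)
      have fd: "(f has_derivative (\<lambda>h. \<Sum>i\<in>UNIV. h $ i *\<^sub>R partial_deriv i f ?y)) (at ?y)"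
        by (intro has_derivative_partial schwartz_differentiable assms)
      have ld: "((\<lambda>s. f (x + s *\<^sub>R axis j 1)) has_derivative (\<lambda>t. t *\<^sub>R partial_deriv j f ?y)) (at s)"
      proof -
        have "(\<Sum>i\<in>UNIV. (t *\<^sub>R axis j 1) $ i *\<^sub>R partial_deriv i f ?y) = t *\<^sub>R partial_deriv j f ?y" for t
        proof -
          have "(\<Sum>i\<in>UNIV. (t *\<^sub>R axis j 1) $ i *\<^sub>R partial_deriv i f ?y)
            = (\<Sum>i\<in>UNIV. if i = j then t *\<^sub>R partial_deriv j f ?y else 0)"
            by (rule sum.cong) (auto simp: axis_def)
          then show ?thesis by simp
        qed
        then show ?thesis using has_derivative_compose[OF d fd] by simp
      qed
      have "(?g has_derivative (\<lambda>t. t *\<^sub>R partial_deriv j f ?y - t *\<^sub>R partial_deriv j f x)) (at s)"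
        by (intro has_derivative_diff ld has_derivative_scaleR_left has_derivative_ident)
      then show "(?g has_derivative (\<lambda>t. t *\<^sub>R (partial_deriv j f ?y - partial_deriv j f x)))
          (at s within closed_segment 0 h)"
        unfolding scaleR_diff_right by (rule has_derivative_at_withinI)
      have s': "\<bar>s\<bar> \<le> \<bar>h\<bar>" using segment_bound1[OF s] by simp
      have "norm (partial_deriv j f ?y - partial_deriv j f x) \<le> C * \<bar>s\<bar> * (1 + \<bar>s\<bar>) ^ M / (1 + norm x) ^ M"
        using C[of x ?y] by (simp add: norm_minus_commute)
      also have "\<dots> \<le> ?B"
        using s' C0 by (intro divide_right_mono mult_mono power_mono) auto
      finally have K: "norm (partial_deriv j f ?y - partial_deriv j f x) \<le> ?B" .
      show "onorm (\<lambda>t. t *\<^sub>R (partial_deriv j f ?y - partial_deriv j f x)) \<le> ?B"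
      proof (intro onorm_bound)
        fix t :: real
        from mult_right_mono[OF K, of "\<bar>t\<bar>"]
        show "norm (t *\<^sub>R (partial_deriv j f ?y - partial_deriv j f x)) \<le> ?B * norm t"
          by (simp add: mult.commute)
      qed (auto intro!: C0 divide_nonneg_nonneg mult_nonneg_nonneg)
    qed auto
    moreover have "?g h - ?g 0 = f (x + h *\<^sub>R axis j 1) - f x - h *\<^sub>R partial_deriv j f x" by simp
    moreover have h2: "h\<^sup>2 = \<bar>h\<bar> * \<bar>h\<bar>" by (simp add: power2_eq_square)
    have "?B * norm (h - 0) = C * h\<^sup>2 * (1 + \<bar>h\<bar>) ^ M / (1 + norm x) ^ M"
      unfolding h2
      by (simp only: mult_ac times_divide_eq_left times_divide_eq_right real_norm_def diff_0_right)
    ultimately show ?thesis by (simp only:)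
  qed
  then show ?thesis using C0 by blast
qed

lemma schwartz_seminorm_le:
  "(\<And>x. (1 + norm x) ^ M * norm (partial_derivs is \<phi> x) \<le> e) \<Longrightarrow> schwartz_seminorm M is \<phi> \<le> e"
  unfolding schwartz_seminorm_def by (rule cSUP_least) auto

lemma schwartz_seminorm_ge:
  assumes "\<phi> \<in> schwartz"
  shows "(1 + norm x) ^ M * norm (partial_derivs is \<phi> x) \<le> schwartz_seminorm M is \<phi>"
proof -
  obtain C where "\<And>x. (1 + norm x) ^ M * norm (partial_derivs is \<phi> x) \<le> C"
    using schwartz_rapid[OF schwartz_partial_derivs[OF assms]] unfolding rapid_def by blast
  then have "bdd_above (range (\<lambda>x. (1 + norm x) ^ M * norm (partial_derivs is \<phi> x)))"
    by (rule bdd_aboveI2)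
  then show ?thesis unfolding schwartz_seminorm_def by (rule cSUP_upper[rotated]) simp
qed

lemma schwartz_seminorm_nonneg: "\<phi> \<in> schwartz \<Longrightarrow> 0 \<le> schwartz_seminorm M is \<phi>"
  by (rule order.trans[OF _ schwartz_seminorm_ge[of _ 0]]) auto

lemma finite_lists_le: "finite {is :: 'n::finite list. length is \<le> M}"
  using finite_lists_length_le[of "UNIV :: 'n set" M] by simp

section \<open>The Fourier transform on the Schwartz space\<close>

lemma has_derivative_quadratic:
  fixes f :: "'a::real_normed_vector \<Rightarrow> 'b::real_normed_vector"
  assumes "bounded_linear D" and C: "\<And>h. norm (f (x + h) - f x - D h) \<le> C * (norm h)\<^sup>2"
  shows "(f has_derivative D) (at x)"
  unfolding has_derivative_iff_norm
proof
  have "((\<lambda>y. C * norm (y - x)) \<longlongrightarrow> C * norm (x - x)) (at x)" by (intro tendsto_intros)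
  then have l: "((\<lambda>y. C * norm (y - x)) \<longlongrightarrow> 0) (at x)" by simp
  have b: "norm (f y - f x - D (y - x)) / norm (y - x) \<le> C * norm (y - x)" if "y \<noteq> x" for y
    using C[of "y - x"] that by (simp add: divide_le_eq power2_eq_square mult_ac)
  show "((\<lambda>y. norm (f y - f x - D (y - x)) / norm (y - x)) \<longlongrightarrow> 0) (at x)"
    by (rule tendsto_sandwich[OF _ _ tendsto_const l])
      (auto simp: eventually_at intro!: exI[of _ 1] b)
qed fact

lemma iexp_taylor1: "norm (iexp t - 1 - \<i> * of_real t) \<le> t\<^sup>2"
proof -
  have "norm (iexp t - (\<Sum>k \<le> 1. (\<i> * t) ^ k / fact k)) \<le> \<bar>t\<bar> ^ Suc 1 / fact (Suc 1)"
    by (rule iexp_approx1)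
  moreover have "(\<Sum>k \<le> 1. (\<i> * complex_of_real t) ^ k / fact k) = 1 + \<i> * t" by simp
  ultimately have "norm (iexp t - (1 + \<i> * t)) \<le> \<bar>t\<bar>\<^sup>2 / 2" by (simp add: power2_eq_square)
  also have "\<dots> \<le> t\<^sup>2" by simp
  finally show ?thesis by (simp add: diff_diff_eq)
qed

text \<open>The kernel of \<open>fourier\<close>. It is symmetric, of modulus one and multiplicative
  in each argument, and the inverse transform is expressed by it as well.\<close>

definition wave :: "real ^ 'n \<Rightarrow> real ^ 'n \<Rightarrow> complex" where
  "wave x \<xi> = exp (- \<i> * complex_of_real (x \<bullet> \<xi>))"

lemma norm_wave [simp]: "norm (wave x \<xi>) = 1"
  by (simp add: wave_def)

lemma wave_add: "wave (x + y) \<xi> = wave x \<xi> * wave y \<xi>" "wave x (\<xi> + \<eta>) = wave x \<xi> * wave x \<eta>"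
  by (simp_all add: wave_def inner_add algebra_simps flip: exp_add)

lemma wave_minus: "wave (- x) \<xi> = wave x (- \<xi>)"
  by (simp add: wave_def)

lemma wave_commute: "wave x \<xi> = wave \<xi> x"
  by (simp add: wave_def inner_commute)

lemma wave_zero [simp]: "wave 0 \<xi> = 1" "wave x 0 = 1"
  by (simp_all add: wave_def)

lemma wave_eq_iexp: "wave x \<xi> = iexp (- (x \<bullet> \<xi>))"
  by (simp add: wave_def)

lemma wave_measurable [measurable]:
  assumes [measurable]: "f \<in> borel_measurable M" "g \<in> borel_measurable M"
  shows "(\<lambda>x. wave (f x) (g x)) \<in> borel_measurable M"
  unfolding wave_def by measurable

lemma fourier_eq: "fourier f \<xi> = (\<integral>x. f x * wave x \<xi> \<partial>lborel)"
  by (simp add: fourier_def wave_def)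

lemma integrable_wave: "integrable lborel f \<Longrightarrow> integrable lborel (\<lambda>x. f x * wave x \<xi>)"
  by (rule integrable_bounded_mult[where A=1]) auto

lemma fourier_add:
  "integrable lborel f \<Longrightarrow> integrable lborel g \<Longrightarrow> fourier (\<lambda>x. f x + g x) \<xi> = fourier f \<xi> + fourier g \<xi>"
  by (simp add: fourier_eq distrib_right integrable_wave)

lemma fourier_diff:
  "integrable lborel f \<Longrightarrow> integrable lborel g \<Longrightarrow> fourier (\<lambda>x. f x - g x) \<xi> = fourier f \<xi> - fourier g \<xi>"
  by (simp add: fourier_eq left_diff_distrib integrable_wave)

lemma fourier_cmult: "fourier (\<lambda>x. c * f x) \<xi> = c * fourier f \<xi>"
  by (simp add: fourier_eq mult.assoc)

lemma norm_fourier_le: "norm (fourier f \<xi>) \<le> (\<integral>x. norm (f x) \<partial>lborel)"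
  unfolding fourier_eq by (rule order.trans[OF integral_norm_bound]) (simp add: norm_mult)

lemma inv_fourier_eq: "inv_fourier f x = (1 / (2 * of_real pi) ^ CARD('n)) * fourier f (- x :: real ^ 'n)"
  by (simp add: inv_fourier_def fourier_eq wave_def inner_commute)

lemma schwartz_minus_ii: "f \<in> schwartz \<Longrightarrow> (\<lambda>x. - \<i> * (complex_of_real (x $ j) * f x)) \<in> schwartz"
  by (rule schwartz_cmult[OF schwartz_coord])

lemma has_derivative_fourier:
  assumes f: "f \<in> schwartz"
  shows "(fourier f has_derivative
    (\<lambda>h. \<Sum>j\<in>UNIV. h $ j *\<^sub>R fourier (\<lambda>x. - \<i> * (complex_of_real (x $ j) * f x)) \<xi>)) (at \<xi>)"
proof -
  \<comment> \<open>Of the 2d + 2 powers, two pay for the factor |x|^2 in the quadratic remainder of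
    the exponential; the other 2d leave \<open>weight\<close>.\<close>
  obtain C where C: "norm (f x) \<le> C / (1 + norm x) ^ (2 * CARD('a) + 2)" for x
    using rapidD[OF schwartz_rapid[OF f]] by blast
  show ?thesis
  proof (rule has_derivative_quadratic[where C = "C * (\<integral>(x :: real ^ 'a). weight x \<partial>lborel)"])
  show "bounded_linear (\<lambda>h. \<Sum>j\<in>UNIV. h $ j *\<^sub>R fourier (\<lambda>x. - \<i> * (complex_of_real (x $ j) * f x)) \<xi>)"
    by (intro bounded_linear_sum bounded_linear_scaleR_const bounded_linear_vec_nth)
next
  fix h
  let ?g = "\<lambda>x. f x * wave x \<xi> * (wave x h - 1 + \<i> * complex_of_real (x \<bullet> h))"
  have i: "integrable lborel (\<lambda>x. - \<i> * (complex_of_real (x $ j) * f x) * wave x \<xi>)" for j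
    by (rule integrable_wave[OF schwartz_integrable[OF schwartz_minus_ii[OF f]]])
  have i0: "integrable lborel (\<lambda>x. f x * wave x \<eta>)" for \<eta>
    by (rule integrable_wave[OF schwartz_integrable[OF f]])
  have pt: "?g x = f x * wave x (\<xi> + h) - f x * wave x \<xi>
      - (\<Sum>j\<in>UNIV. h $ j *\<^sub>R (- \<i> * (complex_of_real (x $ j) * f x) * wave x \<xi>))" for x
  proof -
    have "complex_of_real (x \<bullet> h) = (\<Sum>j\<in>UNIV. complex_of_real (x $ j) * complex_of_real (h $ j))"
      by (simp add: inner_vec_def)
    then show ?thesis
      by (simp add: wave_add algebra_simps sum_distrib_left sum_distrib_right scaleR_conv_of_real sum_negf)
  qed
  have "fourier f (\<xi> + h) - fourier f \<xi> - (\<Sum>j\<in>UNIV. h $ j *\<^sub>R fourier (\<lambda>x. - \<i> * (complex_of_real (x $ j) * f x)) \<xi>)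
    = (\<integral>x. ?g x \<partial>lborel)"
    unfolding pt fourier_eq using i i0
    by (subst Bochner_Integration.integral_diff)
      (auto intro!: Bochner_Integration.integrable_sum integrable_scaleR_right Bochner_Integration.integrable_diff
        simp: Bochner_Integration.integral_sum simp del: integral_mult_right_zero)
  also have "norm \<dots> \<le> (\<integral>(x :: real ^ 'a). C * (norm h)\<^sup>2 * weight x \<partial>lborel)"
  proof (rule Bochner_Integration.integral_norm_bound_integral)
    show "integrable lborel ?g" unfolding pt using i i0
      by (intro Bochner_Integration.integrable_diff Bochner_Integration.integrable_sum integrable_scaleR_right)
    show "integrable lborel (\<lambda>x :: real ^ 'a. C * (norm h)\<^sup>2 * weight x)"
      by (intro integrable_mult_right integrable_weight)
    fix x :: "real ^ 'a"
    have "norm (wave x h - 1 + \<i> * complex_of_real (x \<bullet> h)) \<le> (x \<bullet> h)\<^sup>2"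
      using iexp_taylor1[of "- (x \<bullet> h)"] by (simp add: wave_eq_iexp)
    also have "\<dots> \<le> (norm x * norm h)\<^sup>2"
      using Cauchy_Schwarz_ineq2[of x h] by (simp add: abs_le_square_iff[symmetric])
    also have "\<dots> \<le> (1 + norm x)\<^sup>2 * (norm h)\<^sup>2"
      unfolding power_mult_distrib by (intro mult_right_mono power_mono) auto
    finally have "norm (?g x) \<le> C / (1 + norm x) ^ (2 * CARD('a) + 2) * ((1 + norm x)\<^sup>2 * (norm h)\<^sup>2)"
      unfolding norm_mult norm_wave mult_1_right by (intro mult_mono C) (use order.trans[OF norm_ge_zero C] in auto)
    also have "\<dots> = C * (norm h)\<^sup>2 * weight x"
    proof -
      have "1 + norm x \<noteq> 0" by (metis add_pos_nonneg norm_ge_zero less_irrefl zero_less_one)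
      then show ?thesis by (simp add: weight_def power_add power2_eq_square)
    qed
    finally show "norm (?g x) \<le> C * (norm h)\<^sup>2 * weight x" .
  qed
  also have "\<dots> = (C * (\<integral>(x :: real ^ 'a). weight x \<partial>lborel)) * (norm h)\<^sup>2" by simp
  finally show "norm (fourier f (\<xi> + h) - fourier f \<xi> -
      (\<Sum>j\<in>UNIV. h $ j *\<^sub>R fourier (\<lambda>x. - \<i> * (complex_of_real (x $ j) * f x)) \<xi>))
    \<le> (C * (\<integral>(x :: real ^ 'a). weight x \<partial>lborel)) * (norm h)\<^sup>2" .
qed
qed

lemma partial_deriv_fourier:
  assumes "f \<in> schwartz"
  shows "partial_deriv j (fourier f) = fourier (\<lambda>x. - \<i> * (complex_of_real (x $ j) * f x))"
proof
  fix \<xi>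
  have "partial_deriv j (fourier f) \<xi> =
      (\<Sum>k\<in>UNIV. axis j 1 $ k *\<^sub>R fourier (\<lambda>x. - \<i> * (complex_of_real (x $ k) * f x)) \<xi>)"
    by (rule partial_deriv_eq[OF has_derivative_fourier[OF assms]])
  also have "\<dots> = (\<Sum>k\<in>UNIV. if k = j then fourier (\<lambda>x. - \<i> * (complex_of_real (x $ j) * f x)) \<xi> else 0)"
    by (rule sum.cong) (auto simp: axis_def)
  finally show "partial_deriv j (fourier f) \<xi> = fourier (\<lambda>x. - \<i> * (complex_of_real (x $ j) * f x)) \<xi>"
    by simp
qed

lemma fourier_shift:
  assumes "f \<in> borel_measurable borel"
  shows "fourier (\<lambda>x. f (x + a)) \<xi> = wave a (- \<xi>) * fourier f \<xi>"
proof -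
  have [measurable]: "f \<in> borel_measurable borel" by fact
  have "(\<lambda>x. f (x + a) * wave x \<xi>) = (\<lambda>x. wave a (- \<xi>) * (f (x + a) * wave (x + a) \<xi>))"
  proof
    fix x
    have one: "wave a (- \<xi>) * wave a \<xi> = 1" using wave_add(2)[of a "- \<xi>" \<xi>] by simp
    have "f (x + a) * wave x \<xi> = (wave a (- \<xi>) * wave a \<xi>) * (f (x + a) * wave x \<xi>)" by (simp add: one)
    also have "\<dots> = wave a (- \<xi>) * (f (x + a) * wave (x + a) \<xi>)" by (simp only: wave_add(1) mult_ac)
    finally show "f (x + a) * wave x \<xi> = wave a (- \<xi>) * (f (x + a) * wave (x + a) \<xi>)" .
  qed
  then show ?thesis
    unfolding fourier_eq using integral_shift_vec(1)[of "\<lambda>x. f x * wave x \<xi>" a] by simp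
qed

text \<open>Stands in for a passage to the limit h -> 0. It is used for difference quotients and for
  the truncation of Riemann sums.\<close>

lemma eq_zero_of_le_linear:
  fixes x C :: real
  assumes "\<And>h. 0 < h \<Longrightarrow> h \<le> 1 \<Longrightarrow> x \<le> C * h"
  shows "x \<le> 0"
proof (rule ccontr)
  assume "\<not> x \<le> 0"
  then have x: "x > 0" by simp
  define h where "h = min 1 (x / (2 * (\<bar>C\<bar> + 1)))"
  have "h > 0" "h \<le> 1" unfolding h_def using x by auto
  then have "x \<le> C * h" by (rule assms)
  also have "\<dots> \<le> (\<bar>C\<bar> + 1) * h" using \<open>h > 0\<close> by (intro mult_right_mono) auto
  also have "\<dots> \<le> (\<bar>C\<bar> + 1) * (x / (2 * (\<bar>C\<bar> + 1)))" unfolding h_def by (intro mult_left_mono) auto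
  also have "\<dots> = x / 2" by (simp add: field_simps)
  finally show False using x by simp
qed

text \<open>In place of integration by parts, the difference quotient of f in direction j is
  transformed. The shift becomes multiplication by exp(i h xi_j), and the remainders on both sides
  are quadratic in h, by \<open>schwartz_taylor\<close> and \<open>iexp_taylor1\<close>.\<close>

lemma fourier_partial_deriv:
  assumes f: "f \<in> schwartz"
  shows "fourier (partial_deriv j f) \<xi> = \<i> * complex_of_real (\<xi> $ j) * fourier f \<xi>"
proof -
  let ?M = "2 * CARD('a)"
  obtain C where C0: "C \<ge> 0" and C: "norm (f (x + h *\<^sub>R axis j 1) - f x - h *\<^sub>R partial_deriv j f x)
    \<le> C * h\<^sup>2 * (1 + \<bar>h\<bar>) ^ ?M / (1 + norm x) ^ ?M" for x h
    using schwartz_taylor[OF f] by blast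
  let ?W = "\<integral>(x :: real ^ 'a). weight x \<partial>lborel"
  let ?D = "fourier (partial_deriv j f) \<xi> - \<i> * complex_of_real (\<xi> $ j) * fourier f \<xi>"
  have "norm ?D \<le> (C * 2 ^ ?M * ?W + (\<xi> $ j)\<^sup>2 * norm (fourier f \<xi>)) * h" if h: "0 < h" "h \<le> 1" for h
  proof -
    let ?g = "\<lambda>x. f (x + h *\<^sub>R axis j 1) - f x - complex_of_real h * partial_deriv j f x"
    have i: "integrable lborel f" "integrable lborel (\<lambda>x. f (x + h *\<^sub>R axis j 1))"
       "integrable lborel (\<lambda>x. complex_of_real h * partial_deriv j f x)"
      using f by (intro schwartz_integrable schwartz_shift schwartz_cmult schwartz_partial_deriv; assumption)+
    have "fourier ?g \<xi> = wave (h *\<^sub>R axis j 1) (- \<xi>) * fourier f \<xi> - fourier f \<xi> - of_real h * fourier (partial_deriv j f) \<xi>"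
      using i by (simp add: fourier_diff fourier_cmult fourier_shift)
    also have "wave (h *\<^sub>R axis j 1) (- \<xi>) = iexp (h * \<xi> $ j)"
      by (simp add: wave_eq_iexp inner_axis inner_commute)
    finally have eq: "of_real h * ?D = (iexp (h * \<xi> $ j) - 1 - \<i> * of_real (h * \<xi> $ j)) * fourier f \<xi> - fourier ?g \<xi>"
      by (simp add: algebra_simps)
    have "norm (fourier ?g \<xi>) \<le> (\<integral>x. norm (?g x) \<partial>lborel)" by (rule norm_fourier_le)
    also have "\<dots> \<le> (\<integral>(x :: real ^ 'a). C * h\<^sup>2 * 2 ^ ?M * weight x \<partial>lborel)"
    proof (rule integral_mono)
      show "integrable lborel (\<lambda>x. norm (?g x))" using i by (intro integrable_norm Bochner_Integration.integrable_diff)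
      show "integrable lborel (\<lambda>x :: real ^ 'a. C * h\<^sup>2 * 2 ^ ?M * weight x)"
        by (intro integrable_mult_right integrable_weight)
      fix x
      have "norm (?g x) \<le> C * h\<^sup>2 * (1 + \<bar>h\<bar>) ^ ?M / (1 + norm x) ^ ?M"
        using C[of x h] by (simp add: scaleR_conv_of_real)
      also have "\<dots> \<le> C * h\<^sup>2 * 2 ^ ?M / (1 + norm x) ^ ?M"
        using h C0 by (intro divide_right_mono mult_left_mono power_mono) auto
      finally show "norm (?g x) \<le> C * h\<^sup>2 * 2 ^ ?M * weight x" by (simp add: weight_def)
    qed
    finally have g: "norm (fourier ?g \<xi>) \<le> C * 2 ^ ?M * ?W * h\<^sup>2" by (simp add: mult_ac)
    have "h * norm ?D = norm (of_real h * ?D)" unfolding norm_mult using h by simp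
    also have "\<dots> \<le> norm ((iexp (h * \<xi> $ j) - 1 - \<i> * of_real (h * \<xi> $ j)) * fourier f \<xi>) + norm (fourier ?g \<xi>)"
      unfolding eq by (rule norm_triangle_ineq4)
    also have "\<dots> \<le> (h * \<xi> $ j)\<^sup>2 * norm (fourier f \<xi>) + C * 2 ^ ?M * ?W * h\<^sup>2"
      unfolding norm_mult by (intro add_mono g mult_right_mono iexp_taylor1) auto
    also have "\<dots> = h * ((C * 2 ^ ?M * ?W + (\<xi> $ j)\<^sup>2 * norm (fourier f \<xi>)) * h)"
      by (simp add: power2_eq_square algebra_simps)
    finally show ?thesis using h by (metis mult_le_cancel_left_pos)
  qed
  then have "norm ?D \<le> 0" by (rule eq_zero_of_le_linear)
  then show ?thesis by simp
qed

text \<open>Induction on the weight: 1 + |x| is at most 1 plus the sum of the |x_j|, and each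
  product x_j g belongs to \<open>Y\<close> again, so one more power of the weight is reduced to
  boundedness within \<open>Y\<close>.\<close>

lemma rapid_coord_closed:
  fixes Y :: "(real ^ 'n \<Rightarrow> complex) set"
  assumes "f \<in> Y" and b: "\<And>g. g \<in> Y \<Longrightarrow> \<exists>C. \<forall>x. norm (g x) \<le> C"
    and c: "\<And>g j. g \<in> Y \<Longrightarrow> (\<lambda>x. complex_of_real (x $ j) * g x) \<in> Y"
  shows "rapid f"
proof -
  have "\<exists>C. \<forall>x. (1 + norm x) ^ M * norm (g x) \<le> C" if "g \<in> Y" for g M
    using that
  proof (induction M arbitrary: g)
    case 0
    then show ?case using b by simp
  next
    case (Suc M)
    have "\<forall>j. \<exists>C. \<forall>x. (1 + norm x) ^ M * norm (complex_of_real (x $ j) * g x) \<le> C"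
      using Suc c by blast
    then obtain D where D: "(1 + norm x) ^ M * norm (complex_of_real (x $ j) * g x) \<le> D j" for j x
      by metis
    obtain C where C: "(1 + norm x) ^ M * norm (g x) \<le> C" for x using Suc by blast
    have "(1 + norm x) ^ Suc M * norm (g x) \<le> C + (\<Sum>j\<in>UNIV. D j)" for x
    proof -
      have "(1 + norm x) ^ Suc M * norm (g x) = (1 + norm x) * ((1 + norm x) ^ M * norm (g x))" by simp
      also have "\<dots> \<le> (1 + (\<Sum>j\<in>UNIV. \<bar>x $ j\<bar>)) * ((1 + norm x) ^ M * norm (g x))"
        by (intro mult_right_mono add_left_mono norm_le_l1_cart) auto
      also have "\<dots> = (1 + norm x) ^ M * norm (g x) + (\<Sum>j\<in>UNIV. (1 + norm x) ^ M * norm (complex_of_real (x $ j) * g x))"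
        by (simp only: distrib_right mult_1_left sum_distrib_right norm_mult norm_of_real
              mult.left_commute[of "(1 + norm x) ^ M"])
      also have "\<dots> \<le> C + (\<Sum>j\<in>UNIV. D j)" by (intro add_mono C sum_mono D)
      finally show ?thesis .
    qed
    then show ?case by blast
  qed
  then show ?thesis using assms(1) by (simp add: rapid_def)
qed

text \<open>The scalar multiples of transforms are stable under both operations that matter: a
  derivative of a transform is the transform of -i x_j f, and x_j times a transform is the transform
  of -i times the j-th derivative of f.\<close>

lemma schwartz_fourier:
  assumes "f \<in> schwartz"
  shows "fourier f \<in> schwartz"
proof (rule schwartz_coinduct[where X="{\<lambda>\<xi>. c * fourier f \<xi> | f c. f \<in> schwartz}"])
  let ?X = "{\<lambda>\<xi> :: real ^ 'a. c * fourier f \<xi> | f c. f \<in> schwartz}"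
  show "fourier f \<in> ?X" using assms by (auto intro!: exI[of _ f] exI[of _ 1])
  fix g assume "g \<in> ?X"
  then obtain f c where "f \<in> schwartz" "g = (\<lambda>\<xi>. c * fourier f \<xi>)" by blast
  then have f: "(\<lambda>x. c * f x) \<in> schwartz" and g: "g = fourier (\<lambda>x. c * f x)"
    by (auto simp: fourier_cmult schwartz_cmult)
  show "g differentiable (at x)" for x
    unfolding g by (rule differentiableI[OF has_derivative_fourier[OF f]])
  show "partial_deriv i g \<in> ?X" for i
    unfolding g partial_deriv_fourier[OF f] using schwartz_minus_ii[OF f, of i]
    by (auto intro!: exI[of _ "\<lambda>x. - \<i> * (complex_of_real (x $ i) * (c * f x))"] exI[of _ 1])
  show "rapid g"
  proof (rule rapid_coord_closed[where Y="?X"])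
    fix g :: "real ^ 'a \<Rightarrow> complex" assume "g \<in> ?X"
    then obtain f c where f: "f \<in> schwartz" and g: "g = (\<lambda>\<xi>. c * fourier f \<xi>)" by blast
    show "\<exists>C. \<forall>x. norm (g x) \<le> C"
      unfolding g norm_mult using norm_fourier_le[of f] by (blast intro: mult_left_mono norm_ge_zero)
    have "complex_of_real (x $ j) * g x = c * fourier (\<lambda>x. - \<i> * partial_deriv j f x) x" for j x
      unfolding g fourier_cmult fourier_partial_deriv[OF f] by (simp add: mult.assoc)
    then show "(\<lambda>x. complex_of_real (x $ j) * g x) \<in> ?X" for j
      using schwartz_cmult[OF schwartz_partial_deriv[OF f], of "- \<i>" j] by blast
  qed fact
qed

lemma schwartz_inv_fourier: "f \<in> schwartz \<Longrightarrow> inv_fourier f \<in> schwartz"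
  unfolding inv_fourier_eq[abs_def]
  by (rule schwartz_cmult[OF schwartz_uminus_arg[OF schwartz_fourier]])

section \<open>Fubini's theorem and the multiplication formula\<close>

lemma fubini_bounded_kernel:
  fixes f g :: "'a::euclidean_space \<Rightarrow> complex" and k :: "'a \<Rightarrow> 'a \<Rightarrow> complex"
  assumes f: "integrable lborel f" and g: "integrable lborel g"
    and k [measurable]: "(\<lambda>(x, y). k x y) \<in> borel_measurable (lborel \<Otimes>\<^sub>M lborel)"
    and A: "\<And>x y. norm (k x y) \<le> A"
  shows "(\<integral>x. (\<integral>y. f x * g y * k x y \<partial>lborel) \<partial>lborel) = (\<integral>y. (\<integral>x. f x * g y * k x y \<partial>lborel) \<partial>lborel)"
proof -
  have fm [measurable]: "f \<in> borel_measurable lborel" and gm [measurable]: "g \<in> borel_measurable lborel"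
    using f g by simp_all
  have A0: "0 \<le> A" using A norm_ge_zero order.trans by blast
  have km [measurable]: "k x \<in> borel_measurable borel" for x
    using measurable_compose_Pair1[OF _ k, of x] by simp
  have i1: "integrable lborel (\<lambda>y. f x * g y * k x y)" for x
    using integrable_bounded_mult(1)[OF g _ A[of x]] by (simp add: mult.assoc)
  have "integrable (lborel \<Otimes>\<^sub>M lborel) (\<lambda>(x, y). f x * g y * k x y)"
  proof (rule lborel_pair.Fubini_integrable)
    show "(\<lambda>(x, y). f x * g y * k x y) \<in> borel_measurable (lborel \<Otimes>\<^sub>M lborel)" by measurable
    show "integrable lborel (\<lambda>x. \<integral>y. norm (case (x, y) of (x, y) \<Rightarrow> f x * g y * k x y) \<partial>lborel)"
    proof (rule Bochner_Integration.integrable_bound)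
      show "integrable lborel (\<lambda>x. A * (\<integral>y. norm (g y) \<partial>lborel) * norm (f x))"
        using f by simp
      show "(\<lambda>x. \<integral>y. norm (case (x, y) of (x, y) \<Rightarrow> f x * g y * k x y) \<partial>lborel) \<in> borel_measurable lborel"
        by measurable
      show "AE x in lborel. norm (\<integral>y. norm (case (x, y) of (x, y) \<Rightarrow> f x * g y * k x y) \<partial>lborel)
        \<le> norm (A * (\<integral>y. norm (g y) \<partial>lborel) * norm (f x))"
      proof (rule AE_I2)
        fix x
        have "(\<integral>y. norm (f x * g y * k x y) \<partial>lborel) \<le> (\<integral>y. A * norm (f x) * norm (g y) \<partial>lborel)"
        proof (rule integral_mono)
          fix y
          show "norm (f x * g y * k x y) \<le> A * norm (f x) * norm (g y)"
            using mult_left_mono[OF A[of x y], of "norm (f x) * norm (g y)"] by (simp add: norm_mult mult_ac)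
        qed (use i1 g in auto)
        then show "norm (\<integral>y. norm (case (x, y) of (x, y) \<Rightarrow> f x * g y * k x y) \<partial>lborel)
          \<le> norm (A * (\<integral>y. norm (g y) \<partial>lborel) * norm (f x))"
          using A0 by (simp add: abs_mult mult_ac)
      qed
    qed
    show "AE x in lborel. integrable lborel (\<lambda>y. case (x, y) of (x, y) \<Rightarrow> f x * g y * k x y)"
      using i1 by simp
  qed
  from lborel_pair.Fubini_integral[OF this] show ?thesis by simp
qed

text \<open>Here \<open>g\<close> is merely bounded. Integrability on the product space comes from
  the translation invariance of the integral of |K|, which makes the inner integral at most a
  constant times |f x|.\<close>

lemma fubini_convolution:
  fixes f K g :: "real ^ 'n \<Rightarrow> complex"
  assumes f: "integrable lborel f" and K: "integrable lborel K"
    and g [measurable]: "g \<in> borel_measurable borel" and A: "\<And>y. norm (g y) \<le> A"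
  shows "(\<integral>x. f x * (\<integral>y. K (x - y) * g y \<partial>lborel) \<partial>lborel) = (\<integral>y. g y * (\<integral>x. f x * K (x - y) \<partial>lborel) \<partial>lborel)"
proof -
  have [measurable]: "f \<in> borel_measurable borel" "K \<in> borel_measurable borel"
    using f K by simp_all
  have A0: "0 \<le> A" using A norm_ge_zero order.trans by blast
  have i0: "integrable lborel (\<lambda>y. K (x - y) * g y)" for x
    using integrable_bounded_mult(1)[OF integrable_shift_vec(3)[OF K] _ A] g by simp
  have i1: "integrable lborel (\<lambda>y. f x * K (x - y) * g y)" for x
    using integrable_mult_right[OF i0, of "f x" x] by (simp add: mult.assoc)
  have "integrable (lborel \<Otimes>\<^sub>M lborel) (\<lambda>(x, y). f x * K (x - y) * g y)"
  proof (rule lborel_pair.Fubini_integrable)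
    show "(\<lambda>(x, y). f x * K (x - y) * g y) \<in> borel_measurable (lborel \<Otimes>\<^sub>M lborel)" by measurable
    show "integrable lborel (\<lambda>x. \<integral>y. norm (case (x, y) of (x, y) \<Rightarrow> f x * K (x - y) * g y) \<partial>lborel)"
    proof (rule Bochner_Integration.integrable_bound)
      show "integrable lborel (\<lambda>x. A * (\<integral>y. norm (K y) \<partial>lborel) * norm (f x))"
        using f by simp
      show "(\<lambda>x. \<integral>y. norm (case (x, y) of (x, y) \<Rightarrow> f x * K (x - y) * g y) \<partial>lborel) \<in> borel_measurable lborel"
        by measurable
      show "AE x in lborel. norm (\<integral>y. norm (case (x, y) of (x, y) \<Rightarrow> f x * K (x - y) * g y) \<partial>lborel)
        \<le> norm (A * (\<integral>y. norm (K y) \<partial>lborel) * norm (f x))"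
      proof (rule AE_I2)
        fix x
        have "(\<integral>y. norm (f x * K (x - y) * g y) \<partial>lborel) \<le> (\<integral>y. A * norm (f x) * norm (K (x - y)) \<partial>lborel)"
        proof (rule integral_mono)
          fix y
          show "norm (f x * K (x - y) * g y) \<le> A * norm (f x) * norm (K (x - y))"
            using mult_left_mono[OF A[of y], of "norm (f x) * norm (K (x - y))"] by (simp add: norm_mult mult_ac)
        qed (use i1 integrable_shift_vec(3)[OF K, of x] in auto)
        also have "\<dots> = A * norm (f x) * (\<integral>y. norm (K y) \<partial>lborel)"
          using integral_shift_vec(3)[of "\<lambda>y. norm (K y)" x] by simp
        finally show "norm (\<integral>y. norm (case (x, y) of (x, y) \<Rightarrow> f x * K (x - y) * g y) \<partial>lborel)
          \<le> norm (A * (\<integral>y. norm (K y) \<partial>lborel) * norm (f x))"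
          using A0 by (simp add: abs_mult mult_ac)
      qed
    qed
    show "AE x in lborel. integrable lborel (\<lambda>y. case (x, y) of (x, y) \<Rightarrow> f x * K (x - y) * g y)"
      using i1 by simp
  qed
  from lborel_pair.Fubini_integral[OF this]
  have "(\<integral>y. (\<integral>x. f x * K (x - y) * g y \<partial>lborel) \<partial>lborel) = (\<integral>x. (\<integral>y. f x * K (x - y) * g y \<partial>lborel) \<partial>lborel)"
    by simp
  moreover have "(\<integral>y. f x * K (x - y) * g y \<partial>lborel) = f x * (\<integral>y. K (x - y) * g y \<partial>lborel)" for x
    by (simp add: mult.assoc)
  ultimately show ?thesis by (simp add: mult.commute)
qed

lemma fourier_multiplication_formula:
  fixes f g :: "real ^ 'n \<Rightarrow> complex"
  assumes "integrable lborel f" "integrable lborel g"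
  shows "(\<integral>\<xi>. fourier f \<xi> * g \<xi> \<partial>lborel) = (\<integral>x. f x * fourier g x \<partial>lborel)"
proof -
  have "(\<integral>x. (\<integral>y. f x * g y * wave x y \<partial>lborel) \<partial>lborel) = (\<integral>y. (\<integral>x. f x * g y * wave x y \<partial>lborel) \<partial>lborel)"
    by (rule fubini_bounded_kernel[OF assms, where A=1]) (simp_all add: wave_def)
  moreover have "(\<integral>y. f x * g y * wave x y \<partial>lborel) = f x * fourier g x" for x
    by (simp add: fourier_eq mult.assoc wave_commute[of x])
  moreover have "(\<integral>x. f x * g y * wave x y \<partial>lborel) = fourier f y * g y" for y
  proof -
    have "(\<lambda>x. f x * g y * wave x y) = (\<lambda>x. (f x * wave x y) * g y)" by (simp add: mult_ac)
    then show ?thesis by (simp add: fourier_eq)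
  qed
  ultimately show ?thesis by simp
qed

section \<open>Gaussians and Fourier inversion\<close>

lemma integrable_gauss1: "integrable lborel (\<lambda>s::real. complex_of_real (exp (- s\<^sup>2 / 2)))"
proof -
  have "integrable lborel (\<lambda>s. sqrt (2 * pi) * std_normal_density s)"
    by (intro integrable_mult_right) simp
  then have "integrable lborel (\<lambda>s::real. exp (- s\<^sup>2 / 2))" by (simp add: std_normal_density_def)
  then show ?thesis by (rule integrable_of_real)
qed

text \<open>This is the characteristic function of the standard normal distribution, freed from the
  normalising constant of its density.\<close>

lemma fourier_gauss1:
  "(\<integral>s. complex_of_real (exp (- s\<^sup>2 / 2)) * iexp (- (s * t)) \<partial>lborel)
    = complex_of_real (sqrt (2 * pi)) * complex_of_real (exp (- t\<^sup>2 / 2))"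
proof -
  have "complex_of_real (exp (- t\<^sup>2 / 2)) = char std_normal_distribution (- t)"
    by (simp add: char_std_normal_distribution)
  also have "\<dots> = (\<integral>s. std_normal_density s *\<^sub>R iexp (- t * s) \<partial>lborel)"
    unfolding char_def by (subst integral_density) auto
  also have "complex_of_real (sqrt (2 * pi)) * \<dots>
    = (\<integral>s. complex_of_real (sqrt (2 * pi)) * (std_normal_density s *\<^sub>R iexp (- t * s)) \<partial>lborel)"
    by (rule integral_mult_right_zero[symmetric])
  also have "\<dots> = (\<integral>s. complex_of_real (exp (- s\<^sup>2 / 2)) * iexp (- (s * t)) \<partial>lborel)"
  proof (rule Bochner_Integration.integral_cong)
    fix s :: real
    have "complex_of_real (sqrt (2 * pi)) * complex_of_real (std_normal_density s) = complex_of_real (exp (- s\<^sup>2 / 2))"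
      unfolding std_normal_density_def of_real_mult[symmetric] by simp
    then show "complex_of_real (sqrt (2 * pi)) * (std_normal_density s *\<^sub>R iexp (- t * s))
      = complex_of_real (exp (- s\<^sup>2 / 2)) * iexp (- (s * t))"
      by (simp only: scaleR_conv_of_real mult.assoc[symmetric]) (simp add: mult.commute)
  qed simp
  finally show ?thesis by simp
qed

lemma fourier_gauss:
  "fourier gauss \<xi> = complex_of_real (sqrt (2 * pi)) ^ CARD('n) * gauss (\<xi> :: real ^ 'n)"
proof -
  have g: "gauss x = (\<Prod>i\<in>UNIV. complex_of_real (exp (- (x $ i)\<^sup>2 / 2)))" for x :: "real ^ 'n"
    by (simp add: gauss_def inner_vec_def power2_eq_square sum_divide_distrib exp_sum flip: of_real_prod sum_negf)
  have w: "wave x \<xi> = (\<Prod>i\<in>UNIV. iexp (- (x $ i * \<xi> $ i)))" for x :: "real ^ 'n"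
    by (simp add: wave_eq_iexp inner_vec_def sum_distrib_left flip: exp_sum sum_negf)
  have i: "integrable lborel (\<lambda>s. complex_of_real (exp (- s\<^sup>2 / 2)) * iexp (- (s * \<xi> $ i)))" for i
    by (rule integrable_bounded_mult(1)[OF integrable_gauss1, where A=1]) (auto simp del: of_real_minus of_real_mult)
  have "fourier gauss \<xi> = (\<integral>(x :: real ^ 'n). (\<Prod>i\<in>UNIV. complex_of_real (exp (- (x $ i)\<^sup>2 / 2)) * iexp (- (x $ i * \<xi> $ i))) \<partial>lborel)"
    unfolding fourier_eq by (simp only: g w prod.distrib)
  also have "\<dots> = (\<Prod>i\<in>UNIV. \<integral>s. complex_of_real (exp (- s\<^sup>2 / 2)) * iexp (- (s * \<xi> $ i)) \<partial>lborel)"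
    by (rule integral_prod_vec(2)[OF i])
  also have "\<dots> = complex_of_real (sqrt (2 * pi)) ^ CARD('n) * gauss \<xi>"
    unfolding fourier_gauss1 prod.distrib g by simp
  finally show ?thesis .
qed

lemma integral_gauss: "(\<integral>x. gauss (x :: real ^ 'n) \<partial>lborel) = complex_of_real (sqrt (2 * pi)) ^ CARD('n)"
  using fourier_gauss[of "0 :: real ^ 'n"] by (simp add: fourier_eq gauss_def)

lemma norm_gauss_le [simp]: "norm (gauss x) \<le> 1"
  by (simp add: gauss_def)

text \<open>The rescaled Gaussians form an approximate identity up to their mass (2 pi)^(d/2).
  Polynomial growth of \<open>g\<close> suffices, because 1 + |x + z/n| <= (1 + |x|)(1 + |z|) and
  the Gaussian absorbs the power of 1 + |z|, so dominated convergence applies.\<close>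

lemma gauss_approximation:
  fixes g :: "real ^ 'n \<Rightarrow> complex"
  assumes g: "continuous_on UNIV g" "polynomial_growth g"
  shows "(\<lambda>n. \<integral>z. g (x + (1 / real (Suc n)) *\<^sub>R z) * gauss z \<partial>lborel) \<longlonglongrightarrow> g x * complex_of_real (sqrt (2 * pi)) ^ CARD('n)"
proof -
  have [measurable]: "g \<in> borel_measurable borel" "gauss \<in> borel_measurable (borel :: (real^'n) measure)"
    using g by (auto intro: borel_measurable_continuous_onI schwartz_measurable gauss_schwartz)
  obtain C M where C: "norm (g y) \<le> C * (1 + norm y) ^ M" for y
    using g(2) unfolding polynomial_growth_def by blast
  have C0: "0 \<le> C" using order.trans[OF norm_ge_zero C[of 0]] by simp
  obtain D where D0: "0 \<le> D" and D: "norm (gauss z) \<le> D / (1 + norm z) ^ (M + 2 * CARD('n))" for z :: "real ^ 'n"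
    using rapidD[OF schwartz_rapid[OF gauss_schwartz]] by blast
  have "(\<lambda>n. \<integral>z. g (x + (1 / real (Suc n)) *\<^sub>R z) * gauss z \<partial>lborel) \<longlonglongrightarrow> (\<integral>(z :: real^'n). g x * gauss z \<partial>lborel)"
  proof (rule integral_dominated_convergence[where w="\<lambda>z :: real ^ 'n. C * (1 + norm x) ^ M * D * weight z"])
    show "integrable lborel (\<lambda>z :: real^'n. C * (1 + norm x) ^ M * D * weight z)"
      by (intro integrable_mult_right integrable_weight)
    have "(\<lambda>n. g (x + (1 / real (Suc n)) *\<^sub>R z) * gauss z) \<longlonglongrightarrow> g x * gauss z" for z
    proof (intro tendsto_mult tendsto_const)
      have "(\<lambda>n. x + (1 / real (Suc n)) *\<^sub>R z) \<longlonglongrightarrow> x + 0 *\<^sub>R z"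
        by (intro tendsto_intros LIMSEQ_Suc lim_1_over_n)
      then have "(\<lambda>n. x + (1 / real (Suc n)) *\<^sub>R z) \<longlonglongrightarrow> x" by simp
      then show "(\<lambda>n. g (x + (1 / real (Suc n)) *\<^sub>R z)) \<longlonglongrightarrow> g x"
        using continuous_on_tendsto_compose[OF g(1)] by auto
    qed
    then show "AE z in lborel. (\<lambda>n. g (x + (1 / real (Suc n)) *\<^sub>R z) * gauss z) \<longlonglongrightarrow> g x * gauss z" by simp
    fix n
    have "norm (g (x + (1 / real (Suc n)) *\<^sub>R z) * gauss z) \<le> C * (1 + norm x) ^ M * D * weight z" for z
    proof -
      have nz: "1 + norm z \<noteq> 0" by (metis add_pos_nonneg norm_ge_zero less_irrefl zero_less_one)
      have "norm (x + (1 / real (Suc n)) *\<^sub>R z) \<le> norm x + norm ((1 / real (Suc n)) *\<^sub>R z)" by (rule norm_triangle_ineq)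
      also have "norm ((1 / real (Suc n)) *\<^sub>R z) \<le> 1 * norm z"
        unfolding norm_scaleR by (intro mult_right_mono) (auto simp: divide_simps)
      finally have "norm (x + (1 / real (Suc n)) *\<^sub>R z) \<le> norm x + norm z" by simp
      then have "1 + norm (x + (1 / real (Suc n)) *\<^sub>R z) \<le> (1 + norm x) * (1 + norm z)"
        using mult_nonneg_nonneg[OF norm_ge_zero[of x] norm_ge_zero[of z]]
        by (simp only: distrib_left distrib_right mult_1_left mult_1_right)
      then have "(1 + norm (x + (1 / real (Suc n)) *\<^sub>R z)) ^ M \<le> (1 + norm x) ^ M * (1 + norm z) ^ M"
        unfolding power_mult_distrib[symmetric] by (intro power_mono) auto
      then have "norm (g (x + (1 / real (Suc n)) *\<^sub>R z)) \<le> C * ((1 + norm x) ^ M * (1 + norm z) ^ M)"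
        using C0 by (intro order.trans[OF C] mult_left_mono)
      then have "norm (g (x + (1 / real (Suc n)) *\<^sub>R z) * gauss z)
          \<le> C * ((1 + norm x) ^ M * (1 + norm z) ^ M) * (D / (1 + norm z) ^ (M + 2 * CARD('n)))"
        unfolding norm_mult by (intro mult_mono D) (use C0 in auto)
      also have "\<dots> = C * (1 + norm x) ^ M * D * weight z"
        using nz by (simp add: weight_def power_add)
      finally show ?thesis .
    qed
    then show "AE z in lborel. norm (g (x + (1 / real (Suc n)) *\<^sub>R z) * gauss z) \<le> C * (1 + norm x) ^ M * D * weight z" by simp
  qed measurable
  then show ?thesis by (simp add: integral_gauss)
qed

lemma bounded_polynomial_growth: "(\<And>x. norm (g x) \<le> A) \<Longrightarrow> polynomial_growth g"
  unfolding polynomial_growth_def by (intro exI[of _ A] exI[of _ 0]) simp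

lemma schwartz_bounded: "f \<in> schwartz \<Longrightarrow> \<exists>C\<ge>0. \<forall>x. norm (f x) \<le> C"
  using rapidD[OF schwartz_rapid, of f 0] by simp

lemma schwartz_polynomial_growth: "f \<in> schwartz \<Longrightarrow> polynomial_growth f"
  using schwartz_bounded[of f] by (auto intro: bounded_polynomial_growth)

lemma fourier_gauss_dilate:
  fixes x :: "real ^ 'n"
  assumes "\<epsilon> > 0"
  shows "fourier (\<lambda>\<xi>. gauss (\<epsilon> *\<^sub>R \<xi>)) x = complex_of_real (sqrt (2 * pi) / \<epsilon>) ^ CARD('n) * gauss ((1 / \<epsilon>) *\<^sub>R x)"
proof -
  have [measurable]: "gauss \<in> borel_measurable (borel :: (real^'n) measure)"
    by (rule schwartz_measurable[OF gauss_schwartz])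
  have "fourier gauss ((1 / \<epsilon>) *\<^sub>R x) = \<bar>\<epsilon>\<bar> ^ CARD('n) *\<^sub>R (\<integral>\<xi>. gauss (0 + \<epsilon> *\<^sub>R \<xi>) * wave (0 + \<epsilon> *\<^sub>R \<xi>) ((1 / \<epsilon>) *\<^sub>R x) \<partial>lborel)"
    unfolding fourier_eq using assms by (intro integral_affine_vec) simp_all
  moreover have "wave (0 + \<epsilon> *\<^sub>R \<xi>) ((1 / \<epsilon>) *\<^sub>R x) = wave \<xi> x" for \<xi>
    using assms by (simp add: wave_def)
  ultimately have "complex_of_real \<epsilon> ^ CARD('n) * fourier (\<lambda>\<xi>. gauss (\<epsilon> *\<^sub>R \<xi>)) x
      = complex_of_real (sqrt (2 * pi)) ^ CARD('n) * gauss ((1 / \<epsilon>) *\<^sub>R x)"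
    using assms by (simp add: fourier_gauss scaleR_conv_of_real flip: fourier_eq)
  then show ?thesis using assms by (simp add: power_divide field_simps)
qed

text \<open>A wide Gaussian is inserted under the integral of the transform, and the multiplication
  formula turns it into a narrow Gaussian against f. Each of the two limits is a dominated
  convergence; the mass of the Gaussian and the constant of its transform each contribute (2
  pi)^(d/2).\<close>

lemma fourier_inversion_0:
  fixes f :: "real ^ 'n \<Rightarrow> complex"
  assumes f: "f \<in> schwartz"
  shows "(\<integral>\<xi>. fourier f \<xi> \<partial>lborel) = (2 * of_real pi) ^ CARD('n) * f 0"
proof -
  let ?s = "complex_of_real (sqrt (2 * pi))"
  have [measurable]: "f \<in> borel_measurable borel" "fourier f \<in> borel_measurable borel"
      "gauss \<in> borel_measurable (borel :: (real^'n) measure)"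
    using f by (auto intro: schwartz_measurable gauss_schwartz schwartz_fourier)
  have eq: "(\<integral>\<xi>. fourier f \<xi> * gauss ((1 / real (Suc n)) *\<^sub>R \<xi>) \<partial>lborel)
      = ?s ^ CARD('n) * (\<integral>z. f (0 + (1 / real (Suc n)) *\<^sub>R z) * gauss z \<partial>lborel)" for n
  proof -
    let ?e = "1 / real (Suc n)"
    have e: "?e > 0" by simp
    have m: "(\<lambda>x. f x * fourier (\<lambda>\<xi>. gauss (?e *\<^sub>R \<xi>)) x) \<in> borel_measurable borel"
      by (intro borel_measurable_times schwartz_measurable schwartz_fourier schwartz_dilate gauss_schwartz f) simp
    have "(\<integral>\<xi>. fourier f \<xi> * gauss (?e *\<^sub>R \<xi>) \<partial>lborel) = (\<integral>x. f x * fourier (\<lambda>\<xi>. gauss (?e *\<^sub>R \<xi>)) x \<partial>lborel)"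
      by (intro fourier_multiplication_formula schwartz_integrable f schwartz_dilate gauss_schwartz) simp
    also have "\<dots> = ?e ^ CARD('n) *\<^sub>R (\<integral>z. f (0 + ?e *\<^sub>R z) * fourier (\<lambda>\<xi>. gauss (?e *\<^sub>R \<xi>)) (0 + ?e *\<^sub>R z) \<partial>lborel)"
      using e by (subst integral_affine_vec[where c="?e" and t=0, OF _ m]) simp_all
    also have "(\<lambda>z. f (0 + ?e *\<^sub>R z) * fourier (\<lambda>\<xi>. gauss (?e *\<^sub>R \<xi>)) (0 + ?e *\<^sub>R z))
      = (\<lambda>z. (?s / complex_of_real ?e) ^ CARD('n) * (f (0 + ?e *\<^sub>R z) * gauss z))"
      by (rule ext) (simp only: fourier_gauss_dilate[OF e] of_real_divide, simp)
    also have "?e ^ CARD('n) *\<^sub>R (\<integral>z. (?s / complex_of_real ?e) ^ CARD('n) * (f (0 + ?e *\<^sub>R z) * gauss z) \<partial>lborel)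
       = complex_of_real ?e ^ CARD('n) * (?s / complex_of_real ?e) ^ CARD('n) * (\<integral>z. f (0 + ?e *\<^sub>R z) * gauss z \<partial>lborel)"
      by (subst integral_mult_right_zero) (simp only: scaleR_conv_of_real of_real_power mult.assoc)
    also have "complex_of_real ?e ^ CARD('n) * (?s / complex_of_real ?e) ^ CARD('n) = ?s ^ CARD('n)"
      using e by (simp add: power_mult_distrib[symmetric] del: of_real_divide)
    finally show ?thesis .
  qed
  have lim1: "(\<lambda>n. ?s ^ CARD('n) * (\<integral>z. f (0 + (1 / real (Suc n)) *\<^sub>R z) * gauss z \<partial>lborel))
      \<longlonglongrightarrow> ?s ^ CARD('n) * (f 0 * ?s ^ CARD('n))"
    by (intro tendsto_mult tendsto_const gauss_approximation schwartz_continuous schwartz_polynomial_growth f)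
  have lim2: "(\<lambda>n. \<integral>\<xi>. fourier f \<xi> * gauss ((1 / real (Suc n)) *\<^sub>R \<xi>) \<partial>lborel) \<longlonglongrightarrow> (\<integral>\<xi>. fourier f \<xi> * 1 \<partial>lborel)"
  proof (rule integral_dominated_convergence[where w="\<lambda>\<xi>. norm (fourier f \<xi>)"])
    have "(\<lambda>n. fourier f \<xi> * gauss ((1 / real (Suc n)) *\<^sub>R \<xi>)) \<longlonglongrightarrow> fourier f \<xi> * 1" for \<xi>
    proof (intro tendsto_mult tendsto_const)
      have "(\<lambda>n. (1 / real (Suc n)) *\<^sub>R \<xi>) \<longlonglongrightarrow> 0 *\<^sub>R \<xi>"
        by (intro tendsto_intros LIMSEQ_Suc lim_1_over_n)
      then have "(\<lambda>n. gauss ((1 / real (Suc n)) *\<^sub>R \<xi>)) \<longlonglongrightarrow> gauss (0 *\<^sub>R \<xi>)"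
        by (rule continuous_on_tendsto_compose[OF schwartz_continuous[OF gauss_schwartz]]) simp_all
      then show "(\<lambda>n. gauss ((1 / real (Suc n)) *\<^sub>R \<xi>)) \<longlonglongrightarrow> 1" by (simp add: gauss_def)
    qed
    then show "AE \<xi> in lborel. (\<lambda>n. fourier f \<xi> * gauss ((1 / real (Suc n)) *\<^sub>R \<xi>)) \<longlonglongrightarrow> fourier f \<xi> * 1" by simp
    show "integrable lborel (\<lambda>\<xi>. norm (fourier f \<xi>))"
      by (intro integrable_norm schwartz_integrable schwartz_fourier f)
    show "AE \<xi> in lborel. norm (fourier f \<xi> * gauss ((1 / real (Suc n)) *\<^sub>R \<xi>)) \<le> norm (fourier f \<xi>)" for n
      by (auto simp: norm_mult intro!: mult_left_le)
  qed measurable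
  have "(\<integral>\<xi>. fourier f \<xi> \<partial>lborel) = ?s ^ CARD('n) * (f 0 * ?s ^ CARD('n))"
    using LIMSEQ_unique[OF lim2[unfolded eq] lim1] by (simp only: mult_1_right)
  also have "\<dots> = (?s * ?s) ^ CARD('n) * f 0" by (simp add: power_mult_distrib)
  also have "?s * ?s = 2 * of_real pi" unfolding of_real_mult[symmetric] by simp
  finally show ?thesis .
qed

text \<open>Inversion at x is inversion at the origin for the translate of f by x, as translation
  multiplies the transform by a wave.\<close>

theorem inv_fourier_fourier:
  assumes "f \<in> schwartz"
  shows "inv_fourier (fourier f) = f"
proof
  fix x :: "real ^ 'a"
  have "fourier (fourier f) (- x) = (\<integral>\<xi>. fourier (\<lambda>y. f (y + x)) \<xi> \<partial>lborel)"
    unfolding fourier_shift[OF schwartz_measurable[OF assms]]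
    by (simp add: fourier_eq[of "fourier f"] mult.commute wave_minus wave_commute[of x])
  also have "\<dots> = (2 * of_real pi) ^ CARD('a) * f x"
    using fourier_inversion_0[OF schwartz_shift[OF assms, of x]] by simp
  finally show "inv_fourier (fourier f) x = f x" by (simp add: inv_fourier_eq)
qed

lemma fourier_reflect:
  fixes f :: "real ^ 'n \<Rightarrow> complex"
  assumes "f \<in> borel_measurable borel"
  shows "fourier (\<lambda>x. f (- x)) \<xi> = fourier f (- \<xi>)"
proof -
  have [measurable]: "f \<in> borel_measurable borel" by fact
  have "fourier (\<lambda>x. f (- x)) \<xi> = (\<integral>x. f (0 - x) * wave (0 - x) (- \<xi>) \<partial>lborel)"
    by (simp add: fourier_eq wave_minus)
  then show ?thesis
    unfolding fourier_eq using integral_shift_vec(3)[of "\<lambda>x. f x * wave x (- \<xi>)" 0] by simp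
qed

theorem fourier_inv_fourier:
  assumes f: "f \<in> schwartz"
  shows "fourier (inv_fourier f) = f"
proof
  fix \<xi> :: "real ^ 'a"
  have "fourier (inv_fourier f) \<xi> = inv_fourier (fourier f) \<xi>"
    unfolding inv_fourier_eq[abs_def] fourier_cmult
    by (subst fourier_reflect[OF schwartz_measurable[OF schwartz_fourier[OF f]]]) simp
  then show "fourier (inv_fourier f) \<xi> = f \<xi>" by (simp add: inv_fourier_fourier f)
qed

text \<open>Testing against Gaussians that concentrate at x recovers the value at x. This is the
  uniqueness behind the definite description in \<open>fun_of_dist\<close>.\<close>

lemma dist_of_inject:
  fixes g h :: "real ^ 'n \<Rightarrow> complex"
  assumes g: "continuous_on UNIV g" "polynomial_growth g"
    and h: "continuous_on UNIV h" "polynomial_growth h"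
    and eq: "dist_of g = dist_of h"
  shows "g = h"
proof
  fix x
  let ?s = "complex_of_real (sqrt (2 * pi)) ^ CARD('n)"
  have gm [measurable]: "g \<in> borel_measurable borel" and hm [measurable]: "h \<in> borel_measurable borel"
    and [measurable]: "gauss \<in> borel_measurable (borel :: (real^'n) measure)"
    using g h by (auto intro: borel_measurable_continuous_onI schwartz_measurable gauss_schwartz)
  have same: "(\<integral>z. g (x + (1 / real (Suc n)) *\<^sub>R z) * gauss z \<partial>lborel) = (\<integral>z. h (x + (1 / real (Suc n)) *\<^sub>R z) * gauss z \<partial>lborel)" for n
  proof -
    let ?c = "real (Suc n)"
    let ?\<psi> = "\<lambda>y :: real ^ 'n. gauss (?c *\<^sub>R y + (- ?c *\<^sub>R x))"
    have psi: "?\<psi> \<in> schwartz" by (intro schwartz_affine gauss_schwartz) simp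
    have *: "(\<integral>y. k y * ?\<psi> y \<partial>lborel) = \<bar>1 / ?c\<bar> ^ CARD('n) *\<^sub>R (\<integral>z. k (x + (1 / ?c) *\<^sub>R z) * gauss z \<partial>lborel)"
      if [measurable]: "k \<in> borel_measurable borel" for k :: "real ^ 'n \<Rightarrow> complex"
      by (subst integral_affine_vec[where c="1 / ?c" and t=x]) (simp_all add: scaleR_add_right del: of_nat_Suc)
    have "(\<integral>y. g y * ?\<psi> y \<partial>lborel) = (\<integral>y. h y * ?\<psi> y \<partial>lborel)"
      using fun_cong[OF eq, of ?\<psi>] psi by (simp add: dist_of_def on_schwartz_def)
    then have "\<bar>1 / ?c\<bar> ^ CARD('n) *\<^sub>R (\<integral>z. g (x + (1 / ?c) *\<^sub>R z) * gauss z \<partial>lborel)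
        = \<bar>1 / ?c\<bar> ^ CARD('n) *\<^sub>R (\<integral>z. h (x + (1 / ?c) *\<^sub>R z) * gauss z \<partial>lborel)"
      by (simp only: *[of g] *[of h] gm hm)
    then show ?thesis by (simp del: of_nat_Suc)
  qed
  have "g x * ?s = h x * ?s"
    by (rule LIMSEQ_unique[OF gauss_approximation[OF g, of x, unfolded same] gauss_approximation[OF h, of x]])
  then show "g x = h x" by simp
qed

section \<open>Tempered distributions and Fourier multipliers\<close>

lemma one_plus_norm_pos [simp]: "0 < 1 + norm x" "1 + norm x \<noteq> 0"
proof -
  show "0 < 1 + norm x" by (simp add: add_pos_nonneg)
  then show "1 + norm x \<noteq> 0" by linarith
qed

lemma
  assumes "u \<in> tempered"
  shows tempered_add: "f \<in> schwartz \<Longrightarrow> g \<in> schwartz \<Longrightarrow> u (\<lambda>x. f x + g x) = u f + u g"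
    and tempered_cmult: "f \<in> schwartz \<Longrightarrow> u (\<lambda>x. c * f x) = c * u f"
    and tempered_off_schwartz: "f \<notin> schwartz \<Longrightarrow> u f = 0"
  using assms unfolding tempered_def by (auto simp: on_schwartz_def fun_eq_iff split: if_splits)

lemma tempered_diff:
  assumes "u \<in> tempered" "f \<in> schwartz" "g \<in> schwartz"
  shows "u (\<lambda>x. f x - g x) = u f - u g"
  using tempered_add[OF assms(1,2) schwartz_cmult[OF assms(3), of "-1"]]
    tempered_cmult[OF assms(1,3), of "-1"] by simp

lemma tempered_zero: "u \<in> tempered \<Longrightarrow> u (\<lambda>x. 0) = 0"
  using tempered_cmult[of u "\<lambda>x. 0" 0] schwartz_zero by simp

lemma tempered_sum:
  assumes u: "u \<in> tempered" and "\<And>k. k \<in> A \<Longrightarrow> f k \<in> schwartz"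
  shows "u (\<lambda>x. \<Sum>k\<in>A. f k x) = (\<Sum>k\<in>A. u (f k))"
  using assms(2)
  by (induction A rule: infinite_finite_induct)
    (simp_all add: tempered_zero[OF u] tempered_add[OF u] schwartz_sum)

text \<open>Continuity in a form convenient for estimates: one number e bounds all weighted
  derivatives of order at most M. The finitely many multi-indices are counted into the constant;
  \<open>temperedI\<close> is the converse.\<close>

lemma tempered_bound:
  fixes u :: "(real ^ 'n \<Rightarrow> complex) \<Rightarrow> complex"
  assumes "u \<in> tempered"
  obtains C M where "0 \<le> C" "\<And>\<phi> e. \<phi> \<in> schwartz \<Longrightarrow>
    (\<And>is x. length is \<le> M \<Longrightarrow> (1 + norm x) ^ M * norm (partial_derivs is \<phi> x) \<le> e) \<Longrightarrow> norm (u \<phi>) \<le> C * e"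
proof -
  obtain C M where C: "norm (u \<phi>) \<le> C * (\<Sum>is | length is \<le> M. schwartz_seminorm M is \<phi>)"
    if "\<phi> \<in> schwartz" for \<phi> :: "real ^ 'n \<Rightarrow> complex"
    using assms unfolding tempered_def by blast
  let ?L = "{is :: 'n list. length is \<le> M}"
  show ?thesis
  proof (rule that)
    show "0 \<le> \<bar>C\<bar> * real (card ?L)" by simp
    fix \<phi> :: "real ^ 'n \<Rightarrow> complex" and e assume phi: "\<phi> \<in> schwartz"
      and e: "\<And>is x. length is \<le> M \<Longrightarrow> (1 + norm x) ^ M * norm (partial_derivs is \<phi> x) \<le> e"
    have "norm (u \<phi>) \<le> \<bar>C\<bar> * (\<Sum>is | length is \<le> M. schwartz_seminorm M is \<phi>)"
      using phi by (intro order.trans[OF C] mult_right_mono sum_nonneg schwartz_seminorm_nonneg) auto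
    also have "\<dots> \<le> \<bar>C\<bar> * (\<Sum>is\<in>?L. e)"
      by (intro mult_left_mono sum_mono schwartz_seminorm_le e) auto
    finally show "norm (u \<phi>) \<le> \<bar>C\<bar> * real (card ?L) * e" by simp
  qed
qed

lemma temperedI:
  fixes u :: "(real ^ 'n \<Rightarrow> complex) \<Rightarrow> complex"
  assumes "\<And>\<phi>. \<phi> \<notin> schwartz \<Longrightarrow> u \<phi> = 0"
    and "\<And>\<phi> \<psi>. \<phi> \<in> schwartz \<Longrightarrow> \<psi> \<in> schwartz \<Longrightarrow> u (\<lambda>x. \<phi> x + \<psi> x) = u \<phi> + u \<psi>"
    and "\<And>c \<phi>. \<phi> \<in> schwartz \<Longrightarrow> u (\<lambda>x. c * \<phi> x) = c * u \<phi>"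
    and b: "0 \<le> C" "\<And>\<phi> e. \<phi> \<in> schwartz \<Longrightarrow>
      (\<And>is x. length is \<le> M \<Longrightarrow> (1 + norm x) ^ M * norm (partial_derivs is \<phi> x) \<le> e) \<Longrightarrow> norm (u \<phi>) \<le> C * e"
  shows "u \<in> tempered"
proof -
  have "norm (u \<phi>) \<le> C * (\<Sum>is | length is \<le> M. schwartz_seminorm M is \<phi>)" if phi: "\<phi> \<in> schwartz" for \<phi> :: "real ^ 'n \<Rightarrow> complex"
  proof (rule b(2)[OF phi])
    fix "is" :: "'n list" and x
    assume l: "length is \<le> M"
    have "(1 + norm x) ^ M * norm (partial_derivs is \<phi> x) \<le> schwartz_seminorm M is \<phi>"
      by (rule schwartz_seminorm_ge[OF phi])
    also have "\<dots> \<le> (\<Sum>is | length is \<le> M. schwartz_seminorm M is \<phi>)"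
      using l by (intro member_le_sum) (auto simp: schwartz_seminorm_nonneg[OF phi] finite_lists_le)
    finally show "(1 + norm x) ^ M * norm (partial_derivs is \<phi> x) \<le> (\<Sum>is | length is \<le> M. schwartz_seminorm M is \<phi>)" .
  qed
  then show ?thesis
    using assms(1-3) unfolding tempered_def by (auto simp: on_schwartz_def fun_eq_iff)
qed

lemma tempered_minus:
  fixes u v :: "(real ^ 'n \<Rightarrow> complex) \<Rightarrow> complex"
  assumes u: "u \<in> tempered" and v: "v \<in> tempered"
  shows "u - v \<in> tempered"
proof -
  obtain C M where C: "0 \<le> C" "\<And>\<phi> e. \<phi> \<in> schwartz \<Longrightarrow>
    (\<And>is x. length is \<le> M \<Longrightarrow> (1 + norm x) ^ M * norm (partial_derivs is \<phi> x) \<le> e) \<Longrightarrow> norm (u \<phi>) \<le> C * e"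
    using tempered_bound[OF u] by metis
  obtain D N where D: "0 \<le> D" "\<And>\<phi> e. \<phi> \<in> schwartz \<Longrightarrow>
    (\<And>is x. length is \<le> N \<Longrightarrow> (1 + norm x) ^ N * norm (partial_derivs is \<phi> x) \<le> e) \<Longrightarrow> norm (v \<phi>) \<le> D * e"
    using tempered_bound[OF v] by metis
  show ?thesis
  proof (rule temperedI[where C="C + D" and M="max M N"])
    fix \<phi> :: "real ^ 'n \<Rightarrow> complex" and e assume phi: "\<phi> \<in> schwartz"
      and e: "\<And>is x. length is \<le> max M N \<Longrightarrow> (1 + norm x) ^ max M N * norm (partial_derivs is \<phi> x) \<le> e"
    have *: "(1 + norm x) ^ L * norm (partial_derivs is \<phi> x) \<le> e" if "L \<le> max M N" "length is \<le> L" for L "is" x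
    proof -
      have "(1 + norm x) ^ L * norm (partial_derivs is \<phi> x) \<le> (1 + norm x) ^ max M N * norm (partial_derivs is \<phi> x)"
        using that by (intro mult_right_mono power_increasing) auto
      also have "\<dots> \<le> e" using that by (intro e) auto
      finally show ?thesis .
    qed
    have "norm ((u - v) \<phi>) \<le> norm (u \<phi>) + norm (v \<phi>)" by (simp add: norm_triangle_ineq4)
    also have "\<dots> \<le> C * e + D * e"
      using * by (intro add_mono C D phi) auto
    finally show "norm ((u - v) \<phi>) \<le> (C + D) * e" by (simp add: distrib_right)
  qed (use u v C(1) D(1) in \<open>simp_all add: tempered_off_schwartz tempered_add tempered_cmult right_diff_distrib\<close>)
qed

lemma integrable_bounded_schwartz:
  assumes "g \<in> borel_measurable borel" "\<And>x. norm (g x) \<le> A" "\<phi> \<in> schwartz"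
  shows "integrable lborel (\<lambda>x. g x * \<phi> x)"
  using integrable_bounded_mult(2)[OF schwartz_integrable[OF assms(3)] _ assms(2)] assms(1) by simp

lemma tempered_dist_of:
  fixes g :: "real ^ 'n \<Rightarrow> complex"
  assumes g: "g \<in> borel_measurable borel" "\<And>x. norm (g x) \<le> A"
  shows "dist_of g \<in> tempered"
proof (rule temperedI[where C="A * (\<integral>(x :: real ^ 'n). weight x \<partial>lborel)" and M="2 * CARD('n)"])
  have A: "0 \<le> A" using g(2) norm_ge_zero order.trans by blast
  show "0 \<le> A * (\<integral>(x :: real ^ 'n). weight x \<partial>lborel)"
    using A by (intro mult_nonneg_nonneg integral_nonneg) auto
  fix \<phi> \<psi> :: "real ^ 'n \<Rightarrow> complex" and c
  show "dist_of g \<phi> = 0" if "\<phi> \<notin> schwartz" using that by (simp add: dist_of_def on_schwartz_def)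
  show "dist_of g (\<lambda>x. \<phi> x + \<psi> x) = dist_of g \<phi> + dist_of g \<psi>" if "\<phi> \<in> schwartz" "\<psi> \<in> schwartz"
    using that integrable_bounded_schwartz[OF g] by (simp add: dist_of_def on_schwartz_def schwartz_add distrib_left)
  show "dist_of g (\<lambda>x. c * \<phi> x) = c * dist_of g \<phi>" if "\<phi> \<in> schwartz"
    using that by (simp add: dist_of_def on_schwartz_def schwartz_cmult mult.left_commute[of _ c])
  fix e assume phi: "\<phi> \<in> schwartz"
    and e: "\<And>is x. length is \<le> 2 * CARD('n) \<Longrightarrow> (1 + norm x) ^ (2 * CARD('n)) * norm (partial_derivs is \<phi> x) \<le> e"
  have "norm (dist_of g \<phi>) \<le> (\<integral>(x :: real ^ 'n). A * e * weight x \<partial>lborel)"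
    using phi unfolding dist_of_def on_schwartz_def
  proof (simp only: if_True, intro Bochner_Integration.integral_norm_bound_integral)
    show "integrable lborel (\<lambda>x. g x * \<phi> x)" by (rule integrable_bounded_schwartz[OF g phi])
    show "integrable lborel (\<lambda>x :: real ^ 'n. A * e * weight x)" by (intro integrable_mult_right integrable_weight)
    fix x
    have "norm (\<phi> x) \<le> e * weight x"
      using e[of "[]" x] by (simp add: weight_def pos_le_divide_eq add_pos_nonneg mult.commute)
    then show "norm (g x * \<phi> x) \<le> A * e * weight x"
      unfolding norm_mult mult.assoc by (intro mult_mono g A) auto
  qed
  then show "norm (dist_of g \<phi>) \<le> A * (\<integral>(x :: real ^ 'n). weight x \<partial>lborel) * e" by (simp add: mult_ac)
qed

lemma dist_of_diff:
  assumes "g \<in> borel_measurable borel" "\<And>x. norm (g x) \<le> A" "h \<in> borel_measurable borel" "\<And>x. norm (h x) \<le> B"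
  shows "dist_of g - dist_of h = dist_of (\<lambda>x. g x - h x)"
  using integrable_bounded_schwartz[OF assms(1,2)] integrable_bounded_schwartz[OF assms(3,4)]
  by (auto simp: dist_of_def on_schwartz_def fun_eq_iff left_diff_distrib)

text \<open>The transpose of the multiplier operator; on the Schwartz space it is convolution with the
  reflected kernel.\<close>

definition mult_adj :: "(real ^ 'n \<Rightarrow> complex) \<Rightarrow> (real ^ 'n \<Rightarrow> complex) \<Rightarrow> real ^ 'n \<Rightarrow> complex" where
  "mult_adj m \<phi> = fourier (\<lambda>\<xi>. m \<xi> * inv_fourier \<phi> \<xi>)"

lemma schwartz_mult_adj: "m \<in> schwartz \<Longrightarrow> \<phi> \<in> schwartz \<Longrightarrow> mult_adj m \<phi> \<in> schwartz"
  unfolding mult_adj_def by (intro schwartz_fourier schwartz_mult schwartz_inv_fourier)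

lemma multiplier_eq:
  assumes "m \<in> schwartz"
  shows "multiplier m u = on_schwartz (\<lambda>\<phi>. u (mult_adj m \<phi>))"
  using assms
  by (auto simp: multiplier_def dist_inv_fourier_def dist_mult_def dist_fourier_def on_schwartz_def
      mult_adj_def schwartz_inv_fourier schwartz_mult fun_eq_iff)

lemma mult_adj_mult_adj:
  assumes "m1 \<in> schwartz" "m2 \<in> schwartz" "\<phi> \<in> schwartz"
  shows "mult_adj m2 (mult_adj m1 \<phi>) = mult_adj (\<lambda>\<xi>. m1 \<xi> * m2 \<xi>) \<phi>"
proof -
  have "(\<lambda>\<xi>. m1 \<xi> * inv_fourier \<phi> \<xi>) \<in> schwartz"
    by (intro schwartz_mult schwartz_inv_fourier assms)
  then show ?thesis unfolding mult_adj_def by (simp add: inv_fourier_fourier mult_ac)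
qed

lemma multiplier_multiplier:
  assumes "m1 \<in> schwartz" "m2 \<in> schwartz"
  shows "multiplier m1 (multiplier m2 u) = multiplier (\<lambda>\<xi>. m1 \<xi> * m2 \<xi>) u"
  using assms
  by (auto simp: multiplier_eq schwartz_mult on_schwartz_def schwartz_mult_adj mult_adj_mult_adj fun_eq_iff)

text \<open>Fubini for the product of m(xi), phi(x) and exp(-i xi.(y - x)): integrating in xi leaves
  the kernel, integrating in x leaves the transform of phi.\<close>

lemma mult_adj_convolution:
  fixes m \<phi> :: "real ^ 'n \<Rightarrow> complex"
  assumes m: "m \<in> schwartz" and phi: "\<phi> \<in> schwartz"
  shows "mult_adj m \<phi> y = (\<integral>x. \<phi> x * inv_fourier m (x - y) \<partial>lborel)"
proof -
  let ?c = "1 / (2 * complex_of_real pi) ^ CARD('n)"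
  have "(\<integral>\<xi>. (\<integral>x. m \<xi> * \<phi> x * wave \<xi> (y - x) \<partial>lborel) \<partial>lborel) = (\<integral>x. (\<integral>\<xi>. m \<xi> * \<phi> x * wave \<xi> (y - x) \<partial>lborel) \<partial>lborel)"
  proof (rule fubini_bounded_kernel[OF schwartz_integrable[OF m] schwartz_integrable[OF phi], where A=1])
    show "(\<lambda>(x, ya). wave x (y - ya)) \<in> borel_measurable (lborel \<Otimes>\<^sub>M lborel)"
      unfolding wave_def by measurable
  qed simp
  moreover have "(\<integral>\<xi>. m \<xi> * \<phi> x * wave \<xi> (y - x) \<partial>lborel) = \<phi> x * fourier m (y - x)" for x
  proof -
    have "(\<lambda>\<xi>. m \<xi> * \<phi> x * wave \<xi> (y - x)) = (\<lambda>\<xi>. \<phi> x * (m \<xi> * wave \<xi> (y - x)))" by (simp add: mult_ac)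
    then show ?thesis by (simp add: fourier_eq)
  qed
  moreover have "(\<integral>x. m \<xi> * \<phi> x * wave \<xi> (y - x) \<partial>lborel) = m \<xi> * fourier \<phi> (- \<xi>) * wave \<xi> y" for \<xi>
  proof -
    have "wave \<xi> (y - x) = wave x (- \<xi>) * wave \<xi> y" for x
      using wave_add(2)[of \<xi> y "- x"] by (simp add: wave_minus[symmetric] wave_commute[of \<xi>] mult.commute)
        (metis wave_commute wave_minus)
    then have "(\<lambda>x. m \<xi> * \<phi> x * wave \<xi> (y - x)) = (\<lambda>x. m \<xi> * (\<phi> x * wave x (- \<xi>)) * wave \<xi> y)" by (simp add: mult_ac)
    then show ?thesis by (simp add: fourier_eq)
  qed
  ultimately have eq: "(\<integral>\<xi>. m \<xi> * fourier \<phi> (- \<xi>) * wave \<xi> y \<partial>lborel) = (\<integral>x. \<phi> x * fourier m (y - x) \<partial>lborel)"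
    by simp
  have "mult_adj m \<phi> y = (\<integral>\<xi>. ?c * (m \<xi> * fourier \<phi> (- \<xi>) * wave \<xi> y) \<partial>lborel)"
    by (simp only: mult_adj_def, subst fourier_eq, simp only: inv_fourier_eq mult_ac)
  also have "\<dots> = (\<integral>x. ?c * (\<phi> x * fourier m (y - x)) \<partial>lborel)"
    by (simp only: integral_mult_right_zero eq)
  also have "\<dots> = (\<integral>x. \<phi> x * inv_fourier m (x - y) \<partial>lborel)"
    by (simp add: inv_fourier_eq)
  finally show ?thesis .
qed

text \<open>For bounded \<open>g\<close> the transpose is undone by Fubini alone; general tempered
  distributions are treated through Riemann sums below.\<close>

lemma multiplier_dist_of:
  fixes m g :: "real ^ 'n \<Rightarrow> complex"
  assumes m: "m \<in> schwartz" and g: "g \<in> borel_measurable borel" "\<And>x. norm (g x) \<le> A"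
  shows "multiplier m (dist_of g) = dist_of (\<lambda>x. \<integral>y. inv_fourier m (x - y) * g y \<partial>lborel)"
proof -
  have "(\<integral>y. g y * mult_adj m \<phi> y \<partial>lborel) = (\<integral>x. (\<integral>y. inv_fourier m (x - y) * g y \<partial>lborel) * \<phi> x \<partial>lborel)"
    if phi: "\<phi> \<in> schwartz" for \<phi>
    unfolding mult_adj_convolution[OF m phi]
    using fubini_convolution[OF schwartz_integrable[OF phi] schwartz_integrable[OF schwartz_inv_fourier[OF m]] g]
    by (simp add: mult.commute)
  then show ?thesis
    by (auto simp: multiplier_eq[OF m] dist_of_def on_schwartz_def schwartz_mult_adj[OF m] fun_eq_iff)
qed

primrec deriv_symbol :: "'n list \<Rightarrow> (real ^ 'n \<Rightarrow> complex) \<Rightarrow> real ^ 'n \<Rightarrow> complex" where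
  "deriv_symbol [] m = m"
| "deriv_symbol (i # is) m = (\<lambda>\<xi>. - \<i> * (complex_of_real (\<xi> $ i) * deriv_symbol is m \<xi>))"

lemma schwartz_deriv_symbol: "m \<in> schwartz \<Longrightarrow> deriv_symbol is m \<in> schwartz"
  by (induction "is") (simp_all only: deriv_symbol.simps schwartz_minus_ii)

lemma partial_derivs_fourier: "m \<in> schwartz \<Longrightarrow> partial_derivs is (fourier m) = fourier (deriv_symbol is m)"
  by (induction "is") (simp_all only: deriv_symbol.simps partial_derivs.simps partial_deriv_fourier schwartz_deriv_symbol)

text \<open>Derivatives fall on the symbol, so each of them is again an explicit convolution. This
  is the form that \<open>tempered_convolution\<close> requires of its test function.\<close>

lemma partial_derivs_mult_adj:
  assumes m: "m \<in> schwartz" and phi: "\<phi> \<in> schwartz"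
  shows "partial_derivs is (mult_adj m \<phi>) = mult_adj (deriv_symbol is m) \<phi>"
proof -
  have "deriv_symbol is (\<lambda>\<xi>. m \<xi> * inv_fourier \<phi> \<xi>) = (\<lambda>\<xi>. deriv_symbol is m \<xi> * inv_fourier \<phi> \<xi>)"
    by (induction "is") (simp_all add: mult_ac)
  then show ?thesis
    unfolding mult_adj_def using partial_derivs_fourier[OF schwartz_mult[OF m schwartz_inv_fourier[OF phi]]] by simp
qed

section \<open>Riemann sums and convolution with a tempered distribution\<close>

lemma riemann_sum_bound:
  fixes H :: "real ^ 'n \<Rightarrow> complex"
  assumes H: "continuous_on UNIV H" and D: "D tagged_division_of cbox a b" "(\<lambda>x. ball x \<delta>) fine D"
    and osc: "\<And>x t. t \<in> cbox a b \<Longrightarrow> norm (x - t) \<le> \<delta> \<Longrightarrow> norm (H x - H t) \<le> \<eta>"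
  shows "norm (integral (cbox a b) H - (\<Sum>(t, Q)\<in>D. of_real (measure lborel Q) * H t)) \<le> \<eta> * measure lborel (cbox a b)"
proof -
  have int: "H integrable_on cbox c d" for c d
    using H continuous_on_subset by (intro integrable_continuous) blast
  have "integral (cbox a b) H - (\<Sum>(t, Q)\<in>D. of_real (measure lborel Q) * H t)
    = (\<Sum>(t, Q)\<in>D. integral Q H - of_real (measure lborel Q) * H t)"
    using integral_combine_tagged_division_topdown[OF int D(1)] by (simp add: sum_subtractf case_prod_unfold)
  also have "norm \<dots> \<le> (\<Sum>(t, Q)\<in>D. \<eta> * measure lborel Q)"
  proof (rule sum_norm_le, clarify)
    fix t Q assume tQ: "(t, Q) \<in> D"
    obtain c d where Q: "Q = cbox c d" using tagged_division_ofD(4)[OF D(1) tQ] by blast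
    have t: "t \<in> cbox a b" "t \<in> Q" using tagged_division_ofD(2,3)[OF D(1) tQ] by auto
    have "Q \<subseteq> ball t \<delta>" using D(2) tQ unfolding fine_def by blast
    then have o: "norm (H x - H t) \<le> \<eta>" if "x \<in> Q" for x
      using that by (intro osc t) (auto simp: dist_norm norm_minus_commute)
    have "((\<lambda>x. H x - H t) has_integral (integral Q H - measure lborel Q *\<^sub>R H t)) Q"
      unfolding Q by (intro has_integral_diff integrable_integral int has_integral_const)
    then have "norm (integral Q H - measure lborel Q *\<^sub>R H t) \<le> \<eta> * measure lborel Q"
      unfolding Q using o Q t(2) by (intro has_integral_bound) (auto intro: order.trans[OF norm_ge_zero o])
    then show "norm (integral Q H - of_real (measure lborel Q) * H t) \<le> \<eta> * measure lborel Q"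
      by (simp add: scaleR_conv_of_real)
  qed
  also have "\<dots> = \<eta> * measure lborel (cbox a b)"
    by (simp add: additive_content_tagged_division[OF D(1), symmetric] sum_distrib_left case_prod_unfold)
  finally show ?thesis .
qed


text \<open>The seminorms of order M of a translate by x grow at most like (1 + |x|)^M, by
  \<open>peetre\<close>, and depend on x in a Lipschitz manner, by
  \<open>schwartz_diff_bound\<close>. Only finitely many multi-indices occur, so one constant serves
  them all.\<close>

lemma schwartz_translate_bounds:
  fixes k :: "real ^ 'n \<Rightarrow> complex"
  assumes k: "k \<in> schwartz"
  shows "\<exists>C\<ge>0. \<forall>is x x' y. length is \<le> M \<longrightarrow>
    (1 + norm y) ^ M * norm (partial_derivs is k (y - x)) \<le> C * (1 + norm x) ^ M \<and>
    (1 + norm y) ^ M * norm (partial_derivs is k (y - x) - partial_derivs is k (y - x'))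
      \<le> C * (1 + norm x) ^ M * (norm (x - x') * (1 + norm (x - x')) ^ M)"
proof -
  let ?P = "\<lambda>C is x x' y.
    (1 + norm y) ^ M * norm (partial_derivs is k (y - x)) \<le> C * (1 + norm x) ^ M \<and>
    (1 + norm y) ^ M * norm (partial_derivs is k (y - x) - partial_derivs is k (y - x'))
      \<le> C * (1 + norm x) ^ M * (norm (x - x') * (1 + norm (x - x')) ^ M)"
  have "\<exists>C\<ge>0. \<forall>x x' y. ?P C is x x' y" for "is"
  proof -
    let ?f = "partial_derivs is k"
    have f: "?f \<in> schwartz" by (rule schwartz_partial_derivs[OF k])
    obtain C1 where C1: "C1 \<ge> 0" "\<And>z. norm (?f z) \<le> C1 / (1 + norm z) ^ M"
      using rapidD[OF schwartz_rapid[OF f]] by blast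
    obtain C2 where C2: "C2 \<ge> 0" "\<And>z w. norm (?f z - ?f w) \<le> C2 * norm (z - w) * (1 + norm (z - w)) ^ M / (1 + norm z) ^ M"
      using schwartz_diff_bound[OF f] by blast
    have y: "(1 + norm y) ^ M \<le> (1 + norm x) ^ M * (1 + norm (y - x)) ^ M" for x y :: "real ^ 'n"
      using peetre[of y "- x"] unfolding power_mult_distrib[symmetric] by (intro power_mono) auto
    have pos: "0 < (1 + norm z) ^ M" for z :: "real ^ 'n" by (simp add: add_pos_nonneg)
    have "?P (C1 + C2) is x x' y" for x x' y
    proof
      have "(1 + norm y) ^ M * norm (?f (y - x)) \<le> (1 + norm x) ^ M * (1 + norm (y - x)) ^ M * (C1 / (1 + norm (y - x)) ^ M)"
        by (intro mult_mono y C1) auto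
      also have "\<dots> = C1 * (1 + norm x) ^ M" using pos[of "y - x"] by simp
      also have "\<dots> \<le> (C1 + C2) * (1 + norm x) ^ M" using C2 by (intro mult_right_mono) auto
      finally show "(1 + norm y) ^ M * norm (?f (y - x)) \<le> (C1 + C2) * (1 + norm x) ^ M" .
      let ?q = "norm (x - x') * (1 + norm (x - x')) ^ M"
      have "norm (?f (y - x) - ?f (y - x')) \<le> C2 * ?q / (1 + norm (y - x)) ^ M"
        using C2(2)[of "y - x" "y - x'"] by (simp add: norm_minus_commute mult.assoc)
      then have "(1 + norm y) ^ M * norm (?f (y - x) - ?f (y - x'))
          \<le> (1 + norm x) ^ M * (1 + norm (y - x)) ^ M * (C2 * ?q / (1 + norm (y - x)) ^ M)"
        by (intro mult_mono y) auto
      also have "\<dots> = C2 * ((1 + norm x) ^ M * ?q)" using pos[of "y - x"] by simp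
      also have "\<dots> \<le> (C1 + C2) * ((1 + norm x) ^ M * ?q)" using C1 by (intro mult_right_mono) auto
      finally show "(1 + norm y) ^ M * norm (?f (y - x) - ?f (y - x')) \<le> (C1 + C2) * (1 + norm x) ^ M * ?q"
        by (simp add: mult.assoc)
    qed
    then show ?thesis using C1 C2 by (intro exI[of _ "C1 + C2"]) auto
  qed
  then obtain C where C0: "C is \<ge> 0" and C: "?P (C is) is x x' y" for "is" x x' y by metis
  let ?L = "{is :: 'n list. length is \<le> M}"
  have "?P (\<Sum>is\<in>?L. C is) is x x' y" if "length is \<le> M" for "is" x x' y
  proof -
    have le: "C is \<le> (\<Sum>is\<in>?L. C is)"
      using that C0 by (intro member_le_sum) (auto simp: finite_lists_le)
    show ?thesis
    proof -
      have "?P (C is) is x x' y" by (rule C)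
      then show ?thesis
        by (elim conjE, intro conjI; elim order.trans; intro mult_right_mono le) auto
    qed
  qed
  then show ?thesis using C0 by (intro exI[of _ "\<Sum>is\<in>?L. C is"]) (auto intro: sum_nonneg)
qed

text \<open>A growth and modulus condition with a single constant. It is met by the map sending x to
  the value of a tempered distribution on a translate, and also, uniformly in y, by the weighted
  derivatives of the translates at y; one Riemann sum estimate then covers both.\<close>

definition moderate :: "nat \<Rightarrow> real \<Rightarrow> (real ^ 'n \<Rightarrow> complex) \<Rightarrow> bool" where
  "moderate M K P \<longleftrightarrow> (\<forall>x. norm (P x) \<le> K * (1 + norm x) ^ M) \<and>
    (\<forall>x t. norm (P x - P t) \<le> K * (1 + norm x) ^ M * (norm (x - t) * (1 + norm (x - t)) ^ M))"

lemma moderate_continuous: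
  assumes "moderate M K P"
  shows "continuous_on UNIV P"
proof -
  have "isCont P x" for x
  proof -
    have "((\<lambda>t. K * (1 + norm x) ^ M * (norm (x - t) * (1 + norm (x - t)) ^ M)) \<longlongrightarrow>
        K * (1 + norm x) ^ M * (norm (x - x) * (1 + norm (x - x)) ^ M)) (at x)"
      by (intro tendsto_intros)
    then have "((\<lambda>t. K * (1 + norm x) ^ M * (norm (x - t) * (1 + norm (x - t)) ^ M)) \<longlongrightarrow> 0) (at x)"
      by simp
    then have "((\<lambda>t. P t - P x) \<longlongrightarrow> 0) (at x)"
      by (rule Lim_null_comparison[rotated])
        (use assms in \<open>auto simp: moderate_def norm_minus_commute[of "P _" "P x"]\<close>)
    then show ?thesis by (simp add: isCont_def LIM_zero_iff)
  qed
  then show ?thesis by (simp add: continuous_at_imp_continuous_on)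
qed

lemma moderate_polynomial_growth: "moderate M K P \<Longrightarrow> polynomial_growth P"
  unfolding moderate_def polynomial_growth_def by blast

text \<open>One power of decay is kept beyond what integrability takes; it makes the tail outside a
  box of radius R of order 1/R.\<close>

lemma moderate_mult_schwartz:
  fixes \<phi> P :: "real ^ 'n \<Rightarrow> complex"
  assumes P: "moderate M K P" and D: "\<And>x. norm (\<phi> x) \<le> D / (1 + norm x) ^ (M + 2 * CARD('n) + 1)"
  shows "norm (\<phi> x * P x) \<le> K * D * weight x / (1 + norm x)"
proof -
  have pos: "0 < 1 + norm x" by (simp add: add_pos_nonneg)
  have "norm (\<phi> x * P x) \<le> (D / (1 + norm x) ^ (M + 2 * CARD('n) + 1)) * (K * (1 + norm x) ^ M)"
    unfolding norm_mult
  proof (intro mult_mono D)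
    show "norm (P x) \<le> K * (1 + norm x) ^ M" using P by (simp add: moderate_def)
    show "0 \<le> D / (1 + norm x) ^ (M + 2 * CARD('n) + 1)" by (rule order.trans[OF norm_ge_zero D])
  qed simp
  also have "\<dots> = K * D * weight x / (1 + norm x)"
    using pos by (simp add: weight_def power_add mult_ac)
  finally show ?thesis .
qed

lemma integrable_moderate_mult_schwartz:
  fixes \<phi> P :: "real ^ 'n \<Rightarrow> complex"
  assumes P: "moderate M K P" and phi: "\<phi> \<in> schwartz"
  shows "integrable lborel (\<lambda>x. \<phi> x * P x)"
proof -
  obtain D where D: "D \<ge> 0" "\<And>x. norm (\<phi> x) \<le> D / (1 + norm x) ^ (M + 2 * CARD('n) + 1)"
    using rapidD[OF schwartz_rapid[OF phi]] by blast
  have K: "0 \<le> K" using P norm_ge_zero[of "P 0"] unfolding moderate_def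
    by (metis add_0_right mult.right_neutral norm_zero order.trans power_one)
  show ?thesis
  proof (rule Bochner_Integration.integrable_bound)
    show "integrable lborel (\<lambda>x :: real ^ 'n. K * D * weight x)" by (intro integrable_mult_right integrable_weight)
    show "(\<lambda>x. \<phi> x * P x) \<in> borel_measurable lborel"
      using borel_measurable_continuous_onI[OF moderate_continuous[OF P]] schwartz_measurable[OF phi] by simp
    have "norm (\<phi> x * P x) \<le> K * D * weight x" for x
    proof -
      have "norm (\<phi> x * P x) \<le> K * D * weight x / (1 + norm x)" by (rule moderate_mult_schwartz[OF P D(2)])
      also have "\<dots> \<le> K * D * weight x / 1" using K D by (intro divide_left_mono) auto
      finally show ?thesis by simp
    qed
    then show "AE x in lborel. norm (\<phi> x * P x) \<le> norm (K * D * weight x)" using K D by simp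
  qed
qed

text \<open>The order of the quantifiers is the point: the mesh depends on R and on the accuracy but
  not on \<open>P\<close>, so a single division of the box works for all moderate integrands
  simultaneously. The first error term is the tail outside the box, the second the oscillation
  inside.\<close>

lemma riemann_sum_approximation:
  fixes \<phi> :: "real ^ 'n \<Rightarrow> complex"
  assumes phi: "\<phi> \<in> schwartz"
  defines "B \<equiv> \<lambda>R. cbox (\<chi> i. - R) (\<chi> i :: 'n. R)"
  shows "\<exists>T\<ge>0. \<forall>R>0. \<forall>\<eta>>0. \<exists>\<delta>>0. \<forall>P K D. moderate M K P \<longrightarrow> D tagged_division_of B R \<longrightarrow>
    (\<lambda>x. ball x \<delta>) fine D \<longrightarrow>
    norm ((\<integral>x. \<phi> x * P x \<partial>lborel) - (\<Sum>(t, Q)\<in>D. of_real (measure lborel Q) * (\<phi> t * P t)))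
      \<le> K * (T / (1 + R) + \<eta> * measure lborel (B R))"
proof -
  obtain D where D: "D \<ge> 0" "\<And>x. norm (\<phi> x) \<le> D / (1 + norm x) ^ (M + 2 * CARD('n) + 1)"
    using rapidD[OF schwartz_rapid[OF phi]] by blast
  obtain F where F: "F \<ge> 0" "\<And>x. norm (\<phi> x) \<le> F"
    using schwartz_bounded[OF phi] by blast
  obtain E where E: "E \<ge> 0" "\<And>x t. norm (\<phi> x - \<phi> t) \<le> E * norm (x - t)"
    using schwartz_diff_bound[OF phi, of 0] by auto
  let ?T = "D * (\<integral>(x :: real ^ 'n). weight x \<partial>lborel)"
  have T: "0 \<le> ?T" using D by (intro mult_nonneg_nonneg integral_nonneg) auto
  have "\<exists>\<delta>>0. \<forall>P K S. moderate M K P \<longrightarrow> S tagged_division_of B R \<longrightarrow> (\<lambda>x. ball x \<delta>) fine S \<longrightarrow>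
    norm ((\<integral>x. \<phi> x * P x \<partial>lborel) - (\<Sum>(t, Q)\<in>S. of_real (measure lborel Q) * (\<phi> t * P t)))
      \<le> K * (?T / (1 + R) + \<eta> * measure lborel (B R))" if R: "R > 0" and eta: "\<eta> > 0" for R \<eta>
  proof -
    have "bounded (B R)" unfolding B_def by (rule bounded_cbox)
    then obtain \<rho> where rho: "\<And>x. x \<in> B R \<Longrightarrow> norm x \<le> \<rho>" unfolding bounded_iff by blast
    have rho0: "0 \<le> \<rho>" using rho[of 0] R by (simp add: B_def mem_box_cart)
    \<comment> \<open>Up to the factor \<open>K\<close>, this is a Lipschitz constant of the
      integrand on the box; the added 1 keeps it positive. The mesh is also kept below 1, so that
      the factor (1 + |x - t|)^M is at most 2^M.\<close>
    define L where "L = (1 + \<rho>) ^ M * (E + F * 2 ^ M) + 1"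
    have "0 \<le> (1 + \<rho>) ^ M * (E + F * 2 ^ M)"
      using rho0 E F by (intro mult_nonneg_nonneg add_nonneg_nonneg) auto
    then have L: "L > 0" unfolding L_def by linarith
    define \<delta> where "\<delta> = min 1 (\<eta> / L)"
    have delta: "\<delta> > 0" "\<delta> \<le> 1" using L eta by (auto simp: \<delta>_def)
    have "norm ((\<integral>x. \<phi> x * P x \<partial>lborel) - (\<Sum>(t, Q)\<in>S. of_real (measure lborel Q) * (\<phi> t * P t)))
      \<le> K * (?T / (1 + R) + \<eta> * measure lborel (B R))"
      if P: "moderate M K P" and S: "S tagged_division_of B R" "(\<lambda>x. ball x \<delta>) fine S" for P K S
    proof -
      have K: "0 \<le> K" using P norm_ge_zero[of "P 0"] unfolding moderate_def
        by (metis add_0_right mult.right_neutral norm_zero order.trans power_one)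
      let ?H = "\<lambda>x. \<phi> x * P x"
      have Hc: "continuous_on UNIV ?H"
        by (intro continuous_on_mult schwartz_continuous phi moderate_continuous[OF P])
      have Hi: "integrable lborel ?H" by (rule integrable_moderate_mult_schwartz[OF P phi])
      have osc: "norm (?H x - ?H t) \<le> K * \<eta>" if t: "t \<in> B R" and xt: "norm (x - t) \<le> \<delta>" for x t
      proof -
        have t1: "(1 + norm t) ^ M \<le> (1 + \<rho>) ^ M" using rho[OF t] by (intro power_mono) auto
        have "?H x - ?H t = (\<phi> x - \<phi> t) * P t - \<phi> x * (P t - P x)" by (simp add: algebra_simps)
        also have "norm \<dots> \<le> norm (\<phi> x - \<phi> t) * norm (P t) + norm (\<phi> x) * norm (P t - P x)"
          using norm_triangle_ineq4 by (metis norm_mult)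
        also have "\<dots> \<le> (E * norm (x - t)) * (K * (1 + \<rho>) ^ M) + F * (K * (1 + \<rho>) ^ M * (norm (x - t) * 2 ^ M))"
        proof (intro add_mono mult_mono E F)
          have "norm (P t) \<le> K * (1 + norm t) ^ M" using P by (simp add: moderate_def)
          also have "\<dots> \<le> K * (1 + \<rho>) ^ M" by (intro mult_left_mono t1 K)
          finally show "norm (P t) \<le> K * (1 + \<rho>) ^ M" .
          have "norm (P t - P x) \<le> K * (1 + norm t) ^ M * (norm (t - x) * (1 + norm (t - x)) ^ M)"
            using P by (simp add: moderate_def)
          also have "\<dots> \<le> K * (1 + \<rho>) ^ M * (norm (x - t) * 2 ^ M)"
            using t1 rho[OF t] K rho0 xt delta by (intro mult_mono power_mono) (auto simp: norm_minus_commute)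
          finally show "norm (P t - P x) \<le> K * (1 + \<rho>) ^ M * (norm (x - t) * 2 ^ M)" .
        qed (use E F in auto)
        also have "\<dots> = K * (norm (x - t) * ((1 + \<rho>) ^ M * (E + F * 2 ^ M)))" by (simp add: algebra_simps)
        also have "\<dots> \<le> K * (\<eta> / L * L)"
        proof (intro mult_left_mono mult_mono K)
          show "norm (x - t) \<le> \<eta> / L" using xt by (simp add: \<delta>_def)
        qed (use L eta rho0 E F in \<open>auto simp: L_def\<close>)
        finally show ?thesis using L by simp
      qed
      have r: "norm (integral (B R) ?H - (\<Sum>(t, Q)\<in>S. of_real (measure lborel Q) * ?H t)) \<le> K * \<eta> * measure lborel (B R)"
        using S osc unfolding B_def by (intro riemann_sum_bound[OF Hc]) auto
      have "integral (B R) ?H = (\<integral>x. indicator (B R) x *\<^sub>R ?H x \<partial>lborel)"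
        using set_borel_integral_eq_integral(2)[of "B R" ?H] Hi
        by (simp add: set_integrable_def set_lebesgue_integral_def integrable_mult_indicator B_def)
      also have "(\<integral>x. ?H x \<partial>lborel) - \<dots> = (\<integral>x. ?H x - indicator (B R) x *\<^sub>R ?H x \<partial>lborel)"
        using Hi by (intro Bochner_Integration.integral_diff[symmetric])
          (auto intro!: integrable_mult_indicator simp: B_def)
      also have "norm \<dots> \<le> (\<integral>(x :: real ^ 'n). K * D / (1 + R) * weight x \<partial>lborel)"
      proof (rule Bochner_Integration.integral_norm_bound_integral)
        show "integrable lborel (\<lambda>x. ?H x - indicator (B R) x *\<^sub>R ?H x)"
          using Hi by (intro Bochner_Integration.integrable_diff) (auto intro!: integrable_mult_indicator simp: B_def)
        show "integrable lborel (\<lambda>x :: real ^ 'n. K * D / (1 + R) * weight x)"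
          by (intro integrable_mult_right integrable_weight)
        fix x :: "real ^ 'n"
        show "norm (?H x - indicator (B R) x *\<^sub>R ?H x) \<le> K * D / (1 + R) * weight x"
        proof (cases "x \<in> B R")
          case True
          then show ?thesis using K D R by simp
        next
          case False
          then obtain i where "x $ i < - R \<or> R < x $ i" unfolding B_def mem_box_cart by (auto simp: not_le)
          then have "R \<le> norm x" using component_le_norm_cart[of x i] by linarith
          have "norm (?H x) \<le> K * D * weight x / (1 + norm x)" by (rule moderate_mult_schwartz[OF P D(2)])
          also have "\<dots> \<le> K * D * weight x / (1 + R)"
            using K D R \<open>R \<le> norm x\<close> by (intro divide_left_mono mult_nonneg_nonneg mult_pos_pos) auto
          finally show ?thesis using False by simp
        qed
      qed
      also have "\<dots> = K * (?T / (1 + R))" by simp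
      finally have tail: "norm ((\<integral>x. ?H x \<partial>lborel) - integral (B R) ?H) \<le> K * (?T / (1 + R))" .
      show ?thesis
        using norm_triangle_le[OF add_mono[OF tail r]] by (simp add: algebra_simps)
    qed
    then show ?thesis using delta by blast
  qed
  then show ?thesis using T by blast
qed

lemma moderate_tempered:
  fixes u :: "(real ^ 'n \<Rightarrow> complex) \<Rightarrow> complex"
  assumes u: "u \<in> tempered" and k: "k \<in> schwartz"
    and C: "0 \<le> C" "\<And>\<phi> e. \<phi> \<in> schwartz \<Longrightarrow>
    (\<And>is x. length is \<le> M \<Longrightarrow> (1 + norm x) ^ M * norm (partial_derivs is \<phi> x) \<le> e) \<Longrightarrow> norm (u \<phi>) \<le> C * e"
    and E: "\<And>is x x' y. length is \<le> M \<Longrightarrow>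
    (1 + norm y) ^ M * norm (partial_derivs is k (y - x)) \<le> E * (1 + norm x) ^ M \<and>
    (1 + norm y) ^ M * norm (partial_derivs is k (y - x) - partial_derivs is k (y - x'))
      \<le> E * (1 + norm x) ^ M * (norm (x - x') * (1 + norm (x - x')) ^ M)"
  shows "moderate M (C * E) (\<lambda>x. u (\<lambda>y. k (y - x)))"
  unfolding moderate_def
proof (intro conjI allI)
  have s: "(\<lambda>y. k (y - x)) \<in> schwartz" for x by (rule schwartz_shift_diff[OF k])
  fix x t
  have "norm (u (\<lambda>y. k (y - x))) \<le> C * (E * (1 + norm x) ^ M)"
    using E by (intro C s) (auto simp: partial_derivs_shift[OF k])
  then show "norm (u (\<lambda>y. k (y - x))) \<le> C * E * (1 + norm x) ^ M" by (simp add: mult.assoc)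
  have "norm (u (\<lambda>y. k (y - x) - k (y - t))) \<le> C * (E * (1 + norm x) ^ M * (norm (x - t) * (1 + norm (x - t)) ^ M))"
    using E by (intro C schwartz_diff s) (auto simp: partial_derivs_shift[OF k] partial_derivs_diff[OF s s])
  then show "norm (u (\<lambda>y. k (y - x)) - u (\<lambda>y. k (y - t))) \<le> C * E * (1 + norm x) ^ M * (norm (x - t) * (1 + norm (x - t)) ^ M)"
    by (simp add: tempered_diff[OF u s s] mult.assoc)
qed

text \<open>A tempered distribution commutes with convolution integrals, because these are limits of
  Riemann sums in every Schwartz seminorm.\<close>

lemma tempered_convolution:
  fixes u :: "(real ^ 'n \<Rightarrow> complex) \<Rightarrow> complex"
  assumes u: "u \<in> tempered" and k: "k \<in> schwartz" and phi: "\<phi> \<in> schwartz"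
    and Phi: "\<Phi> \<in> schwartz" "\<And>is y. partial_derivs is \<Phi> y = (\<integral>x. \<phi> x * partial_derivs is k (y - x) \<partial>lborel)"
  shows "u \<Phi> = (\<integral>x. \<phi> x * u (\<lambda>y. k (y - x)) \<partial>lborel)"
proof -
  obtain C M where C: "0 \<le> C" "\<And>\<phi> e. \<phi> \<in> schwartz \<Longrightarrow>
    (\<And>is x. length is \<le> M \<Longrightarrow> (1 + norm x) ^ M * norm (partial_derivs is \<phi> x) \<le> e) \<Longrightarrow> norm (u \<phi>) \<le> C * e"
    using tempered_bound[OF u] by metis
  obtain E where E0: "E \<ge> 0" and E: "\<And>is x x' y. length is \<le> M \<Longrightarrow>
    (1 + norm y) ^ M * norm (partial_derivs is k (y - x)) \<le> E * (1 + norm x) ^ M \<and>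
    (1 + norm y) ^ M * norm (partial_derivs is k (y - x) - partial_derivs is k (y - x'))
      \<le> E * (1 + norm x) ^ M * (norm (x - x') * (1 + norm (x - x')) ^ M)"
    using schwartz_translate_bounds[OF k, of M] by blast
  let ?G = "\<lambda>x. u (\<lambda>y. k (y - x))"
  let ?B = "\<lambda>R. cbox (\<chi> i. - R) (\<chi> i :: 'n. R)"
  have G: "moderate M (C * E) ?G" by (rule moderate_tempered[OF u k C E])
  have P: "moderate M E (\<lambda>x. of_real ((1 + norm y) ^ M) * partial_derivs is k (y - x))"
    if "length is \<le> M" for "is" y
  proof -
    have "norm (of_real ((1 + norm y) ^ M) * z) = (1 + norm y) ^ M * norm z" for z :: complex
      unfolding norm_mult norm_of_real by simp
    then show ?thesis
      using E[OF that, of y] unfolding moderate_def right_diff_distrib[symmetric] by simp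
  qed
  obtain T where T: "T \<ge> 0" and approx: "\<And>R \<eta>. R > 0 \<Longrightarrow> \<eta> > 0 \<Longrightarrow> \<exists>\<delta>>0. \<forall>P K D. moderate M K P \<longrightarrow>
    D tagged_division_of ?B R \<longrightarrow> (\<lambda>x. ball x \<delta>) fine D \<longrightarrow>
    norm ((\<integral>x. \<phi> x * P x \<partial>lborel) - (\<Sum>(t, Q)\<in>D. of_real (measure lborel Q) * (\<phi> t * P t)))
      \<le> K * (T / (1 + R) + \<eta> * measure lborel (?B R))"
    using riemann_sum_approximation[OF phi, of M] by blast
  let ?I = "\<integral>x. \<phi> x * ?G x \<partial>lborel"
  have main: "norm (u \<Phi> - ?I) \<le> 2 * (C * E) * (T / (1 + R) + \<eta> * measure lborel (?B R))"
    if R: "R > 0" and eta: "\<eta> > 0" for R \<eta>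
  proof -
    let ?e = "E * (T / (1 + R) + \<eta> * measure lborel (?B R))"
    obtain \<delta> where "\<delta> > 0" and delta: "\<And>P K D. moderate M K P \<Longrightarrow>
      D tagged_division_of ?B R \<Longrightarrow> (\<lambda>x. ball x \<delta>) fine D \<Longrightarrow>
      norm ((\<integral>x. \<phi> x * P x \<partial>lborel) - (\<Sum>(t, Q)\<in>D. of_real (measure lborel Q) * (\<phi> t * P t)))
        \<le> K * (T / (1 + R) + \<eta> * measure lborel (?B R))"
      using approx[OF R eta] by blast
    have "gauge (\<lambda>x :: real ^ 'n. ball x \<delta>)" using \<open>\<delta> > 0\<close> by (rule gauge_ball)
    then obtain D where D: "D tagged_division_of ?B R" "(\<lambda>x. ball x \<delta>) fine D"
      by (rule fine_division_exists)
    \<comment> \<open>The Riemann sum is itself a finite combination of translates of k, so u acts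
      on it term by term.\<close>
    let ?S = "\<lambda>y. \<Sum>d\<in>D. of_real (measure lborel (snd d)) * \<phi> (fst d) * k (y - fst d)"
    have Sk: "(\<lambda>y. c * k (y - t)) \<in> schwartz" for c t
      by (intro schwartz_cmult schwartz_shift_diff k)
    have S: "?S \<in> schwartz" by (intro schwartz_sum Sk)
    have dS: "partial_derivs is ?S y = (\<Sum>d\<in>D. of_real (measure lborel (snd d)) * \<phi> (fst d) * partial_derivs is k (y - fst d))" for "is" y
      by (simp add: partial_derivs_sum[OF Sk] partial_derivs_cmult[OF schwartz_shift_diff[OF k]] partial_derivs_shift[OF k])
    have uS: "u ?S = (\<Sum>d\<in>D. of_real (measure lborel (snd d)) * \<phi> (fst d) * ?G (fst d))"
      by (simp add: tempered_sum[OF u Sk] tempered_cmult[OF u schwartz_shift_diff[OF k]])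
    have "norm (u (\<lambda>y. \<Phi> y - ?S y)) \<le> C * ?e"
    proof (intro C schwartz_diff Phi S)
      fix "is" :: "'n list" and y assume l: "length is \<le> M"
      have "(1 + norm y) ^ M * norm (partial_derivs is (\<lambda>y. \<Phi> y - ?S y) y)
        = norm (of_real ((1 + norm y) ^ M) * (partial_derivs is \<Phi> y - partial_derivs is ?S y))"
        unfolding partial_derivs_diff[OF Phi(1) S] norm_mult norm_of_real by simp
      also have "of_real ((1 + norm y) ^ M) * (partial_derivs is \<Phi> y - partial_derivs is ?S y)
        = (\<integral>x. \<phi> x * (of_real ((1 + norm y) ^ M) * partial_derivs is k (y - x)) \<partial>lborel)
          - (\<Sum>(t, Q)\<in>D. of_real (measure lborel Q) * (\<phi> t * (of_real ((1 + norm y) ^ M) * partial_derivs is k (y - t))))"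
        unfolding dS Phi(2) right_diff_distrib sum_distrib_left integral_mult_right_zero[symmetric]
        by (simp only: mult_ac case_prod_unfold)
      also have "norm \<dots> \<le> ?e" by (rule delta[OF P[OF l] D])
      finally show "(1 + norm y) ^ M * norm (partial_derivs is (\<lambda>y. \<Phi> y - ?S y) y) \<le> ?e" .
    qed
    then have 1: "norm (u \<Phi> - u ?S) \<le> C * ?e" by (simp only: tempered_diff[OF u Phi(1) S])
    \<comment> \<open>The same division is used for the scalar integral, which is possible because
      the mesh does not depend on the moderate function.\<close>
    have 2: "norm (?I - u ?S) \<le> C * E * (T / (1 + R) + \<eta> * measure lborel (?B R))"
      using delta[OF G D] unfolding uS by (simp only: case_prod_unfold mult.assoc)
    show ?thesis
      using norm_triangle_le_diff[OF add_mono[OF 1 2]] by (simp add: mult.assoc)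
  qed
  have "norm (u \<Phi> - ?I) \<le> (2 * (C * E) * T) * h" if h: "0 < h" "h \<le> 1" for h
  proof -
    have "norm (u \<Phi> - ?I) \<le> 2 * (C * E) * T / (1 + 1 / h)"
    proof (rule field_le_epsilon)
      fix e :: real assume e: "e > 0"
      \<comment> \<open>The radius R = 1/h is fixed before the accuracy, which is then chosen as e /
        (?V + 1) to outweigh the volume of the box; the remaining tail is linear in h.\<close>
      let ?V = "2 * (C * E) * measure lborel (?B (1 / h))"
      have V: "0 \<le> ?V" using C E0 by simp
      have "norm (u \<Phi> - ?I) \<le> 2 * (C * E) * (T / (1 + 1 / h) + e / (?V + 1) * measure lborel (?B (1 / h)))"
        using h e V by (intro main) auto
      also have "\<dots> = 2 * (C * E) * T / (1 + 1 / h) + e * (?V / (?V + 1))" by (simp add: distrib_left)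
      also have "e * (?V / (?V + 1)) \<le> e * 1" using V e by (intro mult_left_mono) auto
      finally show "norm (u \<Phi> - ?I) \<le> 2 * (C * E) * T / (1 + 1 / h) + e" by simp
    qed
    also have "\<dots> \<le> 2 * (C * E) * T / (1 / h)"
      using h C E0 T by (intro divide_left_mono mult_pos_pos) (auto intro: add_pos_pos)
    finally show ?thesis using h by simp
  qed
  then have "norm (u \<Phi> - ?I) \<le> 0" by (rule eq_zero_of_le_linear)
  then show ?thesis by simp
qed

text \<open>Filtering by a Schwartz symbol is convolution with its kernel, evaluated by letting u
  act on the reflected translate. Through this every block and every smooth projection becomes an
  honest function.\<close>

theorem multiplier_tempered:
  fixes m :: "real ^ 'n \<Rightarrow> complex"
  assumes u: "u \<in> tempered" and m: "m \<in> schwartz"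
  defines "g \<equiv> \<lambda>x. u (\<lambda>y. inv_fourier m (x - y))"
  shows "multiplier m u = dist_of g" "continuous_on UNIV g" "polynomial_growth g"
proof -
  let ?c = "1 / (2 * complex_of_real pi) ^ CARD('n)"
  define k where "k = (\<lambda>z. ?c * fourier m z)"
  have k: "k \<in> schwartz" unfolding k_def by (intro schwartz_cmult schwartz_fourier m)
  have kx: "inv_fourier m (x - y) = k (y - x)" for x y :: "real ^ 'n" by (simp add: inv_fourier_eq k_def)
  have dk: "partial_derivs is k (y - x) = inv_fourier (deriv_symbol is m) (x - y)" for "is" x y
    unfolding k_def partial_derivs_cmult[OF schwartz_fourier[OF m]] partial_derivs_fourier[OF m]
    by (simp add: inv_fourier_eq)
  have g: "g = (\<lambda>x. u (\<lambda>y. k (y - x)))" by (simp add: g_def kx)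
  have "\<exists>M K. moderate M K g"
    unfolding g using moderate_tempered[OF u k] tempered_bound[OF u] schwartz_translate_bounds[OF k]
    by (metis (no_types, lifting))
  then show "continuous_on UNIV g" "polynomial_growth g"
    using moderate_continuous moderate_polynomial_growth by blast+
  have "u (mult_adj m \<phi>) = (\<integral>x. \<phi> x * u (\<lambda>y. k (y - x)) \<partial>lborel)" if phi: "\<phi> \<in> schwartz" for \<phi>
    by (rule tempered_convolution[OF u k phi schwartz_mult_adj[OF m phi]])
      (simp only: partial_derivs_mult_adj[OF m phi] mult_adj_convolution[OF schwartz_deriv_symbol[OF m] phi] dk)
  then show "multiplier m u = dist_of g"
    by (auto simp: multiplier_eq[OF m] dist_of_def on_schwartz_def g mult.commute fun_eq_iff)
qed

lemma fun_of_dist_dist_of: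
  assumes "continuous_on UNIV g" "polynomial_growth g"
  shows "fun_of_dist (dist_of g) = g"
  unfolding fun_of_dist_def using assms by (intro the_equality) (auto dest: dist_of_inject)

section \<open>Dyadic cubes\<close>

text \<open>The index of the cube containing x. The dyadic cubes of generation N are the level sets
  of \<open>cell N\<close>, so that being constant on cubes means factoring through this
  map.\<close>

definition cell :: "nat \<Rightarrow> real ^ 'n \<Rightarrow> int ^ 'n" where
  "cell N x = (\<chi> i. \<lfloor>2 ^ N * x $ i\<rfloor>)"

definition corner :: "nat \<Rightarrow> int ^ 'n \<Rightarrow> real ^ 'n" where
  "corner N \<nu> = (\<chi> i. of_int (\<nu> $ i) / 2 ^ N)"

lemma mem_dyadic_cube: "x \<in> dyadic_cube N \<nu> \<longleftrightarrow> cell N x = \<nu>"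
  by (auto simp: dyadic_cube_def cell_def vec_eq_iff floor_eq_iff algebra_simps)

lemma dyadic_cube_eq: "dyadic_cube N \<nu> = {x. cell N x = \<nu>}"
  by (auto simp: mem_dyadic_cube)

lemma cell_corner [simp]: "cell N (corner N \<nu>) = \<nu>"
  by (simp add: cell_def corner_def vec_eq_iff)

lemma dyadic_cube_Ico: "dyadic_cube N \<nu> = {x. \<forall>i. x $ i \<in> {of_int (\<nu> $ i) / 2 ^ N ..< (of_int (\<nu> $ i) + 1) / 2 ^ N}}"
  by (auto simp: dyadic_cube_def field_simps)

lemma dyadic_cube_sets [measurable, simp]: "dyadic_cube N \<nu> \<in> sets borel"
  unfolding dyadic_cube_Ico by measurable

lemma cell_measurable [measurable]: "(cell N :: real ^ 'n \<Rightarrow> _) \<in> measurable borel (count_space UNIV)"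
proof -
  have "cell N -` {\<nu>} = dyadic_cube N \<nu>" for \<nu> :: "int ^ 'n" by (auto simp: mem_dyadic_cube)
  then show ?thesis by (simp add: measurable_count_space_eq2_countable)
qed

text \<open>The function factors through a countable set of indices, so measurability is
  automatic.\<close>

lemma cell_constant_measurable:
  assumes "\<And>x y. cell N x = cell N y \<Longrightarrow> h x = h y"
  shows "h \<in> borel_measurable borel"
proof -
  have "h = (\<lambda>x. (\<lambda>\<nu>. h (corner N \<nu>)) (cell N x))"
    by (rule ext, rule assms) simp
  also have "\<dots> \<in> borel_measurable borel"
    by (rule measurable_compose[OF cell_measurable]) simp
  finally show ?thesis .
qed

lemma norm_diff_same_cell:
  fixes x y :: "real ^ 'n"
  assumes "cell N x = cell N y"
  shows "norm (x - y) \<le> CARD('n) / 2 ^ N"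
proof -
  have "\<bar>(x - y) $ i\<bar> \<le> 1 / 2 ^ N" for i
  proof -
    have "\<lfloor>2 ^ N * x $ i\<rfloor> = \<lfloor>2 ^ N * y $ i\<rfloor>" using assms by (simp add: cell_def vec_eq_iff)
    then have "\<bar>2 ^ N * x $ i - 2 ^ N * y $ i\<bar> \<le> 1" by linarith
    then have "2 ^ N * \<bar>(x - y) $ i\<bar> \<le> 1" by (simp add: abs_mult flip: right_diff_distrib)
    then show ?thesis by (simp add: field_simps)
  qed
  then have "(\<Sum>i\<in>UNIV. \<bar>(x - y) $ i\<bar>) \<le> (\<Sum>i\<in>(UNIV :: 'n set). 1 / 2 ^ N)" by (intro sum_mono)
  then show ?thesis using norm_le_l1_cart[of "x - y"] by simp
qed

lemma emeasure_lborel_product: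
  fixes S :: "'n::finite \<Rightarrow> real set"
  assumes S: "\<And>i. S i \<in> sets borel" "\<And>i. emeasure lborel (S i) = ennreal (l i)" "\<And>i. 0 \<le> l i"
  shows "emeasure lborel {x :: real ^ 'n. \<forall>i. x $ i \<in> S i} = ennreal (\<Prod>i\<in>UNIV. l i)"
proof -
  have [measurable]: "S i \<in> sets borel" for i by (rule S)
  have "emeasure lborel {x :: real ^ 'n. \<forall>i. x $ i \<in> S i} = (\<integral>\<^sup>+x. indicator {x :: real ^ 'n. \<forall>i. x $ i \<in> S i} x \<partial>lborel)"
    by (rule nn_integral_indicator[symmetric]) measurable
  also have "\<dots> = (\<integral>\<^sup>+(x :: real ^ 'n). (\<Prod>i\<in>UNIV. indicator (S i) (x $ i)) \<partial>lborel)"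
    by (rule nn_integral_cong) (auto simp: indicator_def prod.neutral intro!: prod_zero)
  also have "\<dots> = (\<Prod>i\<in>UNIV. \<integral>\<^sup>+s. indicator (S i) s \<partial>lborel)"
    by (rule nn_integral_prod_vec) measurable
  also have "\<dots> = ennreal (\<Prod>i\<in>UNIV. l i)" by (simp add: S prod_ennreal)
  finally show ?thesis .
qed

lemma emeasure_dyadic_cube: "emeasure lborel (dyadic_cube N \<nu> :: (real ^ 'n) set) = ennreal (1 / 2 ^ (N * CARD('n)))"
proof -
  have "emeasure lborel {of_int (\<nu> $ i) / 2 ^ N ..< (of_int (\<nu> $ i) + 1 :: real) / 2 ^ N} = ennreal (1 / 2 ^ N)" for i
    by (subst emeasure_lborel_Ico) (auto simp: add_divide_distrib)
  then show ?thesis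
    unfolding dyadic_cube_Ico by (subst emeasure_lborel_product) (auto simp: power_mult power_one_over)
qed

lemma measure_dyadic_cube: "measure lborel (dyadic_cube N \<nu> :: (real ^ 'n) set) = 1 / 2 ^ (N * CARD('n))"
  by (simp add: measure_def emeasure_dyadic_cube)

text \<open>Weierstrass' product inequality. It bounds the volume lost when a cube is intersected
  with a translate of itself.\<close>

lemma one_minus_sum_le_prod:
  fixes x :: "'a \<Rightarrow> real"
  assumes "finite A" "\<And>i. i \<in> A \<Longrightarrow> 0 \<le> x i \<and> x i \<le> 1"
  shows "1 - (\<Sum>i\<in>A. x i) \<le> (\<Prod>i\<in>A. 1 - x i)"
  using assms
proof (induction A rule: finite_induct)
  case (insert a A)
  have p: "0 \<le> (\<Prod>i\<in>A. 1 - x i)" "(\<Prod>i\<in>A. 1 - x i) \<le> 1"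
    using insert by (auto intro!: prod_nonneg prod_le_1)
  have "1 - (\<Sum>i\<in>A. x i) \<le> (\<Prod>i\<in>A. 1 - x i)" using insert by auto
  moreover have "x a * (\<Prod>i\<in>A. 1 - x i) \<le> x a" using p insert.prems[of a] by (intro mult_left_le) auto
  ultimately show ?case using insert by (simp add: left_diff_distrib)
qed simp

text \<open>The symmetric difference of a cube with side s and its translate is measured through
  their intersection, a box with sides max(0, s - |z_i|). The loss of volume is at most s^(d-1)
  times the sum of the |z_i|: this is the boundary layer.\<close>

lemma dyadic_cube_translation:
  fixes z :: "real ^ 'n"
  shows "(\<integral>\<^sup>+y. ennreal \<bar>indicator (dyadic_cube N \<nu>) (y + z) - indicator (dyadic_cube N \<nu>) y\<bar> \<partial>lborel)
    \<le> ennreal (2 * CARD('n) * 2 ^ N / 2 ^ (N * CARD('n)) * norm z)"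
proof -
  let ?Q = "dyadic_cube N \<nu> :: (real ^ 'n) set"
  define s :: real where "s = 1 / 2 ^ N"
  have s: "s > 0" by (simp add: s_def)
  have sd: "s ^ CARD('n) = 1 / 2 ^ (N * CARD('n))" by (simp add: s_def power_one_over power_mult)
  define a :: "'n \<Rightarrow> real" where "a i = of_int (\<nu> $ i) / 2 ^ N" for i
  have Q: "?Q = {y. \<forall>i. y $ i \<in> {a i ..< a i + s}}"
    unfolding dyadic_cube_Ico a_def s_def by (simp add: add_divide_distrib)
  \<comment> \<open>The i-th side of the intersection of the cube with its translate by -z; it is
    empty when |z_i| exceeds the side length.\<close>
  define S where "S i = {max (a i) (a i - z $ i) ..< min (a i + s) (a i + s - z $ i)}" for i
  define l where "l i = max 0 (s - \<bar>z $ i\<bar>)" for i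
  have S: "emeasure lborel (S i) = ennreal (l i)" "0 \<le> l i" for i
  proof -
    show "0 \<le> l i" by (simp add: l_def)
    show "emeasure lborel (S i) = ennreal (l i)"
    proof (cases "\<bar>z $ i\<bar> \<le> s")
      case True
      then show ?thesis unfolding S_def l_def by (subst emeasure_lborel_Ico) (auto simp: max_def min_def abs_if split: if_splits)
    next
      case False
      then have "S i = {}" unfolding S_def by (auto simp: abs_if split: if_splits)
      then show ?thesis using False by (simp add: l_def)
    qed
  qed
  let ?R = "{y :: real ^ 'n. \<forall>i. y $ i \<in> S i}"
  have R: "emeasure lborel ?R = ennreal (\<Prod>i\<in>UNIV. l i)"
    by (rule emeasure_lborel_product[OF _ S]) (simp add: S_def)
  have Rm: "measure lborel ?R = (\<Prod>i\<in>UNIV. l i)" unfolding measure_def R by (simp add: prod_nonneg S)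
  have Rs [measurable]: "?R \<in> sets borel" unfolding S_def by measurable
  have i1: "integrable lborel (\<lambda>y. indicator ?Q y :: real)"
    by (simp add: integrable_indicator_iff emeasure_dyadic_cube)
  have i2: "integrable lborel (\<lambda>y. indicator ?Q (y + z) :: real)" by (rule integrable_shift_vec(1)[OF i1])
  have i3: "integrable lborel (\<lambda>y. indicator ?R y :: real)"
    using R by (simp add: integrable_indicator_iff)
  have eq: "\<bar>indicator ?Q (y + z) - indicator ?Q y\<bar> = (indicator ?Q (y + z) + indicator ?Q y - 2 * indicator ?R y :: real)" for y
  proof -
    have "y \<in> ?R \<longleftrightarrow> y \<in> ?Q \<and> y + z \<in> ?Q" unfolding Q S_def by (force simp: algebra_simps)
    then show ?thesis by (auto simp: indicator_def)
  qed
  have xle: "1 - l i / s \<le> \<bar>z $ i\<bar> / s" "0 \<le> 1 - l i / s" "1 - l i / s \<le> 1" for i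
  proof -
    have "(s - l i) / s \<le> \<bar>z $ i\<bar> / s" using s by (intro divide_right_mono) (auto simp: l_def)
    then show "1 - l i / s \<le> \<bar>z $ i\<bar> / s" using s by (simp add: diff_divide_distrib)
    show "0 \<le> 1 - l i / s" "1 - l i / s \<le> 1" using s by (auto simp: l_def)
  qed
  have "1 - (\<Sum>i\<in>UNIV. 1 - l i / s) \<le> (\<Prod>i\<in>UNIV. 1 - (1 - l i / s))"
    by (rule one_minus_sum_le_prod) (use xle in auto)
  also have "\<dots> = (\<Prod>i\<in>UNIV. l i) / s ^ CARD('n)" by (simp add: prod_dividef)
  finally have "1 - (\<Prod>i\<in>UNIV. l i) / s ^ CARD('n) \<le> (\<Sum>i\<in>UNIV. 1 - l i / s)" by simp
  also have "\<dots> \<le> (\<Sum>i\<in>(UNIV :: 'n set). norm z / s)"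
    using s by (intro sum_mono order.trans[OF xle(1)] divide_right_mono component_le_norm_cart) auto
  finally have le: "s ^ CARD('n) - (\<Prod>i\<in>UNIV. l i) \<le> s ^ CARD('n) * (CARD('n) * norm z / s)"
    using s by (simp add: field_simps)
  have I: "(\<integral>y. \<bar>indicator ?Q (y + z) - indicator ?Q y\<bar> \<partial>lborel) = 2 * (s ^ CARD('n) - (\<Prod>i\<in>UNIV. l i))"
    unfolding eq using i1 i2 i3 integral_shift_vec(1)[of "\<lambda>y. indicator ?Q y :: real" z]
    by (simp add: Rm measure_dyadic_cube sd)
  have "integrable lborel (\<lambda>y. \<bar>indicator ?Q (y + z) - indicator ?Q y :: real\<bar>)"
    using i1 i2 by auto
  then have "(\<integral>\<^sup>+y. ennreal \<bar>indicator ?Q (y + z) - indicator ?Q y\<bar> \<partial>lborel) = ennreal (2 * (s ^ CARD('n) - (\<Prod>i\<in>UNIV. l i)))"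
    by (subst nn_integral_eq_integral) (simp_all only: I, simp)
  also have "\<dots> \<le> ennreal (2 * (s ^ CARD('n) * (CARD('n) * norm z / s)))"
    by (intro ennreal_leI mult_left_mono le) simp
  also have "2 * (s ^ CARD('n) * (CARD('n) * norm z / s)) = 2 * CARD('n) * 2 ^ N / 2 ^ (N * CARD('n)) * norm z"
    unfolding sd by (simp add: s_def)
  finally show ?thesis .
qed

text \<open>Countable additivity over all cubes of one generation, enumerated by
  \<open>to_nat\<close>.\<close>

lemma integral_zero_of_cells:
  fixes f :: "real ^ 'n \<Rightarrow> complex"
  assumes f: "integrable lborel f" and z: "\<And>\<nu>. (LINT y : dyadic_cube M \<nu> | lborel. f y) = 0"
  shows "(\<integral>y. f y \<partial>lborel) = 0"
proof -
  define A where "A i = {y :: real ^ 'n. to_nat (cell M y) = i}" for i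
  have A: "A i = (if i \<in> range (to_nat :: int ^ 'n \<Rightarrow> nat) then dyadic_cube M (from_nat i) else {})" for i
    unfolding A_def dyadic_cube_eq by auto
  have UN: "(\<Union>i. A i) = UNIV" by (auto simp: A_def)
  have "(LINT y:(\<Union>i. A i)|lborel. f y) = (\<Sum>i. (LINT y:(A i)|lborel. f y))"
  proof (rule lebesgue_integral_countable_add)
    show "A i \<in> sets lborel" for i by (auto simp: A)
    show "i \<noteq> j \<Longrightarrow> A i \<inter> A j = {}" for i j by (auto simp: A_def)
    show "set_integrable lborel (\<Union>i. A i) f" unfolding UN using f by (simp add: set_integrable_def)
  qed
  moreover have "(LINT y:(A i)|lborel. f y) = 0" for i
    unfolding A using z by (simp add: set_lebesgue_integral_def)
  ultimately have "(LINT y:UNIV|lborel. f y) = 0" unfolding UN by simp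
  then show ?thesis by (simp add: set_lebesgue_integral_def)
qed

section \<open>Dilated kernels\<close>

text \<open>The dilation that preserves the integral. It is the kernel side of replacing a symbol
  m(xi) by m(2^-k xi), see \<open>inv_fourier_dilate\<close>.\<close>

definition dil :: "nat \<Rightarrow> (real ^ 'n \<Rightarrow> complex) \<Rightarrow> real ^ 'n \<Rightarrow> complex" where
  "dil k K x = 2 ^ (k * CARD('n)) * K (2 ^ k *\<^sub>R x)"

definition conv :: "(real ^ 'n \<Rightarrow> complex) \<Rightarrow> (real ^ 'n \<Rightarrow> complex) \<Rightarrow> real ^ 'n \<Rightarrow> complex" where
  "conv K g x = (\<integral>y. K (x - y) * g y \<partial>lborel)"

lemma dil_0 [simp]: "dil 0 K = K"
  by (simp add: dil_def fun_eq_iff)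

lemma schwartz_dil: "K \<in> schwartz \<Longrightarrow> dil k K \<in> schwartz"
  unfolding dil_def[abs_def] by (intro schwartz_cmult schwartz_dilate) auto

lemma norm_dil: "norm (dil k K x) = 2 ^ (k * CARD('n)) * norm (K (2 ^ k *\<^sub>R x :: real ^ 'n))"
  by (simp add: dil_def norm_mult norm_power)

lemma integrable_dilate:
  fixes f :: "real ^ 'n \<Rightarrow> real"
  assumes "integrable lborel f"
  shows "integrable lborel (\<lambda>x. 2 ^ (k * CARD('n)) * f (2 ^ k *\<^sub>R x))"
  using integrable_affine_vec[of "2 ^ k" f 0] assms by simp

lemma integral_dilate:
  fixes f :: "real ^ 'n \<Rightarrow> real"
  assumes "f \<in> borel_measurable borel"
  shows "(\<integral>x. 2 ^ (k * CARD('n)) * f (2 ^ k *\<^sub>R x) \<partial>lborel) = (\<integral>x. f x \<partial>lborel)"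
  using integral_affine_vec[of "2 ^ k" f 0] assms by (simp add: power_mult)

lemma inv_fourier_dilate:
  fixes m :: "real ^ 'n \<Rightarrow> complex"
  assumes m: "m \<in> borel_measurable borel"
  shows "inv_fourier (\<lambda>\<xi>. m ((1/2) ^ k *\<^sub>R \<xi>)) = dil k (inv_fourier m)"
proof
  fix x :: "real ^ 'n"
  have [measurable]: "m \<in> borel_measurable borel" by fact
  have "fourier (\<lambda>\<xi>. m ((1/2) ^ k *\<^sub>R \<xi>)) (- x)
    = \<bar>2 ^ k :: real\<bar> ^ CARD('n) *\<^sub>R (\<integral>\<xi>. m ((1/2) ^ k *\<^sub>R (0 + 2 ^ k *\<^sub>R \<xi>)) * wave (0 + 2 ^ k *\<^sub>R \<xi>) (- x) \<partial>lborel)"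
    unfolding fourier_eq by (rule integral_affine_vec) simp_all
  also have "\<dots> = 2 ^ (k * CARD('n)) * fourier m (- (2 ^ k *\<^sub>R x))"
    by (simp add: fourier_eq power_one_over wave_def scaleR_conv_of_real[where 'a=complex] power_mult)
  finally show "inv_fourier (\<lambda>\<xi>. m ((1/2) ^ k *\<^sub>R \<xi>)) x = dil k (inv_fourier m) x"
    by (simp add: inv_fourier_eq dil_def)
qed

lemma integral_inv_fourier:
  assumes "m \<in> schwartz"
  shows "(\<integral>x. inv_fourier m x \<partial>lborel) = m 0"
  using fun_cong[OF fourier_inv_fourier[OF assms], of 0] by (simp add: fourier_eq)

section \<open>Estimates for convolutions with dilated kernels\<close>

lemma integrable_conv:
  assumes "K \<in> schwartz" "g \<in> borel_measurable borel" "\<And>y. norm (g y) \<le> A"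
  shows "integrable lborel (\<lambda>y. K (x - y) * g y)"
  using integrable_bounded_mult(1)[OF integrable_shift_vec(3)[OF schwartz_integrable[OF assms(1)]] _ assms(3)] assms(2)
  by simp

lemma norm_conv_dil_le:
  fixes K g :: "real ^ 'n \<Rightarrow> complex"
  assumes K: "K \<in> schwartz" and g: "g \<in> borel_measurable borel" "\<And>y. norm (g y) \<le> A"
  shows "norm (conv (dil k K) g x) \<le> (\<integral>z. norm (K z) \<partial>lborel) * A"
proof -
  have [measurable]: "K \<in> borel_measurable borel" by (rule schwartz_measurable[OF K])
  have i: "integrable lborel (\<lambda>z. norm (dil k K z))"
    by (intro integrable_norm schwartz_integrable schwartz_dil K)
  have "norm (conv (dil k K) g x) \<le> (\<integral>y. norm (dil k K (x - y)) * A \<partial>lborel)"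
    unfolding conv_def
  proof (rule Bochner_Integration.integral_norm_bound_integral[OF integrable_conv[OF schwartz_dil[OF K] g]])
    show "integrable lborel (\<lambda>y. norm (dil k K (x - y)) * A)"
      by (intro integrable_mult_left integrable_shift_vec(3)[OF i])
    show "norm (dil k K (x - y) * g y) \<le> norm (dil k K (x - y)) * A" for y
      unfolding norm_mult by (intro mult_left_mono g) auto
  qed
  also have "\<dots> = (\<integral>z. norm (dil k K z) \<partial>lborel) * A"
    using integral_shift_vec(3)[of "\<lambda>z. norm (dil k K z)" x] i by simp
  also have "(\<integral>z. norm (dil k K z) \<partial>lborel) = (\<integral>z. norm (K z) \<partial>lborel)"
    unfolding norm_dil using integral_dilate[of "\<lambda>z. norm (K z)" k] by simp
  finally show ?thesis .
qed

text \<open>For |t| <= 1 the pointwise Lipschitz bound with decay is integrated; for |t| > 1 the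
  trivial bound by twice the norm of K is already linear in |t|.\<close>

lemma schwartz_L1_modulus:
  fixes K :: "real ^ 'n \<Rightarrow> complex"
  assumes K: "K \<in> schwartz"
  shows "\<exists>C\<ge>0. \<forall>t. (\<integral>z. norm (K (z + t) - K z) \<partial>lborel) \<le> C * norm t"
proof -
  obtain C where C: "C \<ge> 0" "\<And>x y. norm (K x - K y) \<le> C * norm (x - y) * (1 + norm (x - y)) ^ (2 * CARD('n)) / (1 + norm x) ^ (2 * CARD('n))"
    using schwartz_diff_bound[OF K] by blast
  let ?W = "\<integral>(x :: real ^ 'n). weight x \<partial>lborel" and ?N = "\<integral>z. norm (K z) \<partial>lborel"
  have W: "0 \<le> ?W" "0 \<le> ?N" by (auto intro!: integral_nonneg)
  have i: "integrable lborel (\<lambda>z. norm (K z))" "integrable lborel (\<lambda>z. norm (K (z + t)))" for t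
    by (intro integrable_norm schwartz_integrable K schwartz_shift)+
  have id: "integrable lborel (\<lambda>z. norm (K (z + t) - K z))" for t
    by (intro integrable_norm schwartz_integrable K schwartz_diff schwartz_shift)
  have "(\<integral>z. norm (K (z + t) - K z) \<partial>lborel) \<le> (C * 2 ^ (2 * CARD('n)) * ?W + 2 * ?N) * norm t" for t
  proof (cases "norm t \<le> 1")
    case True
    have "(\<integral>z. norm (K (z + t) - K z) \<partial>lborel) \<le> (\<integral>(z :: real ^ 'n). C * norm t * 2 ^ (2 * CARD('n)) * weight z \<partial>lborel)"
    proof (rule integral_mono[OF id])
      show "integrable lborel (\<lambda>z :: real ^ 'n. C * norm t * 2 ^ (2 * CARD('n)) * weight z)"
        by (intro integrable_mult_right integrable_weight)
      fix z
      have "norm (K (z + t) - K z) \<le> C * norm t * (1 + norm t) ^ (2 * CARD('n)) / (1 + norm z) ^ (2 * CARD('n))"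
        using C(2)[of z "z + t"] by (simp add: norm_minus_commute)
      also have "\<dots> \<le> C * norm t * 2 ^ (2 * CARD('n)) / (1 + norm z) ^ (2 * CARD('n))"
        using C(1) True by (intro divide_right_mono mult_left_mono power_mono) auto
      finally show "norm (K (z + t) - K z) \<le> C * norm t * 2 ^ (2 * CARD('n)) * weight z" by (simp add: weight_def)
    qed
    also have "\<dots> = C * 2 ^ (2 * CARD('n)) * ?W * norm t" by simp
    also have "\<dots> \<le> (C * 2 ^ (2 * CARD('n)) * ?W + 2 * ?N) * norm t" using W by (intro mult_right_mono) auto
    finally show ?thesis .
  next
    case False
    have "(\<integral>z. norm (K (z + t) - K z) \<partial>lborel) \<le> (\<integral>z. norm (K (z + t)) + norm (K z) \<partial>lborel)"
      by (intro integral_mono id Bochner_Integration.integrable_add i norm_triangle_ineq4)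
    also have "\<dots> = 2 * ?N" using i integral_shift_vec(1)[of "\<lambda>z. norm (K z)" t] by simp
    also have "\<dots> \<le> 2 * ?N * norm t" using False W mult_left_mono[of 1 "norm t" "2 * ?N"] by simp
    also have "\<dots> \<le> (C * 2 ^ (2 * CARD('n)) * ?W + 2 * ?N) * norm t" using W C by (intro mult_right_mono) auto
    finally show ?thesis .
  qed
  then show ?thesis using W C by (intro exI[of _ "C * 2 ^ (2 * CARD('n)) * ?W + 2 * ?N"]) auto
qed

text \<open>After rescaling, the kernel is shifted by 2^k (x - x'), and the modulus of continuity in
  the mean supplies the factor 2^k. Only boundedness of g is used.\<close>

lemma conv_dil_lipschitz:
  fixes K :: "real ^ 'n \<Rightarrow> complex"
  assumes K: "K \<in> schwartz"
  shows "\<exists>C\<ge>0. \<forall>k g A x x'. g \<in> borel_measurable borel \<longrightarrow> (\<forall>y. norm (g y) \<le> A) \<longrightarrow>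
    norm (conv (dil k K) g x - conv (dil k K) g x') \<le> C * A * 2 ^ k * norm (x - x')"
proof -
  obtain C where C: "C \<ge> 0" "\<And>t. (\<integral>z. norm (K (z + t) - K z) \<partial>lborel) \<le> C * norm t"
    using schwartz_L1_modulus[OF K] by blast
  have [measurable]: "K \<in> borel_measurable borel" by (rule schwartz_measurable[OF K])
  have "norm (conv (dil k K) g x - conv (dil k K) g x') \<le> C * A * 2 ^ k * norm (x - x')"
    if g: "g \<in> borel_measurable borel" "\<And>y. norm (g y) \<le> A" for k g A x x'
  proof -
    let ?K = "dil k K"
    have A: "0 \<le> A" using g(2) norm_ge_zero order.trans by blast
    have S: "?K \<in> schwartz" by (rule schwartz_dil[OF K])
    have [measurable]: "?K \<in> borel_measurable borel" by (rule schwartz_measurable[OF S])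
    have i: "integrable lborel (\<lambda>z. norm (?K (z + (x - x')) - ?K z))"
      by (intro integrable_norm schwartz_integrable schwartz_diff schwartz_shift S)
    have "conv ?K g x - conv ?K g x' = (\<integral>y. (?K (x - y) - ?K (x' - y)) * g y \<partial>lborel)"
      unfolding conv_def left_diff_distrib
      by (rule Bochner_Integration.integral_diff[symmetric]; rule integrable_conv[OF S g])
    also have "norm \<dots> \<le> (\<integral>y. norm (?K (x - y) - ?K (x' - y)) * A \<partial>lborel)"
    proof (rule Bochner_Integration.integral_norm_bound_integral)
      show "integrable lborel (\<lambda>y. (?K (x - y) - ?K (x' - y)) * g y)"
        unfolding left_diff_distrib by (intro Bochner_Integration.integrable_diff integrable_conv[OF S g])
      show "integrable lborel (\<lambda>y. norm (?K (x - y) - ?K (x' - y)) * A)"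
        using integrable_shift_vec(3)[OF i, of x'] by (intro integrable_mult_left) (simp add: algebra_simps)
      show "norm ((?K (x - y) - ?K (x' - y)) * g y) \<le> norm (?K (x - y) - ?K (x' - y)) * A" for y
        unfolding norm_mult by (intro mult_left_mono g) auto
    qed
    also have "\<dots> = (\<integral>y. norm (?K (x' - y + (x - x')) - ?K (x' - y)) \<partial>lborel) * A"
      by (simp add: algebra_simps)
    also have "(\<integral>y. norm (?K (x' - y + (x - x')) - ?K (x' - y)) \<partial>lborel) = (\<integral>z. norm (?K (z + (x - x')) - ?K z) \<partial>lborel)"
      using i by (intro integral_shift_vec(3)[of "\<lambda>z. norm (?K (z + (x - x')) - ?K z)"]) simp
    also have "\<dots> = (\<integral>z. 2 ^ (k * CARD('n)) * norm (K (2 ^ k *\<^sub>R z + 2 ^ k *\<^sub>R (x - x')) - K (2 ^ k *\<^sub>R z)) \<partial>lborel)"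
      by (simp add: dil_def scaleR_add_right norm_mult norm_power flip: right_diff_distrib)
    also have "\<dots> = (\<integral>z. norm (K (z + 2 ^ k *\<^sub>R (x - x')) - K z) \<partial>lborel)"
      by (rule integral_dilate) measurable
    also have "\<dots> \<le> C * norm (2 ^ k *\<^sub>R (x - x'))" by (rule C)
    finally show ?thesis using A by (simp add: mult_ac mult_right_mono)
  qed
  then show ?thesis using C(1) by blast
qed


text \<open>The radius d is the bound for the diameter of a cube of generation M after dilation by
  2^k with k <= M; in this range the Peetre factor is a constant.\<close>

lemma schwartz_local_lipschitz:
  fixes K :: "real ^ 'n \<Rightarrow> complex"
  assumes K: "K \<in> schwartz"
  shows "\<exists>C\<ge>0. \<forall>x y. norm (x - y) \<le> CARD('n) \<longrightarrow> norm (K x - K y) \<le> C * norm (x - y) * weight x"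
proof -
  obtain C where C: "C \<ge> 0" "\<And>x y. norm (K x - K y) \<le> C * norm (x - y) * (1 + norm (x - y)) ^ (2 * CARD('n)) / (1 + norm x) ^ (2 * CARD('n))"
    using schwartz_diff_bound[OF K] by blast
  let ?D = "(1 + real CARD('n)) ^ (2 * CARD('n))"
  have "norm (K x - K y) \<le> (C * ?D) * norm (x - y) * weight x" if "norm (x - y) \<le> CARD('n)" for x y
  proof -
    have "norm (K x - K y) \<le> C * norm (x - y) * (1 + norm (x - y)) ^ (2 * CARD('n)) / (1 + norm x) ^ (2 * CARD('n))"
      by (rule C)
    also have "\<dots> \<le> C * norm (x - y) * ?D / (1 + norm x) ^ (2 * CARD('n))"
      using C(1) that by (intro divide_right_mono mult_left_mono power_mono) auto
    finally show ?thesis by (simp add: weight_def mult_ac)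
  qed
  then show ?thesis using C(1) by (intro exI[of _ "C * ?D"]) auto
qed

text \<open>Since h integrates to zero over each cube, the kernel may be replaced on every cube by
  its difference to the value at the corner. The kernel varies at scale 2^-k and the cubes have side
  2^-M, whence the gain 2^(k-M).\<close>

lemma conv_mean_zero_bound:
  fixes K :: "real ^ 'n \<Rightarrow> complex"
  assumes K: "K \<in> schwartz"
  shows "\<exists>C\<ge>0. \<forall>k M h A x. k \<le> M \<longrightarrow> h \<in> borel_measurable borel \<longrightarrow> (\<forall>y. norm (h y) \<le> A) \<longrightarrow>
    (\<forall>\<nu>. (LINT y : dyadic_cube M \<nu> | lborel. h y) = 0) \<longrightarrow> norm (conv (dil k K) h x) \<le> C * A * 2 ^ k / 2 ^ M"
proof -
  obtain C where C: "C \<ge> 0" "\<And>x y. norm (x - y) \<le> CARD('n) \<Longrightarrow> norm (K x - K y) \<le> C * norm (x - y) * weight x"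
    using schwartz_local_lipschitz[OF K] by blast
  let ?W = "\<integral>(x :: real ^ 'n). weight x \<partial>lborel"
  have W: "0 \<le> ?W" by (auto intro!: integral_nonneg)
  have "norm (conv (dil k K) h x) \<le> (C * CARD('n) * ?W) * A * 2 ^ k / 2 ^ M"
    if kM: "k \<le> M" and h: "h \<in> borel_measurable borel" "\<And>y. norm (h y) \<le> A"
      and z: "\<And>\<nu>. (LINT y : dyadic_cube M \<nu> | lborel. h y) = 0" for k M h A x
  proof -
    let ?K = "dil k K" and ?c = "\<lambda>y. corner M (cell M y)"
    have A: "0 \<le> A" using h(2) norm_ge_zero order.trans by blast
    have S: "?K \<in> schwartz" by (rule schwartz_dil[OF K])
    have [measurable]: "h \<in> borel_measurable borel" "?K \<in> borel_measurable borel"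
      by (fact, rule schwartz_measurable[OF S])
    have cm: "(\<lambda>y. ?K (x - ?c y)) \<in> borel_measurable borel"
      by (rule cell_constant_measurable[of M]) simp
    have d: "norm (?K (x - y) - ?K (x - ?c y)) \<le> 2 ^ (k * CARD('n)) * (C * (2 ^ k * (CARD('n) / 2 ^ M)) * weight (2 ^ k *\<^sub>R (x - y)))" for y
    proof -
      let ?u = "2 ^ k *\<^sub>R (x - y)" and ?v = "2 ^ k *\<^sub>R (x - ?c y)"
      have "?u - ?v = 2 ^ k *\<^sub>R (?c y - y)" by (simp add: algebra_simps)
      then have "norm (?u - ?v) = 2 ^ k * norm (?c y - y)" by simp
      also have "\<dots> \<le> 2 ^ k * (CARD('n) / 2 ^ M)"
        by (intro mult_left_mono norm_diff_same_cell) simp_all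
      finally have n: "norm (?u - ?v) \<le> 2 ^ k * (CARD('n) / 2 ^ M)" .
      have "2 ^ k * (CARD('n) / 2 ^ M) \<le> real CARD('n)"
        using kM power_increasing[of k M "2::real"] by (simp add: divide_le_eq mult.commute)
      with n have "norm (K ?u - K ?v) \<le> C * norm (?u - ?v) * weight ?u" by (intro C) linarith
      also have "\<dots> \<le> C * (2 ^ k * (CARD('n) / 2 ^ M)) * weight ?u"
        by (intro mult_right_mono mult_left_mono n C) auto
      finally have b: "norm (K ?u - K ?v) \<le> C * (2 ^ k * (CARD('n) / 2 ^ M)) * weight ?u" .
      have "norm (?K (x - y) - ?K (x - ?c y)) = 2 ^ (k * CARD('n)) * norm (K ?u - K ?v)"
        by (simp add: dil_def norm_mult norm_power flip: right_diff_distrib)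
      also have "\<dots> \<le> 2 ^ (k * CARD('n)) * (C * (2 ^ k * (CARD('n) / 2 ^ M)) * weight ?u)"
        by (intro mult_left_mono b) simp
      finally show ?thesis .
    qed
    have wi: "integrable lborel (\<lambda>y. 2 ^ (k * CARD('n)) * weight (2 ^ k *\<^sub>R (x - y)))"
      by (rule integrable_shift_vec(3)[OF integrable_dilate[OF integrable_weight]])
    have Di: "integrable lborel (\<lambda>y. ?K (x - y) - ?K (x - ?c y))"
    proof (rule Bochner_Integration.integrable_bound)
      show "integrable lborel (\<lambda>y. (C * (2 ^ k * (CARD('n) / 2 ^ M))) * (2 ^ (k * CARD('n)) * weight (2 ^ k *\<^sub>R (x - y))))"
        by (intro integrable_mult_right wi)
      show "(\<lambda>y. ?K (x - y) - ?K (x - ?c y)) \<in> borel_measurable lborel" using cm by simp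
      show "AE y in lborel. norm (?K (x - y) - ?K (x - ?c y)) \<le> norm ((C * (2 ^ k * (CARD('n) / 2 ^ M))) * (2 ^ (k * CARD('n)) * weight (2 ^ k *\<^sub>R (x - y))))"
        using d C(1) by (intro AE_I2 order.trans[OF d]) (simp add: mult_ac)
    qed
    have i1: "integrable lborel (\<lambda>y. ?K (x - y))" by (intro schwartz_integrable schwartz_reflect S)
    have ci: "integrable lborel (\<lambda>y. ?K (x - ?c y))"
      using Bochner_Integration.integrable_diff[OF i1 Di] by simp
    have chi: "integrable lborel (\<lambda>y. ?K (x - ?c y) * h y)" by (rule integrable_bounded_mult(1)[OF ci _ h(2)]) simp
    have "(\<integral>y. ?K (x - ?c y) * h y \<partial>lborel) = 0"
    proof (rule integral_zero_of_cells[OF chi])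
      fix \<nu>
      have "(LINT y : dyadic_cube M \<nu> | lborel. ?K (x - ?c y) * h y)
        = (LINT y : dyadic_cube M \<nu> | lborel. ?K (x - corner M \<nu>) * h y)"
        by (rule set_lebesgue_integral_cong) (auto simp: mem_dyadic_cube)
      then show "(LINT y : dyadic_cube M \<nu> | lborel. ?K (x - ?c y) * h y) = 0" using z by simp
    qed
    then have "conv ?K h x = (\<integral>y. (?K (x - y) - ?K (x - ?c y)) * h y \<partial>lborel)"
      unfolding conv_def left_diff_distrib
      by (subst Bochner_Integration.integral_diff[OF integrable_conv[OF S h] chi]) simp
    also have "norm \<dots> \<le> (\<integral>y. (C * (2 ^ k * (CARD('n) / 2 ^ M)) * A) * (2 ^ (k * CARD('n)) * weight (2 ^ k *\<^sub>R (x - y))) \<partial>lborel)"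
    proof (rule Bochner_Integration.integral_norm_bound_integral)
      show "integrable lborel (\<lambda>y. (?K (x - y) - ?K (x - ?c y)) * h y)" by (rule integrable_bounded_mult(1)[OF Di _ h(2)]) simp
      show "integrable lborel (\<lambda>y. (C * (2 ^ k * (CARD('n) / 2 ^ M)) * A) * (2 ^ (k * CARD('n)) * weight (2 ^ k *\<^sub>R (x - y))))"
        by (intro integrable_mult_right wi)
      fix y
      have "norm ((?K (x - y) - ?K (x - ?c y)) * h y)
        \<le> (2 ^ (k * CARD('n)) * (C * (2 ^ k * (CARD('n) / 2 ^ M)) * weight (2 ^ k *\<^sub>R (x - y)))) * A"
        unfolding norm_mult using C(1) by (intro mult_mono d h) auto
      then show "norm ((?K (x - y) - ?K (x - ?c y)) * h y)
        \<le> (C * (2 ^ k * (CARD('n) / 2 ^ M)) * A) * (2 ^ (k * CARD('n)) * weight (2 ^ k *\<^sub>R (x - y)))"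
        by (simp add: mult_ac)
    qed
    also have "\<dots> = (C * (2 ^ k * (CARD('n) / 2 ^ M)) * A) * ?W"
      unfolding integral_mult_right_zero
      using integral_shift_vec(3)[of "\<lambda>z :: real ^ 'n. 2 ^ (k * CARD('n)) * weight (2 ^ k *\<^sub>R z)" x] integral_dilate[OF weight_measurable, where 'n='n, of k]
      by simp
    finally show ?thesis by (simp add: mult_ac)
  qed
  then show ?thesis using C(1) W by (intro exI[of _ "C * CARD('n) * ?W"]) auto
qed

text \<open>Because K has mean zero, h(y) may be replaced by h(y) - h(x). This vanishes within
  distance delta of x, and on the rest p spare powers of kernel decay give the factor (1 + 2^k
  delta)^-p.\<close>

lemma conv_jump_bound:
  fixes K :: "real ^ 'n \<Rightarrow> complex"
  assumes K: "K \<in> schwartz" and K0: "(\<integral>z. K z \<partial>lborel) = 0"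
  shows "\<exists>C\<ge>0. \<forall>k L h H A x \<delta>. L \<le> k \<longrightarrow> h \<in> borel_measurable borel \<longrightarrow> (\<forall>y. norm (h y) \<le> H) \<longrightarrow>
    (\<forall>y. norm (h y - h x) \<le> A * (1 + 2 ^ L * norm (x - y))) \<longrightarrow> 0 \<le> \<delta> \<longrightarrow>
    (\<forall>y. norm (x - y) < \<delta> \<longrightarrow> h y = h x) \<longrightarrow> norm (conv (dil k K) h x) \<le> C * A / (1 + 2 ^ k * \<delta>) ^ p"
proof -
  \<comment> \<open>The exponent splits into 2d powers for \<open>weight\<close>, p for the gain and
    one for the linear growth allowed to h(y) - h(x), which is harmless as L <= k.\<close>
  obtain C where C: "C \<ge> 0" "\<And>x. norm (K x) \<le> C / (1 + norm x) ^ (2 * CARD('n) + p + 1)"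
    using rapidD[OF schwartz_rapid[OF K]] by blast
  let ?W = "\<integral>(x :: real ^ 'n). weight x \<partial>lborel"
  have W: "0 \<le> ?W" by (auto intro!: integral_nonneg)
  have "norm (conv (dil k K) h x) \<le> (C * ?W) * A / (1 + 2 ^ k * \<delta>) ^ p"
    if Lk: "L \<le> k" and h: "h \<in> borel_measurable borel" "\<And>y. norm (h y) \<le> H"
      and j: "\<And>y. norm (h y - h x) \<le> A * (1 + 2 ^ L * norm (x - y))" and \<delta>: "0 \<le> \<delta>"
      and loc: "\<And>y. norm (x - y) < \<delta> \<Longrightarrow> h y = h x" for k L h H A x \<delta>
  proof -
    let ?K = "dil k K"
    have A: "0 \<le> A" using j[of x] by simp
    have S: "?K \<in> schwartz" by (rule schwartz_dil[OF K])
    have [measurable]: "h \<in> borel_measurable borel" "?K \<in> borel_measurable borel"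
      by (fact, rule schwartz_measurable[OF S])
    have "(\<integral>z. ?K z \<partial>lborel) = 0"
      using integral_affine_vec[of "2 ^ k" K 0] schwartz_measurable[OF K] K0 by (simp add: dil_def[abs_def])
    then have z: "(\<integral>y. ?K (x - y) \<partial>lborel) = 0" using integral_shift_vec(3)[of ?K x] by simp
    have i1: "integrable lborel (\<lambda>y. ?K (x - y))" by (intro schwartz_integrable schwartz_reflect S)
    have i2: "integrable lborel (\<lambda>y. ?K (x - y) * (h y - h x))"
      unfolding right_diff_distrib
      by (intro Bochner_Integration.integrable_diff integrable_conv[OF S h] integrable_mult_left i1)
    have wi: "integrable lborel (\<lambda>y. 2 ^ (k * CARD('n)) * weight (2 ^ k *\<^sub>R (x - y)))"
      by (rule integrable_shift_vec(3)[OF integrable_dilate[OF integrable_weight]])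
    have "conv ?K h x = (\<integral>y. ?K (x - y) * (h y - h x) \<partial>lborel)"
      unfolding conv_def right_diff_distrib using z
      by (subst Bochner_Integration.integral_diff[OF integrable_conv[OF S h] integrable_mult_left[OF i1]]) simp
    also have "norm \<dots> \<le> (\<integral>y. (C * A / (1 + 2 ^ k * \<delta>) ^ p) * (2 ^ (k * CARD('n)) * weight (2 ^ k *\<^sub>R (x - y))) \<partial>lborel)"
    proof (rule Bochner_Integration.integral_norm_bound_integral[OF i2])
      show "integrable lborel (\<lambda>y. (C * A / (1 + 2 ^ k * \<delta>) ^ p) * (2 ^ (k * CARD('n)) * weight (2 ^ k *\<^sub>R (x - y))))"
        by (intro integrable_mult_right wi)
      fix y
      let ?s = "2 ^ k * norm (x - y)"
      have pos: "0 < 1 + 2 ^ k * \<delta>" using \<delta> by (simp add: add_pos_nonneg)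
      show "norm (?K (x - y) * (h y - h x)) \<le> (C * A / (1 + 2 ^ k * \<delta>) ^ p) * (2 ^ (k * CARD('n)) * weight (2 ^ k *\<^sub>R (x - y)))"
      proof (cases "norm (x - y) < \<delta>")
        case True
        then show ?thesis using loc C(1) A \<delta> by simp
      next
        case False
        have s: "0 < 1 + ?s" by (simp add: add_pos_nonneg)
        have "norm (h y - h x) \<le> A * (1 + ?s)"
          using Lk by (intro order.trans[OF j] mult_left_mono A add_left_mono mult_right_mono power_increasing) auto
        then have "norm (?K (x - y) * (h y - h x)) \<le> 2 ^ (k * CARD('n)) * (C / (1 + ?s) ^ (2 * CARD('n) + p + 1)) * (A * (1 + ?s))"
          unfolding norm_mult norm_dil using C(2)[of "2 ^ k *\<^sub>R (x - y)"]
          by (intro mult_mono) (use C(1) in auto)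
        also have "\<dots> = 2 ^ (k * CARD('n)) * (C * A * weight (2 ^ k *\<^sub>R (x - y))) / (1 + ?s) ^ p"
          using s by (simp add: weight_def power_add)
        also have "\<dots> \<le> 2 ^ (k * CARD('n)) * (C * A * weight (2 ^ k *\<^sub>R (x - y))) / (1 + 2 ^ k * \<delta>) ^ p"
          using False pos s C(1) A \<delta> by (intro divide_left_mono power_mono mult_pos_pos mult_nonneg_nonneg) auto
        finally show ?thesis by (simp add: mult_ac)
      qed
    qed
    also have "\<dots> = (C * A / (1 + 2 ^ k * \<delta>) ^ p) * ?W"
      unfolding integral_mult_right_zero
      using integral_shift_vec(3)[of "\<lambda>z :: real ^ 'n. 2 ^ (k * CARD('n)) * weight (2 ^ k *\<^sub>R z)" x] integral_dilate[OF weight_measurable, where 'n='n, of k]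
      by simp
    finally show ?thesis by (simp add: mult_ac)
  qed
  then show ?thesis using C(1) W by (intro exI[of _ "C * ?W"] conjI mult_nonneg_nonneg) blast+
qed

text \<open>Fubini transfers the convolution to the indicator of the cube. The mean zero of the
  kernel turns that into differences of translated indicators, whose L^1 norm is linear in the
  shift; the first moment of the dilated kernel then yields 2^-j.\<close>

lemma cube_average_conv_bound:
  fixes K :: "real ^ 'n \<Rightarrow> complex"
  assumes K: "K \<in> schwartz" and K0: "(\<integral>z. K z \<partial>lborel) = 0"
  shows "\<exists>C\<ge>0. \<forall>j N \<nu> G A. G \<in> borel_measurable borel \<longrightarrow> (\<forall>y. norm (G y) \<le> A) \<longrightarrow>
    norm (LINT x : dyadic_cube N \<nu> | lborel. conv (dil j K) G x) \<le> C * A * (2 ^ N / 2 ^ j) / 2 ^ (N * CARD('n))"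
proof -
  let ?V = "\<integral>z. norm (K z) * norm z \<partial>lborel"
  have Vi: "integrable lborel (\<lambda>z. norm (K z) * norm z)"
  proof -
    obtain C where C: "C \<ge> 0" "\<And>x. norm (K x) \<le> C / (1 + norm x) ^ (2 * CARD('n) + 1)"
      using rapidD[OF schwartz_rapid[OF K]] by blast
    show ?thesis
    proof (rule Bochner_Integration.integrable_bound)
      show "integrable lborel (\<lambda>x :: real ^ 'n. C * weight x)" by (intro integrable_mult_right integrable_weight)
      show "(\<lambda>z. norm (K z) * norm z) \<in> borel_measurable lborel" using schwartz_measurable[OF K] by simp
      have "norm (K z) * norm z \<le> C * weight z" for z
      proof -
        have "norm (K z) * norm z \<le> C / (1 + norm z) ^ (2 * CARD('n) + 1) * (1 + norm z)"
          by (intro mult_mono C) (use C(1) in auto)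
        then show ?thesis by (simp add: weight_def)
      qed
      then show "AE z in lborel. norm (norm (K z) * norm z) \<le> norm (C * weight z)" using C(1) by simp
    qed
  qed
  have V: "0 \<le> ?V" by (auto intro!: integral_nonneg)
  have "norm (LINT x : dyadic_cube N \<nu> | lborel. conv (dil j K) G x) \<le> (2 * CARD('n) * ?V) * A * (2 ^ N / 2 ^ j) / 2 ^ (N * CARD('n))"
    if G: "G \<in> borel_measurable borel" "\<And>y. norm (G y) \<le> A" for j N \<nu> G A
  proof -
    let ?K = "dil j K" and ?Q = "dyadic_cube N \<nu> :: (real ^ 'n) set"
    let ?I = "\<lambda>x. indicator ?Q x :: complex"
    have A: "0 \<le> A" using G(2) norm_ge_zero order.trans by blast
    have S: "?K \<in> schwartz" by (rule schwartz_dil[OF K])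
    have Ki: "integrable lborel ?K" by (rule schwartz_integrable[OF S])
    have [measurable]: "G \<in> borel_measurable borel" "?K \<in> borel_measurable borel"
      by (fact, rule schwartz_measurable[OF S])
    have Kz: "(\<integral>z. ?K z \<partial>lborel) = 0"
      using integral_affine_vec[of "2 ^ j" K 0] schwartz_measurable[OF K] K0 by (simp add: dil_def[abs_def])
    have "integrable lborel (\<lambda>x. complex_of_real (indicator ?Q x))"
      by (intro integrable_of_real) (simp add: integrable_indicator_iff emeasure_dyadic_cube)
    moreover have "(\<lambda>x. complex_of_real (indicator ?Q x)) = ?I" by (auto simp: indicator_def)
    ultimately have Ii: "integrable lborel ?I" by simp
    let ?F = "\<lambda>y. \<integral>x. ?I x * ?K (x - y) \<partial>lborel"
    have F: "?F y = (\<integral>z. (?I (y + z) - ?I y) * ?K z \<partial>lborel)" for y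
    proof -
      have "?F y = (\<integral>z. ?I (z + y) * ?K ((z + y) - y) \<partial>lborel)"
        by (rule integral_shift_vec(1)[symmetric]) measurable
      also have "\<dots> = (\<integral>z. ?I (y + z) * ?K z - ?I y * ?K z \<partial>lborel)"
      proof (subst Bochner_Integration.integral_diff)
        show "integrable lborel (\<lambda>z. ?I (y + z) * ?K z)"
          by (rule integrable_bounded_mult(2)[OF Ki, where A=1]) (auto simp: indicator_def)
        show "integrable lborel (\<lambda>z. ?I y * ?K z)" using Ki by simp
      qed (simp add: Kz add.commute)
      finally show ?thesis by (simp add: left_diff_distrib)
    qed
    have Fb: "ennreal (norm (?F y)) \<le> (\<integral>\<^sup>+z. ennreal (norm (?K z)) * ennreal \<bar>indicator ?Q (y + z) - indicator ?Q y\<bar> \<partial>lborel)" for y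
    proof -
      have "integrable lborel (\<lambda>z. (?I (y + z) - ?I y) * ?K z)"
        by (rule integrable_bounded_mult(2)[OF Ki, where A=1]) (auto simp: indicator_def)
      then have "ennreal (norm (?F y)) \<le> (\<integral>\<^sup>+z. ennreal (norm ((?I (y + z) - ?I y) * ?K z)) \<partial>lborel)"
        unfolding F by (rule integral_norm_bound_ennreal)
      also have "\<dots> = (\<integral>\<^sup>+z. ennreal (norm (?K z)) * ennreal \<bar>indicator ?Q (y + z) - indicator ?Q y\<bar> \<partial>lborel)"
        by (rule nn_integral_cong) (auto simp: norm_mult indicator_def)
      finally show ?thesis .
    qed
    have "(\<integral>\<^sup>+y. ennreal (norm (?F y)) \<partial>lborel)
      \<le> (\<integral>\<^sup>+y. (\<integral>\<^sup>+z. ennreal (norm (?K z)) * ennreal \<bar>indicator ?Q (y + z) - indicator ?Q y\<bar> \<partial>lborel) \<partial>lborel)"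
      by (rule nn_integral_mono) (rule Fb)
    also have "\<dots> = (\<integral>\<^sup>+z. (\<integral>\<^sup>+y. ennreal (norm (?K z)) * ennreal \<bar>indicator ?Q (y + z) - indicator ?Q y\<bar> \<partial>lborel) \<partial>lborel)"
      by (rule lborel_pair.Fubini') measurable
    also have "\<dots> = (\<integral>\<^sup>+z. ennreal (norm (?K z)) * (\<integral>\<^sup>+y. ennreal \<bar>indicator ?Q (y + z) - indicator ?Q y\<bar> \<partial>lborel) \<partial>lborel)"
      by (rule nn_integral_cong, rule nn_integral_cmult) measurable
    also have "\<dots> \<le> (\<integral>\<^sup>+z. ennreal (norm (?K z)) * ennreal (2 * CARD('n) * 2 ^ N / 2 ^ (N * CARD('n)) * norm z) \<partial>lborel)"
      by (intro nn_integral_mono mult_left_mono dyadic_cube_translation) simp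
    also have "\<dots> = (\<integral>\<^sup>+z. ennreal ((2 * CARD('n) * 2 ^ N / 2 ^ (N * CARD('n)) / 2 ^ j) * (2 ^ (j * CARD('n)) * (norm (K (2 ^ j *\<^sub>R z)) * norm (2 ^ j *\<^sub>R z)))) \<partial>lborel)"
      by (intro nn_integral_cong) (simp add: norm_dil mult_ac flip: ennreal_mult)
    also have "\<dots> = ennreal ((2 * CARD('n) * 2 ^ N / 2 ^ (N * CARD('n)) / 2 ^ j) * ?V)"
      using integral_dilate[of "\<lambda>z. norm (K z) * norm z" j] Vi integrable_dilate[OF Vi, of j]
      by (subst nn_integral_eq_integral) (auto simp del: norm_scaleR)
    finally have Fint: "(\<integral>\<^sup>+y. ennreal (norm (?F y)) \<partial>lborel) \<le> ennreal ((2 * CARD('n) * 2 ^ N / 2 ^ (N * CARD('n)) / 2 ^ j) * ?V)" .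
    have Fm: "?F \<in> borel_measurable borel" by measurable
    have Fi: "integrable lborel ?F"
      using Fm Fint by (auto simp: integrable_iff_bounded intro: le_less_trans)
    have GFi: "integrable lborel (\<lambda>y. G y * ?F y)" by (rule integrable_bounded_mult(2)[OF Fi _ G(2)]) simp
    have "(LINT x : ?Q | lborel. conv ?K G x) = (\<integral>x. ?I x * (\<integral>y. ?K (x - y) * G y \<partial>lborel) \<partial>lborel)"
      unfolding set_lebesgue_integral_def conv_def by (intro Bochner_Integration.integral_cong) (auto simp: indicator_def)
    also have "\<dots> = (\<integral>y. G y * ?F y \<partial>lborel)" by (rule fubini_convolution[OF Ii Ki G])
    finally have eq: "(LINT x : ?Q | lborel. conv ?K G x) = (\<integral>y. G y * ?F y \<partial>lborel)" .
    have "ennreal (norm (LINT x : ?Q | lborel. conv ?K G x)) \<le> (\<integral>\<^sup>+y. ennreal (norm (G y * ?F y)) \<partial>lborel)"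
      unfolding eq by (rule integral_norm_bound_ennreal[OF GFi])
    also have "\<dots> \<le> (\<integral>\<^sup>+y. ennreal A * ennreal (norm (?F y)) \<partial>lborel)"
      by (intro nn_integral_mono) (auto simp: norm_mult A G mult_right_mono simp flip: ennreal_mult)
    also have "\<dots> = ennreal A * (\<integral>\<^sup>+y. ennreal (norm (?F y)) \<partial>lborel)"
      using Fm by (intro nn_integral_cmult) measurable
    also have "\<dots> \<le> ennreal A * ennreal ((2 * CARD('n) * 2 ^ N / 2 ^ (N * CARD('n)) / 2 ^ j) * ?V)"
      by (intro mult_left_mono Fint) simp
    also have "\<dots> = ennreal ((2 * CARD('n) * ?V) * A * (2 ^ N / 2 ^ j) / 2 ^ (N * CARD('n)))"
      using A V by (simp add: mult_ac flip: ennreal_mult)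
    finally show ?thesis using A V by (subst (asm) ennreal_le_iff) auto
  qed
  then show ?thesis using V by (intro exI[of _ "2 * CARD('n) * ?V"]) auto
qed

section \<open>The quasi-norm of \<open>F\<^sup>0\<^bsub>\<infinity>,r\<^esub>\<close>\<close>

lemma ennreal_powr_le:
  assumes "t \<le> ennreal c" "0 \<le> c" "0 \<le> p"
  shows "ennreal_powr t p \<le> ennreal (c powr p)"
proof -
  have "t \<noteq> \<infinity>" using assms(1) by (auto simp: top_unique)
  moreover have "enn2real t \<le> c" using assms(1,2) by (metis enn2real_ennreal enn2real_mono ennreal_less_top)
  ultimately show ?thesis
    using assms by (auto simp: ennreal_powr_def intro!: ennreal_leI powr_mono2)
qed

lemma ennreal_powr_one: "ennreal_powr t 1 = t"
  by (cases t) (auto simp: ennreal_powr_def)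

text \<open>The distance from 2^L s to the nearest integer, so that
  \<open>lattice_dist L s / 2 ^ L\<close> is the distance from s to the endpoints of the dyadic
  intervals of generation L.\<close>

definition lattice_dist :: "nat \<Rightarrow> real \<Rightarrow> real" where
  "lattice_dist L s = min (frac (2 ^ L * s)) (1 - frac (2 ^ L * s))"

lemma lattice_dist_nonneg [simp]: "0 \<le> lattice_dist L s"
  using frac_lt_1[of "2 ^ L * s"] by (simp add: lattice_dist_def)

lemma lattice_dist_measurable [measurable]: "lattice_dist L \<in> borel_measurable borel"
  unfolding lattice_dist_def frac_def by measurable

lemma cell_eq_if_near:
  fixes x y :: "real ^ 'n"
  assumes "\<And>i. \<bar>x $ i - y $ i\<bar> < lattice_dist L (x $ i) / 2 ^ L"
  shows "cell L y = cell L x"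
proof -
  have "\<lfloor>2 ^ L * y $ i\<rfloor> = \<lfloor>2 ^ L * x $ i\<rfloor>" for i
  proof -
    have "2 ^ L * \<bar>x $ i - y $ i\<bar> < lattice_dist L (x $ i)"
      using assms[of i] by (simp add: field_simps)
    then have "\<bar>2 ^ L * x $ i - 2 ^ L * y $ i\<bar> < lattice_dist L (x $ i)"
      by (simp add: abs_mult flip: right_diff_distrib)
    then show ?thesis unfolding lattice_dist_def frac_def by (simp add: floor_eq_iff) linarith
  qed
  then show ?thesis by (simp add: cell_def)
qed

section \<open>Integrals over boundary layers of dyadic cells\<close>

lemma nn_integral_inverse_square_le:
  assumes "0 < c" "0 \<le> l"
  shows "(\<integral>\<^sup>+s. ennreal (1 / (1 + c * (s - b))\<^sup>2) * indicator {b..b + l} s \<partial>lborel) \<le> ennreal (1 / c)"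
    and "(\<integral>\<^sup>+s. ennreal (1 / (1 + c * (b + l - s))\<^sup>2) * indicator {b..b + l} s \<partial>lborel) \<le> ennreal (1 / c)"
proof -
  have p: "0 < 1 + c * (s - b)" if "b \<le> s" for s using assms that by (simp add: add_pos_nonneg)
  have q: "0 < 1 + c * (b + l - s)" if "s \<le> b + l" for s using assms that by (simp add: add_pos_nonneg)
  have "(\<integral>\<^sup>+s. ennreal (1 / (1 + c * (s - b))\<^sup>2) * indicator {b..b + l} s \<partial>lborel)
      = ennreal (- (1 / c) / (1 + c * (b + l - b)) - (- (1 / c) / (1 + c * (b - b))))"
  proof (rule nn_integral_FTC_Icc)
    fix s assume "s \<in> {b..b + l}"
    then have s: "b \<le> s" "s \<le> b + l" by auto
    show "((\<lambda>s. - (1 / c) / (1 + c * (s - b))) has_real_derivative 1 / (1 + c * (s - b))\<^sup>2) (at s)"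
      using p[OF s(1)] assms by (auto intro!: derivative_eq_intros simp: power2_eq_square)
  qed (use assms in auto)
  also have "\<dots> \<le> ennreal (1 / c)" using assms by (intro ennreal_leI) simp
  finally show "(\<integral>\<^sup>+s. ennreal (1 / (1 + c * (s - b))\<^sup>2) * indicator {b..b + l} s \<partial>lborel) \<le> ennreal (1 / c)" .
  have "(\<integral>\<^sup>+s. ennreal (1 / (1 + c * (b + l - s))\<^sup>2) * indicator {b..b + l} s \<partial>lborel)
      = ennreal ((1 / c) / (1 + c * (b + l - (b + l))) - (1 / c) / (1 + c * (b + l - b)))"
  proof (rule nn_integral_FTC_Icc)
    fix s assume "s \<in> {b..b + l}"
    then have s: "b \<le> s" "s \<le> b + l" by auto
    show "((\<lambda>s. (1 / c) / (1 + c * (b + l - s))) has_real_derivative 1 / (1 + c * (b + l - s))\<^sup>2) (at s)"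
      using q[OF s(2)] assms by (auto intro!: derivative_eq_intros simp: power2_eq_square)
  qed (use assms in auto)
  also have "\<dots> \<le> ennreal (1 / c)" using assms by (intro ennreal_leI) simp
  finally show "(\<integral>\<^sup>+s. ennreal (1 / (1 + c * (b + l - s))\<^sup>2) * indicator {b..b + l} s \<partial>lborel) \<le> ennreal (1 / c)" .
qed

text \<open>For L <= n a dyadic interval of generation n has no lattice point of generation L in its
  interior, so the lattice is no closer to s than the nearer endpoint of that interval.\<close>

lemma lattice_dist_ge:
  assumes "L \<le> n" and s: "of_int j / 2 ^ n \<le> s" "s < (of_int j + 1) / 2 ^ n"
  shows "min (s - of_int j / 2 ^ n) ((of_int j + 1) / 2 ^ n - s) \<le> lattice_dist L s / 2 ^ L"
proof -
  define q where "q = \<lfloor>2 ^ L * s\<rfloor>"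
  have j: "of_int j \<le> 2 ^ n * s" "2 ^ n * s < of_int j + 1" using s by (auto simp: field_simps)
  have pw: "(2::real) ^ n = 2 ^ (n - L) * 2 ^ L" using assms(1) by (simp flip: power_add)
  have q: "of_int q \<le> 2 ^ L * s" "2 ^ L * s < of_int q + 1" unfolding q_def by linarith+
  have "2 ^ (n - L) * of_int q \<le> 2 ^ (n - L) * (2 ^ L * s)" by (intro mult_left_mono q) simp
  moreover have pws: "2 ^ n * s = 2 ^ (n - L) * (2 ^ L * s)" by (simp add: pw)
  ultimately have "2 ^ (n - L) * real_of_int q < of_int j + 1" using j by linarith
  then have "real_of_int (2 ^ (n - L) * q) < of_int (j + 1)" by simp
  then have "2 ^ (n - L) * q < j + 1" by (simp only: of_int_less_iff)
  then have "2 ^ (n - L) * q \<le> j" by simp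
  then have "real_of_int (2 ^ (n - L) * q) \<le> of_int j" by (simp only: of_int_le_iff)
  then have 1: "of_int q / 2 ^ L \<le> (of_int j / 2 ^ n :: real)" unfolding pw by (simp add: field_simps)
  have "2 ^ (n - L) * (2 ^ L * s) < 2 ^ (n - L) * (of_int q + 1)" using q by (intro mult_strict_left_mono) auto
  then have "real_of_int j < 2 ^ (n - L) * (of_int q + 1)" using j pws by linarith
  then have "real_of_int j < of_int (2 ^ (n - L) * (q + 1))" by simp
  then have "j < 2 ^ (n - L) * (q + 1)" by (simp only: of_int_less_iff)
  then have "j + 1 \<le> 2 ^ (n - L) * (q + 1)" by simp
  then have "real_of_int (j + 1) \<le> of_int (2 ^ (n - L) * (q + 1))" by (simp only: of_int_le_iff)
  then have "(of_int j + 1) / 2 ^ n \<le> 2 ^ (n - L) * (of_int q + 1) / (2 ^ n :: real)"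
    by (intro divide_right_mono) simp_all
  also have "\<dots> = (of_int q + 1) / 2 ^ L" unfolding pw by simp
  finally have 2: "(of_int j + 1) / 2 ^ n \<le> ((of_int q + 1) / 2 ^ L :: real)" .
  have "lattice_dist L s / 2 ^ L = min (s - of_int q / 2 ^ L) ((of_int q + 1) / 2 ^ L - s)"
    unfolding lattice_dist_def frac_def q_def[symmetric]
    by (simp add: min_divide_distrib_right diff_divide_distrib add_divide_distrib algebra_simps)
  then show ?thesis using 1 2 by linarith
qed

text \<open>If n >= L, the profile is dominated by two one-sided ones starting at the endpoints,
  each with integral at most 2^-k. If n < L, the interval is halved repeatedly; the power 2^(L-n),
  with truncated subtraction, counts the resulting intervals.\<close>

lemma nn_integral_lattice_dist:
  fixes j :: int
  shows "(\<integral>\<^sup>+s. ennreal (1 / (1 + 2 ^ k * (lattice_dist L s / 2 ^ L))\<^sup>2)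
      * indicator {of_int j / 2 ^ n ..< (of_int j + 1) / 2 ^ n} s \<partial>lborel) \<le> ennreal (2 * 2 ^ (L - n) / 2 ^ k)"
    (is "?I n j \<le> _")
proof (induction "L - n" arbitrary: n j)
  case 0
  let ?b = "of_int j / 2 ^ n" and ?l = "1 / 2 ^ n"
  have e: "(of_int j + 1) / 2 ^ n = ?b + (?l :: real)" by (simp add: add_divide_distrib)
  have "?I n j \<le> (\<integral>\<^sup>+s. ennreal (1 / (1 + 2 ^ k * (s - ?b))\<^sup>2) * indicator {?b..?b + ?l} s
      + ennreal (1 / (1 + 2 ^ k * (?b + ?l - s))\<^sup>2) * indicator {?b..?b + ?l} s \<partial>lborel)"
  proof (rule nn_integral_mono)
    fix s :: real
    show "ennreal (1 / (1 + 2 ^ k * (lattice_dist L s / 2 ^ L))\<^sup>2) * indicator {?b ..< (of_int j + 1) / 2 ^ n} s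
      \<le> ennreal (1 / (1 + 2 ^ k * (s - ?b))\<^sup>2) * indicator {?b..?b + ?l} s
      + ennreal (1 / (1 + 2 ^ k * (?b + ?l - s))\<^sup>2) * indicator {?b..?b + ?l} s"
    proof (cases "s \<in> {?b ..< (of_int j + 1) / 2 ^ n}")
      case True
      then have s: "?b \<le> s" "s < (of_int j + 1) / 2 ^ n" by auto
      have "min (s - ?b) (?b + ?l - s) \<le> lattice_dist L s / 2 ^ L"
        using lattice_dist_ge[OF _ s, of L] 0 unfolding e by simp
      then have "s - ?b \<le> lattice_dist L s / 2 ^ L \<or> ?b + ?l - s \<le> lattice_dist L s / 2 ^ L" by linarith
      moreover have "1 / (1 + 2 ^ k * (lattice_dist L s / 2 ^ L))\<^sup>2 \<le> 1 / (1 + 2 ^ k * t)\<^sup>2"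
        if "0 \<le> t" "t \<le> lattice_dist L s / 2 ^ L" for t :: real
        using that by (intro divide_left_mono power_mono add_left_mono mult_left_mono mult_pos_pos zero_less_power)
          (auto intro!: add_pos_nonneg)
      ultimately have "1 / (1 + 2 ^ k * (lattice_dist L s / 2 ^ L))\<^sup>2
          \<le> 1 / (1 + 2 ^ k * (s - ?b))\<^sup>2 + 1 / (1 + 2 ^ k * (?b + ?l - s))\<^sup>2"
        using s unfolding e by (smt (verit, best) divide_nonneg_nonneg zero_le_power2)
      then show ?thesis using s unfolding e by (simp add: ennreal_leI flip: ennreal_plus)
    qed simp
  qed
  also have "\<dots> = (\<integral>\<^sup>+s. ennreal (1 / (1 + 2 ^ k * (s - ?b))\<^sup>2) * indicator {?b..?b + ?l} s \<partial>lborel)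
      + (\<integral>\<^sup>+s. ennreal (1 / (1 + 2 ^ k * (?b + ?l - s))\<^sup>2) * indicator {?b..?b + ?l} s \<partial>lborel)"
    by (rule nn_integral_add) measurable
  also have "\<dots> \<le> ennreal (1 / 2 ^ k) + ennreal (1 / 2 ^ k)"
    by (intro add_mono nn_integral_inverse_square_le) auto
  also have "\<dots> = ennreal (2 * 2 ^ (L - n) / 2 ^ k)" using 0 by (simp flip: ennreal_plus)
  finally show ?case .
next
  case (Suc i)
  then have i: "i = L - Suc n" and n: "L - n = Suc (L - Suc n)" by auto
  have sp: "indicator {of_int j / 2 ^ n ..< (of_int j + 1) / 2 ^ n} s
     = (indicator {of_int (2 * j) / 2 ^ Suc n ..< (of_int (2 * j) + 1) / 2 ^ Suc n} s
      + indicator {of_int (2 * j + 1) / 2 ^ Suc n ..< (of_int (2 * j + 1) + 1) / 2 ^ Suc n} s :: ennreal)" for s :: real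
    by (auto simp: indicator_def field_simps)
  have "?I n j = ?I (Suc n) (2 * j) + ?I (Suc n) (2 * j + 1)"
    unfolding sp distrib_left by (rule nn_integral_add) measurable
  also have "\<dots> \<le> ennreal (2 * 2 ^ (L - Suc n) / 2 ^ k) + ennreal (2 * 2 ^ (L - Suc n) / 2 ^ k)"
    by (intro add_mono Suc(1) i)
  also have "\<dots> = ennreal (2 * 2 ^ (L - n) / 2 ^ k)" unfolding n by (simp flip: ennreal_plus)
  finally show ?case .
qed

text \<open>The integrand depends on one coordinate only, and the others contribute their side
  lengths. The exponent n + (L - n) is max(n, L), truncated subtraction being intended.\<close>

lemma nn_integral_cube_lattice_dist:
  fixes \<nu> :: "int ^ 'n"
  shows "(\<integral>\<^sup>+x. ennreal (1 / (1 + 2 ^ k * (lattice_dist L (x $ i) / 2 ^ L))\<^sup>2) * indicator (dyadic_cube n \<nu>) x \<partial>lborel)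
    \<le> ennreal (2 * 2 ^ (n + (L - n)) / 2 ^ k / 2 ^ (n * CARD('n)))"
proof -
  let ?V = "\<lambda>s. ennreal (1 / (1 + 2 ^ k * (lattice_dist L s / 2 ^ L))\<^sup>2)"
  let ?J = "\<lambda>j. {of_int (\<nu> $ j) / 2 ^ n ..< (of_int (\<nu> $ j) + 1 :: real) / 2 ^ n}"
  have V: "?V \<in> borel_measurable borel" by measurable
  have J: "(\<integral>\<^sup>+s. indicator (?J j) s \<partial>lborel) = ennreal (1 / 2 ^ n)" for j
    by (simp add: add_divide_distrib)
  have "(\<integral>\<^sup>+x. ?V (x $ i) * indicator (dyadic_cube n \<nu>) x \<partial>lborel)
    = (\<integral>\<^sup>+(x :: real ^ 'n). (\<Prod>j\<in>UNIV. (if j = i then ?V (x $ j) else 1) * indicator (?J j) (x $ j)) \<partial>lborel)"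
  proof (rule nn_integral_cong)
    fix x :: "real ^ 'n"
    have "(\<Prod>j\<in>UNIV. indicator (?J j) (x $ j)) = (indicator (dyadic_cube n \<nu>) x :: ennreal)"
      unfolding dyadic_cube_Ico by (auto simp: indicator_def prod.neutral intro!: prod_zero)
    then show "?V (x $ i) * indicator (dyadic_cube n \<nu>) x
      = (\<Prod>j\<in>UNIV. (if j = i then ?V (x $ j) else 1) * indicator (?J j) (x $ j))"
      unfolding prod.distrib by (simp add: prod.delta)
  qed
  also have "\<dots> = (\<Prod>j\<in>UNIV. \<integral>\<^sup>+s. (if j = i then ?V s else 1) * indicator (?J j) s \<partial>lborel)"
    by (rule nn_integral_prod_vec) (use V in simp)
  also have "\<dots> = (\<integral>\<^sup>+s. ?V s * indicator (?J i) s \<partial>lborel) * (\<Prod>j\<in>UNIV - {i}. ennreal (1 / 2 ^ n))"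
    by (subst prod.remove[of _ i]) (auto simp: J intro!: arg_cong2[where f="(*)"] prod.cong)
  also have "\<dots> \<le> ennreal (2 * 2 ^ (L - n) / 2 ^ k) * (\<Prod>j\<in>UNIV - {i}. ennreal (1 / 2 ^ n))"
    by (intro mult_right_mono nn_integral_lattice_dist) simp
  also have "(\<Prod>j\<in>UNIV - {i}. ennreal (1 / 2 ^ n)) = ennreal ((1 / 2 ^ n) ^ (CARD('n) - 1))"
    by (simp add: ennreal_power)
  also have "ennreal (2 * 2 ^ (L - n) / 2 ^ k) * ennreal ((1 / 2 ^ n) ^ (CARD('n) - 1))
    = ennreal (2 * 2 ^ (L - n) / 2 ^ k * (1 / 2 ^ n) ^ (CARD('n) - 1))"
    by (rule ennreal_mult[symmetric]) auto
  also have "(1 / 2 ^ n :: real) ^ (CARD('n) - 1) = 2 ^ n / 2 ^ (n * CARD('n))"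
  proof -
    obtain d where d: "CARD('n) = Suc d" using gr0_implies_Suc[OF zero_less_card_finite] by blast
    show ?thesis unfolding d by (simp add: power_one_over power_mult power_add)
  qed
  finally show ?thesis by (simp add: power_add mult_ac)
qed

lemma sum_geometric_below:
  fixes q :: real
  assumes "0 < q" "q < 1"
  shows "(\<Sum>k<K. if k \<le> N then q ^ (N - k) else 0) \<le> 1 / (1 - q)"
proof -
  have "(\<Sum>k<K. if k \<le> N then q ^ (N - k) else 0) \<le> (\<Sum>k<max K (Suc N). if k \<le> N then q ^ (N - k) else 0)"
    using assms by (intro sum_mono2) auto
  also have "\<dots> = (\<Sum>k\<le>N. q ^ (N - k))"
    by (rule sum.mono_neutral_cong_right) auto
  also have "\<dots> = (\<Sum>k\<le>N. q ^ k)"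
    by (rule sum.reindex_bij_witness[of _ "\<lambda>k. N - k" "\<lambda>k. N - k"]) auto
  also have "\<dots> \<le> (\<Sum>k. q ^ k)"
    using assms by (intro sum_le_suminf summable_geometric) auto
  also have "\<dots> = 1 / (1 - q)" using assms by (intro suminf_geometric) auto
  finally show ?thesis .
qed

lemma sum_geometric_above:
  fixes q :: real
  assumes "0 < q" "q < 1"
  shows "(\<Sum>k<K. if m \<le> k then q ^ (k - m) else 0) \<le> 1 / (1 - q)"
proof -
  have "(\<Sum>k<K. if m \<le> k then q ^ (k - m) else 0) \<le> (\<Sum>k<m + K. if m \<le> k then q ^ (k - m) else 0)"
    using assms by (intro sum_mono2) auto
  also have "\<dots> = (\<Sum>k\<in>{m..<m + K}. q ^ (k - m))"
    by (rule sum.mono_neutral_cong_right) auto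
  also have "\<dots> = (\<Sum>k<K. q ^ k)"
    by (rule sum.reindex_bij_witness[of _ "\<lambda>k. m + k" "\<lambda>k. k - m"]) auto
  also have "\<dots> \<le> (\<Sum>k. q ^ k)"
    using assms by (intro sum_le_suminf summable_geometric) auto
  also have "\<dots> = 1 / (1 - q)" using assms by (intro suminf_geometric) auto
  finally show ?thesis .
qed

text \<open>This is where a small r is compensated: a decay order p with p r >= 2 leaves, after
  taking r-th powers, the integrable inverse square.\<close>

lemma one_over_power_powr_le:
  fixes t r :: real
  assumes "0 \<le> t" "2 \<le> real p * r"
  shows "(1 / (1 + t) ^ p) powr r \<le> 1 / (1 + t)\<^sup>2"
proof -
  have "(1 / (1 + t) ^ p) powr r = 1 / (1 + t) powr (real p * r)"
    using assms by (simp add: powr_divide powr_powr flip: powr_realpow)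
  also have "\<dots> \<le> 1 / (1 + t) powr 2"
    using assms by (intro divide_left_mono powr_mono mult_pos_pos) auto
  also have "\<dots> = 1 / (1 + t)\<^sup>2" using assms by (simp add: powr_numeral)
  finally show ?thesis .
qed

text \<open>At frequencies above \<open>2\<^sup>N\<close> the blocks are only required to be small away from the cell
  boundaries of generation \<open>N + 1\<close>; this suffices, as a \<open>2\<^sup>-\<^sup>k\<close>-neighbourhood of the boundaries
  occupies a proportion of order \<open>2\<^sup>N\<^sup>-\<^sup>k\<close> of each cell.\<close>

lemma F_norm_le:
  fixes \<phi>0 :: "real ^ 'n \<Rightarrow> complex"
  assumes r: "0 < r" and p: "2 \<le> real p * r"
  shows "\<exists>C\<ge>0. \<forall>N w A. 0 \<le> A \<longrightarrow> (\<forall>k. lp_block \<phi>0 k w \<in> borel_measurable borel) \<longrightarrow>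
    (\<forall>k x. k \<le> N \<longrightarrow> norm (lp_block \<phi>0 k w x) \<le> A * (2 ^ k / 2 ^ N)) \<longrightarrow>
    (\<forall>k x \<delta>. N < k \<longrightarrow> 0 \<le> \<delta> \<longrightarrow> (\<forall>y. norm (x - y) < \<delta> \<longrightarrow> cell (Suc N) y = cell (Suc N) x) \<longrightarrow>
      norm (lp_block \<phi>0 k w x) \<le> A / (1 + 2 ^ k * \<delta>) ^ p) \<longrightarrow>
    F_norm \<phi>0 r w \<le> ennreal (C * A)"
proof -
  \<comment> \<open>The ratio of the geometric series formed by the r-th powers of the bounds
    2^(k-N) for k <= N.\<close>
  define q where "q = 2 powr (- r)"
  have q: "0 < q" "q < 1" using r by (auto simp: q_def powr_less_one)
  \<comment> \<open>The first summand is the geometric series of the low blocks. The second is 2d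
    times the sum 2 of the halving series of the high blocks.\<close>
  define S where "S = 1 / (1 - q) + 4 * CARD('n)"
  have S: "0 \<le> S" using q by (auto simp: S_def)
  have main: "F_norm \<phi>0 r w \<le> ennreal (S powr (1 / r) * A)"
    if A: "0 \<le> A" and m: "\<And>k. lp_block \<phi>0 k w \<in> borel_measurable borel"
      and low: "\<And>k x. k \<le> N \<Longrightarrow> norm (lp_block \<phi>0 k w x) \<le> A * (2 ^ k / 2 ^ N)"
      and high: "\<And>k x \<delta>. N < k \<Longrightarrow> 0 \<le> \<delta> \<Longrightarrow> (\<And>y. norm (x - y) < \<delta> \<Longrightarrow> cell (Suc N) y = cell (Suc N) x) \<Longrightarrow>
        norm (lp_block \<phi>0 k w x) \<le> A / (1 + 2 ^ k * \<delta>) ^ p" for N w A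
  proof -
    let ?L = "Suc N"
    let ?w = "\<lambda>k x. norm (lp_block \<phi>0 k w x) powr r"
    let ?V = "\<lambda>k s. 1 / (1 + 2 ^ k * (lattice_dist ?L s / 2 ^ ?L))\<^sup>2"
    have [measurable]: "lp_block \<phi>0 k w \<in> borel_measurable borel" for k by (rule m)
    have low': "?w k x \<le> A powr r * q ^ (N - k)" if k: "k \<le> N" for k x
    proof -
      have "?w k x \<le> (A * (2 ^ k / 2 ^ N)) powr r" using r by (intro powr_mono2 low k) auto
      also have "\<dots> = A powr r * (2 ^ k / 2 ^ N) powr r" by (rule powr_mult)
      also have "(2 ^ k / 2 ^ N :: real) = 2 powr (- real (N - k))"
        using k by (simp add: of_nat_diff powr_diff powr_realpow)
      also have "\<dots> powr r = q powr real (N - k)" by (simp add: q_def powr_powr mult.commute)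
      also have "\<dots> = q ^ (N - k)" using q by (simp add: powr_realpow)
      finally show ?thesis .
    qed
    have high': "?w k x \<le> A powr r * (\<Sum>i\<in>UNIV. ?V k (x $ i))" if k: "N < k" for k x
    proof -
      \<comment> \<open>The ball around x inside its cell has radius governed by the closest
        coordinate hyperplane. Replacing the minimum over coordinates by the sum of the profiles
        leaves integrands in a single variable.\<close>
      let ?D = "range (\<lambda>i. lattice_dist ?L (x $ i))"
      have "Min ?D \<in> ?D" by (intro Min_in) auto
      then obtain i where i: "Min ?D = lattice_dist ?L (x $ i)" by blast
      have le: "lattice_dist ?L (x $ i) \<le> lattice_dist ?L (x $ j)" for j unfolding i[symmetric] by (intro Min_le) auto
      let ?\<delta> = "lattice_dist ?L (x $ i) / 2 ^ ?L"
      have d0: "0 \<le> ?\<delta>" by simp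
      have "norm (lp_block \<phi>0 k w x) \<le> A / (1 + 2 ^ k * ?\<delta>) ^ p"
      proof (rule high[OF k d0], rule cell_eq_if_near)
        fix y j assume "norm (x - y) < ?\<delta>"
        also have "?\<delta> \<le> lattice_dist ?L (x $ j) / 2 ^ ?L" by (intro divide_right_mono le) simp
        finally show "\<bar>x $ j - y $ j\<bar> < lattice_dist ?L (x $ j) / 2 ^ ?L"
          using component_le_norm_cart[of "x - y" j] by simp
      qed
      then have "?w k x \<le> (A * (1 / (1 + 2 ^ k * ?\<delta>) ^ p)) powr r" using r by (intro powr_mono2) auto
      also have "\<dots> = A powr r * (1 / (1 + 2 ^ k * ?\<delta>) ^ p) powr r"
        by (rule powr_mult)
      also have "\<dots> \<le> A powr r * ?V k (x $ i)"
        by (intro mult_left_mono one_over_power_powr_le[OF _ p]) auto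
      also have "\<dots> \<le> A powr r * (\<Sum>i\<in>UNIV. ?V k (x $ i))"
        by (intro mult_left_mono member_le_sum) auto
      finally show ?thesis .
    qed
    have avg: "(\<integral>\<^sup>+x \<in> dyadic_cube n \<nu>. (\<Sum>k. ennreal (?w (n + k) x)) \<partial>lborel) / emeasure lborel (dyadic_cube n \<nu>)
        \<le> ennreal (A powr r * S)" for n and \<nu> :: "int ^ 'n"
    proof -
      let ?Q = "dyadic_cube n \<nu>"
      let ?e = "1 / 2 ^ (n * CARD('n)) :: real"
      \<comment> \<open>This is max(n, N + 1): cubes smaller than the cells of generation N + 1 gain
        only from their own generation on, which is enough since the sum starts at k = n.\<close>
      let ?m = "n + (?L - n)"
      let ?\<alpha> = "\<lambda>k. if k \<le> N then q ^ (N - k) else 0" and ?\<beta> = "\<lambda>k. if ?m \<le> k then (1/2) ^ (k - ?m) else 0 :: real"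
      have one: "(\<integral>\<^sup>+x. ennreal (?w k x) * indicator ?Q x \<partial>lborel) \<le> ennreal (A powr r * (?\<alpha> k + 2 * CARD('n) * ?\<beta> k) * ?e)" if nk: "n \<le> k" for k
      proof (cases "k \<le> N")
        case True
        have "(\<integral>\<^sup>+x. ennreal (?w k x) * indicator ?Q x \<partial>lborel) \<le> (\<integral>\<^sup>+x. ennreal (A powr r * q ^ (N - k)) * indicator ?Q x \<partial>lborel)"
          by (intro nn_integral_mono mult_right_mono ennreal_leI low' True) simp
        also have "\<dots> = ennreal (A powr r * q ^ (N - k)) * ennreal ?e"
          by (subst nn_integral_cmult_indicator) (auto simp: emeasure_dyadic_cube)
        also have "\<dots> = ennreal (A powr r * q ^ (N - k) * ?e)" using q by (intro ennreal_mult[symmetric]) auto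
        also have "\<dots> \<le> ennreal (A powr r * (?\<alpha> k + 2 * CARD('n) * ?\<beta> k) * ?e)"
          using True by (intro ennreal_leI mult_right_mono mult_left_mono) auto
        finally show ?thesis .
      next
        case False
        then have mk: "?m \<le> k" using nk by auto
        have "(\<integral>\<^sup>+x. ennreal (?w k x) * indicator ?Q x \<partial>lborel)
          \<le> (\<integral>\<^sup>+x. ennreal (A powr r) * (\<Sum>i\<in>UNIV. ennreal (?V k (x $ i)) * indicator ?Q x) \<partial>lborel)"
        proof (rule nn_integral_mono)
          fix x
          have "ennreal (?w k x) \<le> ennreal (A powr r) * (\<Sum>i\<in>UNIV. ennreal (?V k (x $ i)))"
            using high'[of k x] False
            by (subst sum_ennreal) (auto simp: ennreal_leI sum_nonneg simp flip: ennreal_mult)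
          then have "ennreal (?w k x) * indicator ?Q x \<le> ennreal (A powr r) * (\<Sum>i\<in>UNIV. ennreal (?V k (x $ i))) * indicator ?Q x"
            by (rule mult_right_mono) simp
          then show "ennreal (?w k x) * indicator ?Q x \<le> ennreal (A powr r) * (\<Sum>i\<in>UNIV. ennreal (?V k (x $ i)) * indicator ?Q x)"
            by (simp only: sum_distrib_right mult.assoc)
        qed
        also have "\<dots> = ennreal (A powr r) * (\<Sum>i\<in>UNIV. \<integral>\<^sup>+x. ennreal (?V k (x $ i)) * indicator ?Q x \<partial>lborel)"
          by (subst nn_integral_cmult, measurable) (subst nn_integral_sum, measurable)
        also have "\<dots> \<le> ennreal (A powr r) * (\<Sum>i\<in>(UNIV :: 'n set). ennreal (2 * 2 ^ ?m / 2 ^ k / 2 ^ (n * CARD('n))))"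
          by (intro mult_left_mono sum_mono nn_integral_cube_lattice_dist) simp
        also have "\<dots> = ennreal (A powr r * (CARD('n) * (2 * 2 ^ ?m / 2 ^ k / 2 ^ (n * CARD('n)))))"
          by (subst sum_ennreal) (auto simp flip: ennreal_mult)
        also have "A powr r * (CARD('n) * (2 * 2 ^ ?m / 2 ^ k / 2 ^ (n * CARD('n)))) = A powr r * (?\<alpha> k + 2 * CARD('n) * ?\<beta> k) * ?e"
          using False mk by (simp add: power_one_over power_diff)
        finally show ?thesis .
      qed
      have "(\<integral>\<^sup>+x \<in> ?Q. (\<Sum>k. ennreal (?w (n + k) x)) \<partial>lborel) = (\<Sum>k. \<integral>\<^sup>+x. ennreal (?w (n + k) x) * indicator ?Q x \<partial>lborel)"
        by (subst nn_integral_suminf[symmetric]) (auto simp: ennreal_suminf_multc)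
      also have "\<dots> \<le> ennreal (A powr r * S * ?e)"
      proof (rule suminf_le_const)
        fix K
        have "(\<Sum>k<K. \<integral>\<^sup>+x. ennreal (?w (n + k) x) * indicator ?Q x \<partial>lborel)
          \<le> (\<Sum>k<K. ennreal (A powr r * (?\<alpha> (n + k) + 2 * CARD('n) * ?\<beta> (n + k)) * ?e))"
          by (intro sum_mono one) simp
        also have "\<dots> = ennreal (\<Sum>k<K. A powr r * (?\<alpha> (n + k) + 2 * CARD('n) * ?\<beta> (n + k)) * ?e)"
          using q by (intro sum_ennreal) (auto intro!: mult_nonneg_nonneg add_nonneg_nonneg)
        also have "\<dots> \<le> ennreal (A powr r * S * ?e)"
        proof (rule ennreal_leI)
          have "(\<Sum>k<K. ?\<alpha> (n + k) + 2 * CARD('n) * ?\<beta> (n + k)) = (\<Sum>k\<in>{n..<n + K}. ?\<alpha> k + 2 * CARD('n) * ?\<beta> k)"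
            by (rule sum.reindex_bij_witness[of _ "\<lambda>k. k - n" "\<lambda>k. n + k"]) auto
          also have "\<dots> \<le> (\<Sum>k<n + K. ?\<alpha> k + 2 * CARD('n) * ?\<beta> k)"
            using q by (intro sum_mono2) (auto intro!: add_nonneg_nonneg mult_nonneg_nonneg)
          also have "\<dots> = (\<Sum>k<n + K. ?\<alpha> k) + 2 * CARD('n) * (\<Sum>k<n + K. ?\<beta> k)"
            by (simp only: sum.distrib sum_distrib_left)
          also have "\<dots> \<le> 1 / (1 - q) + 2 * CARD('n) * (1 / (1 - 1/2))"
            using q by (intro add_mono mult_left_mono sum_geometric_below sum_geometric_above) auto
          also have "\<dots> = S" by (simp add: S_def)
          finally show "(\<Sum>k<K. A powr r * (?\<alpha> (n + k) + 2 * CARD('n) * ?\<beta> (n + k)) * ?e) \<le> A powr r * S * ?e"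
            unfolding sum_distrib_right[symmetric] sum_distrib_left[symmetric]
            by (intro mult_right_mono mult_left_mono) auto
        qed
        finally show "(\<Sum>k<K. \<integral>\<^sup>+x. ennreal (?w (n + k) x) * indicator ?Q x \<partial>lborel) \<le> ennreal (A powr r * S * ?e)" .
      qed auto
      finally have "(\<integral>\<^sup>+x \<in> ?Q. (\<Sum>k. ennreal (?w (n + k) x)) \<partial>lborel) / emeasure lborel ?Q \<le> ennreal (A powr r * S * ?e) / ennreal ?e"
        unfolding emeasure_dyadic_cube by (rule divide_right_mono_ennreal)
      also have "\<dots> = ennreal (A powr r * S)" using S by (subst divide_ennreal) auto
      finally show ?thesis .
    qed
    have eq: "(A powr r * S) powr (1 / r) = S powr (1 / r) * A"
      using A S r by (simp add: powr_mult powr_powr mult.commute)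
    have "ennreal_powr ((\<integral>\<^sup>+x \<in> dyadic_cube n \<nu>. (\<Sum>k. ennreal (?w (n + k) x)) \<partial>lborel) / emeasure lborel (dyadic_cube n \<nu>)) (1 / r)
      \<le> ennreal (S powr (1 / r) * A)" for n and \<nu> :: "int ^ 'n"
      unfolding eq[symmetric] by (rule ennreal_powr_le[OF avg]) (use S r in simp_all)
    then show ?thesis unfolding F_norm_def by (intro SUP_least)
  qed
  show ?thesis
    by (intro exI[of _ "S powr (1 / r)"] conjI allI impI main) auto
qed

section \<open>Littlewood--Paley blocks\<close>

text \<open>The set where the bound fails is open, and a nonempty open set is not negligible. This
  turns the essential suprema in \<open>B_norm\<close> into pointwise bounds.\<close>

lemma norm_le_everywhere_of_AE:
  fixes f :: "'a::euclidean_space \<Rightarrow> 'b::real_normed_vector"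
  assumes f: "continuous_on UNIV f" and b: "AE x in lborel. norm (f x) \<le> b"
  shows "norm (f x) \<le> b"
proof (rule ccontr)
  let ?S = "{y. b < norm (f y)}"
  assume "\<not> norm (f x) \<le> b"
  then have ne: "?S \<noteq> {}" by (auto simp: not_le)
  have o: "open ?S" using f by (intro open_Collect_less continuous_intros)
  have "AE y in lborel. y \<notin> ?S" using b by eventually_elim auto
  then have "?S \<in> null_sets lborel" using o by (subst AE_iff_null_sets) auto
  then have "negligible ?S" unfolding negligible_iff_null_sets by (rule null_sets_completionI)
  then show False using open_not_negligible[OF o ne] by blast
qed

text \<open>A common form for blocks and smooth projections, so that both can be multiplied, added
  and compared at the level of symbols.\<close>

definition symbol_fun :: "(real ^ 'n \<Rightarrow> complex) \<Rightarrow> ((real ^ 'n \<Rightarrow> complex) \<Rightarrow> complex) \<Rightarrow> real ^ 'n \<Rightarrow> complex" where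
  "symbol_fun m u = fun_of_dist (multiplier m u)"

lemma lp_block_eq: "lp_block \<phi>0 k = symbol_fun (lp_piece \<phi>0 k)"
  by (simp add: lp_block_def symbol_fun_def fun_eq_iff)

lemma symbol_fun_eqI:
  "continuous_on UNIV g \<Longrightarrow> polynomial_growth g \<Longrightarrow> multiplier m u = dist_of g \<Longrightarrow> symbol_fun m u = g"
  by (simp add: symbol_fun_def fun_of_dist_dist_of)

lemma
  assumes u: "u \<in> tempered" and m: "m \<in> schwartz"
  shows symbol_fun_apply: "symbol_fun m u x = u (\<lambda>y. inv_fourier m (x - y))"
    and continuous_symbol_fun: "continuous_on UNIV (symbol_fun m u)"
    and multiplier_eq_symbol_fun: "multiplier m u = dist_of (symbol_fun m u)"
proof -
  have "symbol_fun m u = (\<lambda>x. u (\<lambda>y. inv_fourier m (x - y)))"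
    using multiplier_tempered[OF u m] by (intro symbol_fun_eqI)
  then show "symbol_fun m u x = u (\<lambda>y. inv_fourier m (x - y))" "continuous_on UNIV (symbol_fun m u)"
    "multiplier m u = dist_of (symbol_fun m u)"
    using multiplier_tempered[OF u m] by simp_all
qed

lemma measurable_symbol_fun: "u \<in> tempered \<Longrightarrow> m \<in> schwartz \<Longrightarrow> symbol_fun m u \<in> borel_measurable borel"
  by (intro borel_measurable_continuous_onI continuous_symbol_fun)

lemma continuous_conv:
  assumes K: "K \<in> schwartz" and g: "g \<in> borel_measurable borel" "\<And>y. norm (g y) \<le> A"
  shows "continuous_on UNIV (conv K g)"
proof -
  obtain C where C: "\<And>x x'. norm (conv K g x - conv K g x') \<le> C * A * norm (x - x')"
    using conv_dil_lipschitz[OF K] g by (metis dil_0 mult.right_neutral power_0)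
  have "isCont (conv K g) x" for x
  proof -
    have "((\<lambda>y. C * A * norm (y - x)) \<longlongrightarrow> C * A * norm (x - x)) (at x)" by (intro tendsto_intros)
    then have "((\<lambda>y. C * A * norm (y - x)) \<longlongrightarrow> 0) (at x)" by simp
    then have "((\<lambda>y. conv K g y - conv K g x) \<longlongrightarrow> 0) (at x)"
      by (rule Lim_null_comparison[rotated]) (use C in auto)
    then show ?thesis by (simp add: isCont_def LIM_zero_iff)
  qed
  then show ?thesis by (simp add: continuous_at_imp_continuous_on)
qed

lemma norm_conv_le:
  assumes "K \<in> schwartz" "g \<in> borel_measurable borel" "\<And>y. norm (g y) \<le> A"
  shows "norm (conv K g x) \<le> (\<integral>z. norm (K z) \<partial>lborel) * A"
  using norm_conv_dil_le[OF assms, of 0 x] by simp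

lemma symbol_fun_dist_of:
  assumes m: "m \<in> schwartz" and g: "g \<in> borel_measurable borel" "\<And>y. norm (g y) \<le> A"
  shows "symbol_fun m (dist_of g) = conv (inv_fourier m) g"
proof (rule symbol_fun_eqI)
  have K: "inv_fourier m \<in> schwartz" by (rule schwartz_inv_fourier[OF m])
  show "continuous_on UNIV (conv (inv_fourier m) g)" by (rule continuous_conv[OF K g])
  show "polynomial_growth (conv (inv_fourier m) g)"
    using norm_conv_le[OF K g] by (rule bounded_polynomial_growth)
  show "multiplier m (dist_of g) = dist_of (conv (inv_fourier m) g)"
    unfolding multiplier_dist_of[OF m g] conv_def[abs_def] ..
qed

text \<open>Boundedness of the inner factor makes the outer convolution an ordinary integral.
  Depending on which of two commuting symbols is put inside, different bounds result.\<close>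

lemma symbol_fun_mult:
  assumes u: "u \<in> tempered" and m: "m1 \<in> schwartz" "m2 \<in> schwartz" and A: "\<And>x. norm (symbol_fun m2 u x) \<le> A"
  shows "symbol_fun (\<lambda>\<xi>. m1 \<xi> * m2 \<xi>) u = conv (inv_fourier m1) (symbol_fun m2 u)"
proof -
  have "multiplier m1 (dist_of (symbol_fun m2 u)) = multiplier (\<lambda>\<xi>. m1 \<xi> * m2 \<xi>) u"
    by (simp only: multiplier_eq_symbol_fun[OF u m(2), symmetric] multiplier_multiplier[OF m])
  then have "symbol_fun (\<lambda>\<xi>. m1 \<xi> * m2 \<xi>) u = symbol_fun m1 (dist_of (symbol_fun m2 u))"
    by (simp add: symbol_fun_def)
  also have "\<dots> = conv (inv_fourier m1) (symbol_fun m2 u)"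
    by (rule symbol_fun_dist_of[OF m(1) measurable_symbol_fun[OF u m(2)] A])
  finally show ?thesis .
qed

lemma inv_fourier_add:
  assumes "f \<in> schwartz" "g \<in> schwartz"
  shows "inv_fourier (\<lambda>\<xi>. f \<xi> + g \<xi>) x = inv_fourier f x + inv_fourier g x"
  unfolding inv_fourier_eq using fourier_add[OF schwartz_integrable[OF assms(1)] schwartz_integrable[OF assms(2)]]
  by (simp add: distrib_left)

lemma inv_fourier_diff:
  assumes "f \<in> schwartz" "g \<in> schwartz"
  shows "inv_fourier (\<lambda>\<xi>. f \<xi> - g \<xi>) x = inv_fourier f x - inv_fourier g x"
  unfolding inv_fourier_eq using fourier_diff[OF schwartz_integrable[OF assms(1)] schwartz_integrable[OF assms(2)]]
  by (simp add: right_diff_distrib)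

lemma symbol_fun_add_symbol:
  assumes u: "u \<in> tempered" and m: "m1 \<in> schwartz" "m2 \<in> schwartz"
  shows "symbol_fun (\<lambda>\<xi>. m1 \<xi> + m2 \<xi>) u x = symbol_fun m1 u x + symbol_fun m2 u x"
  using tempered_add[OF u schwartz_reflect[OF schwartz_inv_fourier[OF m(1)]] schwartz_reflect[OF schwartz_inv_fourier[OF m(2)]]]
  by (simp add: symbol_fun_apply[OF u] m schwartz_add inv_fourier_add)

lemma symbol_fun_diff_symbol:
  assumes u: "u \<in> tempered" and m: "m1 \<in> schwartz" "m2 \<in> schwartz"
  shows "symbol_fun (\<lambda>\<xi>. m1 \<xi> - m2 \<xi>) u x = symbol_fun m1 u x - symbol_fun m2 u x"
  using tempered_diff[OF u schwartz_reflect[OF schwartz_inv_fourier[OF m(1)]] schwartz_reflect[OF schwartz_inv_fourier[OF m(2)]]]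
  by (simp add: symbol_fun_apply[OF u] m schwartz_diff inv_fourier_diff)

lemma symbol_fun_zero: "u \<in> tempered \<Longrightarrow> symbol_fun (\<lambda>\<xi>. 0) u x = 0"
  using symbol_fun_diff_symbol[of u "\<lambda>\<xi>. 0" "\<lambda>\<xi>. 0" x] schwartz_zero by simp

lemma symbol_fun_sum_symbol:
  assumes u: "u \<in> tempered" and m: "\<And>k. k \<in> A \<Longrightarrow> m k \<in> schwartz"
  shows "symbol_fun (\<lambda>\<xi>. \<Sum>k\<in>A. m k \<xi>) u x = (\<Sum>k\<in>A. symbol_fun (m k) u x)"
  using m
  by (induction A rule: infinite_finite_induct)
    (simp_all add: symbol_fun_zero[OF u] symbol_fun_add_symbol[OF u] schwartz_sum)

lemma symbol_fun_diff:
  assumes "u \<in> tempered" "v \<in> tempered" "m \<in> schwartz"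
  shows "symbol_fun m (u - v) x = symbol_fun m u x - symbol_fun m v x"
  using assms by (simp add: symbol_fun_apply tempered_minus)

text \<open>Up to dilation there are only two different pieces, one for k = 0 and one for k > 0;
  kernel constants can therefore be taken uniform in k.\<close>

definition lp_base :: "(real ^ 'n \<Rightarrow> complex) \<Rightarrow> nat \<Rightarrow> real ^ 'n \<Rightarrow> complex" where
  "lp_base \<phi>0 k = (if k = 0 then \<phi>0 else (\<lambda>\<xi>. \<phi>0 \<xi> - \<phi>0 (2 *\<^sub>R \<xi>)))"

lemma lp_piece_eq: "lp_piece \<phi>0 k = (\<lambda>\<xi>. lp_base \<phi>0 k ((1/2) ^ k *\<^sub>R \<xi>))"
  by (cases k) (simp_all add: lp_base_def fun_eq_iff)

lemma lp_base_pos: "k > 0 \<Longrightarrow> lp_base \<phi>0 k = lp_base \<phi>0 1"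
  by (simp add: lp_base_def)

lemma sum_lp_piece: "(\<Sum>k\<le>K. lp_piece \<phi>0 k \<xi>) = \<phi>0 ((1/2) ^ K *\<^sub>R \<xi>)"
  by (induction K) simp_all

section \<open>Blocks for a fixed Littlewood-Paley cutoff\<close>

context
  fixes \<phi>0 :: "real ^ 'n \<Rightarrow> complex"
  assumes lp: "lp_cutoff \<phi>0"
begin

lemma schwartz_lp_cutoff: "\<phi>0 \<in> schwartz"
  using lp by (simp add: lp_cutoff_def test_function_schwartz)

lemma schwartz_lp_base: "lp_base \<phi>0 k \<in> schwartz"
  by (auto simp: lp_base_def intro!: schwartz_diff schwartz_dilate schwartz_lp_cutoff)

lemma schwartz_lp_piece: "lp_piece \<phi>0 k \<in> schwartz"
  unfolding lp_piece_eq by (intro schwartz_dilate schwartz_lp_base) simp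

lemma inv_fourier_lp_piece: "inv_fourier (lp_piece \<phi>0 k) = dil k (inv_fourier (lp_base \<phi>0 k))"
  unfolding lp_piece_eq by (rule inv_fourier_dilate[OF schwartz_measurable[OF schwartz_lp_base]])

lemma lp_cutoff_zero: "\<phi>0 0 = 1"
  using lp by (simp add: lp_cutoff_def)

lemma integral_inv_fourier_lp_base: "k > 0 \<Longrightarrow> (\<integral>z. inv_fourier (lp_base \<phi>0 k) z \<partial>lborel) = 0"
  unfolding integral_inv_fourier[OF schwartz_lp_base] by (simp add: lp_base_def)

lemma lp_block_dist_of:
  assumes "g \<in> borel_measurable borel" "\<And>y. norm (g y) \<le> A"
  shows "lp_block \<phi>0 k (dist_of g) = conv (dil k (inv_fourier (lp_base \<phi>0 k))) g"
  unfolding lp_block_eq using symbol_fun_dist_of[OF schwartz_lp_piece assms] by (simp add: inv_fourier_lp_piece)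

lemma measurable_lp_block: "u \<in> tempered \<Longrightarrow> lp_block \<phi>0 k u \<in> borel_measurable borel"
  unfolding lp_block_eq by (intro measurable_symbol_fun schwartz_lp_piece)

lemma continuous_lp_block: "u \<in> tempered \<Longrightarrow> continuous_on UNIV (lp_block \<phi>0 k u)"
  unfolding lp_block_eq by (intro continuous_symbol_fun schwartz_lp_piece)

lemma B_space_bound:
  assumes "f \<in> B_space \<phi>0"
  obtains b where "0 \<le> b" "B_norm \<phi>0 f = ennreal b" "\<And>k x. norm (lp_block \<phi>0 k f x) \<le> b"
proof -
  have f: "f \<in> tempered" and fin: "B_norm \<phi>0 f < \<infinity>" using assms by (auto simp: B_space_def)
  obtain b where b: "0 \<le> b" "B_norm \<phi>0 f = ennreal b" using fin by (cases "B_norm \<phi>0 f") auto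
  have "norm (lp_block \<phi>0 k f x) \<le> b" for k x
  proof (rule norm_le_everywhere_of_AE[OF continuous_lp_block[OF f]])
    let ?g = "\<lambda>x. ennreal (norm (lp_block \<phi>0 k f x))"
    have "AE x in lborel. ?g x \<le> esssup lborel ?g" by (rule esssup_AE)
    then show "AE x in lborel. norm (lp_block \<phi>0 k f x) \<le> b"
    proof eventually_elim
      case (elim x)
      also have "esssup lborel ?g \<le> ennreal b" unfolding b(2)[symmetric] B_norm_def by (rule SUP_upper) simp
      finally show ?case using b(1) by simp
    qed
  qed
  with b that show ?thesis by blast
qed

section \<open>Blocks determine the distribution; uniqueness of limits\<close>

lemma mult_adj_partial_deriv:
  assumes m: "m \<in> schwartz" and phi: "\<phi> \<in> schwartz"
  shows "mult_adj m (partial_deriv j \<phi>) = partial_deriv j (mult_adj m \<phi>)"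
proof -
  have "inv_fourier (partial_deriv j \<phi>) \<xi> = - \<i> * (complex_of_real (\<xi> $ j) * inv_fourier \<phi> \<xi>)" for \<xi>
    by (simp add: inv_fourier_eq fourier_partial_deriv[OF phi])
  then show ?thesis
    unfolding mult_adj_def partial_deriv_fourier[OF schwartz_mult[OF m schwartz_inv_fourier[OF phi]]]
    by (simp add: mult_ac)
qed

lemma mult_adj_partial_derivs:
  assumes m: "m \<in> schwartz" and phi: "\<phi> \<in> schwartz"
  shows "mult_adj m (partial_derivs is \<phi>) = partial_derivs is (mult_adj m \<phi>)"
  by (induction "is") (simp_all add: mult_adj_partial_deriv[OF m schwartz_partial_derivs[OF phi]])

text \<open>The kernel of the cutoff at scale 2^K has integral 1, the value of the symbol at 0, so
  the error is an average of differences of psi. Beyond \<open>weight\<close>, M powers of kernel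
  decay pay for the weight at y and one more yields 2^-K.\<close>

lemma mult_adj_approximation:
  assumes psi: "\<psi> \<in> schwartz"
  shows "\<exists>C. \<forall>K y. (1 + norm y) ^ M * norm (mult_adj (\<lambda>\<xi>. \<phi>0 ((1/2) ^ K *\<^sub>R \<xi>)) \<psi> y - \<psi> y) \<le> C / 2 ^ K"
proof -
  let ?T = "inv_fourier \<phi>0"
  have T: "?T \<in> schwartz" by (intro schwartz_inv_fourier schwartz_lp_cutoff)
  obtain C where C: "C \<ge> 0" "\<And>x y. norm (\<psi> x - \<psi> y) \<le> C * norm (x - y) * (1 + norm (x - y)) ^ M / (1 + norm x) ^ M"
    using schwartz_diff_bound[OF psi] by blast
  obtain D where D: "D \<ge> 0" "\<And>x. norm (?T x) \<le> D / (1 + norm x) ^ (M + 2 * CARD('n) + 1)"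
    using rapidD[OF schwartz_rapid[OF T]] by blast
  let ?W = "\<integral>(x :: real ^ 'n). weight x \<partial>lborel"
  have "(1 + norm y) ^ M * norm (mult_adj (\<lambda>\<xi>. \<phi>0 ((1/2) ^ K *\<^sub>R \<xi>)) \<psi> y - \<psi> y) \<le> (C * D * ?W) / 2 ^ K" for K y
  proof -
    let ?K = "dil K ?T"
    have mS: "(\<lambda>\<xi>. \<phi>0 ((1/2) ^ K *\<^sub>R \<xi>)) \<in> schwartz" by (intro schwartz_dilate schwartz_lp_cutoff) simp
    have S: "?K \<in> schwartz" by (rule schwartz_dil[OF T])
    have "(\<integral>z. ?K z \<partial>lborel) = 1"
      using integral_affine_vec[of "2 ^ K" ?T 0] schwartz_measurable[OF T] integral_inv_fourier[OF schwartz_lp_cutoff]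
      by (simp add: dil_def[abs_def] lp_cutoff_zero power_mult scaleR_conv_of_real)
    then have one: "(\<integral>x. ?K (x - y) \<partial>lborel) = 1"
      using integral_shift_vec(2)[of ?K y] schwartz_measurable[OF S] by simp
    have i1: "integrable lborel (\<lambda>x. \<psi> x * ?K (x - y))"
      by (intro schwartz_integrable schwartz_mult psi schwartz_shift_diff S)
    have i2: "integrable lborel (\<lambda>x. \<psi> y * ?K (x - y))"
      by (intro schwartz_integrable schwartz_cmult schwartz_shift_diff S)
    have wi: "integrable lborel (\<lambda>x. 2 ^ (K * CARD('n)) * weight (2 ^ K *\<^sub>R (x - y)))"
      by (rule integrable_shift_vec(2)[OF integrable_dilate[OF integrable_weight]])
    have "mult_adj (\<lambda>\<xi>. \<phi>0 ((1/2) ^ K *\<^sub>R \<xi>)) \<psi> y - \<psi> y = (\<integral>x. (\<psi> x - \<psi> y) * ?K (x - y) \<partial>lborel)"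
      unfolding mult_adj_convolution[OF mS psi] inv_fourier_dilate[OF schwartz_measurable[OF schwartz_lp_cutoff]] left_diff_distrib
      by (subst Bochner_Integration.integral_diff[OF i1 i2]) (simp add: one)
    also have "norm \<dots> \<le> (\<integral>x. (C * D / (2 ^ K * (1 + norm y) ^ M)) * (2 ^ (K * CARD('n)) * weight (2 ^ K *\<^sub>R (x - y))) \<partial>lborel)"
    proof (rule Bochner_Integration.integral_norm_bound_integral)
      show "integrable lborel (\<lambda>x. (\<psi> x - \<psi> y) * ?K (x - y))"
        unfolding left_diff_distrib by (rule Bochner_Integration.integrable_diff[OF i1 i2])
      show "integrable lborel (\<lambda>x. (C * D / (2 ^ K * (1 + norm y) ^ M)) * (2 ^ (K * CARD('n)) * weight (2 ^ K *\<^sub>R (x - y))))"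
        by (intro integrable_mult_right wi)
      fix x
      let ?z = "x - y" and ?s = "1 + norm (2 ^ K *\<^sub>R (x - y))"
      have z1: "2 ^ K * norm ?z \<le> ?s" by simp
      have "1 * norm ?z \<le> 2 ^ K * norm ?z" by (intro mult_right_mono) auto
      then have z2: "(1 + norm ?z) ^ M \<le> ?s ^ M" by (intro power_mono) auto
      have "norm (\<psi> x - \<psi> y) \<le> C * norm ?z * (1 + norm ?z) ^ M / (1 + norm y) ^ M"
        using C(2)[of y x] by (simp add: norm_minus_commute)
      also have "\<dots> = C / 2 ^ K * ((2 ^ K * norm ?z) * (1 + norm ?z) ^ M) / (1 + norm y) ^ M" by simp
      also have "\<dots> \<le> C / 2 ^ K * (?s * ?s ^ M) / (1 + norm y) ^ M"
        using C(1) z1 z2 by (intro divide_right_mono mult_left_mono mult_mono) auto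
      finally have "norm ((\<psi> x - \<psi> y) * ?K ?z) \<le> (C / 2 ^ K * (?s * ?s ^ M) / (1 + norm y) ^ M) *
          (2 ^ (K * CARD('n)) * (D / ?s ^ (M + 2 * CARD('n) + 1)))"
        unfolding norm_mult norm_dil using C(1) by (intro mult_mono D(2)) auto
      also have "\<dots> = (C * D / (2 ^ K * (1 + norm y) ^ M)) * (2 ^ (K * CARD('n)) * weight (2 ^ K *\<^sub>R ?z))"
      proof -
        have "?s \<noteq> 0" by (rule one_plus_norm_pos)
        then have "?s * ?s ^ M * (D / ?s ^ (M + 2 * CARD('n) + 1)) = D * weight (2 ^ K *\<^sub>R ?z)"
          unfolding weight_def power_add by (simp del: norm_scaleR)
        moreover have "(c / k * a / z) * (p * (d / t)) = (c / (k * z)) * p * (a * (d / t))" for c k a z p d t :: real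
          by (simp add: divide_inverse mult_ac)
        ultimately have "(C / 2 ^ K * (?s * ?s ^ M) / (1 + norm y) ^ M) * (2 ^ (K * CARD('n)) * (D / ?s ^ (M + 2 * CARD('n) + 1)))
          = (C / (2 ^ K * (1 + norm y) ^ M)) * 2 ^ (K * CARD('n)) * (D * weight (2 ^ K *\<^sub>R ?z))"
          by (simp only:)
        also have "\<dots> = (C * D / (2 ^ K * (1 + norm y) ^ M)) * (2 ^ (K * CARD('n)) * weight (2 ^ K *\<^sub>R ?z))"
          by (simp only: times_divide_eq_left times_divide_eq_right mult_ac)
        finally show ?thesis .
      qed
      finally show "norm ((\<psi> x - \<psi> y) * ?K ?z) \<le> (C * D / (2 ^ K * (1 + norm y) ^ M)) * (2 ^ (K * CARD('n)) * weight (2 ^ K *\<^sub>R ?z))" .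
    qed
    also have "\<dots> = (C * D / (2 ^ K * (1 + norm y) ^ M)) * ?W"
      unfolding integral_mult_right_zero
      using integral_shift_vec(2)[of "\<lambda>z :: real ^ 'n. 2 ^ (K * CARD('n)) * weight (2 ^ K *\<^sub>R z)" y] integral_dilate[OF weight_measurable, where 'n='n, of K]
      by simp
    finally have "norm (mult_adj (\<lambda>\<xi>. \<phi>0 ((1/2) ^ K *\<^sub>R \<xi>)) \<psi> y - \<psi> y) \<le> (C * D * ?W / 2 ^ K) / (1 + norm y) ^ M" by (simp add: mult_ac)
    then show ?thesis by (simp add: pos_le_divide_eq mult.commute)
  qed
  then show ?thesis by blast
qed

text \<open>The pieces telescope to the dilated cutoff, so w vanishes on every
  \<open>mult_adj\<close> of a test function with it. These converge to the test function in the
  finitely many seminorms that control w.\<close>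

lemma lp_blocks_determine:
  assumes w: "w \<in> tempered" and z: "\<And>k x. lp_block \<phi>0 k w x = 0"
  shows "w = (\<lambda>_. 0)"
proof
  fix \<phi>
  show "w \<phi> = 0"
  proof (cases "\<phi> \<in> schwartz")
    case False
    then show ?thesis using w by (rule tempered_off_schwartz[rotated])
  next
    case phi: True
    obtain C M where C: "0 \<le> C" "\<And>\<phi> e. \<phi> \<in> schwartz \<Longrightarrow>
      (\<And>is x. length is \<le> M \<Longrightarrow> (1 + norm x) ^ M * norm (partial_derivs is \<phi> x) \<le> e) \<Longrightarrow> norm (w \<phi>) \<le> C * e"
      using tempered_bound[OF w] by metis
    let ?m = "\<lambda>K \<xi>. \<phi>0 ((1/2) ^ K *\<^sub>R \<xi>)"
    have mS: "?m K \<in> schwartz" for K by (intro schwartz_dilate schwartz_lp_cutoff) simp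
    have "\<forall>is. \<exists>E. \<forall>K y. (1 + norm y) ^ M * norm (mult_adj (?m K) (partial_derivs is \<phi>) y - partial_derivs is \<phi> y) \<le> E / 2 ^ K"
      by (intro allI mult_adj_approximation schwartz_partial_derivs phi)
    then obtain E where E: "\<And>is K y. (1 + norm y) ^ M * norm (mult_adj (?m K) (partial_derivs is \<phi>) y - partial_derivs is \<phi> y) \<le> E is / 2 ^ K"
      by metis
    let ?E = "\<Sum>is | length is \<le> M. \<bar>E is\<bar>"
    have wz: "w (mult_adj (?m K) \<phi>) = 0" for K
    proof -
      have "symbol_fun (?m K) w x = 0" for x
        using symbol_fun_sum_symbol[OF w, of "{..K}" "lp_piece \<phi>0" x] z
        by (simp add: sum_lp_piece schwartz_lp_piece lp_block_eq)
      then have "symbol_fun (?m K) w = (\<lambda>_. 0)" by (rule ext)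
      then have "multiplier (?m K) w = dist_of (\<lambda>_. 0)"
        using multiplier_eq_symbol_fun[OF w mS[of K]] by simp
      from fun_cong[OF this, of \<phi>] show ?thesis
        using phi by (simp add: multiplier_eq[OF mS] on_schwartz_def dist_of_def)
    qed
    have bd: "norm (w \<phi>) \<le> C * (?E / 2 ^ K)" for K
    proof -
      have aS: "mult_adj (?m K) \<phi> \<in> schwartz" by (rule schwartz_mult_adj[OF mS phi])
      have "norm (w (\<lambda>x. mult_adj (?m K) \<phi> x - \<phi> x)) \<le> C * (?E / 2 ^ K)"
      proof (intro C schwartz_diff aS phi)
        fix "is" :: "'n list" and y assume l: "length is \<le> M"
        have "(1 + norm y) ^ M * norm (partial_derivs is (\<lambda>x. mult_adj (?m K) \<phi> x - \<phi> x) y) \<le> E is / 2 ^ K"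
          unfolding partial_derivs_diff[OF aS phi] mult_adj_partial_derivs[OF mS phi, symmetric] by (rule E)
        also have "\<dots> \<le> \<bar>E is\<bar> / 2 ^ K" by (intro divide_right_mono) auto
        also have "\<dots> \<le> ?E / 2 ^ K"
          using l by (intro divide_right_mono member_le_sum) (auto simp: finite_lists_le)
        finally show "(1 + norm y) ^ M * norm (partial_derivs is (\<lambda>x. mult_adj (?m K) \<phi> x - \<phi> x) y) \<le> ?E / 2 ^ K" .
      qed
      then show ?thesis by (simp only: tempered_diff[OF w aS phi] wz) simp
    qed
    have "(\<lambda>K. C * (?E / 2 ^ K)) \<longlonglongrightarrow> C * 0"
      by (intro tendsto_intros LIMSEQ_divide_realpow_zero) simp
    then have "norm (w \<phi>) \<le> C * 0"
      by (rule LIMSEQ_le_const) (use bd in blast)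
    then show ?thesis by simp
  qed
qed

text \<open>One summand of the term n = 0 for r = 1, where the cubes have measure one and no power
  is taken.\<close>

lemma nn_integral_lp_block_le_F_norm:
  fixes \<nu> :: "int ^ 'n"
  shows "(\<integral>\<^sup>+x \<in> dyadic_cube 0 \<nu>. ennreal (norm (lp_block \<phi>0 k u x)) \<partial>lborel) \<le> F_norm \<phi>0 1 u"
proof -
  have "(\<integral>\<^sup>+x \<in> dyadic_cube 0 \<nu>. ennreal (norm (lp_block \<phi>0 k u x)) \<partial>lborel)
    \<le> (\<integral>\<^sup>+x \<in> dyadic_cube 0 \<nu>. (\<Sum>k. ennreal (norm (lp_block \<phi>0 (0 + k) u x) powr 1)) \<partial>lborel)"
  proof (intro nn_integral_mono mult_right_mono)
    fix x
    have "(\<Sum>k\<in>{k}. ennreal (norm (lp_block \<phi>0 (0 + k) u x) powr 1)) \<le> (\<Sum>k. ennreal (norm (lp_block \<phi>0 (0 + k) u x) powr 1))"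
      by (rule sum_le_suminf) auto
    then show "ennreal (norm (lp_block \<phi>0 k u x)) \<le> (\<Sum>k. ennreal (norm (lp_block \<phi>0 (0 + k) u x) powr 1))"
      by (simp only: sum.insert finite.emptyI empty_iff sum.empty add_0_right add_0_left powr_one norm_ge_zero not_False_eq_True)
  qed simp
  also have "\<dots> = ennreal_powr ((\<integral>\<^sup>+x \<in> dyadic_cube 0 \<nu>. (\<Sum>k. ennreal (norm (lp_block \<phi>0 (0 + k) u x) powr 1)) \<partial>lborel)
          / emeasure lborel (dyadic_cube 0 \<nu>)) (1 / 1)"
  proof -
    have e: "emeasure lborel (dyadic_cube 0 \<nu>) = 1" by (simp add: emeasure_dyadic_cube)
    have d: "t / 1 = t" for t :: ennreal
      using divide_ennreal[of _ 1] by (cases t) (auto simp: ennreal_top_divide)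
    show ?thesis unfolding e d div_by_1[where 'a=real] ennreal_powr_one ..
  qed
  also have "\<dots> \<le> F_norm \<phi>0 1 u"
    unfolding F_norm_def by (rule SUP_upper2[where i=0], simp, rule SUP_upper2[where i=\<nu>], simp, rule order.refl)
  finally show ?thesis .
qed

text \<open>The exponent r = 1 suffices. The blocks of u - v have integral zero in modulus over each
  of the countably many unit cubes, hence vanish almost everywhere, and everywhere by
  continuity.\<close>

lemma F_converges_unique:
  assumes u: "F_converges \<phi>0 X u" and v: "F_converges \<phi>0 X v" and X: "\<And>J. X J \<in> tempered"
  shows "u = v"
proof -
  have ut: "u \<in> tempered" and vt: "v \<in> tempered" using u v by (auto simp: F_converges_def)
  have lim: "(\<lambda>J. F_norm \<phi>0 1 (X J - u) + F_norm \<phi>0 1 (X J - v)) \<longlonglongrightarrow> 0 + 0"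
    using u v by (intro tendsto_add) (auto simp: F_converges_def)
  have z: "(\<integral>\<^sup>+x \<in> dyadic_cube 0 \<nu>. ennreal (norm (lp_block \<phi>0 k (u - v) x)) \<partial>lborel) = 0" for k and \<nu> :: "int ^ 'n"
  proof -
    have [measurable]: "lp_block \<phi>0 k (X J - u) \<in> borel_measurable borel" "lp_block \<phi>0 k (X J - v) \<in> borel_measurable borel" for J
      using X ut vt by (auto intro: measurable_lp_block tempered_minus)
    have "(\<integral>\<^sup>+x \<in> dyadic_cube 0 \<nu>. ennreal (norm (lp_block \<phi>0 k (u - v) x)) \<partial>lborel)
      \<le> F_norm \<phi>0 1 (X J - u) + F_norm \<phi>0 1 (X J - v)" for J
    proof -
      have "(\<integral>\<^sup>+x \<in> dyadic_cube 0 \<nu>. ennreal (norm (lp_block \<phi>0 k (u - v) x)) \<partial>lborel)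
        \<le> (\<integral>\<^sup>+x. ennreal (norm (lp_block \<phi>0 k (X J - u) x)) * indicator (dyadic_cube 0 \<nu>) x
            + ennreal (norm (lp_block \<phi>0 k (X J - v) x)) * indicator (dyadic_cube 0 \<nu>) x \<partial>lborel)"
      proof (rule nn_integral_mono)
        fix x
        have "lp_block \<phi>0 k (u - v) x = lp_block \<phi>0 k (X J - v) x - lp_block \<phi>0 k (X J - u) x"
          unfolding lp_block_eq by (simp add: symbol_fun_diff X ut vt schwartz_lp_piece)
        then have "norm (lp_block \<phi>0 k (u - v) x) \<le> norm (lp_block \<phi>0 k (X J - u) x) + norm (lp_block \<phi>0 k (X J - v) x)"
          using norm_triangle_ineq4[of "lp_block \<phi>0 k (X J - v) x" "lp_block \<phi>0 k (X J - u) x"] by simp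
        then show "ennreal (norm (lp_block \<phi>0 k (u - v) x)) * indicator (dyadic_cube 0 \<nu>) x
          \<le> ennreal (norm (lp_block \<phi>0 k (X J - u) x)) * indicator (dyadic_cube 0 \<nu>) x
            + ennreal (norm (lp_block \<phi>0 k (X J - v) x)) * indicator (dyadic_cube 0 \<nu>) x"
          unfolding distrib_right[symmetric] by (intro mult_right_mono) (auto simp: ennreal_leI simp flip: ennreal_plus)
      qed
      also have "\<dots> = (\<integral>\<^sup>+x \<in> dyadic_cube 0 \<nu>. ennreal (norm (lp_block \<phi>0 k (X J - u) x)) \<partial>lborel)
          + (\<integral>\<^sup>+x \<in> dyadic_cube 0 \<nu>. ennreal (norm (lp_block \<phi>0 k (X J - v) x)) \<partial>lborel)"
        by (rule nn_integral_add) measurable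
      also have "\<dots> \<le> F_norm \<phi>0 1 (X J - u) + F_norm \<phi>0 1 (X J - v)"
        by (intro add_mono nn_integral_lp_block_le_F_norm)
      finally show ?thesis .
    qed
    then have "(\<integral>\<^sup>+x \<in> dyadic_cube 0 \<nu>. ennreal (norm (lp_block \<phi>0 k (u - v) x)) \<partial>lborel) \<le> 0 + 0"
      by (intro LIMSEQ_le_const[OF lim]) auto
    then show ?thesis by simp
  qed
  have "norm (lp_block \<phi>0 k (u - v) x) \<le> 0" for k x
  proof (rule norm_le_everywhere_of_AE[OF continuous_lp_block[OF tempered_minus[OF ut vt]]])
    have [measurable]: "lp_block \<phi>0 k (u - v) \<in> borel_measurable borel"
      by (intro measurable_lp_block tempered_minus ut vt)
    have "AE x in lborel. ennreal (norm (lp_block \<phi>0 k (u - v) x)) * indicator (dyadic_cube 0 \<nu>) x = 0" for \<nu> :: "int ^ 'n"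
      using z[of k \<nu>] by (subst (asm) nn_integral_0_iff_AE) auto
    then have "AE x in lborel. \<forall>\<nu>. ennreal (norm (lp_block \<phi>0 k (u - v) x)) * indicator (dyadic_cube 0 \<nu>) x = 0"
      by (simp only: AE_all_countable) simp
    then show "AE x in lborel. norm (lp_block \<phi>0 k (u - v) x) \<le> 0"
    proof eventually_elim
      case (elim x)
      from elim[rule_format, of "cell 0 x"] show ?case by (simp add: mem_dyadic_cube)
    qed
  qed
  then have "u - v = (\<lambda>_. 0)" by (intro lp_blocks_determine tempered_minus ut vt) simp
  then show ?thesis by (simp add: fun_eq_iff)
qed

lemma F_lim_eq:
  "F_converges \<phi>0 X u \<Longrightarrow> (\<And>J. X J \<in> tempered) \<Longrightarrow> F_lim \<phi>0 X = u"
  unfolding F_lim_def by (rule the_equality) (auto intro: F_converges_unique)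

end

section \<open>Conditional expectations and Haar functions\<close>

lemma infsum_single_term:
  fixes f :: "'a \<Rightarrow> complex"
  assumes "\<And>j. j \<noteq> i \<Longrightarrow> f j = 0"
  shows "infsum f UNIV = f i"
proof -
  have "infsum f UNIV = infsum f {i}" by (rule infsum_cong_neutral) (auto simp: assms)
  then show ?thesis by simp
qed

lemma cond_exp_fun_eq:
  fixes g :: "real ^ 'n \<Rightarrow> complex"
  shows "cond_exp_fun N g x = 2 ^ (N * CARD('n)) * (LINT y : dyadic_cube N (cell N x) | lborel. g y)"
  unfolding cond_exp_fun_def
  by (subst infsum_single_term[of "cell N x"]) (auto simp: mem_dyadic_cube indicator_def)

lemma haar_eq_zero:
  assumes "cell N x \<noteq> \<nu>"
  shows "haar N \<nu> \<epsilon> x = 0"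
proof -
  obtain i where i: "\<lfloor>2 ^ N * x $ i\<rfloor> \<noteq> \<nu> $ i" using assms by (auto simp: cell_def vec_eq_iff)
  have "haar1 (\<epsilon> $ i) (2 ^ N * x $ i - of_int (\<nu> $ i)) = 0"
    using i unfolding haar1_def indicator_def by (auto; linarith)
  then show ?thesis unfolding haar_def by (simp add: prod_zero_iff) blast
qed

lemma haar_mult_fun_eq:
  fixes g :: "real ^ 'n \<Rightarrow> complex"
  shows "haar_mult_fun N g a x = (\<Sum>\<epsilon>\<in>Upsilon. a (cell N x) \<epsilon> * 2 ^ (N * CARD('n)) *
    (\<integral>y. g y * haar N (cell N x) \<epsilon> y \<partial>lborel) * haar N (cell N x) \<epsilon> x)"
  unfolding haar_mult_fun_def
  by (intro sum.cong refl, subst infsum_single_term[of "cell N x"]) (auto simp: haar_eq_zero)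

lemma floor_div_two: "\<lfloor>t\<rfloor> = \<lfloor>2 * t\<rfloor> div 2" for t :: real
  by linarith

lemma cell_Suc_component: "cell N x $ i = cell (Suc N) x $ i div 2"
  unfolding cell_def using floor_div_two[of "2 ^ N * x $ i"] by (simp add: mult.assoc)

lemma cell_eq_of_cell_Suc: "cell (Suc N) x = cell (Suc N) y \<Longrightarrow> cell N x = cell N y"
  by (simp add: vec_eq_iff cell_Suc_component[of N])

text \<open>Both profiles jump only at multiples of 1/2, hence the Haar functions of generation N
  are constant on the cubes of generation N + 1.\<close>

lemma haar1_cong_floor:
  assumes "\<lfloor>2 * s\<rfloor> = \<lfloor>2 * t\<rfloor>"
  shows "haar1 e s = haar1 e t"
proof -
  have "s \<in> {0..<1/2} \<longleftrightarrow> \<lfloor>2 * s\<rfloor> = 0" "s \<in> {1/2..<1} \<longleftrightarrow> \<lfloor>2 * s\<rfloor> = 1"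
    "s \<in> {0..<1} \<longleftrightarrow> \<lfloor>2 * s\<rfloor> = 0 \<or> \<lfloor>2 * s\<rfloor> = 1" for s :: real
    by (auto simp: floor_eq_iff)
  then show ?thesis using assms by (simp only: haar1_def indicator_def)
qed

lemma haar_cell_Suc:
  fixes x y :: "real ^ 'n"
  assumes "cell (Suc N) x = cell (Suc N) y"
  shows "haar N \<nu> \<epsilon> x = haar N \<nu> \<epsilon> y"
proof -
  have "haar1 (\<epsilon> $ i) (2 ^ N * x $ i - of_int (\<nu> $ i)) = haar1 (\<epsilon> $ i) (2 ^ N * y $ i - of_int (\<nu> $ i))" for i
  proof -
    have "\<lfloor>2 * (2 ^ N * x $ i - of_int (\<nu> $ i))\<rfloor> = cell (Suc N) x $ i - 2 * \<nu> $ i" for x :: "real ^ 'n"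
      using floor_diff_of_int[of "2 * (2 ^ N * x $ i)" "2 * \<nu> $ i"]
      by (simp add: cell_def right_diff_distrib mult.assoc)
    then show ?thesis using assms by (intro haar1_cong_floor) simp
  qed
  then show ?thesis by (simp add: haar_def)
qed

lemma norm_haar_le: "norm (haar N \<nu> \<epsilon> x) \<le> 1"
proof -
  have "\<bar>haar1 e t\<bar> \<le> 1" for e t by (auto simp: haar1_def indicator_def)
  then have "(\<Prod>i\<in>UNIV. \<bar>haar1 (\<epsilon> $ i) (2 ^ N * x $ i - of_int (\<nu> $ i))\<bar>) \<le> 1"
    by (intro prod_le_1) auto
  then show ?thesis unfolding haar_def norm_of_real abs_prod .
qed

lemma haar_measurable [measurable]: "haar N \<nu> \<epsilon> \<in> borel_measurable borel"
  by (rule cell_constant_measurable[of "Suc N"]) (rule haar_cell_Suc)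

lemma integrable_haar: "integrable lborel (haar N \<nu> \<epsilon> :: real ^ 'n \<Rightarrow> complex)"
proof (rule Bochner_Integration.integrable_bound)
  show "integrable lborel (indicator (dyadic_cube N \<nu>) :: real ^ 'n \<Rightarrow> real)"
    by (simp add: integrable_indicator_iff emeasure_dyadic_cube)
  have "norm (haar N \<nu> \<epsilon> x) \<le> norm (indicator (dyadic_cube N \<nu>) x :: real)" for x :: "real ^ 'n"
    using norm_haar_le[of N \<nu> \<epsilon> x] haar_eq_zero[of N x \<nu> \<epsilon>] by (auto simp: indicator_def mem_dyadic_cube)
  then show "AE x in lborel. norm (haar N \<nu> \<epsilon> x) \<le> norm (indicator (dyadic_cube N \<nu>) x :: real)" by simp
qed simp

lemma integrable_indicator_Ico: "integrable lborel (indicator {a..<b::real} :: real \<Rightarrow> real)"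
  by (cases "a \<le> b") (simp_all add: integrable_indicator_iff)

lemma integrable_haar1: "integrable lborel (haar1 e)"
  unfolding haar1_def[abs_def]
  by (cases e) (auto intro!: Bochner_Integration.integrable_diff integrable_indicator_Ico)

text \<open>Membership in \<open>Upsilon\<close> provides a coordinate carrying the oscillating
  profile; its integral is one factor of the product and vanishes.\<close>

lemma integral_haar:
  assumes "\<epsilon> \<in> Upsilon"
  shows "(\<integral>x. haar N \<nu> \<epsilon> x \<partial>lborel) = 0"
proof -
  obtain i where i: "\<epsilon> $ i" using assms by (auto simp: Upsilon_def vec_eq_iff)
  have int: "integrable lborel (\<lambda>s. haar1 e (- of_int j + 2 ^ N * s))" for e and j :: int
    by (rule lborel_integrable_real_affine[OF integrable_haar1]) simp
  have "(\<integral>s. haar1 True s \<partial>lborel) = 0"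
    unfolding haar1_def
    by (simp only: if_True, subst Bochner_Integration.integral_diff) (auto simp: integrable_indicator_Ico)
  then have z: "(\<integral>s. haar1 True (- of_int j + 2 ^ N * s) \<partial>lborel) = 0" for j :: int
    using lborel_integral_real_affine[of "2 ^ N" "haar1 True" "- of_int j"] by simp
  have "(\<integral>x. haar N \<nu> \<epsilon> x \<partial>lborel)
    = (\<integral>x. (\<Prod>i\<in>UNIV. complex_of_real (haar1 (\<epsilon> $ i) (- of_int (\<nu> $ i) + 2 ^ N * x $ i))) \<partial>lborel)"
    by (simp add: haar_def algebra_simps)
  also have "\<dots> = (\<Prod>i\<in>UNIV. \<integral>s. complex_of_real (haar1 (\<epsilon> $ i) (- of_int (\<nu> $ i) + 2 ^ N * s)) \<partial>lborel)"
    by (rule integral_prod_vec(2)) (intro integrable_of_real int)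
  also have "\<dots> = 0"
  proof (intro prod_zero bexI[of _ i])
    show "(\<integral>s. complex_of_real (haar1 (\<epsilon> $ i) (- of_int (\<nu> $ i) + 2 ^ N * s)) \<partial>lborel) = 0"
      using i z[of "\<nu> $ i"] by simp
  qed auto
  finally show ?thesis .
qed

lemma integrable_bounded_on_cube:
  fixes F :: "real ^ 'n \<Rightarrow> complex"
  assumes "F \<in> borel_measurable borel" "\<And>x. norm (F x) \<le> A"
  shows "integrable lborel (\<lambda>x. indicator (dyadic_cube N \<nu>) x *\<^sub>R F x)"
proof (rule Bochner_Integration.integrable_bound)
  show "integrable lborel (\<lambda>x. A * indicator (dyadic_cube N \<nu>) x)"
    by (intro integrable_mult_right) (simp add: integrable_indicator_iff emeasure_dyadic_cube)
  show "(\<lambda>x. indicator (dyadic_cube N \<nu>) x *\<^sub>R F x) \<in> borel_measurable lborel" using assms(1) by measurable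
  show "AE x in lborel. norm (indicator (dyadic_cube N \<nu>) x *\<^sub>R F x) \<le> norm (A * indicator (dyadic_cube N \<nu>) x)"
    using order.trans[OF assms(2) abs_ge_self] by (auto simp: indicator_def)
qed

lemma norm_set_integral_cube_le:
  fixes F :: "real ^ 'n \<Rightarrow> complex"
  assumes F: "F \<in> borel_measurable borel" "\<And>x. norm (F x) \<le> A'"
    and A: "\<And>x. x \<in> dyadic_cube N \<nu> \<Longrightarrow> norm (F x) \<le> A"
  shows "norm (LINT x : dyadic_cube N \<nu> | lborel. F x) \<le> A / 2 ^ (N * CARD('n))"
proof -
  have "norm (LINT x : dyadic_cube N \<nu> | lborel. F x) \<le> (\<integral>x. A * indicator (dyadic_cube N \<nu>) x \<partial>lborel)"
    unfolding set_lebesgue_integral_def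
  proof (rule Bochner_Integration.integral_norm_bound_integral[OF integrable_bounded_on_cube[OF F]])
    show "integrable lborel (\<lambda>x. A * indicator (dyadic_cube N \<nu>) x)"
      by (intro integrable_mult_right) (simp add: integrable_indicator_iff emeasure_dyadic_cube)
    show "norm (indicator (dyadic_cube N \<nu>) x *\<^sub>R F x) \<le> A * indicator (dyadic_cube N \<nu>) x" for x
      using A by (auto simp: indicator_def)
  qed
  also have "\<dots> = A / 2 ^ (N * CARD('n))" by (simp add: measure_dyadic_cube)
  finally show ?thesis .
qed

definition children :: "int ^ 'n \<Rightarrow> (int ^ 'n) set" where
  "children \<nu> = range (\<lambda>\<sigma> :: bool ^ 'n. \<chi> i. 2 * \<nu> $ i + of_bool (\<sigma> $ i))"

lemma finite_children: "finite (children \<nu>)"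
  by (simp add: children_def)

lemma card_children_le: "card (children (\<nu> :: int ^ 'n)) \<le> 2 ^ CARD('n)"
  using card_image_le[of "UNIV :: (bool ^ 'n) set" "\<lambda>\<sigma>. \<chi> i. 2 * \<nu> $ i + of_bool (\<sigma> $ i)"]
  by (simp add: children_def)

lemma mem_children: "\<mu> \<in> children \<nu> \<longleftrightarrow> (\<forall>i. \<mu> $ i div 2 = \<nu> $ i)"
proof
  assume "\<forall>i. \<mu> $ i div 2 = \<nu> $ i"
  then have "\<mu> $ i = 2 * \<nu> $ i + of_bool (odd (\<mu> $ i))" for i
    by (metis mult_div_mod_eq of_bool_odd_eq_mod_2)
  then have "\<mu> = (\<chi> i. 2 * \<nu> $ i + of_bool ((\<chi> i. odd (\<mu> $ i)) $ i))" by (simp add: vec_eq_iff)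
  then show "\<mu> \<in> children \<nu>" unfolding children_def by (rule range_eqI)
qed (auto simp: children_def)

lemma dyadic_cube_children: "x \<in> dyadic_cube N \<nu> \<longleftrightarrow> cell (Suc N) x \<in> children \<nu>"
  by (auto simp: mem_dyadic_cube mem_children vec_eq_iff cell_Suc_component[of N])

lemma set_integral_children:
  fixes F :: "real ^ 'n \<Rightarrow> complex"
  assumes F: "F \<in> borel_measurable borel" "\<And>x. norm (F x) \<le> A"
  shows "(LINT x : dyadic_cube N \<nu> | lborel. F x) = (\<Sum>\<mu>\<in>children \<nu>. LINT x : dyadic_cube (Suc N) \<mu> | lborel. F x)"
proof -
  have i: "integrable lborel (\<lambda>x. indicator (dyadic_cube M \<mu>) x *\<^sub>R F x)" for M \<mu>
    by (rule integrable_bounded_on_cube) (use F in auto)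
  have "indicator (dyadic_cube N \<nu>) x *\<^sub>R F x = (\<Sum>\<mu>\<in>children \<nu>. indicator (dyadic_cube (Suc N) \<mu>) x *\<^sub>R F x)" for x
    by (simp add: indicator_def dyadic_cube_children[of x N \<nu>] mem_dyadic_cube[of x "Suc N"] finite_children if_distrib
        flip: scaleR_sum_left cong: if_cong)
  then show ?thesis
    unfolding set_lebesgue_integral_def using i by (simp add: Bochner_Integration.integral_sum)
qed


lemma set_integral_cube_const:
  fixes F :: "real ^ 'n \<Rightarrow> complex"
  assumes "\<And>x. x \<in> dyadic_cube N \<nu> \<Longrightarrow> F x = c"
  shows "(LINT x : dyadic_cube N \<nu> | lborel. F x) = c / 2 ^ (N * CARD('n))"
proof -
  have "(LINT x : dyadic_cube N \<nu> | lborel. F x) = (LINT x : dyadic_cube N \<nu> | lborel. c)"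
    by (rule set_lebesgue_integral_cong) (auto simp: assms)
  also have "\<dots> = c / 2 ^ (N * CARD('n))"
    by (simp add: set_lebesgue_integral_def emeasure_dyadic_cube measure_dyadic_cube scaleR_conv_of_real)
  finally show ?thesis .
qed

lemma cond_exp_fun_cell: "cell N x = cell N y \<Longrightarrow> cond_exp_fun N g x = cond_exp_fun N g y"
  by (simp add: cond_exp_fun_eq)

lemma cond_exp_fun_measurable: "cond_exp_fun N g \<in> borel_measurable borel"
  by (rule cell_constant_measurable[of N]) (rule cond_exp_fun_cell)

lemma set_integral_cond_exp_fun:
  fixes g :: "real ^ 'n \<Rightarrow> complex"
  shows "(LINT x : dyadic_cube N \<nu> | lborel. cond_exp_fun N g x) = (LINT x : dyadic_cube N \<nu> | lborel. g x)"
  by (subst set_integral_cube_const[of N \<nu> _ "2 ^ (N * CARD('n)) * (LINT y : dyadic_cube N \<nu> | lborel. g y)"])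
    (simp_all add: cond_exp_fun_eq mem_dyadic_cube)

text \<open>Averaging does not increase the distance to a constant. With c = 0 this is the sup
  bound; with c the value of g at x it turns a Lipschitz estimate for g into closeness of its
  average to g.\<close>

lemma norm_cond_exp_fun_diff_le:
  fixes g :: "real ^ 'n \<Rightarrow> complex"
  assumes g: "g \<in> borel_measurable borel" "\<And>x. norm (g x) \<le> A'"
    and A: "\<And>y. cell N y = cell N x \<Longrightarrow> norm (g y - c) \<le> A"
  shows "norm (cond_exp_fun N g x - c) \<le> A"
proof -
  have "(LINT y : dyadic_cube N (cell N x) | lborel. g y - c)
    = (LINT y : dyadic_cube N (cell N x) | lborel. g y) - (LINT y : dyadic_cube N (cell N x) | lborel. c)"
    by (rule set_integral_diff) (auto simp: set_integrable_def intro!: integrable_bounded_on_cube g)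
  also have "(LINT y : dyadic_cube N (cell N x) | lborel. c) = c / 2 ^ (N * CARD('n))"
    by (rule set_integral_cube_const) simp
  finally have "cond_exp_fun N g x - c = 2 ^ (N * CARD('n)) * (LINT y : dyadic_cube N (cell N x) | lborel. g y - c)"
    by (simp add: cond_exp_fun_eq right_diff_distrib)
  also have "norm \<dots> \<le> 2 ^ (N * CARD('n)) * (A / 2 ^ (N * CARD('n)))"
    unfolding norm_mult norm_power
  proof (intro mult_mono norm_set_integral_cube_le)
    show "(\<lambda>y. g y - c) \<in> borel_measurable borel" using g by simp
    show "norm (g y - c) \<le> A' + norm c" for y using norm_triangle_ineq4[of "g y" c] g(2)[of y] by linarith
    show "norm (g y - c) \<le> A" if "y \<in> dyadic_cube N (cell N x)" for y using that A by (simp add: mem_dyadic_cube)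
  qed auto
  finally show ?thesis by simp
qed

lemma norm_cond_exp_fun_le:
  fixes g :: "real ^ 'n \<Rightarrow> complex"
  assumes "g \<in> borel_measurable borel" "\<And>x. norm (g x) \<le> A"
  shows "norm (cond_exp_fun N g x) \<le> A"
  using norm_cond_exp_fun_diff_le[OF assms, of N x 0 A] assms(2) by simp

lemma cond_exp_fun_diff:
  fixes g h :: "real ^ 'n \<Rightarrow> complex"
  assumes "g \<in> borel_measurable borel" "\<And>x. norm (g x) \<le> A" "h \<in> borel_measurable borel" "\<And>x. norm (h x) \<le> A'"
  shows "cond_exp_fun N g x - cond_exp_fun N h x = cond_exp_fun N (\<lambda>x. g x - h x) x"
  unfolding cond_exp_fun_eq right_diff_distrib[symmetric]
  using integrable_bounded_on_cube[OF assms(1,2), of N "cell N x"] integrable_bounded_on_cube[OF assms(3,4), of N "cell N x"]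
  by (subst set_integral_diff) (simp_all add: set_integrable_def)

text \<open>The martingale property: averaging over the finer cubes and over the coarser ones both
  preserve the integral over a coarser cube.\<close>

lemma set_integral_cond_exp_increment:
  fixes g :: "real ^ 'n \<Rightarrow> complex"
  assumes g: "g \<in> borel_measurable borel" "\<And>x. norm (g x) \<le> A"
  shows "(LINT x : dyadic_cube M \<nu> | lborel. cond_exp_fun (Suc M) g x - cond_exp_fun M g x) = 0"
proof -
  have i: "set_integrable lborel (dyadic_cube M \<nu>) (cond_exp_fun N g)" for N
    unfolding set_integrable_def
    by (rule integrable_bounded_on_cube[OF cond_exp_fun_measurable norm_cond_exp_fun_le[OF g]])
  have "(LINT x : dyadic_cube M \<nu> | lborel. cond_exp_fun (Suc M) g x) = (LINT x : dyadic_cube M \<nu> | lborel. g x)"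
    by (subst set_integral_children[OF g],
        subst set_integral_children[OF cond_exp_fun_measurable norm_cond_exp_fun_le[OF g]],
        simp only: set_integral_cond_exp_fun)
  then show ?thesis
    by (subst set_integral_diff[OF i i]) (simp add: set_integral_cond_exp_fun)
qed

section \<open>Haar coefficients\<close>

lemma integral_mult_haar:
  fixes g :: "real ^ 'n \<Rightarrow> complex"
  shows "(\<integral>y. g y * haar N \<nu> \<epsilon> y \<partial>lborel) = (LINT y : dyadic_cube N \<nu> | lborel. g y * haar N \<nu> \<epsilon> y)"
  unfolding set_lebesgue_integral_def
  by (rule Bochner_Integration.integral_cong) (auto simp: indicator_def mem_dyadic_cube haar_eq_zero)

text \<open>On each of the at most 2^d children the Haar function is a constant of modulus at most
  one, so the coefficient is controlled by the integrals of g over cubes of generation N + 1. This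
  form exploits the cancellation of increments with J >= N.\<close>

lemma norm_integral_mult_haar_le:
  fixes g :: "real ^ 'n \<Rightarrow> complex"
  assumes g: "g \<in> borel_measurable borel" "\<And>x. norm (g x) \<le> A'"
    and A: "\<And>\<mu>. norm (LINT y : dyadic_cube (Suc N) \<mu> | lborel. g y) \<le> A"
  shows "norm (\<integral>y. g y * haar N \<nu> \<epsilon> y \<partial>lborel) \<le> 2 ^ CARD('n) * A"
proof -
  have A0: "0 \<le> A" using order.trans[OF norm_ge_zero A] .
  have gh: "norm (g y * haar N \<nu> \<epsilon> y) \<le> A'" for y
    using mult_mono[OF g(2)[of y] norm_haar_le[of N \<nu> \<epsilon> y]] order.trans[OF norm_ge_zero g(2)]
    by (simp add: norm_mult)
  have "(\<integral>y. g y * haar N \<nu> \<epsilon> y \<partial>lborel) = (\<Sum>\<mu>\<in>children \<nu>. LINT y : dyadic_cube (Suc N) \<mu> | lborel. g y * haar N \<nu> \<epsilon> y)"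
    unfolding integral_mult_haar using g by (intro set_integral_children[OF _ gh]) simp
  also have "norm \<dots> \<le> (\<Sum>\<mu>\<in>children \<nu>. A)"
  proof (rule sum_norm_le)
    fix \<mu>
    have "(LINT y : dyadic_cube (Suc N) \<mu> | lborel. g y * haar N \<nu> \<epsilon> y)
      = (LINT y : dyadic_cube (Suc N) \<mu> | lborel. g y * haar N \<nu> \<epsilon> (corner (Suc N) \<mu>))"
    proof (rule set_lebesgue_integral_cong)
      show "\<forall>y. y \<in> dyadic_cube (Suc N) \<mu> \<longrightarrow> g y * haar N \<nu> \<epsilon> y = g y * haar N \<nu> \<epsilon> (corner (Suc N) \<mu>)"
        by (auto simp: mem_dyadic_cube intro!: haar_cell_Suc)
    qed simp
    also have "norm \<dots> \<le> A * 1"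
      unfolding set_integral_mult_left norm_mult by (intro mult_mono A norm_haar_le A0) simp
    finally show "norm (LINT y : dyadic_cube (Suc N) \<mu> | lborel. g y * haar N \<nu> \<epsilon> y) \<le> A" by simp
  qed
  also have "\<dots> \<le> 2 ^ CARD('n) * A"
  proof -
    have "real (card (children \<nu>)) \<le> real (2 ^ CARD('n))" by (intro of_nat_mono card_children_le)
    then show ?thesis using A0 by (simp add: mult_right_mono)
  qed
  finally show ?thesis .
qed

lemma integrable_mult_haar:
  assumes "g \<in> borel_measurable borel" "\<And>x. norm (g x) \<le> A"
  shows "integrable lborel (\<lambda>y. g y * haar N \<nu> \<epsilon> y)"
  by (rule integrable_bounded_mult(2)[OF integrable_haar _ assms(2)]) (simp add: assms(1))

text \<open>The mean zero of the Haar function permits subtracting a constant from g; only its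
  oscillation on the cube counts, which matters because the projections have no uniform sup
  bound.\<close>

lemma norm_integral_mult_haar_osc_le:
  fixes g :: "real ^ 'n \<Rightarrow> complex"
  assumes g: "g \<in> borel_measurable borel" "\<And>x. norm (g x) \<le> A'" and e: "\<epsilon> \<in> Upsilon"
    and A: "\<And>y. cell N y = \<nu> \<Longrightarrow> norm (g y - c) \<le> A"
  shows "norm (\<integral>y. g y * haar N \<nu> \<epsilon> y \<partial>lborel) \<le> A / 2 ^ (N * CARD('n))"
proof -
  have A0: "0 \<le> A" using order.trans[OF norm_ge_zero A[of "corner N \<nu>"]] by simp
  have gb: "norm (g y - c) \<le> A' + norm c" for y using norm_triangle_ineq4[of "g y" c] g(2)[of y] by linarith
  have gh: "norm ((g y - c) * haar N \<nu> \<epsilon> y) \<le> A' + norm c" for y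
    using mult_mono[OF gb[of y] norm_haar_le[of N \<nu> \<epsilon> y]] order.trans[OF norm_ge_zero gb]
    by (simp add: norm_mult)
  have "(\<integral>y. g y * haar N \<nu> \<epsilon> y \<partial>lborel) = (\<integral>y. (g y - c) * haar N \<nu> \<epsilon> y \<partial>lborel)"
    unfolding left_diff_distrib
    by (subst Bochner_Integration.integral_diff) (auto intro!: integrable_mult_haar g integrable_haar simp: integral_haar[OF e])
  also have "\<dots> = (LINT y : dyadic_cube N \<nu> | lborel. (g y - c) * haar N \<nu> \<epsilon> y)" by (rule integral_mult_haar)
  also have "norm \<dots> \<le> A / 2 ^ (N * CARD('n))"
  proof (rule norm_set_integral_cube_le[OF _ gh])
    fix y assume "y \<in> dyadic_cube N \<nu>"
    then have "norm (g y - c) \<le> A" by (intro A) (simp add: mem_dyadic_cube)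
    then show "norm ((g y - c) * haar N \<nu> \<epsilon> y) \<le> A"
      using mult_mono[OF _ norm_haar_le[of N \<nu> \<epsilon> y], of "norm (g y - c)" A] A0 by (simp add: norm_mult)
  qed (use g in simp)
  finally show ?thesis .
qed

lemma haar_mult_fun_cell_Suc:
  assumes "cell (Suc N) x = cell (Suc N) y"
  shows "haar_mult_fun N g a x = haar_mult_fun N g a y"
  unfolding haar_mult_fun_eq cell_eq_of_cell_Suc[OF assms]
  by (simp only: haar_cell_Suc[OF assms])

lemma haar_mult_fun_diff:
  fixes g h :: "real ^ 'n \<Rightarrow> complex"
  assumes "g \<in> borel_measurable borel" "\<And>x. norm (g x) \<le> A" "h \<in> borel_measurable borel" "\<And>x. norm (h x) \<le> A'"
  shows "haar_mult_fun N g a x - haar_mult_fun N h a x = haar_mult_fun N (\<lambda>x. g x - h x) a x"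
  unfolding haar_mult_fun_eq sum_subtractf[symmetric] left_diff_distrib[of _ _ "haar _ _ _ _"]
  by (intro sum.cong refl, subst Bochner_Integration.integral_diff)
    (auto intro!: integrable_mult_haar assms simp: algebra_simps)

text \<open>At each point only the cube containing it contributes, with fewer than 2^d types of Haar
  function, so no summation over the lattice is involved.\<close>

lemma norm_haar_mult_fun_le:
  fixes g :: "real ^ 'n \<Rightarrow> complex"
  assumes a: "\<And>\<nu> \<epsilon>. \<epsilon> \<in> Upsilon \<Longrightarrow> norm (a \<nu> \<epsilon>) \<le> 1"
    and A: "\<And>\<nu> \<epsilon>. \<epsilon> \<in> Upsilon \<Longrightarrow> norm (\<integral>y. g y * haar N \<nu> \<epsilon> y \<partial>lborel) \<le> A / 2 ^ (N * CARD('n))"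
    and A0: "0 \<le> A"
  shows "norm (haar_mult_fun N g a x) \<le> 2 ^ CARD('n) * A"
proof -
  have "norm (haar_mult_fun N g a x) \<le> (\<Sum>\<epsilon>\<in>(Upsilon :: (bool ^ 'n) set). A)"
    unfolding haar_mult_fun_eq
  proof (rule sum_norm_le)
    fix \<epsilon> :: "bool ^ 'n" assume e: "\<epsilon> \<in> Upsilon"
    have "norm (a (cell N x) \<epsilon> * 2 ^ (N * CARD('n)) * (\<integral>y. g y * haar N (cell N x) \<epsilon> y \<partial>lborel) * haar N (cell N x) \<epsilon> x)
      \<le> 1 * 2 ^ (N * CARD('n)) * (A / 2 ^ (N * CARD('n))) * 1"
      unfolding norm_mult norm_power using A0 by (intro mult_mono a A e norm_haar_le) auto
    then show "norm (a (cell N x) \<epsilon> * 2 ^ (N * CARD('n)) * (\<integral>y. g y * haar N (cell N x) \<epsilon> y \<partial>lborel) * haar N (cell N x) \<epsilon> x) \<le> A"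
      by simp
  qed
  also have "\<dots> \<le> 2 ^ CARD('n) * A"
  proof -
    have "card (Upsilon :: (bool ^ 'n) set) \<le> card (UNIV :: (bool ^ 'n) set)" by (intro card_mono) auto
    then have "real (card (Upsilon :: (bool ^ 'n) set)) \<le> real (2 ^ CARD('n))" by (intro of_nat_mono) simp
    then show ?thesis using A0 by (simp add: mult_right_mono)
  qed
  finally show ?thesis .
qed

lemma set_integral_haar_mult_fun:
  fixes g :: "real ^ 'n \<Rightarrow> complex"
  shows "(LINT x : dyadic_cube N \<nu> | lborel. haar_mult_fun N g a x) = 0"
proof -
  let ?c = "\<lambda>\<epsilon>. a \<nu> \<epsilon> * 2 ^ (N * CARD('n)) * (\<integral>y. g y * haar N \<nu> \<epsilon> y \<partial>lborel)"
  have "(LINT x : dyadic_cube N \<nu> | lborel. haar_mult_fun N g a x) = (\<integral>x. (\<Sum>\<epsilon>\<in>Upsilon. ?c \<epsilon> * haar N \<nu> \<epsilon> x) \<partial>lborel)"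
    unfolding set_lebesgue_integral_def
    by (rule Bochner_Integration.integral_cong)
      (auto simp: indicator_def mem_dyadic_cube haar_mult_fun_eq haar_eq_zero)
  also have "\<dots> = (\<Sum>\<epsilon>\<in>Upsilon. \<integral>x. ?c \<epsilon> * haar N \<nu> \<epsilon> x \<partial>lborel)"
    by (rule Bochner_Integration.integral_sum) (intro integrable_mult_right integrable_haar)
  also have "\<dots> = 0" by (intro sum.neutral) (simp add: integral_haar)
  finally show ?thesis .
qed

section \<open>The approximation family\<close>

lemma conv_diff:
  assumes K: "K \<in> schwartz" and g: "g \<in> borel_measurable borel" "\<And>y. norm (g y) \<le> A"
    and h: "h \<in> borel_measurable borel" "\<And>y. norm (h y) \<le> B"
  shows "conv K (\<lambda>y. g y - h y) x = conv K g x - conv K h x"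
  unfolding conv_def right_diff_distrib
  by (rule Bochner_Integration.integral_diff[OF integrable_conv[OF K g] integrable_conv[OF K h]])

lemma nonneg_of_mult_half_power:
  assumes "0 \<le> c * (1/2 :: real) ^ J"
  shows "0 \<le> c"
  using mult_nonneg_nonneg[OF assms, of "2 ^ J"] by (simp add: power_one_over)

text \<open>A geometric series, kept finite so that it applies both to sequences with a limit and to
  finite chains of generations.\<close>

lemma norm_telescope_le:
  fixes h :: "nat \<Rightarrow> 'a::real_normed_vector"
  assumes inc: "\<And>j. J \<le> j \<Longrightarrow> norm (h (Suc j) - h j) \<le> c * (1/2) ^ j" and JJ: "J \<le> J'"
  shows "norm (h J' - h J) \<le> 2 * c * (1/2) ^ J"
proof -
  have c: "0 \<le> c" using order.trans[OF norm_ge_zero inc[OF order.refl]] by (rule nonneg_of_mult_half_power)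
  \<comment> \<open>The subtracted term makes the bound inductive: each step uses up exactly half of
    what remains.\<close>
  have "norm (h (J + m) - h J) \<le> 2 * c * (1/2) ^ J - 2 * c * (1/2) ^ (J + m)" for m
  proof (induction m)
    case (Suc m)
    have "norm (h (J + Suc m) - h J) \<le> norm (h (Suc (J + m)) - h (J + m)) + norm (h (J + m) - h J)"
      using norm_triangle_ineq[of "h (Suc (J + m)) - h (J + m)" "h (J + m) - h J"] by simp
    also have "\<dots> \<le> c * (1/2) ^ (J + m) + (2 * c * (1/2) ^ J - 2 * c * (1/2) ^ (J + m))"
      by (intro add_mono inc Suc) simp
    finally show ?case by (simp add: algebra_simps)
  qed simp
  from this[of "J' - J"] JJ have "norm (h J' - h J) \<le> 2 * c * (1/2) ^ J - 2 * c * (1/2) ^ J'" by simp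
  also have "\<dots> \<le> 2 * c * (1/2) ^ J" using c by simp
  finally show ?thesis .
qed

text \<open>The properties of the family of smooth projections \<open>P\<^sub>J\<close> that the operators depend on; the
  kernels in the last two clauses are those of the blocks \<open>\<Delta>\<^sub>k\<close>.\<close>

definition tame :: "(real ^ 'n \<Rightarrow> complex) \<Rightarrow> real \<Rightarrow> (nat \<Rightarrow> real ^ 'n \<Rightarrow> complex) \<Rightarrow> bool" where
  "tame \<phi>0 B P \<longleftrightarrow> 0 \<le> B \<and>
    (\<forall>J. P J \<in> borel_measurable borel) \<and> (\<forall>J. \<exists>A. \<forall>x. norm (P J x) \<le> A) \<and>
    (\<forall>J x. norm (P (Suc J) x - P J x) \<le> B) \<and>
    (\<forall>J x y. norm (P J x - P J y) \<le> B * 2 ^ J * norm (x - y)) \<and>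
    (\<forall>J N \<nu>. norm (LINT x : dyadic_cube N \<nu> | lborel. P (Suc J) x - P J x) \<le> B * (2 ^ N / 2 ^ J) / 2 ^ (N * CARD('n))) \<and>
    (\<forall>N J k x. k \<le> N \<longrightarrow> N \<le> J \<longrightarrow>
      norm (conv (dil k (inv_fourier (lp_base \<phi>0 k))) (P J) x - conv (dil k (inv_fourier (lp_base \<phi>0 k))) (P N) x) \<le> B * (2 ^ k / 2 ^ N)) \<and>
    (\<forall>N k x. N < k \<longrightarrow> conv (dil k (inv_fourier (lp_base \<phi>0 k))) (P N) x = 0)"

lemma
  fixes \<phi>0 :: "real ^ 'n \<Rightarrow> complex"
  assumes "tame \<phi>0 B P"
  shows tame_lipschitz: "norm (P J x - P J y) \<le> B * 2 ^ J * norm (x - y)"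
    and tame_average: "norm (LINT x : dyadic_cube N \<nu> | lborel. P (Suc J) x - P J x) \<le> B * (2 ^ N / 2 ^ J) / 2 ^ (N * CARD('n))"
  using assms by (simp_all add: tame_def)

lemma tame_bounded:
  assumes "tame \<phi>0 B P"
  shows "\<exists>A. \<forall>J x. norm (P J x) \<le> A J"
proof -
  have "\<forall>J. \<exists>A. \<forall>x. norm (P J x) \<le> A" using assms by (simp add: tame_def)
  then show ?thesis by (rule choice)
qed

context
  fixes \<phi>0 :: "real ^ 'n \<Rightarrow> complex"
  assumes lp: "lp_cutoff \<phi>0"
begin

abbreviation block_kernel :: "nat \<Rightarrow> real ^ 'n \<Rightarrow> complex" where
  "block_kernel k \<equiv> dil k (inv_fourier (lp_base \<phi>0 k))"

lemma schwartz_base_kernel: "inv_fourier (lp_base \<phi>0 k) \<in> schwartz"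
  by (intro schwartz_inv_fourier schwartz_lp_base lp)

lemma schwartz_block_kernel: "block_kernel k \<in> schwartz"
  by (intro schwartz_dil schwartz_base_kernel)

lemma lp_base_cases:
  obtains "lp_base \<phi>0 k = lp_base \<phi>0 0" | "0 < k" "lp_base \<phi>0 k = lp_base \<phi>0 1"
  using lp_base_pos[of k \<phi>0] by (cases "k = 0") auto

text \<open>By \<open>lp_base_cases\<close> only two kernels occur up to dilation, and dilation
  preserves their L^1 norms; the sum of the two norms is uniform in k.\<close>

lemma block_kernel_bound:
  "\<exists>C\<ge>0. \<forall>k g A x. g \<in> borel_measurable borel \<longrightarrow> (\<forall>y. norm (g y) \<le> A) \<longrightarrow> norm (conv (block_kernel k) g x) \<le> C * A"
proof -
  let ?I = "\<lambda>k. \<integral>z. norm (inv_fourier (lp_base \<phi>0 k) z) \<partial>lborel"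
  have I: "0 \<le> ?I k" for k by simp
  have "norm (conv (block_kernel k) g x) \<le> (?I 0 + ?I 1) * A"
    if g: "g \<in> borel_measurable borel" "\<And>y. norm (g y) \<le> A" for k g A x
  proof -
    have A: "0 \<le> A" using order.trans[OF norm_ge_zero g(2)] .
    have "norm (conv (block_kernel k) g x) \<le> ?I k * A" by (rule norm_conv_dil_le[OF schwartz_base_kernel g])
    also have "?I k \<le> ?I 0 + ?I 1" by (cases k rule: lp_base_cases) (use I[of 0] I[of 1] in auto)
    finally show ?thesis using A by (simp add: mult_right_mono)
  qed
  then show ?thesis using I by (intro exI[of _ "?I 0 + ?I 1"]) auto
qed

lemma block_kernel_mean_zero_bound:
  "\<exists>C\<ge>0. \<forall>k M h A x. k \<le> M \<longrightarrow> h \<in> borel_measurable borel \<longrightarrow> (\<forall>y. norm (h y) \<le> A) \<longrightarrow>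
    (\<forall>\<nu>. (LINT y : dyadic_cube M \<nu> | lborel. h y) = 0) \<longrightarrow> norm (conv (block_kernel k) h x) \<le> C * A * 2 ^ k / 2 ^ M"
proof -
  have "\<forall>j. \<exists>C\<ge>0. \<forall>k M h A x. k \<le> M \<longrightarrow> h \<in> borel_measurable borel \<longrightarrow> (\<forall>y. norm (h y) \<le> A) \<longrightarrow>
    (\<forall>\<nu>. (LINT y : dyadic_cube M \<nu> | lborel. h y) = 0) \<longrightarrow>
    norm (conv (dil k (inv_fourier (lp_base \<phi>0 j))) h x) \<le> C * A * 2 ^ k / 2 ^ M"
    by (intro allI conv_mean_zero_bound schwartz_base_kernel)
  then obtain C where C0: "\<And>j. 0 \<le> C j" and C: "\<And>j k M h A x. k \<le> M \<Longrightarrow> h \<in> borel_measurable borel \<Longrightarrow> (\<And>y. norm (h y) \<le> A) \<Longrightarrow>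
    (\<And>\<nu>. (LINT y : dyadic_cube M \<nu> | lborel. h y) = 0) \<Longrightarrow>
    norm (conv (dil k (inv_fourier (lp_base \<phi>0 j))) h x) \<le> C j * A * 2 ^ k / 2 ^ M" by metis
  have "norm (conv (block_kernel k) h x) \<le> (C 0 + C 1) * A * 2 ^ k / 2 ^ M"
    if kM: "k \<le> M" and h: "h \<in> borel_measurable borel" "\<And>y. norm (h y) \<le> A"
      and z: "\<And>\<nu>. (LINT y : dyadic_cube M \<nu> | lborel. h y) = 0" for k M h A x
  proof -
    have A: "0 \<le> A" using order.trans[OF norm_ge_zero h(2)] .
    have "\<exists>j\<in>{0, 1}. norm (conv (block_kernel k) h x) \<le> C j * A * 2 ^ k / 2 ^ M"
      using C[OF kM h z, where j=0 and x=x] C[OF kM h z, where j=1 and x=x] by (cases k rule: lp_base_cases) auto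
    then obtain j where j: "j \<in> {0, 1}" "norm (conv (block_kernel k) h x) \<le> C j * A * 2 ^ k / 2 ^ M" by blast
    note j(2)
    also have "C j * A * 2 ^ k / 2 ^ M \<le> (C 0 + C 1) * A * 2 ^ k / 2 ^ M"
      using A C0[of 0] C0[of 1] j(1) by (intro divide_right_mono mult_right_mono) auto
    finally show ?thesis .
  qed
  then show ?thesis using C0 by (intro exI[of _ "C 0 + C 1"]) auto
qed

text \<open>\<open>F_norm_le\<close> in terms of functions. The function w to be estimated need not
  be piecewise constant; it suffices that its blocks above N coincide with those of a piecewise
  constant H. There \<open>conv_jump_bound\<close> applies to H, and the distance to the cell
  boundary serves as delta.\<close>

lemma F_norm_dist_of_le:
  assumes r: "0 < r"
  shows "\<exists>C\<ge>0. \<forall>N w A H. 0 \<le> A \<longrightarrow> w \<in> borel_measurable borel \<longrightarrow> (\<exists>B. \<forall>x. norm (w x) \<le> B) \<longrightarrow>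
    (\<forall>k x. k \<le> N \<longrightarrow> norm (conv (block_kernel k) w x) \<le> A * (2 ^ k / 2 ^ N)) \<longrightarrow>
    (\<forall>x y. cell (Suc N) x = cell (Suc N) y \<longrightarrow> H x = H y) \<longrightarrow> (\<exists>B. \<forall>x. norm (H x) \<le> B) \<longrightarrow>
    (\<forall>x y. norm (H y - H x) \<le> A * (1 + 2 ^ Suc N * norm (x - y))) \<longrightarrow>
    (\<forall>k x. N < k \<longrightarrow> conv (block_kernel k) w x = conv (block_kernel k) H x) \<longrightarrow>
    F_norm \<phi>0 r (dist_of w) \<le> ennreal (C * A)"
proof -
  \<comment> \<open>The least natural number that is at least 2/r, which ensures p r >= 2.\<close>
  define p where "p = nat \<lceil>2 / r\<rceil>"
  have "2 / r \<le> real p" unfolding p_def by linarith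
  then have p: "2 \<le> real p * r" using r by (simp add: field_simps)
  obtain F where F: "0 \<le> F" "\<And>N w A. 0 \<le> A \<Longrightarrow> (\<And>k. lp_block \<phi>0 k w \<in> borel_measurable borel) \<Longrightarrow>
    (\<And>k x. k \<le> N \<Longrightarrow> norm (lp_block \<phi>0 k w x) \<le> A * (2 ^ k / 2 ^ N)) \<Longrightarrow>
    (\<And>k x \<delta>. N < k \<Longrightarrow> 0 \<le> \<delta> \<Longrightarrow> (\<And>y. norm (x - y) < \<delta> \<Longrightarrow> cell (Suc N) y = cell (Suc N) x) \<Longrightarrow>
      norm (lp_block \<phi>0 k w x) \<le> A / (1 + 2 ^ k * \<delta>) ^ p) \<Longrightarrow>
    F_norm \<phi>0 r w \<le> ennreal (F * A)"
    using F_norm_le[OF r p, of \<phi>0] by metis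
  obtain G where G: "0 \<le> G" "\<And>k L h H A x \<delta>. L \<le> k \<Longrightarrow> h \<in> borel_measurable borel \<Longrightarrow> (\<And>y. norm (h y) \<le> H) \<Longrightarrow>
    (\<And>y. norm (h y - h x) \<le> A * (1 + 2 ^ L * norm (x - y))) \<Longrightarrow> 0 \<le> \<delta> \<Longrightarrow>
    (\<And>y. norm (x - y) < \<delta> \<Longrightarrow> h y = h x) \<Longrightarrow> norm (conv (dil k (inv_fourier (lp_base \<phi>0 1))) h x) \<le> G * A / (1 + 2 ^ k * \<delta>) ^ p"
    using conv_jump_bound[OF schwartz_base_kernel integral_inv_fourier_lp_base[OF lp zero_less_one], of p] by metis
  have main: "F_norm \<phi>0 r (dist_of w) \<le> ennreal ((F * (1 + G)) * A)"
    if A: "0 \<le> A" and w: "w \<in> borel_measurable borel" and wb: "\<exists>B. \<forall>x. norm (w x) \<le> B"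
      and low: "\<And>k x. k \<le> N \<Longrightarrow> norm (conv (block_kernel k) w x) \<le> A * (2 ^ k / 2 ^ N)"
      and Hc: "\<And>x y. cell (Suc N) x = cell (Suc N) y \<Longrightarrow> H x = H y" and Hb: "\<exists>B. \<forall>x. norm (H x) \<le> B"
      and Hj: "\<And>x y. norm (H y - H x) \<le> A * (1 + 2 ^ Suc N * norm (x - y))"
      and eq: "\<And>k x. N < k \<Longrightarrow> conv (block_kernel k) w x = conv (block_kernel k) H x" for N w A H
  proof -
    obtain B where B: "\<And>x. norm (w x) \<le> B" using wb by blast
    obtain B' where B': "\<And>x. norm (H x) \<le> B'" using Hb by blast
    have lpb: "lp_block \<phi>0 k (dist_of w) = conv (block_kernel k) w" for k by (rule lp_block_dist_of[OF lp w B])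
    have "F_norm \<phi>0 r (dist_of w) \<le> ennreal (F * ((1 + G) * A))"
    proof (rule F(2)[where N=N])
      show "0 \<le> (1 + G) * A" using A G(1) by simp
      show "lp_block \<phi>0 k (dist_of w) \<in> borel_measurable borel" for k
        by (rule measurable_lp_block[OF lp tempered_dist_of[OF w B]])
      fix k x
      show "norm (lp_block \<phi>0 k (dist_of w) x) \<le> (1 + G) * A * (2 ^ k / 2 ^ N)" if k: "k \<le> N"
      proof -
        have "norm (lp_block \<phi>0 k (dist_of w) x) \<le> A * (2 ^ k / 2 ^ N)" unfolding lpb by (rule low[OF k])
        also have "\<dots> \<le> (1 + G) * A * (2 ^ k / 2 ^ N)" using A G(1) by (intro mult_right_mono) (auto simp: distrib_right)
        finally show ?thesis .
      qed
      show "norm (lp_block \<phi>0 k (dist_of w) x) \<le> (1 + G) * A / (1 + 2 ^ k * \<delta>) ^ p"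
        if k: "N < k" and d: "0 \<le> \<delta>" "\<And>y. norm (x - y) < \<delta> \<Longrightarrow> cell (Suc N) y = cell (Suc N) x" for \<delta>
      proof -
        \<comment> \<open>As k > N >= 0 the index is positive, and the base kernel with mean zero is
          the relevant one.\<close>
        have b1: "lp_base \<phi>0 k = lp_base \<phi>0 1" using k by (intro lp_base_pos) simp
        have "norm (conv (block_kernel k) H x) \<le> G * A / (1 + 2 ^ k * \<delta>) ^ p"
          unfolding b1
        proof (rule G(2)[where L="Suc N"])
          show "H \<in> borel_measurable borel" by (rule cell_constant_measurable[of "Suc N"]) (rule Hc)
          show "norm (x - y) < \<delta> \<Longrightarrow> H y = H x" for y by (intro Hc d)
        qed (use k d B' Hj in auto)
        also have "\<dots> \<le> (1 + G) * A / (1 + 2 ^ k * \<delta>) ^ p"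
          using A d(1) by (intro divide_right_mono mult_right_mono) auto
        finally show ?thesis unfolding lpb eq[OF k] .
      qed
    qed
    then show ?thesis by (simp add: mult.assoc)
  qed
  show ?thesis
    apply (intro exI[of _ "F * (1 + G)"] conjI allI impI)
    subgoal using F(1) G(1) by simp
    subgoal for N w A H by (rule main[of A w N H]) blast+
    done
qed

text \<open>Uniform geometric convergence gives the limit H pointwise. For the quasi-norms, h_J - H
  is small in the sup norm and constant on the cells, so \<open>F_norm_dist_of_le\<close> applies
  with this difference in both roles, for every r.\<close>

lemma F_limit_exists:
  fixes h :: "nat \<Rightarrow> real ^ 'n \<Rightarrow> complex"
  assumes hc: "\<And>J x y. cell (Suc N) x = cell (Suc N) y \<Longrightarrow> h J x = h J y"
    and hb: "\<And>J. \<exists>B. \<forall>x. norm (h J x) \<le> B"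
    and inc: "\<And>J x. N \<le> J \<Longrightarrow> norm (h (Suc J) x - h J x) \<le> c * (1/2) ^ J"
  obtains H where "\<And>x y. cell (Suc N) x = cell (Suc N) y \<Longrightarrow> H x = H y" "\<exists>B. \<forall>x. norm (H x) \<le> B"
    "\<And>J x. N \<le> J \<Longrightarrow> norm (H x - h J x) \<le> 2 * c * (1/2) ^ J"
    "F_converges \<phi>0 (\<lambda>J. dist_of (h J)) (dist_of H)" "F_lim \<phi>0 (\<lambda>J. dist_of (h J)) = dist_of H"
proof -
  have c: "0 \<le> c" using order.trans[OF norm_ge_zero inc[OF order.refl]] by (rule nonneg_of_mult_half_power)
  have tele: "norm (h J' x - h J x) \<le> 2 * c * (1/2) ^ J" if "N \<le> J" "J \<le> J'" for J J' x
    by (rule norm_telescope_le[of J "\<lambda>j. h j x"]) (use that inc in auto)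
  have small: "(\<lambda>J. a * (1/2) ^ J) \<longlonglongrightarrow> 0" for a :: real
    using tendsto_mult_right_zero[OF LIMSEQ_realpow_zero[of "1/2 :: real"], of a] by simp
  have "Cauchy (\<lambda>J. h J x)" for x
  proof (rule CauchyI)
    fix e :: real assume "0 < e"
    then have "eventually (\<lambda>J. (4 * c) * (1/2) ^ J < e) sequentially"
      using small[of "4 * c"] by (rule order_tendstoD(2)[rotated])
    then obtain M where M: "\<And>J. M \<le> J \<Longrightarrow> (4 * c) * (1/2) ^ J < e" unfolding eventually_sequentially by blast
    let ?M = "max M N"
    have "norm (h m x - h n x) < e" if "?M \<le> m" "?M \<le> n" for m n
    proof -
      have "norm (h m x - h n x) \<le> norm (h m x - h ?M x) + norm (h n x - h ?M x)"
        using norm_triangle_ineq4[of "h m x - h ?M x" "h n x - h ?M x"] by simp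
      also have "\<dots> \<le> 2 * c * (1/2) ^ ?M + 2 * c * (1/2) ^ ?M" using that by (intro add_mono tele) auto
      also have "\<dots> < e" using M[of ?M] by simp
      finally show ?thesis .
    qed
    then show "\<exists>M. \<forall>m\<ge>M. \<forall>n\<ge>M. norm (h m x - h n x) < e" by blast
  qed
  then have conv: "(\<lambda>J. h J x) \<longlonglongrightarrow> lim (\<lambda>J. h J x)" for x
    by (simp add: Cauchy_convergent_iff convergent_LIMSEQ_iff)
  define H where "H x = lim (\<lambda>J. h J x)" for x
  have Hc: "H x = H y" if "cell (Suc N) x = cell (Suc N) y" for x y
    unfolding H_def using hc[OF that] by simp
  have Hd: "norm (H x - h J x) \<le> 2 * c * (1/2) ^ J" if J: "N \<le> J" for J x
  proof (rule LIMSEQ_le_const2)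
    show "(\<lambda>m. norm (h m x - h J x)) \<longlonglongrightarrow> norm (H x - h J x)"
      unfolding H_def by (intro tendsto_intros conv)
    show "\<exists>M. \<forall>m\<ge>M. norm (h m x - h J x) \<le> 2 * c * (1/2) ^ J" using tele[OF J] by blast
  qed
  have hm: "h J \<in> borel_measurable borel" for J by (rule cell_constant_measurable[of "Suc N"]) (rule hc)
  have Hm: "H \<in> borel_measurable borel" by (rule cell_constant_measurable[of "Suc N"]) (rule Hc)
  have Hb: "\<exists>B. \<forall>x. norm (H x) \<le> B"
  proof -
    obtain B where B: "\<And>x. norm (h N x) \<le> B" using hb by blast
    have "norm (H x) \<le> B + 2 * c * (1/2) ^ N" for x
      using norm_triangle_ineq2[of "H x" "h N x"] B[of x] Hd[OF order.refl, of x] by linarith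
    then show ?thesis by blast
  qed
  then obtain B where B: "\<And>x. norm (H x) \<le> B" by blast
  obtain b where b: "\<And>J x. norm (h J x) \<le> b J" using hb by metis
  have Ht: "dist_of H \<in> tempered" by (rule tempered_dist_of[OF Hm B])
  have ht: "dist_of (h J) \<in> tempered" for J by (rule tempered_dist_of[OF hm b])
  obtain \<kappa> where \<kappa>: "0 \<le> \<kappa>" "\<And>k g A x. g \<in> borel_measurable borel \<Longrightarrow> (\<And>y. norm (g y) \<le> A) \<Longrightarrow> norm (conv (block_kernel k) g x) \<le> \<kappa> * A"
    using block_kernel_bound by metis
  have "(\<lambda>J. F_norm \<phi>0 r (dist_of (h J) - dist_of H)) \<longlonglongrightarrow> 0" if r: "0 < r" for r
  proof -
    obtain C where C: "0 \<le> C" "\<And>N w A H. 0 \<le> A \<Longrightarrow> w \<in> borel_measurable borel \<Longrightarrow> (\<exists>B. \<forall>x. norm (w x) \<le> B) \<Longrightarrow>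
      (\<And>k x. k \<le> N \<Longrightarrow> norm (conv (block_kernel k) w x) \<le> A * (2 ^ k / 2 ^ N)) \<Longrightarrow>
      (\<And>x y. cell (Suc N) x = cell (Suc N) y \<Longrightarrow> H x = H y) \<Longrightarrow> (\<exists>B. \<forall>x. norm (H x) \<le> B) \<Longrightarrow>
      (\<And>x y. norm (H y - H x) \<le> A * (1 + 2 ^ Suc N * norm (x - y))) \<Longrightarrow>
      (\<And>k x. N < k \<Longrightarrow> conv (block_kernel k) w x = conv (block_kernel k) H x) \<Longrightarrow>
      F_norm \<phi>0 r (dist_of w) \<le> ennreal (C * A)"
      using F_norm_dist_of_le[OF r] by metis
    have F: "F_norm \<phi>0 r (dist_of (h J) - dist_of H) \<le> ennreal ((C * ((\<kappa> * 2 ^ N + 2) * (2 * c))) * (1/2) ^ J)" if J: "N \<le> J" for J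
    proof -
      let ?w = "\<lambda>x. h J x - H x" and ?a = "2 * c * (1/2) ^ J"
      \<comment> \<open>Deduced from the sup bound alone: the part with 2^N compensates the factor
        2^k / 2^N missing for low blocks, and the summand 2 covers the jumps. The dependence on N is
        harmless, because N is fixed while J tends to infinity.\<close>
      let ?A = "(\<kappa> * 2 ^ N + 2) * ?a"
      have a: "0 \<le> ?a" using c by simp
      have wa: "norm (?w x) \<le> ?a" for x using Hd[OF J, of x] by (simp add: norm_minus_commute)
      have wm: "?w \<in> borel_measurable borel" using hm Hm by simp
      have "F_norm \<phi>0 r (dist_of ?w) \<le> ennreal (C * ?A)"
      proof (rule C(2)[where N=N and H="?w"])
        show "0 \<le> ?A" using a c \<kappa>(1) by (intro mult_nonneg_nonneg) auto
        show "?w \<in> borel_measurable borel" by (rule wm)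
        show "\<exists>B. \<forall>x. norm (?w x) \<le> B" using wa by blast
        then show "\<exists>B. \<forall>x. norm (?w x) \<le> B" .
        show "norm (conv (block_kernel k) ?w x) \<le> ?A * (2 ^ k / 2 ^ N)" if "k \<le> N" for k x
        proof -
          have "norm (conv (block_kernel k) ?w x) \<le> \<kappa> * ?a" by (rule \<kappa>(2)[OF wm wa])
          also have "\<dots> = (\<kappa> * 2 ^ N) * ?a * (1 / 2 ^ N)" by simp
          also have "\<dots> \<le> ?A * (2 ^ k / 2 ^ N)"
            using a c \<kappa>(1) by (intro mult_mono divide_right_mono) auto
          finally show ?thesis .
        qed
        show "cell (Suc N) x = cell (Suc N) y \<Longrightarrow> ?w x = ?w y" for x y using hc Hc by metis
        show "norm (?w y - ?w x) \<le> ?A * (1 + 2 ^ Suc N * norm (x - y))" for x y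
        proof -
          have "norm (?w y - ?w x) \<le> 2 * ?a" using norm_triangle_ineq4[of "?w y" "?w x"] wa[of x] wa[of y] by linarith
          also have "\<dots> \<le> ?A * 1" using a c \<kappa>(1) by (simp add: distrib_right)
          also have "\<dots> \<le> ?A * (1 + 2 ^ Suc N * norm (x - y))" using a c \<kappa>(1) by (intro mult_left_mono mult_nonneg_nonneg) auto
          finally show ?thesis .
        qed
      qed simp
      then show ?thesis by (simp add: dist_of_diff[OF hm b Hm B] mult.assoc)
    qed
    have "(\<lambda>J. ennreal ((C * ((\<kappa> * 2 ^ N + 2) * (2 * c))) * (1/2) ^ J)) \<longlonglongrightarrow> ennreal 0"
      by (intro tendsto_ennrealI small)
    then have lim: "(\<lambda>J. ennreal ((C * ((\<kappa> * 2 ^ N + 2) * (2 * c))) * (1/2) ^ J)) \<longlonglongrightarrow> 0" by simp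
    show ?thesis
      by (rule tendsto_sandwich[OF _ _ tendsto_const lim]) (auto simp: eventually_sequentially intro: F)
  qed
  then have Fc: "F_converges \<phi>0 (\<lambda>J. dist_of (h J)) (dist_of H)" unfolding F_converges_def using Ht by blast
  show ?thesis by (rule that[OF Hc Hb Hd Fc F_lim_eq[OF lp Fc ht]])
qed


section \<open>Uniform bounds for tame families\<close>

lemma tame_cond_exp_increment:
  fixes B :: real
  assumes P: "tame \<phi>0 B P"
  shows "norm (cond_exp_fun N (P (Suc J)) x - cond_exp_fun N (P J) x) \<le> B * 2 ^ N * (1/2) ^ J"
proof -
  obtain A where A: "\<And>J x. norm (P J x) \<le> A J" using tame_bounded[OF P] by blast
  have m: "P J \<in> borel_measurable borel" for J using P by (simp add: tame_def)
  have "norm (LINT y : dyadic_cube N (cell N x) | lborel. P (Suc J) y - P J y) \<le> B * (2 ^ N / 2 ^ J) / 2 ^ (N * CARD('n))"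
    using P by (simp add: tame_def)
  then have "2 ^ (N * CARD('n)) * norm (LINT y : dyadic_cube N (cell N x) | lborel. P (Suc J) y - P J y)
    \<le> 2 ^ (N * CARD('n)) * (B * (2 ^ N / 2 ^ J) / 2 ^ (N * CARD('n)))"
    by (intro mult_left_mono) auto
  then show ?thesis
    unfolding cond_exp_fun_diff[OF m A m A] unfolding cond_exp_fun_eq
    by (simp add: norm_mult norm_power power_one_over)
qed

text \<open>For J <= M the function P_J is nearly constant on cubes of generation M, and its
  Lipschitz bound gives the d. For J > M the increments beyond M are summed by their small averages,
  which adds the 2.\<close>

lemma tame_cond_exp_near:
  fixes B :: real
  assumes P: "tame \<phi>0 B P"
  shows "norm (cond_exp_fun M (P J) x - P (min J M) x) \<le> (real CARD('n) + 2) * B"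
proof -
  have B: "0 \<le> B" using P by (simp add: tame_def)
  have lip: "norm (cond_exp_fun M (P J) x - P J x) \<le> real CARD('n) * B" if "J \<le> M" for J
  proof -
    obtain A where A: "\<And>J x. norm (P J x) \<le> A J" using tame_bounded[OF P] by blast
    show ?thesis
    proof (rule norm_cond_exp_fun_diff_le[OF _ A])
      show "P J \<in> borel_measurable borel" using P by (simp add: tame_def)
      fix y assume c: "cell M y = cell M x"
      have "norm (P J y - P J x) \<le> B * 2 ^ J * norm (y - x)" by (rule tame_lipschitz[OF P])
      also have "\<dots> \<le> B * 2 ^ M * (CARD('n) / 2 ^ M)"
        using B that by (intro mult_mono norm_diff_same_cell c power_increasing) auto
      finally show "norm (P J y - P J x) \<le> real CARD('n) * B" by (simp add: mult.commute)
    qed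
  qed
  show ?thesis
  proof (cases "J \<le> M")
    case True
    have "norm (cond_exp_fun M (P J) x - P J x) \<le> real CARD('n) * B" by (rule lip[OF True])
    also have "\<dots> \<le> (real CARD('n) + 2) * B" using B by (intro mult_right_mono) auto
    finally show ?thesis using True by (simp add: min_def)
  next
    case False
    have "norm (cond_exp_fun M (P J) x - cond_exp_fun M (P M) x) \<le> 2 * (B * 2 ^ M) * (1/2) ^ M"
      using False by (intro norm_telescope_le[of M "\<lambda>J. cond_exp_fun M (P J) x"] tame_cond_exp_increment[OF P]) auto
    then have "norm (cond_exp_fun M (P J) x - cond_exp_fun M (P M) x) \<le> 2 * B" by (simp add: power_one_over)
    moreover have "norm (cond_exp_fun M (P M) x - P M x) \<le> real CARD('n) * B" by (rule lip) simp
    moreover have "norm (cond_exp_fun M (P J) x - P M x) \<le> norm (cond_exp_fun M (P J) x - cond_exp_fun M (P M) x) + norm (cond_exp_fun M (P M) x - P M x)"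
      using norm_triangle_ineq[of "cond_exp_fun M (P J) x - cond_exp_fun M (P M) x" "cond_exp_fun M (P M) x - P M x"] by simp
    ultimately have "norm (cond_exp_fun M (P J) x - P M x) \<le> (real CARD('n) + 2) * B" unfolding distrib_right by linarith
    then show ?thesis using False by (simp add: min_def)
  qed
qed

text \<open>Both averages are compared with the projections of generations min(J, M + 1) and min(J,
  M), which differ by at most one increment; hence the constant 2 (d + 2) + 1.\<close>

lemma tame_cond_exp_Suc:
  fixes B :: real
  assumes P: "tame \<phi>0 B P"
  shows "norm (cond_exp_fun (Suc M) (P J) x - cond_exp_fun M (P J) x) \<le> (2 * real CARD('n) + 5) * B"
proof -
  have B: "0 \<le> B" using P by (simp add: tame_def)
  have "norm (P (min J (Suc M)) x - P (min J M) x) \<le> B"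
  proof (cases "J \<le> M")
    case True
    then show ?thesis using B by (simp add: min_def)
  next
    case False
    then have "min J (Suc M) = Suc M" "min J M = M" by auto
    then show ?thesis using P by (simp add: tame_def)
  qed
  note 1 = this
  have tri: "norm (a - b) \<le> norm (a - c) + norm (c - d) + norm (b - d)" for a b c d :: complex
    using norm_triangle_ineq4[of "(a - c) + (c - d)" "b - d"] norm_triangle_ineq[of "a - c" "c - d"] by simp
  have "norm (cond_exp_fun (Suc M) (P J) x - cond_exp_fun M (P J) x) \<le>
    norm (cond_exp_fun (Suc M) (P J) x - P (min J (Suc M)) x) + norm (P (min J (Suc M)) x - P (min J M) x)
    + norm (cond_exp_fun M (P J) x - P (min J M) x)" by (rule tri)
  also have "\<dots> \<le> (real CARD('n) + 2) * B + B + (real CARD('n) + 2) * B"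
    by (intro add_mono tame_cond_exp_near[OF P] 1)
  finally show ?thesis by (simp add: algebra_simps)
qed

lemma cond_exp_uniform_bound:
  assumes r: "0 < r"
  shows "\<exists>C\<ge>0. \<forall>B P N. tame \<phi>0 B P \<longrightarrow> (\<exists>H. F_converges \<phi>0 (\<lambda>J. dist_of (cond_exp_fun N (P J))) (dist_of H) \<and>
    F_lim \<phi>0 (\<lambda>J. dist_of (cond_exp_fun N (P J))) = dist_of H \<and>
    F_norm \<phi>0 r (dist_of H - dist_of (P N)) \<le> ennreal (C * B))"
proof -
  obtain C where C: "0 \<le> C" "\<And>N w A H. 0 \<le> A \<Longrightarrow> w \<in> borel_measurable borel \<Longrightarrow> (\<exists>B. \<forall>x. norm (w x) \<le> B) \<Longrightarrow>
    (\<And>k x. k \<le> N \<Longrightarrow> norm (conv (block_kernel k) w x) \<le> A * (2 ^ k / 2 ^ N)) \<Longrightarrow>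
    (\<And>x y. cell (Suc N) x = cell (Suc N) y \<Longrightarrow> H x = H y) \<Longrightarrow> (\<exists>B. \<forall>x. norm (H x) \<le> B) \<Longrightarrow>
    (\<And>x y. norm (H y - H x) \<le> A * (1 + 2 ^ Suc N * norm (x - y))) \<Longrightarrow>
    (\<And>k x. N < k \<Longrightarrow> conv (block_kernel k) w x = conv (block_kernel k) H x) \<Longrightarrow>
    F_norm \<phi>0 r (dist_of w) \<le> ennreal (C * A)"
    using F_norm_dist_of_le[OF r] by metis
  obtain \<kappa> where \<kappa>: "0 \<le> \<kappa>" "\<And>k g A x. g \<in> borel_measurable borel \<Longrightarrow> (\<And>y. norm (g y) \<le> A) \<Longrightarrow> norm (conv (block_kernel k) g x) \<le> \<kappa> * A"
    using block_kernel_bound by metis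
  obtain Z where Z: "0 \<le> Z" "\<And>k M h A x. k \<le> M \<Longrightarrow> h \<in> borel_measurable borel \<Longrightarrow> (\<And>y. norm (h y) \<le> A) \<Longrightarrow>
    (\<And>\<nu>. (LINT y : dyadic_cube M \<nu> | lborel. h y) = 0) \<Longrightarrow> norm (conv (block_kernel k) h x) \<le> Z * A * 2 ^ k / 2 ^ M"
    using block_kernel_mean_zero_bound by metis
  let ?d = "real CARD('n)"
  \<comment> \<open>\<open>L\<close> collects four low-frequency errors: 2 and d times kappa from
    the two approximations, 2 Z (2d + 5) from the mean zero increments and 1 from the projections.
    \<open>D\<close> adds 2d + 8 for the jump of H and 1 for the slope of P_N.\<close>
  define L where "L = (2 + ?d) * \<kappa> + 2 * Z * (2 * ?d + 5) + 1"
  define D where "D = L + 2 * ?d + 9"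
  have L: "0 \<le> L" unfolding L_def using \<kappa>(1) Z(1) by (intro add_nonneg_nonneg mult_nonneg_nonneg) auto
  have D: "0 \<le> D" unfolding D_def using L by simp
  have "\<exists>H. F_converges \<phi>0 (\<lambda>J. dist_of (cond_exp_fun N (P J))) (dist_of H) \<and>
    F_lim \<phi>0 (\<lambda>J. dist_of (cond_exp_fun N (P J))) = dist_of H \<and>
    F_norm \<phi>0 r (dist_of H - dist_of (P N)) \<le> ennreal (C * D * B)" if P: "tame \<phi>0 B P" for B P N
  proof -
    have B: "0 \<le> B" and Pm: "\<And>J. P J \<in> borel_measurable borel" using P by (simp_all add: tame_def)
    obtain A where A: "\<And>J x. norm (P J x) \<le> A J" using tame_bounded[OF P] by blast
    let ?E = "\<lambda>N J. cond_exp_fun N (P J)"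
    have Em: "?E N J \<in> borel_measurable borel" for N J by (rule cond_exp_fun_measurable)
    have Eb: "norm (?E N J x) \<le> A J" for N J x by (rule norm_cond_exp_fun_le[OF Pm A])
    have Eb': "\<exists>b. \<forall>x. norm (?E N J x) \<le> b" for J using Eb by blast
    obtain H where Hc: "\<And>x y. cell (Suc N) x = cell (Suc N) y \<Longrightarrow> H x = H y" and Hb: "\<exists>B. \<forall>x. norm (H x) \<le> B"
      and Hd: "\<And>J x. N \<le> J \<Longrightarrow> norm (H x - ?E N J x) \<le> 2 * (B * 2 ^ N) * (1/2) ^ J"
      and Hl: "F_converges \<phi>0 (\<lambda>J. dist_of (?E N J)) (dist_of H)" "F_lim \<phi>0 (\<lambda>J. dist_of (?E N J)) = dist_of H"
    proof (rule F_limit_exists[of N "?E N" "B * 2 ^ N"])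
      show "cell (Suc N) x = cell (Suc N) y \<Longrightarrow> ?E N J x = ?E N J y" for J x y
        by (rule cond_exp_fun_cell[OF cell_eq_of_cell_Suc])
    qed (rule Eb' tame_cond_exp_increment[OF P] that; assumption)+
    obtain b where b: "\<And>x. norm (H x) \<le> b" using Hb by blast
    have Hm: "H \<in> borel_measurable borel" by (rule cell_constant_measurable[of "Suc N"]) (rule Hc)
    let ?w = "\<lambda>x. H x - P N x"
    have wb: "norm (?w x) \<le> b + A N" for x using norm_triangle_ineq4[of "H x" "P N x"] b[of x] A[of N x] by linarith
    have cw: "conv (block_kernel k) ?w x = conv (block_kernel k) H x - conv (block_kernel k) (P N) x" for k x
      by (rule conv_diff[OF schwartz_block_kernel Hm b Pm A])
    have low: "norm (conv (block_kernel k) ?w x) \<le> L * B * (2 ^ k / 2 ^ N)" if k: "k \<le> N" for k x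
    proof -
      let ?K = "\<lambda>g. conv (block_kernel k) g x"
      \<comment> \<open>J = 2N makes the distance of H to E_N P_J, of order 2^(N-J), equal to 2^-N
        up to constants. R = 3N does the same for the distance of E_R P_J to P_J, where the
        Lipschitz constant 2^J meets cubes of side 2^-R.\<close>
      let ?J = "2 * N" and ?R = "3 * N"
      have pk: "1 / 2 ^ N \<le> (2 ^ k / 2 ^ N :: real)" by (intro divide_right_mono) auto
      have "?K H - ?K (?E N ?J) = ?K (\<lambda>x. H x - ?E N ?J x)"
        by (rule conv_diff[OF schwartz_block_kernel Hm b Em Eb, symmetric])
      also have "norm \<dots> \<le> \<kappa> * (2 * (B * 2 ^ N) * (1/2) ^ ?J)"
        by (rule \<kappa>(2)) (use Hm Em Hd in auto)
      also have "\<dots> = 2 * \<kappa> * B * (1 / 2 ^ N)" by (simp add: power_one_over power_even_eq power2_eq_square)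
      also have "\<dots> \<le> 2 * \<kappa> * B * (2 ^ k / 2 ^ N)" using pk \<kappa>(1) B by (intro mult_left_mono) auto
      finally have 1: "norm (?K H - ?K (?E N ?J)) \<le> 2 * \<kappa> * B * (2 ^ k / 2 ^ N)" .
      \<comment> \<open>The generation M of the averages runs from N to R with J fixed. Each
        increment has mean zero at generation M, so its block is O(2^(k-M)) and the chain sums
        geometrically.\<close>
      have "norm (?K (?E ?R ?J) - ?K (?E N ?J)) \<le> 2 * (Z * ((2 * ?d + 5) * B) * 2 ^ k) * (1/2) ^ N"
      proof (rule norm_telescope_le[of N "\<lambda>M. ?K (?E M ?J)"])
        fix M assume M: "N \<le> M"
        have "?K (?E (Suc M) ?J) - ?K (?E M ?J) = ?K (\<lambda>x. ?E (Suc M) ?J x - ?E M ?J x)"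
          by (rule conv_diff[OF schwartz_block_kernel Em Eb Em Eb, symmetric])
        also have "norm \<dots> \<le> Z * ((2 * ?d + 5) * B) * 2 ^ k / 2 ^ M"
        proof (rule Z(2))
          show "k \<le> M" using k M by simp
          show "(\<lambda>x. ?E (Suc M) ?J x - ?E M ?J x) \<in> borel_measurable borel" using Em by simp
          show "norm (?E (Suc M) ?J y - ?E M ?J y) \<le> (2 * ?d + 5) * B" for y by (rule tame_cond_exp_Suc[OF P])
          show "(LINT y : dyadic_cube M \<nu> | lborel. ?E (Suc M) ?J y - ?E M ?J y) = 0" for \<nu>
            by (rule set_integral_cond_exp_increment[OF Pm A])
        qed
        finally show "norm (?K (?E (Suc M) ?J) - ?K (?E M ?J)) \<le> Z * ((2 * ?d + 5) * B) * 2 ^ k * (1/2) ^ M"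
          by (simp add: power_one_over)
      qed simp
      then have 2: "norm (?K (?E N ?J) - ?K (?E ?R ?J)) \<le> 2 * Z * (2 * ?d + 5) * B * (2 ^ k / 2 ^ N)"
        by (simp add: norm_minus_commute power_one_over algebra_simps)
      have "?K (?E ?R ?J) - ?K (P ?J) = ?K (\<lambda>x. ?E ?R ?J x - P ?J x)"
        by (rule conv_diff[OF schwartz_block_kernel Em Eb Pm A, symmetric])
      also have "norm \<dots> \<le> \<kappa> * (B * 2 ^ ?J * (?d / 2 ^ ?R))"
      proof (rule \<kappa>(2))
        show "(\<lambda>x. ?E ?R ?J x - P ?J x) \<in> borel_measurable borel" using Em Pm by simp
        show "norm (?E ?R ?J y - P ?J y) \<le> B * 2 ^ ?J * (?d / 2 ^ ?R)" for y
        proof (rule norm_cond_exp_fun_diff_le[OF Pm A])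
          fix z assume c: "cell ?R z = cell ?R y"
          have "norm (P ?J z - P ?J y) \<le> B * 2 ^ ?J * norm (z - y)" by (rule tame_lipschitz[OF P])
          also have "\<dots> \<le> B * 2 ^ ?J * (?d / 2 ^ ?R)" using B by (intro mult_left_mono norm_diff_same_cell c) auto
          finally show "norm (P ?J z - P ?J y) \<le> B * 2 ^ ?J * (?d / 2 ^ ?R)" .
        qed
      qed
      also have "\<dots> = ?d * \<kappa> * B * (1 / 2 ^ N)"
      proof -
        have "(2::real) ^ ?R = 2 ^ ?J * 2 ^ N" by (simp flip: power_add)
        then show ?thesis by simp
      qed
      also have "\<dots> \<le> ?d * \<kappa> * B * (2 ^ k / 2 ^ N)" using pk \<kappa>(1) B by (intro mult_left_mono) auto
      finally have 3: "norm (?K (?E ?R ?J) - ?K (P ?J)) \<le> ?d * \<kappa> * B * (2 ^ k / 2 ^ N)" .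
      have 4: "norm (?K (P ?J) - ?K (P N)) \<le> B * (2 ^ k / 2 ^ N)" using P k unfolding tame_def by simp
      have tri: "norm (a - e) \<le> norm (a - b) + norm (b - c) + norm (c - d) + norm (d - e)" for a b c d e :: complex
        using norm_triangle_ineq[of "a - b" "b - c"] norm_triangle_ineq[of "(a - b) + (b - c)" "c - d"]
          norm_triangle_ineq[of "(a - b) + (b - c) + (c - d)" "d - e"] by simp
      have "norm (?K ?w) \<le> norm (?K H - ?K (?E N ?J)) + norm (?K (?E N ?J) - ?K (?E ?R ?J)) + norm (?K (?E ?R ?J) - ?K (P ?J)) + norm (?K (P ?J) - ?K (P N))"
        unfolding cw by (rule tri)
      also have "\<dots> \<le> 2 * \<kappa> * B * (2 ^ k / 2 ^ N) + 2 * Z * (2 * ?d + 5) * B * (2 ^ k / 2 ^ N) + ?d * \<kappa> * B * (2 ^ k / 2 ^ N) + B * (2 ^ k / 2 ^ N)"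
        by (intro add_mono 1 2 3 4)
      also have "\<dots> = L * B * (2 ^ k / 2 ^ N)"
        unfolding distrib_right[symmetric] by (simp only: L_def) (simp add: algebra_simps)
      finally show ?thesis .
    qed
    have "F_norm \<phi>0 r (dist_of ?w) \<le> ennreal (C * (D * B))"
    proof (rule C(2)[where N=N and H=H])
      show "0 \<le> D * B" using D B by simp
      show "?w \<in> borel_measurable borel" using Hm Pm by simp
      show "\<exists>B. \<forall>x. norm (?w x) \<le> B" using wb by blast
      show "norm (conv (block_kernel k) ?w x) \<le> D * B * (2 ^ k / 2 ^ N)" if k: "k \<le> N" for k x
      proof -
        have "norm (conv (block_kernel k) ?w x) \<le> L * B * (2 ^ k / 2 ^ N)" by (rule low[OF k])
        also have "\<dots> \<le> D * B * (2 ^ k / 2 ^ N)" using B by (intro mult_right_mono) (auto simp: D_def)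
        finally show ?thesis .
      qed
      show "cell (Suc N) x = cell (Suc N) y \<Longrightarrow> H x = H y" for x y by (rule Hc)
      show "\<exists>B. \<forall>x. norm (H x) \<le> B" by (rule Hb)
      show "norm (H y - H x) \<le> D * B * (1 + 2 ^ Suc N * norm (x - y))" for x y
      proof -
        \<comment> \<open>H is close to P_N up to a bounded error, so it inherits the growth of the
          Lipschitz function P_N between different points; this replaces a sup bound for H.\<close>
        have near: "norm (H x - P N x) \<le> (?d + 4) * B" for x
        proof -
          have "norm (H x - ?E N N x) \<le> 2 * B" using Hd[OF order.refl, of x] by (simp add: power_one_over)
          moreover have "norm (?E N N x - P N x) \<le> (?d + 2) * B" using tame_cond_exp_near[OF P, of N N x] by simp
          moreover have "norm (H x - P N x) \<le> norm (H x - ?E N N x) + norm (?E N N x - P N x)"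
            using norm_triangle_ineq[of "H x - ?E N N x" "?E N N x - P N x"] by simp
          ultimately show ?thesis by (simp add: distrib_right)
        qed
        have lip: "norm (P N y - P N x) \<le> B * 2 ^ N * norm (x - y)" using tame_lipschitz[OF P, of N y x] by (simp add: norm_minus_commute)
        have tri: "norm (a - d) \<le> norm (a - b) + norm (b - c) + norm (d - c)" for a b c d :: complex
          using norm_triangle_ineq4[of "(a - b) + (b - c)" "d - c"] norm_triangle_ineq[of "a - b" "b - c"] by simp
        have "norm (H y - H x) \<le> norm (H y - P N y) + norm (P N y - P N x) + norm (H x - P N x)" by (rule tri)
        also have "\<dots> \<le> (?d + 4) * B + B * 2 ^ N * norm (x - y) + (?d + 4) * B" by (intro add_mono near lip)
        also have "\<dots> = (2 * ?d + 8) * B + 1 * B * (2 ^ N * norm (x - y))" by (simp add: algebra_simps)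
        also have "\<dots> \<le> D * B + D * B * (2 ^ Suc N * norm (x - y))"
          using B L D by (intro add_mono mult_mono) (auto simp: D_def)
        finally show ?thesis by (simp add: distrib_left)
      qed
      show "conv (block_kernel k) ?w x = conv (block_kernel k) H x" if "N < k" for k x
        unfolding cw using P that by (simp add: tame_def)
    qed
    then have "F_norm \<phi>0 r (dist_of H - dist_of (P N)) \<le> ennreal (C * D * B)"
      by (simp add: dist_of_diff[OF Hm b Pm A] mult.assoc)
    then show ?thesis using Hl by blast
  qed
  then show ?thesis using C(1) D by (intro exI[of _ "C * D"]) auto
qed

lemma haar_mult_uniform_bound:
  assumes r: "0 < r"
  shows "\<exists>C\<ge>0. \<forall>B P a N. tame \<phi>0 B P \<longrightarrow> (\<forall>\<nu>. \<forall>\<epsilon>\<in>Upsilon. norm (a \<nu> \<epsilon>) \<le> 1) \<longrightarrow>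
    (\<exists>H. F_converges \<phi>0 (\<lambda>J. dist_of (haar_mult_fun N (P J) a)) (dist_of H) \<and>
    F_lim \<phi>0 (\<lambda>J. dist_of (haar_mult_fun N (P J) a)) = dist_of H \<and>
    F_norm \<phi>0 r (dist_of H) \<le> ennreal (C * B))"
proof -
  obtain C where C: "0 \<le> C" "\<And>N w A H. 0 \<le> A \<Longrightarrow> w \<in> borel_measurable borel \<Longrightarrow> (\<exists>B. \<forall>x. norm (w x) \<le> B) \<Longrightarrow>
    (\<And>k x. k \<le> N \<Longrightarrow> norm (conv (block_kernel k) w x) \<le> A * (2 ^ k / 2 ^ N)) \<Longrightarrow>
    (\<And>x y. cell (Suc N) x = cell (Suc N) y \<Longrightarrow> H x = H y) \<Longrightarrow> (\<exists>B. \<forall>x. norm (H x) \<le> B) \<Longrightarrow>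
    (\<And>x y. norm (H y - H x) \<le> A * (1 + 2 ^ Suc N * norm (x - y))) \<Longrightarrow>
    (\<And>k x. N < k \<Longrightarrow> conv (block_kernel k) w x = conv (block_kernel k) H x) \<Longrightarrow>
    F_norm \<phi>0 r (dist_of w) \<le> ennreal (C * A)"
    using F_norm_dist_of_le[OF r] by metis
  obtain \<kappa> where \<kappa>: "0 \<le> \<kappa>" "\<And>k g A x. g \<in> borel_measurable borel \<Longrightarrow> (\<And>y. norm (g y) \<le> A) \<Longrightarrow> norm (conv (block_kernel k) g x) \<le> \<kappa> * A"
    using block_kernel_bound by metis
  obtain Z where Z: "0 \<le> Z" "\<And>k M h A x. k \<le> M \<Longrightarrow> h \<in> borel_measurable borel \<Longrightarrow> (\<And>y. norm (h y) \<le> A) \<Longrightarrow>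
    (\<And>\<nu>. (LINT y : dyadic_cube M \<nu> | lborel. h y) = 0) \<Longrightarrow> norm (conv (block_kernel k) h x) \<le> Z * A * 2 ^ k / 2 ^ M"
    using block_kernel_mean_zero_bound by metis
  let ?d = "real CARD('n)" and ?e = "2 ^ CARD('n) :: real"
  \<comment> \<open>A sup bound for H in units of B: 2^d d from T_N P_N through the oscillation of
    P_N on a cube, and 4 * 2^d from the tail of the increments. Unlike for the averages, a uniform
    sup bound is available here.\<close>
  define S where "S = ?e * ?d + 4 * ?e"
  define D where "D = Z * S + 4 * ?e * \<kappa> + 2 * S"
  have S: "0 \<le> S" by (simp add: S_def)
  have D: "0 \<le> D" unfolding D_def using S Z(1) \<kappa>(1) by (intro add_nonneg_nonneg mult_nonneg_nonneg) auto
  have "\<exists>H. F_converges \<phi>0 (\<lambda>J. dist_of (haar_mult_fun N (P J) a)) (dist_of H) \<and>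
    F_lim \<phi>0 (\<lambda>J. dist_of (haar_mult_fun N (P J) a)) = dist_of H \<and>
    F_norm \<phi>0 r (dist_of H) \<le> ennreal (C * D * B)"
    if P: "tame \<phi>0 B P" and a: "\<And>\<nu> \<epsilon>. \<epsilon> \<in> Upsilon \<Longrightarrow> norm (a \<nu> \<epsilon>) \<le> 1" for B P a N
  proof -
    have B: "0 \<le> B" and Pm: "\<And>J. P J \<in> borel_measurable borel" using P by (simp_all add: tame_def)
    obtain A where A: "\<And>J x. norm (P J x) \<le> A J" using tame_bounded[OF P] by blast
    have A0: "0 \<le> A J" for J using order.trans[OF norm_ge_zero A[of J 0]] .
    let ?T = "\<lambda>J. haar_mult_fun N (P J) a"
    have Tm: "?T J \<in> borel_measurable borel" for J
      by (rule cell_constant_measurable[of "Suc N"]) (rule haar_mult_fun_cell_Suc)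
    have Tb: "norm (?T J x) \<le> ?e * A J" for J x
    proof (rule norm_haar_mult_fun_le[OF a _ A0])
      fix \<nu> and \<epsilon> :: "bool ^ 'n" assume e: "\<epsilon> \<in> Upsilon"
      show "norm (\<integral>y. P J y * haar N \<nu> \<epsilon> y \<partial>lborel) \<le> A J / 2 ^ (N * CARD('n))"
        using A by (intro norm_integral_mult_haar_osc_le[OF Pm A e, where c=0]) simp
    qed
    have TN: "norm (?T N x) \<le> ?e * (?d * B)" for x
    proof (rule norm_haar_mult_fun_le[OF a])
      fix \<nu> and \<epsilon> :: "bool ^ 'n" assume e: "\<epsilon> \<in> Upsilon"
      show "norm (\<integral>y. P N y * haar N \<nu> \<epsilon> y \<partial>lborel) \<le> (?d * B) / 2 ^ (N * CARD('n))"
      proof (rule norm_integral_mult_haar_osc_le[OF Pm A e, where c="P N (corner N \<nu>)"])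
        fix y assume y: "cell N y = \<nu>"
        have "norm (P N y - P N (corner N \<nu>)) \<le> B * 2 ^ N * norm (y - corner N \<nu>)" by (rule tame_lipschitz[OF P])
        also have "\<dots> \<le> B * 2 ^ N * (?d / 2 ^ N)" using B y by (intro mult_left_mono norm_diff_same_cell) auto
        finally show "norm (P N y - P N (corner N \<nu>)) \<le> ?d * B" by (simp add: mult.commute)
      qed
    qed (use B in \<open>auto intro: mult_nonneg_nonneg\<close>)
    have inc: "norm (?T (Suc J) x - ?T J x) \<le> (2 * ?e * B * 2 ^ N) * (1/2) ^ J" for J x
    proof -
      \<comment> \<open>The factor 2 arises because the averages are taken over the children, of
        generation N + 1.\<close>
      let ?a = "2 * B * (2 ^ N / 2 ^ J)"
      let ?g = "\<lambda>y. P (Suc J) y - P J y"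
      have gm: "?g \<in> borel_measurable borel" using Pm by simp
      have gb: "norm (?g y) \<le> B" for y using P by (simp add: tame_def)
      have "norm (haar_mult_fun N ?g a x) \<le> ?e * ?a"
      proof (rule norm_haar_mult_fun_le[OF a])
        fix \<nu> and \<epsilon> :: "bool ^ 'n"
        have "norm (LINT y : dyadic_cube (Suc N) \<mu> | lborel. ?g y) \<le> B * (2 ^ Suc N / 2 ^ J) / 2 ^ (Suc N * CARD('n))" for \<mu>
          by (rule tame_average[OF P])
        then have "norm (\<integral>y. ?g y * haar N \<nu> \<epsilon> y \<partial>lborel) \<le> ?e * (B * (2 ^ Suc N / 2 ^ J) / 2 ^ (Suc N * CARD('n)))"
          by (rule norm_integral_mult_haar_le[OF gm gb])
        also have "\<dots> = ?a / 2 ^ (N * CARD('n))" by (simp add: power_add)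
        finally show "norm (\<integral>y. ?g y * haar N \<nu> \<epsilon> y \<partial>lborel) \<le> ?a / 2 ^ (N * CARD('n))" .
      qed (use B in \<open>auto intro: mult_nonneg_nonneg\<close>)
      then show ?thesis
        unfolding haar_mult_fun_diff[OF Pm A Pm A] by (simp add: power_one_over mult_ac)
    qed
    have Tb': "\<exists>b. \<forall>x. norm (?T J x) \<le> b" for J using Tb by blast
    obtain H where Hc: "\<And>x y. cell (Suc N) x = cell (Suc N) y \<Longrightarrow> H x = H y" and Hb: "\<exists>B. \<forall>x. norm (H x) \<le> B"
      and Hd: "\<And>J x. N \<le> J \<Longrightarrow> norm (H x - ?T J x) \<le> 2 * (2 * ?e * B * 2 ^ N) * (1/2) ^ J"
      and Hl: "F_converges \<phi>0 (\<lambda>J. dist_of (?T J)) (dist_of H)" "F_lim \<phi>0 (\<lambda>J. dist_of (?T J)) = dist_of H"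
    proof (rule F_limit_exists[of N ?T "2 * ?e * B * 2 ^ N"])
      show "cell (Suc N) x = cell (Suc N) y \<Longrightarrow> ?T J x = ?T J y" for J x y by (rule haar_mult_fun_cell_Suc)
    qed (rule Tb' inc that; assumption)+
    obtain b where b: "\<And>x. norm (H x) \<le> b" using Hb by blast
    have Hm: "H \<in> borel_measurable borel" by (rule cell_constant_measurable[of "Suc N"]) (rule Hc)
    have HS: "norm (H x) \<le> S * B" for x
    proof -
      have "norm (H x) \<le> norm (H x - ?T N x) + norm (?T N x)" using norm_triangle_ineq[of "H x - ?T N x" "?T N x"] by simp
      also have "\<dots> \<le> 2 * (2 * ?e * B * 2 ^ N) * (1/2) ^ N + ?e * (?d * B)" by (intro add_mono Hd TN order.refl)
      also have "\<dots> = S * B" by (simp add: S_def power_one_over algebra_simps)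
      finally show ?thesis .
    qed
    have TS: "norm (?T J x) \<le> S * B" if "N \<le> J" for J x
    proof -
      have "norm (?T J x - ?T N x) \<le> 2 * (2 * ?e * B * 2 ^ N) * (1/2) ^ N"
        by (rule norm_telescope_le[of N "\<lambda>j. ?T j x"]) (use inc that in auto)
      then have "norm (?T J x) \<le> 2 * (2 * ?e * B * 2 ^ N) * (1/2) ^ N + ?e * (?d * B)"
        using norm_triangle_ineq[of "?T J x - ?T N x" "?T N x"] TN[of x] by simp
      also have "\<dots> = S * B" by (simp add: S_def power_one_over algebra_simps)
      finally show ?thesis .
    qed
    have "F_norm \<phi>0 r (dist_of H) \<le> ennreal (C * (D * B))"
    proof (rule C(2)[where N=N and H=H])
      show "0 \<le> D * B" using D B by simp
      show "H \<in> borel_measurable borel" by (rule Hm)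
      show "\<exists>B. \<forall>x. norm (H x) \<le> B" by (rule Hb)
      then show "\<exists>B. \<forall>x. norm (H x) \<le> B" .
      show "cell (Suc N) x = cell (Suc N) y \<Longrightarrow> H x = H y" for x y by (rule Hc)
      show "norm (H y - H x) \<le> D * B * (1 + 2 ^ Suc N * norm (x - y))" for x y
      proof -
        have "norm (H y - H x) \<le> (2 * S) * B" using norm_triangle_ineq4[of "H y" "H x"] HS[of x] HS[of y] by simp
        also have "\<dots> \<le> D * B" using B S Z(1) \<kappa>(1) by (intro mult_right_mono) (auto simp: D_def)
        also have "\<dots> \<le> D * B * (1 + 2 ^ Suc N * norm (x - y))"
          using mult_left_mono[of 1 "1 + 2 ^ Suc N * norm (x - y)" "D * B"] D B by simp
        finally show ?thesis .
      qed
      show "norm (conv (block_kernel k) H x) \<le> D * B * (2 ^ k / 2 ^ N)" if k: "k \<le> N" for k x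
      proof -
        \<comment> \<open>With J = 2N the uniform error of T_N P_J against H is O(2^-N). The
          function T_N P_J already has mean zero on cubes of generation N, so no chain of
          generations intervenes.\<close>
        let ?K = "\<lambda>g. conv (block_kernel k) g x" and ?J = "2 * N"
        have pk: "1 / 2 ^ N \<le> (2 ^ k / 2 ^ N :: real)" by (intro divide_right_mono) auto
        have "?K H - ?K (?T ?J) = ?K (\<lambda>x. H x - ?T ?J x)"
          by (rule conv_diff[OF schwartz_block_kernel Hm b Tm Tb, symmetric])
        also have "norm \<dots> \<le> \<kappa> * (2 * (2 * ?e * B * 2 ^ N) * (1/2) ^ ?J)"
          by (rule \<kappa>(2)) (use Hm Tm Hd in auto)
        also have "\<dots> = 4 * ?e * \<kappa> * B * (1 / 2 ^ N)" by (simp add: power_one_over power_even_eq power2_eq_square)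
        also have "\<dots> \<le> 4 * ?e * \<kappa> * B * (2 ^ k / 2 ^ N)" using pk \<kappa>(1) B by (intro mult_left_mono) auto
        finally have 1: "norm (?K H - ?K (?T ?J)) \<le> 4 * ?e * \<kappa> * B * (2 ^ k / 2 ^ N)" .
        have "norm (?K (?T ?J)) \<le> Z * (S * B) * 2 ^ k / 2 ^ N"
          by (rule Z(2)[OF k Tm TS set_integral_haar_mult_fun]) simp
        then have 2: "norm (?K (?T ?J)) \<le> Z * S * B * (2 ^ k / 2 ^ N)" by (simp add: mult.assoc)
        have "norm (?K H) \<le> norm (?K H - ?K (?T ?J)) + norm (?K (?T ?J))"
          using norm_triangle_ineq[of "?K H - ?K (?T ?J)" "?K (?T ?J)"] by simp
        also have "\<dots> \<le> 4 * ?e * \<kappa> * B * (2 ^ k / 2 ^ N) + Z * S * B * (2 ^ k / 2 ^ N)" by (rule add_mono[OF 1 2])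
        also have "\<dots> = (4 * ?e * \<kappa> + Z * S) * B * (2 ^ k / 2 ^ N)" by (simp only: distrib_right)
        also have "\<dots> \<le> D * B * (2 ^ k / 2 ^ N)" using B S by (intro mult_right_mono) (auto simp: D_def)
        finally show ?thesis .
      qed
    qed simp
    then show ?thesis using Hl by (auto simp: mult.assoc)
  qed
  then show ?thesis using C(1) D by (intro exI[of _ "C * D"]) auto
qed

end

section \<open>Smooth projections\<close>

lemma norm_half_power_scaleR: "norm ((1/2 :: real) ^ k *\<^sub>R x) = norm (x :: 'a::real_normed_vector) / 2 ^ k"
  by (simp add: power_one_over)

section \<open>Supports of the symbols\<close>

lemma lp_piece_zero_outside:
  assumes lp: "lp_cutoff \<phi>0" and x: "2 ^ Suc k \<le> norm \<xi>"
  shows "lp_piece \<phi>0 k \<xi> = 0"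
proof -
  have z: "\<phi>0 ((1/2) ^ j *\<^sub>R \<xi>) = 0" if "j \<le> k" for j
  proof -
    have "2 * 2 ^ j \<le> norm \<xi>" using x power_increasing[OF that, of "2 :: real"] by (simp del: power_increasing_iff)
    then have "2 \<le> norm ((1/2) ^ j *\<^sub>R \<xi>)" unfolding norm_half_power_scaleR by (simp add: field_simps)
    then show ?thesis using lp unfolding lp_cutoff_def by blast
  qed
  show ?thesis using z[of 0] z[of k] z[of "k - 1"] by (cases k) simp_all
qed

lemma lp_piece_zero_inside:
  assumes lp: "lp_cutoff \<phi>0" and x: "norm \<xi> \<le> 2 ^ k"
  shows "lp_piece \<phi>0 (Suc k) \<xi> = 0"
proof -
  have o: "\<phi>0 ((1/2) ^ j *\<^sub>R \<xi>) = 1" if "k \<le> j" for j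
  proof -
    have "norm \<xi> \<le> 2 ^ j" using x power_increasing[OF that, of "2 :: real"] by (simp del: power_increasing_iff)
    then have "norm ((1/2) ^ j *\<^sub>R \<xi>) \<le> 1" unfolding norm_half_power_scaleR by (simp add: field_simps)
    then show ?thesis using lp unfolding lp_cutoff_def by blast
  qed
  show ?thesis using o[of k] o[of "Suc k"] by simp
qed

lemma proj_cutoff_support: "proj_cutoff \<eta>0 \<Longrightarrow> 3/4 \<le> norm \<xi> \<Longrightarrow> \<eta>0 \<xi> = 0"
  using closure_subset[of "{\<xi>. \<eta>0 \<xi> \<noteq> 0}"] by (fastforce simp: proj_cutoff_def)

text \<open>On the given annulus |xi| >= 2^(J-2), which annihilates all pieces with k + 3 <= J, and
  the full sum up to J + 1 is 1. For J < 2 the truncated difference lets the window start at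
  0.\<close>

lemma sum_lp_piece_window:
  assumes lp: "lp_cutoff \<phi>0" and x: "2 ^ J \<le> 4 * norm \<xi>" "norm \<xi> \<le> 2 ^ Suc J"
  shows "(\<Sum>k\<in>{J - 2..Suc J}. lp_piece \<phi>0 k \<xi>) = 1"
proof -
  have "(\<Sum>k\<in>{J - 2..Suc J}. lp_piece \<phi>0 k \<xi>) = (\<Sum>k\<le>Suc J. lp_piece \<phi>0 k \<xi>)"
  proof (rule sum.mono_neutral_left)
    show "\<forall>k\<in>{..Suc J} - {J - 2..Suc J}. lp_piece \<phi>0 k \<xi> = 0"
    proof
      fix k assume "k \<in> {..Suc J} - {J - 2..Suc J}"
      then have "k + 3 \<le> J" by auto
      then have "(2::real) ^ (k + 3) \<le> 2 ^ J" by (intro power_increasing) auto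
      then have "2 ^ Suc k \<le> norm \<xi>" using x(1) by (simp add: power_add)
      then show "lp_piece \<phi>0 k \<xi> = 0" by (rule lp_piece_zero_outside[OF lp])
    qed
  qed auto
  also have "\<dots> = \<phi>0 ((1/2) ^ Suc J *\<^sub>R \<xi>)" by (rule sum_lp_piece)
  also have "\<dots> = 1"
  proof -
    have "norm ((1/2) ^ Suc J *\<^sub>R \<xi>) \<le> 1" unfolding norm_half_power_scaleR using x(2) by (simp add: field_simps)
    then show ?thesis using lp unfolding lp_cutoff_def by blast
  qed
  finally show ?thesis .
qed

definition proj_symbol :: "(real ^ 'n \<Rightarrow> complex) \<Rightarrow> nat \<Rightarrow> real ^ 'n \<Rightarrow> complex" where
  "proj_symbol \<eta>0 J \<xi> = \<eta>0 ((1/2) ^ J *\<^sub>R \<xi>)"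

text \<open>The symbol of the first increment; dilated by 2^-J it is that of P_(J+1) - P_J. It
  vanishes at the origin, so its kernel has mean zero.\<close>

definition annulus_symbol :: "(real ^ 'n \<Rightarrow> complex) \<Rightarrow> real ^ 'n \<Rightarrow> complex" where
  "annulus_symbol \<eta>0 \<xi> = \<eta>0 ((1/2) *\<^sub>R \<xi>) - \<eta>0 \<xi>"

context
  fixes \<phi>0 \<eta>0 :: "real ^ 'n \<Rightarrow> complex"
  assumes lp: "lp_cutoff \<phi>0" and pc: "proj_cutoff \<eta>0"
begin

lemma schwartz_proj_cutoff: "\<eta>0 \<in> schwartz"
  using pc by (simp add: proj_cutoff_def test_function_schwartz)

lemma schwartz_proj_symbol: "proj_symbol \<eta>0 J \<in> schwartz"
  unfolding proj_symbol_def[abs_def] by (intro schwartz_dilate schwartz_proj_cutoff) simp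

lemma schwartz_annulus_symbol: "annulus_symbol \<eta>0 \<in> schwartz"
  unfolding annulus_symbol_def[abs_def] by (intro schwartz_diff schwartz_dilate schwartz_proj_cutoff) simp

lemma inv_fourier_proj_symbol: "inv_fourier (proj_symbol \<eta>0 J) = dil J (inv_fourier \<eta>0)"
  unfolding proj_symbol_def[abs_def] by (rule inv_fourier_dilate[OF schwartz_measurable[OF schwartz_proj_cutoff]])

lemma integral_inv_fourier_annulus_symbol: "(\<integral>x. inv_fourier (annulus_symbol \<eta>0) x \<partial>lborel) = 0"
  unfolding integral_inv_fourier[OF schwartz_annulus_symbol] by (simp add: annulus_symbol_def)

text \<open>The dilated annulus symbol lives where 1/4 < 2^-J |xi| < 2, and there the window sums to
  1. Hence an increment depends on a bounded number of blocks.\<close>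

lemma annulus_symbol_window:
  "annulus_symbol \<eta>0 ((1/2) ^ J *\<^sub>R \<xi>) * (\<Sum>k\<in>{J - 2..Suc J}. lp_piece \<phi>0 k \<xi>) = proj_symbol \<eta>0 (Suc J) \<xi> - proj_symbol \<eta>0 J \<xi>"
proof -
  let ?z = "(1/2 :: real) ^ J *\<^sub>R \<xi>"
  have half: "norm ((1/2) *\<^sub>R z) = norm z / 2" for z :: "real ^ 'n" by simp
  have e: "annulus_symbol \<eta>0 ?z = proj_symbol \<eta>0 (Suc J) \<xi> - proj_symbol \<eta>0 J \<xi>"
    by (simp add: annulus_symbol_def proj_symbol_def)
  have "annulus_symbol \<eta>0 ?z = 0 \<or> (\<Sum>k\<in>{J - 2..Suc J}. lp_piece \<phi>0 k \<xi>) = 1"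
  proof (cases "1/4 < norm ?z \<and> norm ?z < 2")
    case True
    then have "2 ^ J \<le> 4 * norm \<xi>" "norm \<xi> \<le> 2 ^ Suc J"
      unfolding norm_half_power_scaleR by (simp_all add: field_simps)
    then show ?thesis using sum_lp_piece_window[OF lp] by blast
  next
    case False
    then consider "norm ?z \<le> 1/4" | "2 \<le> norm ?z" by linarith
    then show ?thesis
    proof cases
      case 1
      then have "norm ((1/2) *\<^sub>R ?z) \<le> 1/4" unfolding half using norm_ge_zero[of ?z] by linarith
      with 1 have "\<eta>0 ?z = 1" "\<eta>0 ((1/2) *\<^sub>R ?z) = 1" using pc unfolding proj_cutoff_def by blast+
      then show ?thesis by (simp add: annulus_symbol_def)
    next
      case 2
      then have "3/4 \<le> norm ?z" "3/4 \<le> norm ((1/2) *\<^sub>R ?z)" unfolding half by linarith+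
      then have "\<eta>0 ?z = 0" "\<eta>0 ((1/2) *\<^sub>R ?z) = 0" using proj_cutoff_support[OF pc] by blast+
      then show ?thesis by (simp add: annulus_symbol_def)
    qed
  qed
  then show ?thesis unfolding e by auto
qed

text \<open>The piece lives in |xi| < 2^(k+1) <= 2^J / 4, where the projection symbol equals
  1.\<close>

lemma lp_piece_mult_proj_symbol:
  assumes "k + 3 \<le> J"
  shows "lp_piece \<phi>0 k \<xi> * proj_symbol \<eta>0 J \<xi> = lp_piece \<phi>0 k \<xi>"
proof (cases "2 ^ Suc k \<le> norm \<xi>")
  case True
  then show ?thesis using lp_piece_zero_outside[OF lp] by simp
next
  case False
  have "(2::real) ^ (k + 3) \<le> 2 ^ J" using assms by (intro power_increasing) auto
  then have "4 * norm \<xi> \<le> 2 ^ J" using False by (simp add: power_add)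
  then have "norm ((1/2) ^ J *\<^sub>R \<xi>) \<le> 1/4" unfolding norm_half_power_scaleR by (simp add: field_simps)
  then have "proj_symbol \<eta>0 J \<xi> = 1" using pc unfolding proj_cutoff_def proj_symbol_def by blast
  then show ?thesis by simp
qed

text \<open>The piece vanishes for |xi| <= 2^(k-1) and the projection symbol for |xi| >= (3/4) 2^J;
  with J < k these regions cover everything.\<close>

lemma lp_piece_mult_proj_symbol_zero:
  assumes "J < k"
  shows "lp_piece \<phi>0 k \<xi> * proj_symbol \<eta>0 J \<xi> = 0"
proof -
  obtain k' where k: "k = Suc k'" "J \<le> k'" using assms by (cases k) auto
  show ?thesis
  proof (cases "norm \<xi> \<le> 2 ^ k'")
    case True
    then show ?thesis using lp_piece_zero_inside[OF lp] k by simp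
  next
    case False
    then have "2 ^ J \<le> norm \<xi>" using power_increasing[OF k(2), of "2 :: real"] by (simp del: power_increasing_iff)
    then have "1 \<le> norm ((1/2) ^ J *\<^sub>R \<xi>)" unfolding norm_half_power_scaleR by (simp add: field_simps)
    then have "proj_symbol \<eta>0 J \<xi> = 0" unfolding proj_symbol_def by (intro proj_cutoff_support[OF pc]) simp
    then show ?thesis by simp
  qed
qed

section \<open>Projections of a fixed distribution with bounded blocks\<close>

context
  fixes f :: "(real ^ 'n \<Rightarrow> complex) \<Rightarrow> complex" and b :: real
  assumes f: "f \<in> tempered" and b: "\<And>k x. norm (lp_block \<phi>0 k f x) \<le> b"
begin

lemma block_bound_nonneg: "0 \<le> b"
  using b[of 0 0] norm_ge_zero order.trans by blast

lemma proj_0_eq: "symbol_fun (proj_symbol \<eta>0 0) f = conv (dil 0 (inv_fourier \<eta>0)) (lp_block \<phi>0 0 f)"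
proof -
  have "\<eta>0 \<xi> = \<eta>0 \<xi> * lp_piece \<phi>0 0 \<xi>" for \<xi>
  proof (cases "norm \<xi> \<le> 1")
    case True
    then show ?thesis using lp by (simp add: lp_cutoff_def)
  next
    case False
    then show ?thesis using proj_cutoff_support[OF pc, of \<xi>] by simp
  qed
  then have e: "proj_symbol \<eta>0 0 = (\<lambda>\<xi>. \<eta>0 \<xi> * lp_piece \<phi>0 0 \<xi>)" by (simp add: proj_symbol_def fun_eq_iff)
  show ?thesis
    unfolding e lp_block_eq dil_0
    by (rule symbol_fun_mult[OF f schwartz_proj_cutoff schwartz_lp_piece[OF lp] b[unfolded lp_block_eq]])
qed

text \<open>The function G is the sum of the blocks in the window, of which there are at most four;
  the factor 4 in its bound counts them.\<close>

lemma proj_increment_eq: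
  obtains G where "G \<in> borel_measurable borel" "\<And>y. norm (G y) \<le> 4 * b"
    "\<And>x. symbol_fun (proj_symbol \<eta>0 (Suc J)) f x - symbol_fun (proj_symbol \<eta>0 J) f x = conv (dil J (inv_fourier (annulus_symbol \<eta>0))) G x"
proof -
  let ?w = "\<lambda>\<xi>. \<Sum>k\<in>{J - 2..Suc J}. lp_piece \<phi>0 k \<xi>" and ?c = "\<lambda>\<xi>. annulus_symbol \<eta>0 ((1/2) ^ J *\<^sub>R \<xi>)"
  have w: "?w \<in> schwartz" by (intro schwartz_sum schwartz_lp_piece lp)
  have c: "?c \<in> schwartz" by (intro schwartz_dilate schwartz_annulus_symbol) simp
  have m: "symbol_fun ?w f \<in> borel_measurable borel" by (rule measurable_symbol_fun[OF f w])
  have B: "norm (symbol_fun ?w f y) \<le> 4 * b" for y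
  proof -
    have "symbol_fun ?w f y = (\<Sum>k\<in>{J - 2..Suc J}. lp_block \<phi>0 k f y)"
      unfolding lp_block_eq by (rule symbol_fun_sum_symbol[OF f schwartz_lp_piece[OF lp]])
    then have "norm (symbol_fun ?w f y) \<le> real (card {J - 2..Suc J}) * b" using sum_norm_bound[of "{J - 2..Suc J}" "\<lambda>k. lp_block \<phi>0 k f y" b] b by simp
    also have "\<dots> \<le> 4 * b" using block_bound_nonneg by (intro mult_right_mono) auto
    finally show ?thesis .
  qed
  have "symbol_fun (proj_symbol \<eta>0 (Suc J)) f x - symbol_fun (proj_symbol \<eta>0 J) f x = conv (dil J (inv_fourier (annulus_symbol \<eta>0))) (symbol_fun ?w f) x" for x
  proof -
    have "symbol_fun (proj_symbol \<eta>0 (Suc J)) f x - symbol_fun (proj_symbol \<eta>0 J) f x = symbol_fun (\<lambda>\<xi>. ?c \<xi> * ?w \<xi>) f x"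
      unfolding annulus_symbol_window by (rule symbol_fun_diff_symbol[OF f schwartz_proj_symbol schwartz_proj_symbol, symmetric])
    also have "\<dots> = conv (inv_fourier ?c) (symbol_fun ?w f) x" by (rule fun_cong[OF symbol_fun_mult[OF f c w B]])
    finally show ?thesis
      unfolding inv_fourier_dilate[OF schwartz_measurable[OF schwartz_annulus_symbol]] .
  qed
  then show ?thesis using m B that by blast
qed

text \<open>A qualitative bound, growing with J by a fixed amount per step. It only legitimises
  convolutions and averages and enters no constant.\<close>

lemma proj_bounded: "\<exists>A. \<forall>x. norm (symbol_fun (proj_symbol \<eta>0 J) f x) \<le> A"
proof (induction J)
  case 0
  show ?case
    unfolding proj_0_eq
    using norm_conv_dil_le[OF schwartz_inv_fourier[OF schwartz_proj_cutoff] measurable_lp_block[OF lp f] b] by blast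
next
  case (Suc J)
  then obtain A where A: "\<And>x. norm (symbol_fun (proj_symbol \<eta>0 J) f x) \<le> A" by blast
  obtain G where G: "G \<in> borel_measurable borel" "\<And>y. norm (G y) \<le> 4 * b"
    "\<And>x. symbol_fun (proj_symbol \<eta>0 (Suc J)) f x - symbol_fun (proj_symbol \<eta>0 J) f x = conv (dil J (inv_fourier (annulus_symbol \<eta>0))) G x"
    using proj_increment_eq[of J] by blast
  let ?I = "(\<integral>z. norm (inv_fourier (annulus_symbol \<eta>0) z) \<partial>lborel) * (4 * b)"
  have "norm (symbol_fun (proj_symbol \<eta>0 (Suc J)) f x) \<le> ?I + A" for x
  proof -
    have "norm (symbol_fun (proj_symbol \<eta>0 (Suc J)) f x - symbol_fun (proj_symbol \<eta>0 J) f x) \<le> ?I"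
      unfolding G(3) by (rule norm_conv_dil_le[OF schwartz_inv_fourier[OF schwartz_annulus_symbol] G(1,2)])
    then show ?thesis using A[of x] norm_triangle_ineq2[of "symbol_fun (proj_symbol \<eta>0 (Suc J)) f x" "symbol_fun (proj_symbol \<eta>0 J) f x"] by linarith
  qed
  then show ?case by blast
qed

lemma conv_block_proj:
  "conv (dil k (inv_fourier (lp_base \<phi>0 k))) (symbol_fun (proj_symbol \<eta>0 J) f) = symbol_fun (\<lambda>\<xi>. lp_piece \<phi>0 k \<xi> * proj_symbol \<eta>0 J \<xi>) f"
proof -
  obtain A where A: "\<And>x. norm (symbol_fun (proj_symbol \<eta>0 J) f x) \<le> A" using proj_bounded by blast
  show ?thesis
    unfolding symbol_fun_mult[OF f schwartz_lp_piece[OF lp] schwartz_proj_symbol A] inv_fourier_lp_piece[OF lp] ..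
qed

text \<open>The two filters are interchanged: the projection kernel, of fixed L^1 norm, acts on a
  block of f. This yields a bound uniform in J, which the size of the projection itself would not
  give.\<close>

lemma norm_conv_block_proj_le:
  "norm (symbol_fun (\<lambda>\<xi>. lp_piece \<phi>0 k \<xi> * proj_symbol \<eta>0 J \<xi>) f x) \<le> (\<integral>z. norm (inv_fourier \<eta>0 z) \<partial>lborel) * b"
proof -
  have "symbol_fun (\<lambda>\<xi>. lp_piece \<phi>0 k \<xi> * proj_symbol \<eta>0 J \<xi>) f = symbol_fun (\<lambda>\<xi>. proj_symbol \<eta>0 J \<xi> * lp_piece \<phi>0 k \<xi>) f"
    by (simp add: mult.commute)
  also have "\<dots> = conv (dil J (inv_fourier \<eta>0)) (lp_block \<phi>0 k f)"
    unfolding lp_block_eq inv_fourier_proj_symbol[symmetric]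
    by (rule symbol_fun_mult[OF f schwartz_proj_symbol schwartz_lp_piece[OF lp] b[unfolded lp_block_eq]])
  finally show ?thesis
    using norm_conv_dil_le[OF schwartz_inv_fourier[OF schwartz_proj_cutoff] measurable_lp_block[OF lp f] b] by simp
qed

end

lemma tame_smooth_proj:
  "\<exists>K\<ge>0. \<forall>f b. f \<in> tempered \<longrightarrow> (\<forall>k x. norm (lp_block \<phi>0 k f x) \<le> b) \<longrightarrow> tame \<phi>0 (K * b) (\<lambda>J. symbol_fun (proj_symbol \<eta>0 J) f)"
proof -
  let ?X = "inv_fourier (annulus_symbol \<eta>0)" and ?Y = "inv_fourier \<eta>0"
  let ?IX = "\<integral>z. norm (?X z) \<partial>lborel" and ?IY = "\<integral>z. norm (?Y z) \<partial>lborel"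
  have X: "?X \<in> schwartz" and Y: "?Y \<in> schwartz"
    by (intro schwartz_inv_fourier schwartz_annulus_symbol schwartz_proj_cutoff)+
  obtain CX where CX: "0 \<le> CX" "\<And>k g A x x'. g \<in> borel_measurable borel \<Longrightarrow> (\<And>y. norm (g y) \<le> A) \<Longrightarrow>
    norm (conv (dil k ?X) g x - conv (dil k ?X) g x') \<le> CX * A * 2 ^ k * norm (x - x')"
    using conv_dil_lipschitz[OF X] by metis
  obtain CY where CY: "0 \<le> CY" "\<And>k g A x x'. g \<in> borel_measurable borel \<Longrightarrow> (\<And>y. norm (g y) \<le> A) \<Longrightarrow>
    norm (conv (dil k ?Y) g x - conv (dil k ?Y) g x') \<le> CY * A * 2 ^ k * norm (x - x')"
    using conv_dil_lipschitz[OF Y] by metis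
  obtain CA where CA: "0 \<le> CA" "\<And>j N \<nu> G A. G \<in> borel_measurable borel \<Longrightarrow> (\<And>y. norm (G y) \<le> A) \<Longrightarrow>
    norm (LINT x : dyadic_cube N \<nu> | lborel. conv (dil j ?X) G x) \<le> CA * A * (2 ^ N / 2 ^ j) / 2 ^ (N * CARD('n))"
    using cube_average_conv_bound[OF X integral_inv_fourier_annulus_symbol] by metis
  have I: "0 \<le> ?IX" "0 \<le> ?IY" by simp_all
  \<comment> \<open>One summand per quantitative clause of \<open>tame\<close>: size of increments,
    Lipschitz constant, averages and low blocks. The 8 is two blocks times the 4 by which 2^(N-k) is
    bounded when k > N - 3.\<close>
  define K where "K = 4 * ?IX + (CY + 4 * CX) + 4 * CA + 8 * ?IY"
  have K: "0 \<le> K" "4 * ?IX \<le> K" "CY + 4 * CX \<le> K" "4 * CA \<le> K" "8 * ?IY \<le> K"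
    using CX(1) CY(1) CA(1) I unfolding K_def by linarith+
  have "tame \<phi>0 (K * b) (\<lambda>J. symbol_fun (proj_symbol \<eta>0 J) f)"
    if f: "f \<in> tempered" and b: "\<And>k x. norm (lp_block \<phi>0 k f x) \<le> b" for f b
  proof -
    let ?P = "\<lambda>J. symbol_fun (proj_symbol \<eta>0 J) f" and ?B = "\<lambda>k. dil k (inv_fourier (lp_base \<phi>0 k))"
    have b0: "0 \<le> b" by (rule block_bound_nonneg[OF f b])
    have inc: "norm (?P (Suc J) x - ?P J x) \<le> K * b"
      and lip_inc: "norm ((?P (Suc J) x - ?P J x) - (?P (Suc J) y - ?P J y)) \<le> 4 * CX * b * 2 ^ J * norm (x - y)"
      and avg: "norm (LINT x : dyadic_cube N \<nu> | lborel. ?P (Suc J) x - ?P J x) \<le> K * b * (2 ^ N / 2 ^ J) / 2 ^ (N * CARD('n))"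
      for J N \<nu> x y
    proof -
      obtain G where G: "G \<in> borel_measurable borel" "\<And>y. norm (G y) \<le> 4 * b"
        "\<And>x. ?P (Suc J) x - ?P J x = conv (dil J ?X) G x" using proj_increment_eq[OF f b, of J] by blast
      have "norm (?P (Suc J) x - ?P J x) \<le> ?IX * (4 * b)" unfolding G(3) by (rule norm_conv_dil_le[OF X G(1,2)])
      also have "\<dots> \<le> K * b" using mult_right_mono[OF K(2) b0] by (simp add: mult_ac)
      finally show "norm (?P (Suc J) x - ?P J x) \<le> K * b" .
      show "norm ((?P (Suc J) x - ?P J x) - (?P (Suc J) y - ?P J y)) \<le> 4 * CX * b * 2 ^ J * norm (x - y)"
        unfolding G(3) using CX(2)[OF G(1,2), of J x y] by (simp add: mult_ac)
      have "norm (LINT x : dyadic_cube N \<nu> | lborel. ?P (Suc J) x - ?P J x) \<le> CA * (4 * b) * (2 ^ N / 2 ^ J) / 2 ^ (N * CARD('n))"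
        unfolding G(3) by (rule CA(2)[OF G(1,2)])
      also have "\<dots> \<le> K * b * (2 ^ N / 2 ^ J) / 2 ^ (N * CARD('n))"
        using mult_right_mono[OF K(4) b0] by (intro divide_right_mono mult_right_mono) (simp_all add: mult_ac)
      finally show "norm (LINT x : dyadic_cube N \<nu> | lborel. ?P (Suc J) x - ?P J x) \<le> K * b * (2 ^ N / 2 ^ J) / 2 ^ (N * CARD('n))" .
    qed
    \<comment> \<open>The Lipschitz bounds are summed over the increments. The induction closes
      because the bound doubles with J, while the new increment costs no more than the bound already
      present.\<close>
    have lip: "norm (?P J x - ?P J y) \<le> (CY + 4 * CX) * b * 2 ^ J * norm (x - y)" for J x y
    proof (induction J)
      case 0
      have "norm (?P 0 x - ?P 0 y) \<le> CY * b * 2 ^ 0 * norm (x - y)"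
        unfolding proj_0_eq[OF f b] by (rule CY(2)[OF measurable_lp_block[OF lp f] b])
      also have "\<dots> \<le> (CY + 4 * CX) * b * 2 ^ 0 * norm (x - y)"
        using b0 CX(1) by (intro mult_right_mono) auto
      finally show ?case .
    next
      case (Suc J)
      have "norm (?P (Suc J) x - ?P (Suc J) y) \<le> norm ((?P (Suc J) x - ?P J x) - (?P (Suc J) y - ?P J y)) + norm (?P J x - ?P J y)"
        using norm_triangle_ineq[of "(?P (Suc J) x - ?P J x) - (?P (Suc J) y - ?P J y)" "?P J x - ?P J y"] by (simp add: algebra_simps)
      also have "\<dots> \<le> 4 * CX * b * 2 ^ J * norm (x - y) + (CY + 4 * CX) * b * 2 ^ J * norm (x - y)"
        by (intro add_mono lip_inc Suc)
      also have "\<dots> \<le> (CY + 4 * CX) * b * 2 ^ J * norm (x - y) + (CY + 4 * CX) * b * 2 ^ J * norm (x - y)"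
        using b0 CY(1) by (intro add_right_mono mult_right_mono) auto
      finally show ?case by (simp add: algebra_simps)
    qed
    have near: "norm (conv (?B k) (?P J) x - conv (?B k) (?P N) x) \<le> K * b * (2 ^ k / 2 ^ N)" if "k \<le> N" "N \<le> J" for k N J x
    proof (cases "k + 3 \<le> N")
      case True
      then have "conv (?B k) (?P J) x - conv (?B k) (?P N) x = 0"
        using that unfolding conv_block_proj[OF f b] by (simp add: lp_piece_mult_proj_symbol)
      then show ?thesis using K(1) b0 by (simp add: mult_nonneg_nonneg)
    next
      case False
      have "norm (conv (?B k) (?P J) x - conv (?B k) (?P N) x) \<le> norm (conv (?B k) (?P J) x) + norm (conv (?B k) (?P N) x)"
        by (rule norm_triangle_ineq4)
      also have "\<dots> \<le> ?IY * b + ?IY * b"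
        unfolding conv_block_proj[OF f b] by (intro add_mono norm_conv_block_proj_le[OF f b])
      also have "\<dots> = (8 * ?IY) * b * (1/4)" by simp
      also have "\<dots> \<le> K * b * (2 ^ k / 2 ^ N)"
      proof (intro mult_mono mult_right_mono K b0 mult_nonneg_nonneg)
        have "(2::real) ^ N \<le> 2 ^ (k + 2)" using False by (intro power_increasing) auto
        then show "1/4 \<le> (2 ^ k / 2 ^ N :: real)" by (simp add: field_simps power_add)
      qed auto
      finally show ?thesis .
    qed
    have far: "conv (?B k) (?P N) x = 0" if "N < k" for N k x
      unfolding conv_block_proj[OF f b] using that by (simp add: lp_piece_mult_proj_symbol_zero symbol_fun_zero[OF f])
    have lip': "norm (?P J x - ?P J y) \<le> K * b * 2 ^ J * norm (x - y)" for J x y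
      using order.trans[OF lip[of J x y] mult_right_mono[OF mult_right_mono[OF mult_right_mono[OF K(3) b0]]]] by simp
    show ?thesis
      unfolding tame_def
    proof (intro conjI allI impI)
      show "0 \<le> K * b" using K(1) b0 by simp
      show "?P J \<in> borel_measurable borel" for J by (rule measurable_symbol_fun[OF f schwartz_proj_symbol])
      show "\<exists>A. \<forall>x. norm (?P J x) \<le> A" for J by (rule proj_bounded[OF f b])
    qed (use inc lip' avg near far in auto)
  qed
  then show ?thesis using K(1) by blast
qed

lemma fun_of_dist_smooth_proj: "fun_of_dist (smooth_proj \<eta>0 J f) = symbol_fun (proj_symbol \<eta>0 J) f"
  by (simp add: smooth_proj_def symbol_fun_def proj_symbol_def[abs_def])

lemma smooth_proj_eq: "f \<in> tempered \<Longrightarrow> smooth_proj \<eta>0 J f = dist_of (symbol_fun (proj_symbol \<eta>0 J) f)"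
  using multiplier_eq_symbol_fun[OF _ schwartz_proj_symbol, of f J] by (simp add: smooth_proj_def proj_symbol_def[abs_def])

end

section \<open>Assembly of the two estimates and of the convergence statements\<close>

theorem theorem1p7:
  fixes \<phi>0 \<eta>0 :: "real ^ 'n \<Rightarrow> complex" and r :: real
  assumes "lp_cutoff \<phi>0" and "proj_cutoff \<eta>0" and "0 < r"
  shows "\<exists>C :: real.
    (\<forall>f \<in> B_space \<phi>0.
       (\<forall>N. F_converges \<phi>0 (cond_exp_approx \<eta>0 N f) (cond_exp_dist \<phi>0 \<eta>0 N f)) \<and>
       (SUP N. F_norm \<phi>0 r (cond_exp_dist \<phi>0 \<eta>0 N f - smooth_proj \<eta>0 N f))
         \<le> ennreal C * B_norm \<phi>0 f) \<and>
    (\<forall>f \<in> B_space \<phi>0. \<forall>a :: int ^ 'n \<Rightarrow> bool ^ 'n \<Rightarrow> complex.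
       (\<forall>\<nu>. \<forall>\<epsilon> \<in> Upsilon. norm (a \<nu> \<epsilon>) \<le> 1) \<longrightarrow>
       (\<forall>N. F_converges \<phi>0 (haar_mult_approx \<eta>0 N f a) (haar_mult_dist \<phi>0 \<eta>0 N f a)) \<and>
       (SUP N. F_norm \<phi>0 r (haar_mult_dist \<phi>0 \<eta>0 N f a)) \<le> ennreal C * B_norm \<phi>0 f)"
proof -
  obtain K where K: "0 \<le> K" "\<And>f b. f \<in> tempered \<Longrightarrow> (\<And>k x. norm (lp_block \<phi>0 k f x) \<le> b) \<Longrightarrow>
      tame \<phi>0 (K * b) (\<lambda>J. symbol_fun (proj_symbol \<eta>0 J) f)"
    using tame_smooth_proj[OF assms(1,2)] by metis
  obtain C where C: "0 \<le> C" "\<And>B P N. tame \<phi>0 B P \<Longrightarrow> \<exists>H. F_converges \<phi>0 (\<lambda>J. dist_of (cond_exp_fun N (P J))) (dist_of H) \<and>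
      F_lim \<phi>0 (\<lambda>J. dist_of (cond_exp_fun N (P J))) = dist_of H \<and> F_norm \<phi>0 r (dist_of H - dist_of (P N)) \<le> ennreal (C * B)"
    using cond_exp_uniform_bound[OF assms(1,3)] by blast
  obtain D where D: "0 \<le> D" "\<And>B P a N. tame \<phi>0 B P \<Longrightarrow> \<forall>\<nu>. \<forall>\<epsilon>\<in>Upsilon. norm (a \<nu> \<epsilon>) \<le> 1 \<Longrightarrow>
      \<exists>H. F_converges \<phi>0 (\<lambda>J. dist_of (haar_mult_fun N (P J) a)) (dist_of H) \<and>
      F_lim \<phi>0 (\<lambda>J. dist_of (haar_mult_fun N (P J) a)) = dist_of H \<and> F_norm \<phi>0 r (dist_of H) \<le> ennreal (D * B)"
    using haar_mult_uniform_bound[OF assms(1,3)] by blast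
  define M where "M = (C + D) * K"
  have le: "ennreal (c * (K * b)) \<le> ennreal M * ennreal b" if "c \<in> {C, D}" "0 \<le> b" for c b
  proof -
    have "c * (K * b) \<le> M * b"
      using that C(1) D(1) K(1) unfolding M_def mult.assoc by (intro mult_right_mono mult_nonneg_nonneg) auto
    then show ?thesis using that C(1) D(1) K(1) by (simp add: M_def ennreal_mult[symmetric] ennreal_leI)
  qed
  have "(\<forall>N. F_converges \<phi>0 (cond_exp_approx \<eta>0 N f) (cond_exp_dist \<phi>0 \<eta>0 N f)) \<and>
    (SUP N. F_norm \<phi>0 r (cond_exp_dist \<phi>0 \<eta>0 N f - smooth_proj \<eta>0 N f)) \<le> ennreal M * B_norm \<phi>0 f"
    and "(\<forall>N. F_converges \<phi>0 (haar_mult_approx \<eta>0 N f a) (haar_mult_dist \<phi>0 \<eta>0 N f a)) \<and>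
    (SUP N. F_norm \<phi>0 r (haar_mult_dist \<phi>0 \<eta>0 N f a)) \<le> ennreal M * B_norm \<phi>0 f"
    if f: "f \<in> B_space \<phi>0" and a: "\<forall>\<nu>. \<forall>\<epsilon>\<in>Upsilon. norm (a \<nu> \<epsilon>) \<le> 1" for f and a :: "int ^ 'n \<Rightarrow> bool ^ 'n \<Rightarrow> complex"
  proof -
    have ft: "f \<in> tempered" using f by (simp add: B_space_def)
    obtain b where b: "0 \<le> b" "B_norm \<phi>0 f = ennreal b" "\<And>k x. norm (lp_block \<phi>0 k f x) \<le> b"
      using B_space_bound[OF assms(1) f] by blast
    let ?P = "\<lambda>J. symbol_fun (proj_symbol \<eta>0 J) f"
    have t: "tame \<phi>0 (K * b) ?P" by (rule K(2)[OF ft b(3)])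
    have E: "cond_exp_approx \<eta>0 N f = (\<lambda>J. dist_of (cond_exp_fun N (?P J)))"
      and T: "haar_mult_approx \<eta>0 N f a = (\<lambda>J. dist_of (haar_mult_fun N (?P J) a))" for N
      by (simp_all add: cond_exp_approx_def haar_mult_approx_def fun_of_dist_smooth_proj[OF assms(1,2)] fun_eq_iff)
    have "F_converges \<phi>0 (cond_exp_approx \<eta>0 N f) (cond_exp_dist \<phi>0 \<eta>0 N f) \<and>
      F_norm \<phi>0 r (cond_exp_dist \<phi>0 \<eta>0 N f - smooth_proj \<eta>0 N f) \<le> ennreal M * ennreal b" for N
    proof -
      obtain H where H: "F_converges \<phi>0 (\<lambda>J. dist_of (cond_exp_fun N (?P J))) (dist_of H)"
        "F_lim \<phi>0 (\<lambda>J. dist_of (cond_exp_fun N (?P J))) = dist_of H"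
        "F_norm \<phi>0 r (dist_of H - dist_of (?P N)) \<le> ennreal (C * (K * b))" using C(2)[OF t] by blast
      show ?thesis
        unfolding cond_exp_dist_def E H(2) smooth_proj_eq[OF assms(1,2) ft]
        using H(1) order.trans[OF H(3) le[OF _ b(1)]] by simp
    qed
    then show "(\<forall>N. F_converges \<phi>0 (cond_exp_approx \<eta>0 N f) (cond_exp_dist \<phi>0 \<eta>0 N f)) \<and>
      (SUP N. F_norm \<phi>0 r (cond_exp_dist \<phi>0 \<eta>0 N f - smooth_proj \<eta>0 N f)) \<le> ennreal M * B_norm \<phi>0 f"
      unfolding b(2) by (auto intro: SUP_least)
    have "F_converges \<phi>0 (haar_mult_approx \<eta>0 N f a) (haar_mult_dist \<phi>0 \<eta>0 N f a) \<and>
      F_norm \<phi>0 r (haar_mult_dist \<phi>0 \<eta>0 N f a) \<le> ennreal M * ennreal b" for N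
    proof -
      obtain H where H: "F_converges \<phi>0 (\<lambda>J. dist_of (haar_mult_fun N (?P J) a)) (dist_of H)"
        "F_lim \<phi>0 (\<lambda>J. dist_of (haar_mult_fun N (?P J) a)) = dist_of H"
        "F_norm \<phi>0 r (dist_of H) \<le> ennreal (D * (K * b))" using D(2)[OF t a] by blast
      show ?thesis
        unfolding haar_mult_dist_def T H(2) using H(1) order.trans[OF H(3) le[OF _ b(1)]] by simp
    qed
    then show "(\<forall>N. F_converges \<phi>0 (haar_mult_approx \<eta>0 N f a) (haar_mult_dist \<phi>0 \<eta>0 N f a)) \<and>
      (SUP N. F_norm \<phi>0 r (haar_mult_dist \<phi>0 \<eta>0 N f a)) \<le> ennreal M * B_norm \<phi>0 f"
      unfolding b(2) by (auto intro: SUP_least)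
  qed
  \<comment> \<open>The estimate for the averages was derived in a context that also fixes a
    multiplier sequence; the zero sequence discharges it.\<close>
  from this(1)[where a="\<lambda>_ _. 0"] this(2) show ?thesis by (intro exI[of _ M]) auto
qed

end
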